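(* Let $p$ be a power of $2$, $q$ a power of $p$ with $[\mathbb{F}_q:\mathbb{F}_p]$ even, $\mathbb{F}$ an algebraic closure of $\mathbb{F}_q$, $e\ge1$, and $F(x)=\sum_{i=0}^eb_ix^{p^i}\in\mathbb{F}_q[x]$ satisfying: (i) $b_0b_e\ne0$; (ii) $F^\ast(1)=0$; (iii) $\{x\in\mathbb{F}\mid F^\ast(x)=0\}\subset\mathbb{F}_q$; (iv) $\{x\in\mathbb{F}\mid F^\ast(F(x))=0\}\subset\mathbb{F}_q$. Let $t\in\mathbb{F}_q$ satisfy $\mathrm{Tr}_{\mathbb{F}_q/\mathbb{F}_2}(t)\equiv [\mathbb{F}_q:\mathbb{F}_2]/2+1\pmod 2$. Then the smooth compactification of the curve $D_{F,t}$ is $\mathbb{F}_{q^2}$-maximal.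
   Context: $F^\ast(x):=\sum_{i=0}^e(b_ix)^{p^{-i}}$. $R_F(x):=\sum_{i=1}^ea_ix^{p^i}$ with $a_i=\sum_{j=0}^{e-i}(b_jb_{j+i})^{p^{-j}}$; $\gamma_F:=\sum_{0\le i<j\le e}b_i^{p^{-i}}b_j^{p^{-j}}$; $\alpha_F(t):=\gamma_F+F^\ast(t)^2$; $D_{F,t}$ is the affine curve $y^p-y=x(R_F(x)+\alpha_F(t)x)$. A smooth projective geometrically connected curve of genus $g$ over a field containing $\mathbb{F}_r$ is $\mathbb{F}_r$-maximal if it has $r+1+2g\sqrt r$ $\mathbb{F}_r$-points. *)

theory Defs
  imports Complex_Main "HOL-Algebra.Algebra" "HOL-Algebra.Algebraic_Closure_Type"
begin

section \<open>Smooth projective curves and their function fields\<close>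

text \<open>
  A smooth projective integral curve over a field \<open>k\<close> is given by its function field
  \<open>K / k\<close>, a finitely generated extension of transcendence degree 1.  Its closed points are
  the places of \<open>K / k\<close>, the local ring at a point being the valuation ring of the place;
  conversely every such \<open>K / k\<close> belongs to a unique normal projective curve (Hartshorne,
  Algebraic Geometry, I.6), which is smooth when \<open>k\<close> is perfect.  In this section \<open>K\<close> is a
  HOL-Algebra ring and \<open>k\<close> a subset of its carrier.
\<close>

definition function_field :: "('a, 'b) ring_scheme \<Rightarrow> 'a set \<Rightarrow> bool" where
  "function_field K k \<longleftrightarrow> field K \<and> subfield k K \<and>
     (\<exists>x \<in> carrier K. (ring.transcendental K over k) x \<and>
        ring.finite_dimension K (generate_field K (insert x k)) (carrier K))"

text \<open>
  For perfect \<open>k\<close>, the curve is geometrically connected iff \<open>k\<close> is algebraically closed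
  in \<open>K\<close>, i.e. iff its ring of global regular functions is \<open>k\<close>.
\<close>

definition geometrically_connected :: "('a, 'b) ring_scheme \<Rightarrow> 'a set \<Rightarrow> bool" where
  "geometrically_connected K k \<longleftrightarrow>
     (\<forall>z \<in> carrier K. (ring.algebraic K over k) z \<longrightarrow> z \<in> k)"

text \<open>A place is represented by its valuation ring \<open>V\<close>.\<close>

definition places :: "('a, 'b) ring_scheme \<Rightarrow> 'a set \<Rightarrow> 'a set set" where
  "places K k = {V. subring V K \<and> k \<subseteq> V \<and> V \<noteq> carrier K \<and>
     (\<forall>z \<in> carrier K - {\<zero>\<^bsub>K\<^esub>}. z \<in> V \<or> inv\<^bsub>K\<^esub> z \<in> V)}"

definition place_units :: "('a, 'b) ring_scheme \<Rightarrow> 'a set \<Rightarrow> 'a set" where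
  "place_units K V = Units (K\<lparr>carrier := V\<rparr>)"

definition place_ideal :: "('a, 'b) ring_scheme \<Rightarrow> 'a set \<Rightarrow> 'a set" where
  "place_ideal K V = V - place_units K V"

definition place_degree :: "('a, 'b) ring_scheme \<Rightarrow> 'a set \<Rightarrow> 'a set \<Rightarrow> nat" where
  "place_degree K k V =
     (let A = K\<lparr>carrier := V\<rparr>; \<kappa> = A Quot place_ideal K V
      in ring.dim \<kappa> ((\<lambda>c. place_ideal K V +>\<^bsub>A\<^esub> c) ` k) (carrier \<kappa>))"

text \<open>
  In a function field every valuation ring \<open>V\<close> as above is discrete, so a uniformizer exists
  and the order of a nonzero element is well defined.  The order of zero is left unspecified.
\<close>

definition uniformizer :: "('a, 'b) ring_scheme \<Rightarrow> 'a set \<Rightarrow> 'a \<Rightarrow> bool" where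
  "uniformizer K V t \<longleftrightarrow> t \<in> V \<and> PIdl\<^bsub>K\<lparr>carrier := V\<rparr>\<^esub> t = place_ideal K V"

definition place_ord :: "('a, 'b) ring_scheme \<Rightarrow> 'a set \<Rightarrow> 'a \<Rightarrow> int" where
  "place_ord K V z =
     (THE n::int. \<exists>t u. uniformizer K V t \<and> u \<in> place_units K V \<and>
        z = u \<otimes>\<^bsub>K\<^esub> t [^]\<^bsub>K\<^esub> n)"

definition divisors :: "('a, 'b) ring_scheme \<Rightarrow> 'a set \<Rightarrow> ('a set \<Rightarrow> int) set" where
  "divisors K k = {D. finite {V. D V \<noteq> 0} \<and> {V. D V \<noteq> 0} \<subseteq> places K k}"

definition divisor_degree :: "('a, 'b) ring_scheme \<Rightarrow> 'a set \<Rightarrow> ('a set \<Rightarrow> int) \<Rightarrow> int" where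
  "divisor_degree K k D = (\<Sum>V | D V \<noteq> 0. D V * int (place_degree K k V))"

definition riemann_roch_space ::
    "('a, 'b) ring_scheme \<Rightarrow> 'a set \<Rightarrow> ('a set \<Rightarrow> int) \<Rightarrow> 'a set" where
  "riemann_roch_space K k D =
     {z \<in> carrier K. z \<noteq> \<zero>\<^bsub>K\<^esub> \<longrightarrow> (\<forall>V \<in> places K k. place_ord K V z \<ge> - D V)}"

text \<open>
  The genus after Riemann: the maximum of \<open>deg D + 1 - dim L(D)\<close> over all divisors \<open>D\<close>
  (Stichtenoth, Algebraic Function Fields and Codes, Definition 1.4.15).  The maximum exists
  by Riemann's theorem.
\<close>

definition genus :: "('a, 'b) ring_scheme \<Rightarrow> 'a set \<Rightarrow> int" where
  "genus K k = (GREATEST g. \<exists>D \<in> divisors K k.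
     g = divisor_degree K k D + 1 - int (ring.dim K k (riemann_roch_space K k D)))"

definition rational_points :: "('a, 'b) ring_scheme \<Rightarrow> 'a set \<Rightarrow> 'a set set" where
  "rational_points K k = {V \<in> places K k. place_degree K k V = 1}"

text \<open>
  The smooth projective geometrically connected curve over the finite field \<open>k\<close> of
  cardinality \<open>r\<close> with function field \<open>K\<close> is \<open>k\<close>-maximal.
\<close>

definition maximal_curve :: "('a, 'b) ring_scheme \<Rightarrow> 'a set \<Rightarrow> bool" where
  "maximal_curve K k \<longleftrightarrow> finite k \<and> function_field K k \<and> geometrically_connected K k \<and>
     (let r = real (card k) in
        real (card (rational_points K k)) = r + 1 + 2 * real_of_int (genus K k) * sqrt r)"


section \<open>Smooth compactification of a plane affine curve\<close>

text \<open>
  Let \<open>k\<close> be a subfield of the field \<open>'a\<close> and \<open>f\<close> a polynomial in \<open>Y\<close> (outer variable) over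
  \<open>k[X]\<close> (inner variable).  If \<open>f\<close> is irreducible and of positive degree in \<open>Y\<close>, the function
  field of the affine curve \<open>f = 0\<close> over \<open>k\<close>, i.e. the fraction field of \<open>k[X,Y]/(f)\<close>, is
  \<open>k(X)[Y]/(f)\<close>; the smooth compactification is the smooth projective curve with this function
  field.  If \<open>f\<close> is reducible over \<open>k(X)\<close>, the ring below is not a field, so it does not
  satisfy \<open>function_field\<close>.  The field \<open>k(X)\<close> is taken inside \<open>'a poly fract\<close>.  Polynomials in
  HOL-Algebra are coefficient lists starting with the leading coefficient, hence the \<open>rev\<close>.
\<close>

abbreviation type_ring :: "'a::field ring" where
  "type_ring \<equiv> ring_of_type_algebra"

definition rational_functions :: "'a::field set \<Rightarrow> 'a poly fract set" where
  "rational_functions k =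
     generate_field type_ring (insert (to_fract [:0, 1:]) ((\<lambda>c. to_fract [:c:]) ` k))"

definition curve_equation :: "'a::field poly poly \<Rightarrow> 'a poly fract list" where
  "curve_equation f = rev (map to_fract (Polynomial.coeffs f))"

definition curve_function_field ::
    "'a::field set \<Rightarrow> 'a poly poly \<Rightarrow> 'a poly fract list set ring" where
  "curve_function_field k f = Rupt\<^bsub>type_ring\<^esub> (rational_functions k) (curve_equation f)"

definition curve_constants ::
    "'a::field set \<Rightarrow> 'a poly poly \<Rightarrow> 'a poly fract list set set" where
  "curve_constants k f =
     (\<lambda>c. ring.rupture_surj type_ring (rational_functions k) (curve_equation f)
            (ring.poly_of_const type_ring (to_fract [:c:]))) ` k"

definition smooth_compactification_maximal :: "'a::field set \<Rightarrow> 'a poly poly \<Rightarrow> bool" where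
  "smooth_compactification_maximal k f \<longleftrightarrow>
     maximal_curve (curve_function_field k f) (curve_constants k f)"


section \<open>The curves \<open>D\<^sub>F\<^sub>,\<^sub>t\<close>\<close>

text \<open>
  \<open>frob_root p i z\<close> is \<open>z\<close> to the power \<open>p\<close> to the \<open>-i\<close>: the unique root, in a perfect field
  whose characteristic exponent has \<open>p\<close> among its positive powers.
\<close>

definition frob_root :: "nat \<Rightarrow> nat \<Rightarrow> 'a::field \<Rightarrow> 'a" where
  "frob_root p i z = (THE w. w ^ (p ^ i) = z)"

text \<open>The coefficients of \<open>F\<close> are \<open>b 0, \<dots>, b e\<close>; further values of \<open>b\<close> are irrelevant.\<close>

definition F_poly :: "nat \<Rightarrow> nat \<Rightarrow> (nat \<Rightarrow> 'a::field) \<Rightarrow> 'a poly" where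
  "F_poly p e b = (\<Sum>i\<le>e. Polynomial.monom (b i) (p ^ i))"

definition F_star :: "nat \<Rightarrow> nat \<Rightarrow> (nat \<Rightarrow> 'a::field) \<Rightarrow> 'a \<Rightarrow> 'a" where
  "F_star p e b x = (\<Sum>i\<le>e. frob_root p i (b i * x))"

definition R_coeff :: "nat \<Rightarrow> nat \<Rightarrow> (nat \<Rightarrow> 'a::field) \<Rightarrow> nat \<Rightarrow> 'a" where
  "R_coeff p e b i = (\<Sum>j\<le>e - i. frob_root p j (b j * b (j + i)))"

definition R_poly :: "nat \<Rightarrow> nat \<Rightarrow> (nat \<Rightarrow> 'a::field) \<Rightarrow> 'a poly" where
  "R_poly p e b = (\<Sum>i=1..e. Polynomial.monom (R_coeff p e b i) (p ^ i))"

definition gamma_F :: "nat \<Rightarrow> nat \<Rightarrow> (nat \<Rightarrow> 'a::field) \<Rightarrow> 'a" where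
  "gamma_F p e b = (\<Sum>j\<le>e. \<Sum>i<j. frob_root p i (b i) * frob_root p j (b j))"

definition alpha_F :: "nat \<Rightarrow> nat \<Rightarrow> (nat \<Rightarrow> 'a::field) \<Rightarrow> 'a \<Rightarrow> 'a" where
  "alpha_F p e b t = gamma_F p e b + (F_star p e b t)\<^sup>2"

text \<open>The polynomial \<open>Y^p - Y - X (R_F(X) + \<alpha>_F(t) X)\<close> defining the curve.\<close>

definition D_poly :: "nat \<Rightarrow> nat \<Rightarrow> (nat \<Rightarrow> 'a::field) \<Rightarrow> 'a \<Rightarrow> 'a poly poly" where
  "D_poly p e b t = Polynomial.monom 1 p - Polynomial.monom 1 1
     - [: [:0, 1:] * (R_poly p e b + Polynomial.smult (alpha_F p e b t) [:0, 1:]) :]"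

text \<open>
  Trace from the field with \<open>2^d\<close> elements to the prime field, as the sum of conjugates.
\<close>

definition trace_F2 :: "nat \<Rightarrow> 'a::field \<Rightarrow> 'a" where
  "trace_F2 d t = (\<Sum>i<d. t ^ (2 ^ i))"

end

theory Submission
  imports Defs
begin

text \<open>
  The function field is realised inside an algebraic closure of the rational functions, over the
  field \<open>k\<close> with \<open>q\<^sup>2\<close> elements.  Its places are the pole \<open>\<infinity>\<close> of \<open>x\<close>, with residue field \<open>k\<close>, and the
  Frobenius orbits of affine points; the functions regular away from \<open>\<infinity>\<close> are the polynomials in
  \<open>x\<close> and \<open>y\<close>.  The pole orders \<open>p\<close> of \<open>x\<close> and \<open>h\<close> of \<open>y\<close> are coprime, so counting monomials of bounded weight gives the
  dimension of the multiples of \<open>\<infinity>\<close>, and comparing an arbitrary divisor with such a multiple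
  (by cardinalities, \<open>k\<close> being finite) gives Riemann's inequality and the genus \<open>(p - 1) p\<^sup>e / 2\<close>.
  The number of affine points is evaluated by reducing the trace form of the right-hand side to
  a square by means of \<open>F\<close> and \<open>F\<^sup>*\<close>.
\<close>

subsection \<open>Characteristic two\<close>

text \<open>Maximality is an equality of two numbers: the genus contributes 2 g q = (p - 1) p^e q,
  so each of the p - 1 nontrivial additive characters of the field of order p has to contribute
  exactly p^e q affine points. Scaling x makes these contributions equal, and one sum of signs over
  the field of order q^2 is left. Its exponent depends on F x alone, as a quadratic form: the second
  symmetric function of the conjugates plus a linear term from t. Translating the argument by v^2 +
  v, with v in the field of order q, cancels everything except the y with y + y^q in {0, 1}. That
  these y are values of F on the field of order q^2 is what the hypothesis on the kernel of F^* o F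
  provides; the parity of the trace of t fixes the sign of what is left. On the geometric side,
  genus and points are defined through all divisors and all valuation rings: no place may be
  overlooked, and the genus must bound every divisor as well as be attained.\<close>

lemma char2_power:
  fixes x y :: "'a::comm_ring_1"
  assumes "(2::'a) = 0"
  shows "(x + y) ^ (2 ^ n) = x ^ (2 ^ n) + y ^ (2 ^ n)"
proof (induction n)
  case (Suc n)
  have "(x + y) ^ (2 ^ Suc n) = ((x + y) ^ (2 ^ n))\<^sup>2"
    by (simp add: power_mult[symmetric] mult.commute)
  also have "\<dots> = (x ^ (2 ^ n))\<^sup>2 + (y ^ (2 ^ n))\<^sup>2"
    unfolding Suc by (simp add: power2_sum assms)
  finally show ?case by (simp add: power_mult[symmetric] mult.commute)
qed auto

lemma char2_minus:
  fixes x :: "'a::comm_ring_1"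
  assumes "(2::'a) = 0"
  shows "- x = x"
proof -
  have "x + x = 2 * x" by simp
  thus ?thesis using assms by (simp add: eq_neg_iff_add_eq_0 minus_equation_iff)
qed

lemma char2_add_self:
  fixes x :: "'a::comm_ring_1"
  assumes "(2::'a) = 0"
  shows "x + x = 0"
  using char2_minus[OF assms, of x] by (metis add.right_inverse)

lemma char2_diff:
  fixes x y :: "'a::comm_ring_1"
  assumes "(2::'a) = 0"
  shows "x - y = x + y"
  using char2_minus[OF assms, of y] by (metis diff_conv_add_uminus)

lemma char2_power_sum:
  fixes f :: "'b \<Rightarrow> 'a::comm_ring_1"
  assumes "(2::'a) = 0"
  shows "(\<Sum>i\<in>I. f i) ^ (2 ^ n) = (\<Sum>i\<in>I. f i ^ (2 ^ n))"
  by (induction I rule: infinite_finite_induct) (auto simp: char2_power[OF assms] power_0_left)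

lemma char2_power_inj:
  fixes x y :: "'a::idom"
  assumes "(2::'a) = 0" and "x ^ (2 ^ n) = y ^ (2 ^ n)"
  shows "x = y"
proof -
  have "(x + y) ^ (2 ^ n) = 0"
    using assms char2_power[OF assms(1), of x y n] by (simp add: char2_add_self)
  hence "x + y = 0" by simp
  thus ?thesis using char2_minus[OF assms(1), of y] by (metis eq_neg_iff_add_eq_0)
qed

lemma char2_of_nat:
  assumes "(2::'a::comm_ring_1) = 0"
  shows "(of_nat n :: 'a) = (if even n then 0 else 1)"
proof -
  have "(of_nat n :: 'a) = of_nat (2 * (n div 2) + n mod 2)" by simp
  also have "\<dots> = of_nat (n mod 2)" by (simp only: of_nat_add of_nat_mult) (simp add: assms)
  finally show ?thesis by (simp add: parity_cases mod_2_eq_odd)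
qed

lemma power_frob_mod:
  fixes y :: "'a::monoid_mult"
  assumes "y ^ (2 ^ N) = y"
  shows "y ^ (2 ^ (i mod N)) = y ^ (2 ^ i)"
proof -
  have *: "y ^ (2 ^ (N * k)) = y" for k
  proof (induction k)
    case (Suc k)
    have "y ^ (2 ^ (N * Suc k)) = (y ^ (2 ^ N)) ^ (2 ^ (N * k))"
      by (simp add: power_add power_mult)
    thus ?case using Suc assms by simp
  qed auto
  have "y ^ (2 ^ i) = y ^ (2 ^ (N * (i div N) + i mod N))" by simp
  also have "\<dots> = (y ^ (2 ^ (N * (i div N)))) ^ (2 ^ (i mod N))"
    by (simp only: power_add power_mult)
  finally show ?thesis by (simp add: *)
qed

lemma mod_eq_imp_frob_eq:
  fixes y :: "'a::monoid_mult"
  assumes "y ^ (2 ^ N) = y" and "i mod N = j mod N"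
  shows "y ^ (2 ^ i) = y ^ (2 ^ j)"
  using power_frob_mod[OF assms(1), of i] power_frob_mod[OF assms(1), of j] assms(2) by simp


subsection \<open>The second elementary symmetric polynomial\<close>

text \<open>Taking the coefficient of X^2 in the product of the 1 + v_i X requires no order on the
  index set, so families may be reindexed by any bijection, as \<open>tr_esym2_terms\<close> does
  with pairs of indices.\<close>

definition esym2 :: "('i \<Rightarrow> 'a::comm_ring_1) \<Rightarrow> 'i set \<Rightarrow> 'a" where
  "esym2 v I = poly.coeff (\<Prod>i\<in>I. [:1, v i:]) 2"

lemma coeff_prod_linear:
  assumes "finite I"
  shows "poly.coeff (\<Prod>i\<in>I. [:1, v i:]) 0 = 1"
    and "poly.coeff (\<Prod>i\<in>I. [:1, v i:]) (Suc 0) = (\<Sum>i\<in>I. v i)"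
  using assms by (induction I) (auto simp: algebra_simps)

lemma esym2_empty [simp]: "esym2 v {} = 0"
  by (simp add: esym2_def)

lemma esym2_insert [simp]:
  assumes "finite I" "a \<notin> I"
  shows "esym2 v (insert a I) = esym2 v I + v a * (\<Sum>i\<in>I. v i)"
  using assms coeff_prod_linear[OF assms(1), of v]
  by (simp add: esym2_def numeral_2_eq_2)

lemma esym2_cong:
  assumes "\<And>i. i \<in> I \<Longrightarrow> u i = v i"
  shows "esym2 u I = esym2 v I"
  unfolding esym2_def by (simp add: assms cong: prod.cong)

lemma esym2_reindex:
  assumes "bij_betw h I J"
  shows "esym2 v J = esym2 (\<lambda>i. v (h i)) I"
  unfolding esym2_def by (subst prod.reindex_bij_betw[OF assms, symmetric]) simp

lemma esym2_Un:
  assumes "finite I" "finite J" "I \<inter> J = {}"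
  shows "esym2 v (I \<union> J) = esym2 v I + esym2 v J + (\<Sum>i\<in>I. v i) * (\<Sum>j\<in>J. v j)"
  using assms by (induction I) (auto simp: algebra_simps sum.union_disjoint)

lemma esym2_add:
  assumes "finite I"
  shows "esym2 (\<lambda>i. u i + v i) I =
    esym2 u I + esym2 v I + (\<Sum>i\<in>I. u i) * (\<Sum>i\<in>I. v i) - (\<Sum>i\<in>I. u i * v i)"
  using assms by (induction I) (auto simp: algebra_simps sum.distrib)

lemma esym2_power:
  fixes v :: "'i \<Rightarrow> 'a::comm_ring_1"
  assumes "finite I" "(2::'a) = 0"
  shows "esym2 (\<lambda>i. v i ^ (2 ^ n)) I = esym2 v I ^ (2 ^ n)"
  using assms(1) by (induction I) (auto simp: char2_power[OF assms(2)] char2_power_sum[OF assms(2)] power_mult_distrib power_0_left)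

lemma esym2_mult:
  assumes "finite I"
  shows "esym2 (\<lambda>i. c * v i) I = c\<^sup>2 * esym2 v I"
  using assms by (induction I) (auto simp: algebra_simps power2_eq_square sum_distrib_left)

text \<open>Two distinct elements of \<open>I \<times> J\<close> either share their first index,
  which gives the inner terms, or do not; the products of the second kind combine into products of
  row sums.\<close>

lemma esym2_Times:
  assumes "finite I" "finite J"
  shows "esym2 v (I \<times> J) = (\<Sum>i\<in>I. esym2 (\<lambda>j. v (i, j)) J) + esym2 (\<lambda>i. \<Sum>j\<in>J. v (i, j)) I"
  using assms(1)
proof (induction I)
  case (insert a I)
  have eq: "insert a I \<times> J = ({a} \<times> J) \<union> (I \<times> J)" by auto
  have "bij_betw (Pair a) J ({a} \<times> J)"
    by (auto simp: bij_betw_def inj_on_def)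
  hence 1: "esym2 v ({a} \<times> J) = esym2 (\<lambda>j. v (a, j)) J"
    and 2: "(\<Sum>x\<in>{a}\<times>J. v x) = (\<Sum>j\<in>J. v (a, j))"
    using esym2_reindex[of "Pair a" J "{a} \<times> J" v] sum.reindex_bij_betw[of "Pair a" J "{a} \<times> J" v]
    by simp_all
  have 3: "(\<Sum>x\<in>I\<times>J. v x) = (\<Sum>i\<in>I. \<Sum>j\<in>J. v (i, j))"
    by (simp add: sum.cartesian_product)
  have "esym2 v (insert a I \<times> J) = esym2 v ({a} \<times> J) + esym2 v (I \<times> J)
      + (\<Sum>x\<in>{a}\<times>J. v x) * (\<Sum>x\<in>I\<times>J. v x)"
    unfolding eq using insert assms by (intro esym2_Un) auto
  thus ?case using insert unfolding 1 2 3 by (simp add: algebra_simps)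
qed simp

lemma esym2_one: "esym2 (\<lambda>_. 1) {..<n} = of_nat (n choose 2)"
proof (induction n)
  case (Suc n)
  have "esym2 (\<lambda>_. 1::'a) {..<Suc n} = of_nat (n choose 2) + of_nat n"
    unfolding lessThan_Suc using Suc by simp
  moreover have "Suc n choose 2 = (n choose 2) + n"
    by (simp add: numeral_2_eq_2)
  ultimately show ?case by simp
qed (simp add: numeral_2_eq_2)

text \<open>The ordered form in which \<open>gamma_F\<close> is defined and in which
  \<open>tr_R\<close> collects its terms.\<close>

lemma esym2_atMost:
  "esym2 v {..e::nat} = (\<Sum>j\<le>e. \<Sum>i<j. v i * v j)"
proof (induction e)
  case (Suc e)
  have "{..Suc e} = insert (Suc e) {..e}" by auto
  thus ?case using Suc by (simp add: sum_distrib_left lessThan_Suc_atMost mult.commute)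
qed (simp add: esym2_def numeral_2_eq_2)

subsection \<open>Finite fields of characteristic two\<close>

text \<open>A root splits off as a linear factor, and the cofactor does not vanish there since the
  derivative does not; so the remaining roots are new and induction on the degree applies.\<close>

lemma card_roots_separable:
  fixes P :: "'a::field poly"
  assumes closed: "\<And>Q::'a poly. degree Q > 0 \<Longrightarrow> \<exists>x. poly Q x = 0"
    and "P \<noteq> 0" and "\<And>x. poly P x = 0 \<Longrightarrow> poly (pderiv P) x \<noteq> 0"
  shows "card {x. poly P x = 0} = degree P"
  using assms(2,3)
proof (induction "degree P" arbitrary: P)
  case 0
  then obtain c where "P = [:c:]" "c \<noteq> 0" by (metis degree_eq_zeroE pCons_0_0)
  thus ?case by simp
next
  case (Suc n)
  then obtain a where a: "poly P a = 0" using closed[of P] by auto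
  then obtain Q where Q: "P = [:-a, 1:] * Q" by (metis dvd_def poly_eq_0_iff_dvd)
  have "Q \<noteq> 0" using Q Suc by auto
  have dP: "pderiv P = Q + [:-a, 1:] * pderiv Q"
    unfolding Q pderiv_mult by (simp add: pderiv_pCons)
  have Qa: "poly Q a \<noteq> 0" using Suc.prems(2)[OF a] unfolding dP by simp
  have deg: "degree P = Suc (degree Q)"
    unfolding Q using \<open>Q \<noteq> 0\<close> by (subst degree_mult_eq) auto
  have "card {x. poly Q x = 0} = degree Q"
  proof (rule Suc.hyps(1))
    show "n = degree Q" using deg Suc.hyps(2) by simp
    show "poly (pderiv Q) x \<noteq> 0" if "poly Q x = 0" for x
    proof -
      have "poly P x = 0" using that Q by simp
      from Suc.prems(2)[OF this] show ?thesis unfolding dP using that by auto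
    qed
  qed fact
  moreover have "{x. poly P x = 0} = insert a {x. poly Q x = 0}"
    unfolding Q by (auto simp: algebra_simps)
  ultimately show ?case using Qa deg poly_roots_finite[OF \<open>Q \<noteq> 0\<close>] by simp
qed

locale closed_char2 =
  fixes ty :: "'a::field itself"
  assumes two: "(2::'a) = 0"
    and closed: "\<And>Q::'a poly. degree Q > 0 \<Longrightarrow> \<exists>x. poly Q x = 0"
begin

text \<open>The subfield with 2^k elements, as fixed points of an iterate of squaring. For k = 0 the
  condition is void, hence the positivity hypotheses below.\<close>

abbreviation GF :: "nat \<Rightarrow> 'a set" where "GF k \<equiv> {x. x ^ (2 ^ k) = x}"

lemmas frob_add = char2_power[OF two]
lemmas frob_sum = char2_power_sum[OF two]
lemmas neg_eq = char2_minus[OF two]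
lemmas diff_eq = char2_diff[OF two]
lemmas add_self = char2_add_self[OF two]
lemmas frob_inj = char2_power_inj[OF two]

lemma add_left_self: "x + (x + y) = (y::'a)"
  by (simp add: add.assoc[symmetric] add_self)

lemma eq_iff_add_eq_0: "(x::'a) = y \<longleftrightarrow> x + y = 0"
  by (metis diff_eq eq_iff_diff_eq_0)

lemma card_artin_schreier_roots:
  assumes "j > 0"
  shows "card {x::'a. x ^ (2 ^ j) + x = c} = 2 ^ j"
proof -
  define P :: "'a poly" where "P = Polynomial.monom 1 (2 ^ j) + [:-c, 1:]"
  have j: "(1::nat) < 2 ^ j" using assms by (rule one_less_power[rotated]) simp
  have deg: "degree P = 2 ^ j"
    unfolding P_def using j by (subst degree_add_eq_left) (auto simp: degree_monom_eq)
  hence "P \<noteq> 0" using j by auto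
  have "(of_nat (2 ^ j) :: 'a) = 0" using assms by (subst char2_of_nat[OF two]) auto
  hence "pderiv P = 1"
    unfolding P_def using assms
    by (simp add: pderiv_add pderiv_monom pderiv_pCons power_0_left one_pCons)
  hence "card {x. poly P x = 0} = degree P"
    using \<open>P \<noteq> 0\<close> by (intro card_roots_separable closed) auto
  moreover have "{x. poly P x = 0} = {x. x ^ (2 ^ j) + x = c}"
    by (auto simp: P_def poly_monom algebra_simps)
  ultimately show ?thesis using deg by simp
qed

lemma artin_schreier_solvable:
  assumes "j > 0"
  obtains x :: 'a where "x ^ (2 ^ j) + x = c"
proof -
  have "{x::'a. x ^ (2 ^ j) + x = c} \<noteq> {}"
    using card_artin_schreier_roots[OF assms, of c] by (metis card.empty power_not_zero zero_neq_numeral)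
  thus ?thesis using that by blast
qed

lemma finite_artin_schreier_roots:
  assumes "j > 0"
  shows "finite {x::'a. x ^ (2 ^ j) + x = c}"
  using card_artin_schreier_roots[OF assms, of c] by (metis card.infinite power_not_zero zero_neq_numeral)

lemma GF_eq: "GF j = {x. x ^ (2 ^ j) + x = 0}"
  by (auto simp: eq_iff_add_eq_0[symmetric])

lemma card_GF: "j > 0 \<Longrightarrow> card (GF j) = 2 ^ j"
  unfolding GF_eq by (rule card_artin_schreier_roots)

lemma finite_GF: "j > 0 \<Longrightarrow> finite (GF j)"
  unfolding GF_eq by (rule finite_artin_schreier_roots)

lemma GF_add: "x \<in> GF k \<Longrightarrow> y \<in> GF k \<Longrightarrow> x + y \<in> GF k"
  by (simp add: frob_add)

lemma GF_mult: "x \<in> GF k \<Longrightarrow> y \<in> GF k \<Longrightarrow> x * y \<in> GF k"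
  by (simp add: power_mult_distrib)

lemma GF_inverse: "x \<in> GF k \<Longrightarrow> inverse x \<in> GF k"
  by (simp add: power_inverse)

lemma GF_power: "x \<in> GF k \<Longrightarrow> x ^ n \<in> GF k"
  using power_mult[of x n "2 ^ k"] power_mult[of x "2 ^ k" n] by (simp add: mult.commute)

lemma GF_sum: "(\<And>i. i \<in> I \<Longrightarrow> f i \<in> GF k) \<Longrightarrow> (\<Sum>i\<in>I. f i) \<in> GF k"
  by (simp add: frob_sum)

lemma GF_mono:
  assumes "k dvd l"
  shows "GF k \<subseteq> GF l"
proof
  fix x assume "x \<in> GF k"
  thus "x \<in> GF l" using power_frob_mod[of x k l] assms by auto
qed

lemma GF_0_1 [simp]: "0 \<in> GF k" "1 \<in> GF k"
  by (auto simp: power_0_left)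

lemma frob_root_unique:
  assumes "w ^ ((2 ^ m) ^ i) = (z::'a)"
  shows "frob_root (2 ^ m) i z = w"
  unfolding frob_root_def
proof (rule the_equality)
  fix w' assume "w' ^ ((2 ^ m) ^ i) = z"
  hence "w' ^ (2 ^ (m * i)) = w ^ (2 ^ (m * i))" using assms by (simp add: power_mult)
  thus "w' = w" by (rule frob_inj)
qed fact

lemma frob_root_power:
  shows "frob_root (2 ^ m) i (z::'a) ^ ((2 ^ m) ^ i) = z"
proof -
  define P :: "'a poly" where "P = Polynomial.monom 1 ((2 ^ m) ^ i) + [:-z:]"
  have pos: "0 < ((2::nat) ^ m) ^ i" by simp
  have "degree P = (2 ^ m) ^ i"
    unfolding P_def using pos by (subst degree_add_eq_left) (auto simp: degree_monom_eq)
  then obtain w where "poly P w = 0" using closed[of P] by auto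
  hence "w ^ ((2 ^ m) ^ i) = z" by (simp add: P_def poly_monom)
  with frob_root_unique[OF this] show ?thesis by simp
qed

lemma frob_root_add: "frob_root (2 ^ m) i (x + y :: 'a) = frob_root (2 ^ m) i x + frob_root (2 ^ m) i y"
  by (rule frob_root_unique) (metis frob_add frob_root_power power_mult)

lemma frob_root_mult: "frob_root (2 ^ m) i (x * y :: 'a) = frob_root (2 ^ m) i x * frob_root (2 ^ m) i y"
  by (rule frob_root_unique) (simp add: power_mult_distrib frob_root_power)

lemma frob_root_GF:
  assumes "z \<in> GF k"
  shows "frob_root (2 ^ m) i z \<in> GF k"
proof -
  let ?w = "frob_root (2 ^ m) i z"
  have "(?w ^ (2 ^ k)) ^ (2 ^ (m * i)) = (?w ^ (2 ^ (m * i))) ^ (2 ^ k)"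
    by (simp add: power_mult[symmetric] mult.commute)
  also have "?w ^ (2 ^ (m * i)) = z" using frob_root_power[of m i z] by (simp add: power_mult)
  finally have "(?w ^ (2 ^ k)) ^ (2 ^ (m * i)) = ?w ^ (2 ^ (m * i))"
    using assms frob_root_power[of m i z] by (simp add: power_mult)
  from frob_inj[OF this] show ?thesis by simp
qed


subsection \<open>Traces and additive characters\<close>

abbreviation tr :: "nat \<Rightarrow> 'a \<Rightarrow> 'a" where "tr \<equiv> trace_F2"

lemma tr_add: "tr k (x + y) = tr k x + tr k y"
  by (simp add: trace_F2_def frob_add sum.distrib)

lemma tr_0 [simp]: "tr k 0 = 0"
  by (simp add: trace_F2_def power_0_left)

lemma tr_sum: "tr k (\<Sum>i\<in>I. f i) = (\<Sum>i\<in>I. tr k (f i))"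
  by (induction I rule: infinite_finite_induct) (auto simp: tr_add)

text \<open>Squaring shifts the conjugates by one place, so only the two ends survive. The element
  is arbitrary because the identity is also applied to an \<open>s\<close> with s^(2^d) = s +
  1.\<close>

lemma tr_square_general: "(tr k x)\<^sup>2 = tr k x + x + x ^ (2 ^ k)"
proof -
  have "(tr k x)\<^sup>2 = (\<Sum>i<k. x ^ (2 ^ Suc i))"
    using frob_sum[of "\<lambda>i. x ^ (2 ^ i)" "{..<k}" 1]
    by (simp add: trace_F2_def power_mult[symmetric] mult.commute)
  moreover have "x + (\<Sum>i<k. x ^ (2 ^ Suc i)) = (\<Sum>i<Suc k. x ^ (2 ^ i))"
    by (subst sum.lessThan_Suc_shift) simp
  ultimately have "x + (tr k x)\<^sup>2 = tr k x + x ^ (2 ^ k)"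
    by (simp add: trace_F2_def)
  hence "x + (x + (tr k x)\<^sup>2) = x + (tr k x + x ^ (2 ^ k))" by simp
  thus ?thesis unfolding add_left_self by (simp add: algebra_simps)
qed

lemma tr_in_F2:
  assumes "x \<in> GF k"
  shows "tr k x \<in> {0, 1}"
proof -
  have "(tr k x)\<^sup>2 = tr k x"
    using tr_square_general[of k x] assms by (simp add: add.assoc add_self)
  hence "tr k x * (tr k x - 1) = 0" by (simp add: power2_eq_square algebra_simps)
  thus ?thesis by auto
qed

lemma tr_frob:
  assumes "x \<in> GF k"
  shows "tr k (x ^ (2 ^ j)) = tr k x"
proof (induction j)
  case (Suc j)
  have *: "x ^ (2 ^ j) \<in> GF k" by (intro GF_power assms)
  have "tr k (x ^ (2 ^ Suc j)) = (tr k (x ^ (2 ^ j)))\<^sup>2"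
    using frob_sum[of "\<lambda>i. (x ^ (2 ^ j)) ^ (2 ^ i)" "{..<k}" 1]
    by (simp add: trace_F2_def power_mult[symmetric] mult_ac)
  also have "\<dots> = tr k (x ^ (2 ^ j))" using tr_in_F2[OF *] by auto
  finally show ?case using Suc by simp
qed auto

lemma tr_square: "x \<in> GF k \<Longrightarrow> tr k (x\<^sup>2) = tr k x"
  using tr_frob[of x k 1] by simp

lemma tr_double: "tr (2 * d) x = tr d (x + x ^ (2 ^ d))"
proof -
  have "tr (2 * d) x = (\<Sum>i<d. x ^ (2 ^ i)) + (\<Sum>i=d..<d+d. x ^ (2 ^ i))"
    unfolding trace_F2_def using sum.atLeastLessThan_concat[of 0 d "d+d" "\<lambda>i. x ^ (2 ^ i)"]
    by (simp add: lessThan_atLeast0 mult_2)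
  also have "(\<Sum>i=d..<d+d. x ^ (2 ^ i)) = (\<Sum>i<d. (x ^ (2 ^ d)) ^ (2 ^ i))"
    using sum.shift_bounds_nat_ivl[of "\<lambda>i. x ^ (2 ^ i)" 0 d d]
    by (simp add: lessThan_atLeast0 power_add power_mult[symmetric] mult.commute)
  finally show ?thesis by (simp add: trace_F2_def frob_add sum.distrib)
qed

lemma tr_double_subfield: "x \<in> GF d \<Longrightarrow> tr (2 * d) x = 0"
  by (simp add: tr_double add_self)

text \<open>The trace is a polynomial of degree at most 2^(d-1), nonzero since its linear
  coefficient is 1; it cannot vanish on 2^d elements, and its only other value is 1.\<close>

lemma tr_surj:
  assumes "d > 0"
  obtains v where "v \<in> GF d" "tr d v = 1"
proof (rule ccontr)
  assume neg: "\<not> thesis"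
  define P :: "'a poly" where "P = (\<Sum>i<d. Polynomial.monom 1 (2 ^ i))"
  have P: "poly P x = tr d x" for x by (simp add: P_def poly_sum poly_monom trace_F2_def)
  have "poly.coeff P 1 = (\<Sum>i<d. if (2::nat) ^ i = 1 then 1 else 0)"
    by (simp add: P_def coeff_sum)
  also have "\<dots> = (\<Sum>i<d. if i = 0 then 1 else 0)" by (intro sum.cong) auto
  also have "\<dots> = 1" using assms by simp
  finally have "P \<noteq> 0" by auto
  have "degree P \<le> 2 ^ (d - 1)" unfolding P_def
    by (intro degree_sum_le order.trans[OF degree_monom_le]) (auto intro!: power_increasing)
  moreover have "GF d \<subseteq> {x. poly P x = 0}"
    using neg that tr_in_F2 unfolding P by blast
  hence "2 ^ d \<le> card {x. poly P x = 0}"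
    using card_mono[OF poly_roots_finite[OF \<open>P \<noteq> 0\<close>]] card_GF[OF assms] by metis
  moreover have "card {x. poly P x = 0} \<le> degree P" by (rule card_poly_roots_bound) fact
  ultimately have "(2::nat) ^ d \<le> 2 ^ (d - 1)" by linarith
  hence "d \<le> d - 1" by (subst (asm) power_increasing_iff) auto
  thus False using assms by simp
qed

text \<open>The nontrivial character of {0, 1} as the two-element field. Other arguments get -1 as a
  default, so \<open>psi_add\<close> is restricted to these two.\<close>

definition psi :: "'a \<Rightarrow> int" where "psi x = (if x = 0 then 1 else - 1)"

lemma psi_add: "x \<in> {0, 1} \<Longrightarrow> y \<in> {0, 1} \<Longrightarrow> psi (x + y) = psi x * psi y"
  using add_self[of 1] by (auto simp: psi_def)

lemma psi_0 [simp]: "psi 0 = 1" and psi_1 [simp]: "psi 1 = - 1"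
  by (auto simp: psi_def)

text \<open>For nonzero c some w has tr (c w) = 1; translation by w permutes the field and changes
  every sign, so the sum equals its negative.\<close>

lemma sum_psi_tr:
  assumes "d > 0" "c \<in> GF d"
  shows "(\<Sum>v\<in>GF d. psi (tr d (c * v))) = (if c = 0 then 2 ^ d else 0)"
proof (cases "c = 0")
  case True
  thus ?thesis using card_GF[OF assms(1)] by simp
next
  case False
  obtain u where u: "u \<in> GF d" "tr d u = 1" using tr_surj[OF assms(1)] .
  define w where "w = inverse c * u"
  have w: "w \<in> GF d" "c * w = u"
    using False GF_mult[OF GF_inverse[OF assms(2)] u(1)] by (auto simp: w_def)
  have "bij_betw (\<lambda>v. v + w) (GF d) (GF d)"
    by (rule bij_betw_byWitness[where f' = "\<lambda>v. v + w"])
       (use w in \<open>auto simp: add.assoc add_self frob_add\<close>)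
  hence "(\<Sum>v\<in>GF d. psi (tr d (c * v))) = (\<Sum>v\<in>GF d. psi (tr d (c * (v + w))))"
    by (rule sum.reindex_bij_betw[symmetric])
  also have "\<dots> = (\<Sum>v\<in>GF d. - psi (tr d (c * v)))"
  proof (rule sum.cong)
    fix v assume v: "v \<in> GF d"
    have "tr d (c * (v + w)) = tr d (c * v) + 1" using w u by (simp add: distrib_left tr_add)
    thus "psi (tr d (c * (v + w))) = - psi (tr d (c * v))"
      using psi_add[OF tr_in_F2[OF GF_mult[OF assms(2) v]], of 1] by simp
  qed auto
  finally show ?thesis using False by (simp add: sum_negf)
qed

end

lemma mod_add_right_inj:
  fixes i i' :: nat
  assumes "i < N" "i' < N" "(i + c) mod N = (i' + c) mod N"
  shows "i = i'"
  using assms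
proof (induction i i' rule: linorder_wlog)
  case (le i i')
  hence "N dvd (i' + c) - (i + c)" by (subst mod_eq_dvd_iff_nat[symmetric]) auto
  hence "N dvd i' - i" by simp
  thus ?case using le by (metis diff_is_0_eq' dvd_imp_le le_antisym less_imp_diff_less not_le zero_less_diff)
qed auto

text \<open>For k = 2j > 0 the binomial coefficient is j (2j - 1), and the second factor is odd.
  This links the value of \<open>E2\<close> in \<open>E2_double_conjugate_add_1\<close> to the
  hypothesis on the trace of t.\<close>

lemma even_choose_two:
  assumes "even k"
  shows "even (k choose 2) \<longleftrightarrow> even (k div 2)"
proof -
  obtain j where j: "k = 2 * j" using assms by auto
  have "k choose 2 = j * (2 * j - 1)" unfolding j choose_two by (simp add: mult.assoc)
  thus ?thesis using j by (cases j) (auto simp: choose_two)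
qed

context closed_char2
begin

subsection \<open>The quadratic form of second symmetric functions of conjugates\<close>

lemma add_eq_imp_eq_add: "x + y = c \<Longrightarrow> (y::'a) = x + c"
  by (metis add_left_self)

text \<open>A quadratic form over the two-element field; by \<open>E2_add\<close> its polar form is
  tr y tr w + tr (y w). It is what remains of the equation of the curve under the trace.\<close>

definition E2 :: "nat \<Rightarrow> 'a \<Rightarrow> 'a" where
  "E2 N y = esym2 (\<lambda>i. y ^ (2 ^ i)) {..<N}"

lemma E2_add: "E2 N (y + w) = E2 N y + E2 N w + tr N y * tr N w + tr N (y * w)"
  using esym2_add[of "{..<N}" "\<lambda>i. y ^ (2 ^ i)" "\<lambda>i. w ^ (2 ^ i)"]
  by (simp add: E2_def frob_add trace_F2_def power_mult_distrib diff_eq)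

lemma E2_0 [simp]: "E2 N 0 = 0"
  using E2_add[of N 0 0] by (simp add: add_self)

lemma esym2_double:
  "esym2 (v :: nat \<Rightarrow> 'a) {..<2 * d} = esym2 v {..<d} + esym2 (\<lambda>i. v (d + i)) {..<d}
    + (\<Sum>i<d. v i) * (\<Sum>i<d. v (d + i))"
proof -
  have b: "bij_betw ((+) d) {..<d} {d..<2*d}"
    by (rule bij_betw_byWitness[where f' = "\<lambda>i. i - d"]) auto
  have "{..<2*d} = {..<d} \<union> {d..<2*d}" by auto
  moreover have "esym2 v ({..<d} \<union> {d..<2*d}) = esym2 v {..<d} + esym2 v {d..<2*d} + (\<Sum>i<d. v i) * (\<Sum>i=d..<2*d. v i)"
    by (rule esym2_Un) auto
  ultimately have "esym2 v {..<2*d} = esym2 v {..<d} + esym2 v {d..<2*d} + (\<Sum>i<d. v i) * (\<Sum>i=d..<2*d. v i)"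
    by (rule trans[OF arg_cong])
  thus ?thesis
    using esym2_reindex[OF b, of v] sum.reindex_bij_betw[OF b, of v] by simp
qed

text \<open>Each conjugate of y occurs twice, so the forms of the two halves cancel and only the
  product of the two half sums is left, the square of a trace with value 0 or 1.\<close>

lemma E2_double_subfield:
  assumes "y \<in> GF d"
  shows "E2 (2 * d) y = tr d y"
proof -
  have "y ^ (2 ^ (d + i)) = y ^ (2 ^ i)" for i using assms by (simp add: power_add power_mult)
  hence "E2 (2 * d) y = (esym2 (\<lambda>i. y ^ (2 ^ i)) {..<d} + esym2 (\<lambda>i. y ^ (2 ^ i)) {..<d}) + (tr d y)\<^sup>2"
    by (simp add: E2_def esym2_double trace_F2_def power2_eq_square)
  also have "\<dots> = tr d y" unfolding add_self using tr_in_F2[OF assms] by auto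
  finally show ?thesis .
qed

text \<open>The second half of the conjugates is the first half shifted by 1. All occurrences of the
  half trace T cancel except T + T^2, and this is 1 because s^(2^d) = s + 1.\<close>

lemma E2_double_conjugate_add_1:
  assumes "s ^ (2 ^ d) = s + 1"
  shows "E2 (2 * d) s = of_nat (d choose 2) + 1"
proof -
  define T where "T = tr d s"
  have "s ^ (2 ^ (d + i)) = s ^ (2 ^ i) + 1" for i using assms by (simp add: power_add power_mult frob_add)
  hence "E2 (2 * d) s = esym2 (\<lambda>i. s ^ (2 ^ i)) {..<d} + esym2 (\<lambda>i. s ^ (2 ^ i) + 1) {..<d} + T * (T + of_nat d)"
    by (simp add: E2_def esym2_double T_def trace_F2_def sum.distrib)
  also have "esym2 (\<lambda>i. s ^ (2 ^ i) + 1) {..<d} = esym2 (\<lambda>i. s ^ (2 ^ i)) {..<d} + of_nat (d choose 2) + T * of_nat d + T"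
    using esym2_add[of "{..<d}" "\<lambda>i. s ^ (2 ^ i)" "\<lambda>_. 1"]
    by (simp add: esym2_one T_def trace_F2_def diff_eq)
  finally have "E2 (2 * d) s = (esym2 (\<lambda>i. s ^ (2 ^ i)) {..<d} + esym2 (\<lambda>i. s ^ (2 ^ i)) {..<d})
     + (T * of_nat d + T * of_nat d) + of_nat (d choose 2) + (T + T\<^sup>2)"
    by (simp add: algebra_simps power2_eq_square)
  moreover have "T\<^sup>2 = T + (s + s) + 1" using tr_square_general[of d s] assms by (simp add: T_def)
  ultimately show ?thesis by (simp add: add_self add_left_self)
qed

end


subsection \<open>Counting points\<close>

locale point_count = closed_char2 ty for ty :: "'a::field itself" +
  fixes m n e :: nat and b :: "nat \<Rightarrow> 'a" and t :: 'a
  assumes m: "0 < m" and n: "0 < n" and even_n: "even n" and e: "1 \<le> e"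
    and b_GF: "\<And>i. i \<le> e \<Longrightarrow> b i \<in> GF (m * n)"
    and b_nz: "b 0 * b e \<noteq> 0"
    and F_star_1: "F_star (2 ^ m) e b 1 = 0"
    and ker: "{x. F_star (2 ^ m) e b (poly (F_poly (2 ^ m) e b) x) = 0} \<subseteq> GF (m * n)"
    and t_GF: "t \<in> GF (m * n)"
    and tr_t: "trace_F2 (m * n) t = of_nat (m * n div 2 + 1)"
begin

text \<open>\<open>GF d\<close> is the field of order q, and \<open>GF N\<close> its quadratic
  extension of order q^2.\<close>

abbreviation "d \<equiv> m * n"
abbreviation "N \<equiv> 2 * d"
abbreviation "rt \<equiv> frob_root (2 ^ m)"

definition F :: "'a \<Rightarrow> 'a" where "F x = (\<Sum>i\<le>e. b i * x ^ (2 ^ (m * i)))"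
abbreviation "Fs \<equiv> F_star (2 ^ m) e b"
abbreviation "\<gamma> \<equiv> gamma_F (2 ^ m) e b"

lemma d: "d > 0" "even d" using m n even_n by auto

lemma GF_d_N: "x \<in> GF d \<Longrightarrow> x \<in> GF N"
  using GF_mono[of d N] by auto

lemma F_eq: "poly (F_poly (2 ^ m) e b) x = F x"
  by (simp add: F_poly_def F_def poly_sum poly_monom power_mult)

lemma F_add: "F (x + y) = F x + F y"
  by (simp add: F_def frob_add distrib_left sum.distrib)

lemma Fs_add: "Fs (x + y) = Fs x + Fs y"
  by (simp add: F_star_def frob_root_add distrib_left sum.distrib)

lemma Fs_0: "Fs 0 = 0" using Fs_add[of 0 0] by (simp add: add_self)

lemma F_0: "F 0 = 0" using F_add[of 0 0] by (simp add: add_self)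

lemma ker_F: "Fs (F x) = 0 \<Longrightarrow> x \<in> GF d"
  using ker F_eq by auto

lemma F_GF: "d dvd k \<Longrightarrow> x \<in> GF k \<Longrightarrow> F x \<in> GF k"
  unfolding F_def using GF_mono[of d k]
  by (intro GF_sum GF_mult GF_power) (use b_GF in auto)

lemma F_frob: "F x ^ (2 ^ d) = F (x ^ (2 ^ d))"
proof -
  have "F x ^ (2 ^ d) = (\<Sum>i\<le>e. b i ^ (2 ^ d) * (x ^ (2 ^ (m * i))) ^ (2 ^ d))"
    by (simp add: F_def frob_sum power_mult_distrib)
  also have "\<dots> = F (x ^ (2 ^ d))"
    unfolding F_def using b_GF
    by (intro sum.cong) (auto simp: power_mult[symmetric] mult.commute)
  finally show ?thesis .
qed

lemma F_surj:
  obtains x where "F x = y"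
proof -
  let ?P = "F_poly (2 ^ m) e b + [:- y:]"
  have "poly.coeff (F_poly (2 ^ m) e b) ((2 ^ m) ^ e) = (\<Sum>i\<le>e. if i = e then b i else 0)"
    unfolding F_poly_def coeff_sum using m by (intro sum.cong) (auto simp: power_mult[symmetric])
  hence c: "poly.coeff (F_poly (2 ^ m) e b) ((2 ^ m) ^ e) \<noteq> 0" using b_nz by simp
  hence "degree (F_poly (2 ^ m) e b) \<ge> (2 ^ m) ^ e" by (rule le_degree)
  moreover have "0 < ((2::nat) ^ m) ^ e" by simp
  ultimately have pos: "0 < degree (F_poly (2 ^ m) e b)" by linarith
  hence "degree ?P > 0" by (subst degree_add_eq_left) auto
  then obtain x where "poly ?P x = 0" using closed by blast
  thus ?thesis using that[of x] F_eq[of x] by simp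
qed

text \<open>The derivative of F is the constant b_0, which is not 0, so F has as many roots as its
  degree p^e.\<close>

lemma card_ker_F: "card {x. F x = 0} = 2 ^ (m * e)"
proof -
  let ?P = "F_poly (2 ^ m) e b"
  have "poly.coeff ?P ((2 ^ m) ^ e) = (\<Sum>i\<le>e. if i = e then b i else 0)"
    unfolding F_poly_def coeff_sum using m by (intro sum.cong) (auto simp: power_mult[symmetric])
  hence "poly.coeff ?P ((2 ^ m) ^ e) \<noteq> 0" using b_nz by simp
  hence "degree ?P \<ge> (2 ^ m) ^ e" "?P \<noteq> 0" by (auto intro: le_degree)
  moreover have "degree ?P \<le> (2 ^ m) ^ e" unfolding F_poly_def
    by (intro degree_sum_le order.trans[OF degree_monom_le]) (auto intro!: power_increasing)
  ultimately have deg: "degree ?P = (2 ^ m) ^ e" by simp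
  have even: "(of_nat ((2 ^ m) ^ i) :: 'a) = 0" if "i > 0" for i
    using that m by (subst char2_of_nat[OF two]) auto
  have "pderiv ?P = (\<Sum>i\<le>e. Polynomial.monom (of_nat ((2 ^ m) ^ i) * b i) ((2 ^ m) ^ i - 1))"
    using higher_pderiv_sum[of 1 "\<lambda>i. Polynomial.monom (b i) ((2 ^ m) ^ i)" "{..e}"]
    by (simp add: F_poly_def pderiv_monom)
  also have "\<dots> = (\<Sum>i\<le>e. if i = 0 then [:b 0:] else 0)"
    by (intro sum.cong refl) (use even in \<open>auto simp: monom_0 simp del: of_nat_power\<close>)
  also have "\<dots> = [:b 0:]" by simp
  finally have "card {x. poly ?P x = 0} = degree ?P"
    using b_nz \<open>?P \<noteq> 0\<close> by (intro card_roots_separable closed) auto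
  thus ?thesis by (simp add: deg F_eq power_mult)
qed

text \<open>The sum z of x and its conjugate has F z in {0, 1}, which F^* annihilates; the
  hypothesis on the kernel of F^* o F places z in the field of order q. Conjugating x twice then
  adds z twice.\<close>

lemma F_preimage:
  assumes "F x \<in> GF N" "F x ^ (2 ^ d) + F x \<in> {0, 1}"
  shows "x \<in> GF N"
proof -
  define z where "z = x ^ (2 ^ d) + x"
  have "F z = F x ^ (2 ^ d) + F x" by (simp add: z_def F_add F_frob)
  hence "Fs (F z) = 0" using assms(2) Fs_0 F_star_1 by auto
  hence z: "z \<in> GF d" by (rule ker_F)
  have xq: "x ^ (2 ^ d) = x + z" by (simp add: z_def add.commute add_left_self)
  have "x ^ (2 ^ N) = (x ^ (2 ^ d)) ^ (2 ^ d)"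
    by (simp add: power_mult[symmetric] power_add[symmetric] mult_2)
  also have "\<dots> = x + z + z" unfolding xq frob_add using xq z by simp
  finally show ?thesis by (simp add: add.assoc add_self)
qed

text \<open>F^* is the adjoint of F for the trace form: a trace is unchanged when its argument is
  replaced by its root of order p^i, and this moves the Frobenius power from x to the
  coefficient.\<close>

lemma tr_adjoint:
  assumes "x \<in> GF N" "c \<in> GF d"
  shows "tr N (c * F x) = tr N (Fs c * x)"
proof -
  have "tr N (c * F x) = (\<Sum>i\<le>e. tr N ((b i * c) * x ^ (2 ^ (m * i))))"
    by (simp add: F_def sum_distrib_left tr_sum mult_ac)
  also have "\<dots> = (\<Sum>i\<le>e. tr N (rt i (b i * c) * x))"
  proof (rule sum.cong)
    fix i assume i: "i \<in> {..e}"
    have "b i * c \<in> GF N" using i b_GF assms(2) GF_mult GF_d_N by blast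
    hence "rt i (b i * c) * x \<in> GF N" by (rule GF_mult[OF frob_root_GF assms(1)])
    from tr_frob[OF this, of "m * i"]
    show "tr N ((b i * c) * x ^ (2 ^ (m * i))) = tr N (rt i (b i * c) * x)"
      using frob_root_power[of m i "b i * c"] by (simp add: power_mult_distrib power_mult)
  qed auto
  finally show ?thesis by (simp add: F_star_def sum_distrib_right tr_sum)
qed

text \<open>
  Both sides are the second symmetric function of the family of all conjugates of all the terms
  \<open>b\<^sub>j x\<^bsup>p^j\<^esup>\<close>, which is also the family of all conjugates of the \<open>b\<^sub>j\<^bsup>p^-j\<^esup> x\<close>.
\<close>

lemma tr_esym2_terms:
  assumes x: "x \<in> GF N"
  shows "tr N (esym2 (\<lambda>j. b j * x ^ (2 ^ (m * j))) {..e}) + E2 N (F x) = tr N (\<gamma> * x\<^sup>2)"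
proof -
  define \<beta> where "\<beta> j = rt j (b j)" for j
  define c where "c j = b j * x ^ (2 ^ (m * j))" for j
  define w where "w = (\<lambda>(i, j). (\<beta> j * x) ^ (2 ^ i))"
  define v where "v = (\<lambda>(i, j). c j ^ (2 ^ i))"
  define h where "h = (\<lambda>(i, j::nat). ((i + m * j) mod N, j))"
  have "inj_on h ({..<N} \<times> {..e})"
  proof (rule inj_onI, clarsimp simp: h_def)
    fix i i' j assume *: "i < N" "i' < N" "(i + m * j) mod N = (i' + m * j) mod N"
    thus "i = i'" by (rule mod_add_right_inj)
  qed
  moreover have "h ` ({..<N} \<times> {..e}) \<subseteq> {..<N} \<times> {..e}"
    using d by (auto simp: h_def)
  ultimately have bij: "bij_betw h ({..<N} \<times> {..e}) ({..<N} \<times> {..e})"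
    by (simp add: bij_betw_def endo_inj_surj)
  have \<beta>_GF: "\<beta> j * x \<in> GF N" if "j \<le> e" for j
    unfolding \<beta>_def using that x b_GF GF_d_N by (intro GF_mult frob_root_GF) auto
  have wv: "w (h ij) = v ij" if ij_in: "ij \<in> {..<N} \<times> {..e}" for ij
  proof -
    obtain i j where ij: "ij = (i, j)" "j \<le> e" using ij_in by auto
    have "w (h ij) = (\<beta> j * x) ^ (2 ^ (m * j + i))"
      using \<beta>_GF[OF ij(2)] power_frob_mod[of "\<beta> j * x" N "i + m * j"]
      by (simp add: w_def h_def ij add.commute)
    also have "\<dots> = ((\<beta> j * x) ^ (2 ^ (m * j))) ^ (2 ^ i)" by (simp add: power_add power_mult)
    also have "(\<beta> j * x) ^ (2 ^ (m * j)) = c j"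
      using frob_root_power[of m j "b j"] by (simp add: \<beta>_def c_def power_mult_distrib power_mult)
    finally show ?thesis by (simp add: v_def ij)
  qed
  have "esym2 w ({..<N} \<times> {..e}) = esym2 v ({..<N} \<times> {..e})"
    unfolding esym2_reindex[OF bij, of w] by (intro esym2_cong wv)
  moreover have "esym2 v ({..<N} \<times> {..e}) = tr N (esym2 c {..e}) + E2 N (F x)"
  proof -
    have "(\<Sum>j\<le>e. c j ^ (2 ^ i)) = F x ^ (2 ^ i)" for i
      by (simp add: F_def c_def frob_sum)
    thus ?thesis
      by (simp add: esym2_Times v_def esym2_power[OF _ two] trace_F2_def E2_def)
  qed
  moreover have "esym2 w ({..<N} \<times> {..e}) = tr N (\<gamma> * x\<^sup>2)"
  proof -
    \<comment> \<open>F^*(1) = 0 makes the sum over j vanish for every Frobenius exponent, so in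
      \<open>esym2_Times\<close> only the symmetric functions at a fixed exponent
      contribute.\<close>
    have "(\<Sum>j\<le>e. \<beta> j * x) = Fs 1 * x" by (simp add: F_star_def \<beta>_def sum_distrib_right)
    hence s0: "(\<Sum>j\<le>e. (\<beta> j * x) ^ (2 ^ i)) = 0" for i
      by (simp add: frob_sum[symmetric] F_star_1 power_0_left)
    have "esym2 (\<lambda>j. \<beta> j * x) {..e} = \<gamma> * x\<^sup>2"
      using esym2_mult[of "{..e}" x \<beta>]
      by (simp add: mult.commute esym2_atMost gamma_F_def \<beta>_def)
    moreover have "esym2 (\<lambda>i. 0::'a) {..<N} = 0"
      using E2_0[of N] by (simp add: E2_def power_0_left)
    ultimately show ?thesis
      by (simp add: esym2_Times w_def esym2_power[OF _ two] trace_F2_def s0)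
  qed
  ultimately show ?thesis by (simp add: c_def[abs_def])
qed

definition f :: "'a \<Rightarrow> 'a" where
  "f x = x * (poly (R_poly (2 ^ m) e b) x + alpha_F (2 ^ m) e b t * x)"

lemma R_coeff_GF: "i \<le> e \<Longrightarrow> R_coeff (2 ^ m) e b i \<in> GF d"
  unfolding R_coeff_def by (intro GF_sum frob_root_GF GF_mult b_GF) auto

lemma alpha_GF: "alpha_F (2 ^ m) e b t \<in> GF d"
  unfolding alpha_F_def gamma_F_def F_star_def
  by (intro GF_add GF_power GF_sum GF_mult frob_root_GF b_GF t_GF) auto

lemma f_GF:
  assumes x: "x \<in> GF N"
  shows "f x \<in> GF N"
  unfolding f_def R_poly_def poly_sum poly_monom
  by (intro GF_mult[OF x] GF_add GF_mult[OF GF_d_N[OF alpha_GF] x] GF_sum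
      GF_mult[OF GF_d_N[OF R_coeff_GF]] GF_power[OF x]) auto

text \<open>Under the trace, the summand with index j of a_i may be raised to the power p^j, which
  turns it into a product of the terms of F x with indices j and j + i. As i and j vary, each pair
  of distinct terms appears once.\<close>

lemma tr_R:
  assumes x: "x \<in> GF N"
  shows "tr N (x * poly (R_poly (2 ^ m) e b) x) = tr N (esym2 (\<lambda>j. b j * x ^ (2 ^ (m * j))) {..e})"
proof -
  define c where "c j = b j * x ^ (2 ^ (m * j))" for j
  have term_eq: "tr N (x * (rt j (b j * b (j + i)) * x ^ ((2 ^ m) ^ i))) = tr N (c j * c (j + i))"
    if "j + i \<le> e" for i j
  proof -
    have "b j * b (j + i) \<in> GF N" using that by (intro GF_mult GF_d_N b_GF) auto
    hence "x * (rt j (b j * b (j + i)) * x ^ ((2 ^ m) ^ i)) \<in> GF N"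
      by (intro GF_mult[OF x GF_mult] frob_root_GF GF_power[OF x])
    from tr_frob[OF this, of "m * j"]
    have "tr N (x * (rt j (b j * b (j + i)) * x ^ ((2 ^ m) ^ i)))
        = tr N ((x * (rt j (b j * b (j + i)) * x ^ ((2 ^ m) ^ i))) ^ (2 ^ (m * j)))" by simp
    also have "(x * (rt j (b j * b (j + i)) * x ^ ((2 ^ m) ^ i))) ^ (2 ^ (m * j))
        = x ^ (2 ^ (m * j)) * (rt j (b j * b (j + i)) ^ ((2 ^ m) ^ j) * (x ^ ((2 ^ m) ^ i)) ^ (2 ^ (m * j)))"
      by (simp add: power_mult_distrib power_mult)
    also have "\<dots> = c j * c (j + i)"
      unfolding frob_root_power
      by (simp add: c_def power_mult[symmetric] power_add[symmetric] algebra_simps)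
    finally show ?thesis .
  qed
  have "tr N (x * poly (R_poly (2 ^ m) e b) x)
      = (\<Sum>i=1..e. \<Sum>j\<le>e-i. tr N (x * (rt j (b j * b (j + i)) * x ^ ((2 ^ m) ^ i))))"
    by (simp add: R_poly_def R_coeff_def poly_sum poly_monom sum_distrib_left sum_distrib_right tr_sum)
  also have "\<dots> = (\<Sum>i=1..e. \<Sum>j\<le>e-i. tr N (c j * c (j + i)))"
    by (intro sum.cong refl term_eq) auto
  also have "\<dots> = (\<Sum>(i, j)\<in>(SIGMA i:{1..e}. {..e-i}). tr N (c j * c (j + i)))"
    by (rule sum.Sigma) auto
  also have "\<dots> = (\<Sum>(k, j)\<in>(SIGMA k:{..e}. {..<k}). tr N (c j * c k))"
    by (rule sum.reindex_bij_witness[where i = "\<lambda>(k, j). (k - j, j)" and j = "\<lambda>(i, j). (j + i, j)"]) auto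
  also have "\<dots> = (\<Sum>k\<le>e. \<Sum>j<k. tr N (c j * c k))"
    by (rule sum.Sigma[symmetric]) auto
  finally show ?thesis by (simp add: esym2_atMost tr_sum c_def)
qed

text \<open>The trace of x R_F(x) occurs a second time, together with the quadratic form of F x, in
  the trace of \<gamma>_F x^2; the two copies cancel. The summand F^*(t)^2 x^2 has the trace of
  F^*(t) x, which adjointness rewrites.\<close>

lemma tr_f:
  assumes x: "x \<in> GF N"
  shows "tr N (f x) = E2 N (F x) + tr N (t * F x)"
proof -
  have "Fs t * x \<in> GF N"
    unfolding F_star_def by (intro GF_mult[OF GF_sum x] frob_root_GF GF_mult GF_d_N b_GF t_GF) auto
  hence sq: "tr N ((Fs t)\<^sup>2 * x\<^sup>2) = tr N (Fs t * x)"
    using tr_square[of "Fs t * x" N] by (simp add: power_mult_distrib)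
  define A B where "A = tr N (x * poly (R_poly (2 ^ m) e b) x)" and "B = E2 N (F x)"
  have "f x = x * poly (R_poly (2 ^ m) e b) x + (\<gamma> * x\<^sup>2 + (Fs t)\<^sup>2 * x\<^sup>2)"
    by (simp add: f_def alpha_F_def algebra_simps power2_eq_square)
  hence "tr N (f x) = A + (tr N (\<gamma> * x\<^sup>2) + tr N (Fs t * x))"
    by (simp only: tr_add sq A_def)
  also have "tr N (\<gamma> * x\<^sup>2) = A + B"
    using tr_esym2_terms[OF x] tr_R[OF x] by (simp add: A_def B_def)
  also have "tr N (Fs t * x) = tr N (t * F x)" by (rule tr_adjoint[OF x t_GF, symmetric])
  finally show ?thesis by (simp add: B_def add.assoc add_left_self)
qed

text \<open>The summand factors through F, whose fibres over its image \<open>A\<close> all have p^e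
  elements. The sum over \<open>A\<close> is then averaged over translations by v^2 + v, which
  leaves only the subset \<open>A0\<close>.\<close>

lemma sum_psi_f: "(\<Sum>x\<in>GF N. psi (tr N (f x))) = 2 ^ (m * e) * 2 ^ d"
proof -
  define \<chi> where "\<chi> y = psi (E2 N y + tr N (t * y))" for y
  define A where "A = F ` GF N"
  have finN: "finite (GF N)" and find: "finite (GF d)" using d by (auto intro!: finite_GF)
  have A_GF: "A \<subseteq> GF N" unfolding A_def using F_GF[of N] by auto
  have finA: "finite A" using finN by (simp add: A_def)
  have inA: "y \<in> A" if y: "y \<in> GF N" "y ^ (2 ^ d) + y \<in> {0, 1}" for y
  proof -
    obtain x where "F x = y" using F_surj by blast
    thus ?thesis using F_preimage[of x] y by (auto simp: A_def)
  qed
  have dA: "y \<in> A" if "y \<in> GF d" for y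
    using that by (intro inA GF_d_N) (auto simp: add_self)
  have A_add: "y + z \<in> A" if "y \<in> A" "z \<in> A" for y z
    using that by (auto simp: A_def F_add[symmetric] frob_add)
  have chi_F2: "tr N (t * y) \<in> {0, 1}" "E2 N y + tr N (t * y) \<in> {0, 1}" if yA: "y \<in> A" for y
  proof -
    show "tr N (t * y) \<in> {0, 1}" using that A_GF by (intro tr_in_F2 GF_mult[OF GF_d_N[OF t_GF]]) auto
    obtain x where x: "x \<in> GF N" "y = F x" using yA by (auto simp: A_def)
    have "f x \<in> GF N" by (rule f_GF) fact
    thus "E2 N y + tr N (t * y) \<in> {0, 1}"
      using tr_in_F2[of "f x" N] tr_f[OF x(1)] x(2) by simp
  qed
  have fibre: "card {x \<in> GF N. F x = y} = 2 ^ (m * e)" if yA: "y \<in> A" for y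
  proof -
    obtain x0 where x0: "x0 \<in> GF N" "y = F x0" using yA by (auto simp: A_def)
    have "{x \<in> GF N. F x = y} = (+) x0 ` {x. F x = 0}"
    proof (rule equalityI; rule subsetI)
      fix x assume "x \<in> {x \<in> GF N. F x = y}"
      hence "F (x0 + x) = 0" using x0 by (simp add: F_add add_self)
      thus "x \<in> (+) x0 ` {x. F x = 0}"
        by (intro image_eqI[of _ _ "x0 + x"]) (auto simp: add_left_self)
    next
      fix x assume "x \<in> (+) x0 ` {x. F x = 0}"
      then obtain z where z: "x = x0 + z" "F z = 0" by auto
      hence "z \<in> GF N" using ker_F[of z] Fs_0 GF_d_N[of z] by auto
      thus "x \<in> {x \<in> GF N. F x = y}" using x0 z by (simp add: F_add frob_add)
    qed
    thus ?thesis using card_ker_F by (simp add: card_image)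
  qed
  have "(\<Sum>x\<in>GF N. psi (tr N (f x))) = (\<Sum>x\<in>GF N. \<chi> (F x))"
    by (intro sum.cong) (auto simp: tr_f \<chi>_def)
  also have "\<dots> = (\<Sum>y\<in>A. \<Sum>x\<in>{x \<in> GF N. F x = y}. \<chi> (F x))"
    unfolding A_def using finN by (intro sum.image_gen)
  also have "\<dots> = (\<Sum>y\<in>A. 2 ^ (m * e) * \<chi> y)"
  proof (rule sum.cong)
    fix y assume "y \<in> A"
    have "(\<Sum>x\<in>{x \<in> GF N. F x = y}. \<chi> (F x)) = (\<Sum>x\<in>{x \<in> GF N. F x = y}. \<chi> y)"
      by (intro sum.cong) auto
    thus "(\<Sum>x\<in>{x \<in> GF N. F x = y}. \<chi> (F x)) = 2 ^ (m * e) * \<chi> y"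
      using fibre[OF \<open>y \<in> A\<close>] by simp
  qed auto
  also have "\<dots> = 2 ^ (m * e) * (\<Sum>y\<in>A. \<chi> y)" by (simp add: sum_distrib_left)
  finally have step1: "(\<Sum>x\<in>GF N. psi (tr N (f x))) = 2 ^ (m * e) * (\<Sum>y\<in>A. \<chi> y)" .

  have trd: "tr N (y * u) = tr d ((y + y ^ (2 ^ d)) * u)" if "u \<in> GF d" for y u
    using that by (simp add: tr_double power_mult_distrib distrib_right)
  \<comment> \<open>The element u = v^2 + v lies in the field of order q and has trace 0, so the
    quadratic form and the linear term vanish at u and only the polar term tr (y u) is
    added.\<close>
  have shift: "\<chi> (y + (v\<^sup>2 + v)) = \<chi> y * psi (tr d ((k + k\<^sup>2) * v\<^sup>2))"
    if "y \<in> A" "v \<in> GF d" "k = y + y ^ (2 ^ d)" for y v k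
  proof -
    define u where "u = v\<^sup>2 + v"
    have v2: "v\<^sup>2 \<in> GF d" by (rule GF_power) fact
    have u: "u \<in> GF d" unfolding u_def using v2 that(2) by (rule GF_add)
    have "tr d u = 0" unfolding u_def tr_add using tr_square[OF that(2)] by (simp add: add_self)
    hence "E2 N u = 0" using E2_double_subfield[OF u] by simp
    moreover have "tr N (t * u) = 0" by (intro tr_double_subfield GF_mult t_GF u)
    moreover have "tr N u = 0" by (intro tr_double_subfield u)
    moreover have yN: "y \<in> GF N" using that(1) A_GF by auto
    have k: "k \<in> GF d"
    proof -
      have "(y ^ (2 ^ d)) ^ (2 ^ d) = y"
        using yN by (simp add: power_mult[symmetric] power_add[symmetric] mult_2)
      thus ?thesis by (simp add: that(3) frob_add add.commute)
    qed
    have yu: "tr N (y * u) = tr d ((k + k\<^sup>2) * v\<^sup>2)"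
    proof -
    have "tr N (y * u) = tr d (k * v\<^sup>2 + k * v)"
      unfolding trd[OF u] that(3)[symmetric] by (simp add: u_def distrib_left)
    also have "\<dots> = tr d (k * v\<^sup>2) + tr d ((k * v)\<^sup>2)"
      using tr_square[OF GF_mult[OF k that(2)]] by (simp add: tr_add)
    also have "\<dots> = tr d ((k + k\<^sup>2) * v\<^sup>2)"
      by (simp add: tr_add[symmetric] distrib_right power_mult_distrib)
    finally show ?thesis .
    qed
    ultimately have "E2 N (y + u) + tr N (t * (y + u)) = (E2 N y + tr N (t * y)) + tr N (y * u)"
      by (simp add: E2_add tr_add distrib_left)
    hence "\<chi> (y + u) = psi ((E2 N y + tr N (t * y)) + tr N (y * u))" by (simp add: \<chi>_def)
    also have "\<dots> = \<chi> y * psi (tr N (y * u))"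
      unfolding \<chi>_def by (intro psi_add chi_F2(2) that(1) tr_in_F2 GF_mult yN GF_d_N[OF u])
    finally show ?thesis unfolding yu by (simp add: u_def)
  qed
  \<comment> \<open>Squaring permutes the field of order q, so orthogonality applies with v^2 in
    place of v.\<close>
  have vsum: "(\<Sum>v\<in>GF d. psi (tr d (c * v\<^sup>2))) = (if c = 0 then 2 ^ d else 0)" if "c \<in> GF d" for c
  proof -
    have "inj_on (\<lambda>v. v\<^sup>2) (GF d)" using frob_inj[where n=1] by (intro inj_onI) simp
    moreover have "(\<lambda>v. v\<^sup>2) ` GF d \<subseteq> GF d" using GF_power by auto
    ultimately have "bij_betw (\<lambda>v. v\<^sup>2) (GF d) (GF d)"
      using find by (simp add: bij_betw_def endo_inj_surj)
    from sum.reindex_bij_betw[OF this, of "\<lambda>v. psi (tr d (c * v))"]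
    show ?thesis using sum_psi_tr[OF d(1) that] by simp
  qed
  define A0 where "A0 = {y \<in> GF N. y + y ^ (2 ^ d) \<in> {0, 1}}"
  have A0: "A0 \<subseteq> A" unfolding A0_def using inA by (auto simp: add.commute)
  have "2 ^ d * (\<Sum>y\<in>A. \<chi> y) = (\<Sum>v\<in>GF d. \<Sum>y\<in>A. \<chi> y)"
    using card_GF[OF d(1)] by simp
  also have "\<dots> = (\<Sum>v\<in>GF d. \<Sum>y\<in>A. \<chi> (y + (v\<^sup>2 + v)))"
  proof (rule sum.cong)
    fix v assume v: "v \<in> GF d"
    hence u: "v\<^sup>2 + v \<in> A" by (intro dA GF_add GF_power)
    have "bij_betw (\<lambda>y. y + u) A A" if "u \<in> A" for u
      by (rule bij_betw_byWitness[where f' = "\<lambda>y. y + u"])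
         (use A_add[OF _ that] in \<open>auto simp: add.assoc add_self\<close>)
    from this[OF u] have "bij_betw (\<lambda>y. y + (v\<^sup>2 + v)) A A" .
    from sum.reindex_bij_betw[OF this, of \<chi>]
    show "(\<Sum>y\<in>A. \<chi> y) = (\<Sum>y\<in>A. \<chi> (y + (v\<^sup>2 + v)))" by simp
  qed auto
  also have "\<dots> = (\<Sum>y\<in>A. \<Sum>v\<in>GF d. \<chi> (y + (v\<^sup>2 + v)))" by (rule sum.swap)
  also have "\<dots> = (\<Sum>y\<in>A. if y \<in> A0 then 2 ^ d * \<chi> y else 0)"
  proof (rule sum.cong)
    fix y assume y: "y \<in> A"
    define k where "k = y + y ^ (2 ^ d)"
    have yN: "y \<in> GF N" using y A_GF by auto
    have "(y ^ (2 ^ d)) ^ (2 ^ d) = y"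
      using yN by (simp add: power_mult[symmetric] power_add[symmetric] mult_2)
    hence k: "k \<in> GF d" by (simp add: k_def frob_add add.commute)
    have "(\<Sum>v\<in>GF d. \<chi> (y + (v\<^sup>2 + v))) = \<chi> y * (\<Sum>v\<in>GF d. psi (tr d ((k + k\<^sup>2) * v\<^sup>2)))"
      unfolding sum_distrib_left by (intro sum.cong refl shift y k_def)
    also have "\<dots> = (if k + k\<^sup>2 = 0 then 2 ^ d * \<chi> y else 0)"
      using vsum[OF GF_add[OF k GF_power[OF k]]] by simp
    also have "k + k\<^sup>2 = 0 \<longleftrightarrow> k * (1 + k) = 0" by (simp add: power2_eq_square distrib_left)
    also have "\<dots> \<longleftrightarrow> k \<in> {0, 1}" using eq_iff_add_eq_0[of 1 k] by auto
    also have "\<dots> \<longleftrightarrow> y \<in> A0" using yN by (simp add: A0_def k_def)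
    finally show "(\<Sum>v\<in>GF d. \<chi> (y + (v\<^sup>2 + v))) = (if y \<in> A0 then 2 ^ d * \<chi> y else 0)" .
  qed auto
  also have "\<dots> = 2 ^ d * (\<Sum>y\<in>A0. \<chi> y)"
    using A0 finA by (simp add: sum.inter_restrict[symmetric] Int_absorb1 sum_distrib_left)
  finally have "(\<Sum>y\<in>A. \<chi> y) = (\<Sum>y\<in>A0. \<chi> y)" by simp

  \<comment> \<open>\<open>A0\<close> consists of the field of order q and one of its cosets, that
    of any solution s of s^q + s = 1.\<close>
  obtain s :: 'a where s': "s ^ (2 ^ d) + s = 1" by (rule artin_schreier_solvable[OF d(1), where c = 1])
  have s: "s ^ (2 ^ d) = s + 1" using add_eq_imp_eq_add[of s "s ^ (2 ^ d)" 1] s' by (simp only: add.commute)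
  have sN: "s \<in> GF N"
  proof -
    have "s ^ (2 ^ N) = (s ^ (2 ^ d)) ^ (2 ^ d)"
      by (simp add: power_mult[symmetric] power_add[symmetric] mult_2)
    thus ?thesis unfolding s frob_add by (simp add: s add.assoc add_self)
  qed
  have A0_eq: "A0 = GF d \<union> (+) s ` GF d"
  proof (rule equalityI; rule subsetI)
    fix y assume y: "y \<in> A0"
    show "y \<in> GF d \<union> (+) s ` GF d"
    proof (cases "y + y ^ (2 ^ d) = 0")
      case True
      hence "y ^ (2 ^ d) = y" using eq_iff_add_eq_0[of y "y ^ (2 ^ d)"] by simp
      thus ?thesis by simp
    next
      case False
      hence y1: "y + y ^ (2 ^ d) = 1" using y by (simp add: A0_def)
      hence "y ^ (2 ^ d) = y + 1" by (rule add_eq_imp_eq_add)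
      hence "(s + y) ^ (2 ^ d) = s + y + (1 + 1)" by (simp add: frob_add s)
      hence "s + y \<in> GF d" by (simp add: two)
      thus ?thesis by (intro UnI2 image_eqI[of _ _ "s + y"]) (auto simp: add_left_self)
    qed
  next
    fix y assume y: "y \<in> GF d \<union> (+) s ` GF d"
    show "y \<in> A0"
    proof (cases "y \<in> GF d")
      case True
      thus ?thesis using GF_d_N by (auto simp: A0_def add_self)
    next
      case False
      then obtain w where w: "y = s + w" "w \<in> GF d" using y by auto
      have "y + y ^ (2 ^ d) = (s + s) + (w + w) + 1" using w s by (simp add: frob_add)
      moreover have "y \<in> GF N" unfolding w(1) by (intro GF_add sN GF_d_N w)
      ultimately show ?thesis by (simp add: A0_def add_self)
    qed
  qed
  have disj: "GF d \<inter> (+) s ` GF d = {}"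
  proof -
    have "s + w \<notin> GF d" if "w \<in> GF d" for w
    proof
      assume "s + w \<in> GF d"
      hence "s + w + w \<in> GF d" using that by (rule GF_add)
      hence "s \<in> GF d" by (simp add: add.assoc add_self)
      thus False using s by simp
    qed
    thus ?thesis by blast
  qed
  \<comment> \<open>On the field of order q the exponent is the trace, which gives a nontrivial
    character; this part sums to 0.\<close>
  have "(\<Sum>y\<in>GF d. \<chi> y) = (\<Sum>y\<in>GF d. psi (tr d (1 * y)))"
    by (intro sum.cong) (auto simp: \<chi>_def E2_double_subfield[simplified] tr_double_subfield[OF GF_mult[OF t_GF], simplified])
  also have "\<dots> = 0" by (subst sum_psi_tr) (use d in auto)
  finally have sum_d: "(\<Sum>y\<in>GF d. \<chi> y) = 0" .
  \<comment> \<open>At s + y the form of y and the polar term both contribute tr y. The form of s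
    equals the trace of t by the parity hypothesis, and so does the linear term at s. Every trace
    occurs twice, and the sign is +1 throughout.\<close>
  have chi_s: "\<chi> (s + y) = 1" if y: "y \<in> GF d" for y
  proof -
    have "tr N (s * y) = tr d y" unfolding trd[OF y] using s by (simp add: add_left_self)
    moreover have "tr N y = 0" "tr N (t * y) = 0" "E2 N y = tr d y"
      by (intro tr_double_subfield GF_mult t_GF y E2_double_subfield)+
    moreover have "tr N (t * s) = tr d t" using trd[OF t_GF, of s] s by (simp add: add_left_self mult.commute)
    moreover have "E2 N s = tr d t"
    proof -
      have "even (d choose 2) \<longleftrightarrow> even (d div 2)" by (rule even_choose_two[OF d(2)])
      thus ?thesis using E2_double_conjugate_add_1[OF s] tr_t by (simp add: char2_of_nat[OF two] two)
    qed
    ultimately have "E2 N (s + y) + tr N (t * (s + y)) = (tr d t + tr d t) + (tr d y + tr d y)"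
      by (simp add: E2_add tr_add distrib_left)
    thus ?thesis by (simp add: \<chi>_def add_self)
  qed
  have "(\<Sum>y\<in>A0. \<chi> y) = (\<Sum>y\<in>GF d. \<chi> y) + (\<Sum>y\<in>(+) s ` GF d. \<chi> y)"
    unfolding A0_eq using find disj by (intro sum.union_disjoint) auto
  also have "(\<Sum>y\<in>(+) s ` GF d. \<chi> y) = (\<Sum>y\<in>GF d. \<chi> (s + y))"
    by (subst sum.reindex) auto
  also have "\<dots> = 2 ^ d" using chi_s card_GF[OF d(1)] by simp
  finally show ?thesis
    unfolding step1 \<open>(\<Sum>y\<in>A. \<chi> y) = (\<Sum>y\<in>A0. \<chi> y)\<close> sum_d by simp
qed

text \<open>Iterating y^p = y + w gives y^(q^2) = y + T, with T the trace of w to the field of order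
  p. So all p roots lie in \<open>GF N\<close> or none, according to whether T = 0, which the
  character sum detects.\<close>

lemma card_artin_schreier_in_GF:
  assumes w: "w \<in> GF N"
  shows "int (card {y \<in> GF N. y ^ (2 ^ m) + y = w}) = (\<Sum>c\<in>GF m. psi (tr N (c * w)))"
proof -
  define T where "T = (\<Sum>i<2*n. w ^ (2 ^ (m * i)))"
  have fin: "finite {y::'a. y ^ (2 ^ m) + y = w}" by (rule finite_artin_schreier_roots[OF m])
  have conj: "y ^ (2 ^ N) = y + T" if y: "y ^ (2 ^ m) + y = w" for y
  proof -
    have "y ^ (2 ^ (m * k)) = y + (\<Sum>i<k. w ^ (2 ^ (m * i)))" for k
    proof (induction k)
      case (Suc k)
      have "y ^ (2 ^ m) = y + w" using add_eq_imp_eq_add[of y "y ^ (2 ^ m)" w] y by (simp add: add.commute)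
      moreover have "y ^ (2 ^ (m * Suc k)) = (y ^ (2 ^ m)) ^ (2 ^ (m * k))"
        by (simp add: power_mult[symmetric] power_add[symmetric])
      ultimately show ?case using Suc by (simp add: frob_add add.assoc)
    qed simp
    from this[of "2 * n"] show ?thesis by (simp add: T_def mult_ac)
  qed
  have "{y \<in> GF N. y ^ (2 ^ m) + y = w} = (if T = 0 then {y. y ^ (2 ^ m) + y = w} else {})"
    using conj by auto
  hence lhs: "int (card {y \<in> GF N. y ^ (2 ^ m) + y = w}) = (if T = 0 then 2 ^ m else 0)"
    using card_artin_schreier_roots[OF m, of w] by simp
  have T: "T \<in> GF m"
  proof -
    have "T ^ (2 ^ m) = (\<Sum>i<2*n. w ^ (2 ^ (m * Suc i)))"
      by (simp add: T_def frob_sum power_mult[symmetric] power_add[symmetric] mult.commute add.commute)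
    moreover have "w + (\<Sum>i<2*n. w ^ (2 ^ (m * Suc i))) = (\<Sum>i<Suc (2*n). w ^ (2 ^ (m * i)))"
      by (subst sum.lessThan_Suc_shift) simp
    moreover have "(\<Sum>i<Suc (2*n). w ^ (2 ^ (m * i))) = T + w"
      using w by (simp add: T_def mult_ac)
    ultimately show ?thesis by (simp add: add.commute)
  qed
  have tr_c: "tr N (c * w) = tr m (T * c)" if c: "c \<in> GF m" for c
  proof -
    \<comment> \<open>Transitivity of the trace: the conjugation exponents are grouped by their
      residue modulo m.\<close>
    have *: "(\<Sum>i<m * k. g i) = (\<Sum>j<m. \<Sum>i<k. g (m * i + j))" for g :: "nat \<Rightarrow> 'a" and k
    proof (induction k)
      case (Suc k)
      have "(\<Sum>i<m * Suc k. g i) = (\<Sum>i<m * k. g i) + (\<Sum>i=m*k..<m*k+m. g i)"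
        using sum.atLeastLessThan_concat[of 0 "m * k" "m * k + m" g]
        by (simp add: lessThan_atLeast0 add.commute)
      also have "(\<Sum>i=m*k..<m*k+m. g i) = (\<Sum>j<m. g (m * k + j))"
        using sum.shift_bounds_nat_ivl[of g 0 "m * k" m] by (simp add: lessThan_atLeast0 add.commute)
      finally show ?case using Suc by (simp add: sum.distrib)
    qed simp
    have "tr N (c * w) = (\<Sum>i<m * (2 * n). (c * w) ^ (2 ^ i))" by (simp add: trace_F2_def mult_ac)
    also have "\<dots> = (\<Sum>j<m. \<Sum>i<2*n. (c * w) ^ (2 ^ (m * i + j)))" by (rule *)
    also have "\<dots> = (\<Sum>j<m. (T * c) ^ (2 ^ j))"
    proof (rule sum.cong)
      fix j
      have "(c * w) ^ (2 ^ (m * i + j)) = (w ^ (2 ^ (m * i)) * c) ^ (2 ^ j)" for i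
      proof -
        have "(c * w) ^ (2 ^ (m * i + j)) = ((c * w) ^ (2 ^ (m * i))) ^ (2 ^ j)"
          by (simp add: power_add flip: power_mult)
        also have "(c * w) ^ (2 ^ (m * i)) = w ^ (2 ^ (m * i)) * c"
          using c power_frob_mod[of c m "m * i"] by (simp add: power_mult_distrib mult.commute)
        finally show ?thesis .
      qed
      thus "(\<Sum>i<2*n. (c * w) ^ (2 ^ (m * i + j))) = (T * c) ^ (2 ^ j)"
        by (simp add: T_def sum_distrib_right frob_sum)
    qed auto
    finally show ?thesis by (simp add: trace_F2_def)
  qed
  have "(\<Sum>c\<in>GF m. psi (tr N (c * w))) = (\<Sum>c\<in>GF m. psi (tr m (T * c)))"
    by (intro sum.cong refl) (simp add: tr_c)
  thus ?thesis unfolding lhs using sum_psi_tr[OF m T] by simp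
qed

text \<open>Every exponent of f has the form p^i + 1, and a^(p^i) = a for a in the field of order p.
  As every nonzero element there is a square a^2, each nontrivial character sum reduces to the one
  already evaluated.\<close>

lemma f_scale:
  assumes "a \<in> GF m"
  shows "f (a * x) = a\<^sup>2 * f x"
proof -
  have "(a * x) ^ ((2 ^ m) ^ i) = a * x ^ ((2 ^ m) ^ i)" for i
    using assms power_frob_mod[of a m "m * i"] by (simp add: power_mult_distrib power_mult)
  hence "poly (R_poly (2 ^ m) e b) (a * x) = a * poly (R_poly (2 ^ m) e b) x"
    by (simp add: R_poly_def poly_sum poly_monom sum_distrib_left mult_ac)
  thus ?thesis by (simp add: f_def power2_eq_square algebra_simps)
qed

theorem card_points:
  "int (card {(x, y). x \<in> GF N \<and> y \<in> GF N \<and> y ^ (2 ^ m) + y = f x})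
     = 2 ^ N + (2 ^ m - 1) * 2 ^ (m * e) * 2 ^ d"
proof -
  have finN: "finite (GF N)" and finm: "finite (GF m)" using d m by (auto intro!: finite_GF)
  have mN: "x \<in> GF N" if "x \<in> GF m" for x using GF_mono[of m N] that by auto
  have inner: "(\<Sum>x\<in>GF N. psi (tr N (c * f x))) = (if c = 0 then 2 ^ N else 2 ^ (m * e) * 2 ^ d)"
    if c: "c \<in> GF m" for c
  proof (cases "c = 0")
    case True
    have "N > 0" using d by simp
    thus ?thesis using True card_GF[of N] by simp
  next
    case False
    \<comment> \<open>Root extraction with p = 2 and i = 1 is the square root.\<close>
    define a where "a = frob_root (2 ^ 1) 1 c"
    have a: "a \<in> GF m" unfolding a_def using c by (rule frob_root_GF)
    have ac: "a\<^sup>2 = c" unfolding a_def using frob_root_power[of 1 1 c] by simp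
    hence "a \<noteq> 0" using False by auto
    have "bij_betw ((*) a) (GF N) (GF N)"
      by (rule bij_betw_byWitness[where f' = "(*) (inverse a)"])
         (use \<open>a \<noteq> 0\<close> GF_mult[OF mN[OF a]] GF_mult[OF GF_inverse[OF mN[OF a]]] in
           \<open>auto simp: mult.assoc[symmetric]\<close>)
    from sum.reindex_bij_betw[OF this, of "\<lambda>x. psi (tr N (f x))"]
    show ?thesis using False sum_psi_f by (simp add: f_scale[OF a] ac)
  qed
  have "{(x, y). x \<in> GF N \<and> y \<in> GF N \<and> y ^ (2 ^ m) + y = f x}
      = (SIGMA x:GF N. {y \<in> GF N. y ^ (2 ^ m) + y = f x})" by auto
  hence "int (card {(x, y). x \<in> GF N \<and> y \<in> GF N \<and> y ^ (2 ^ m) + y = f x})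
      = (\<Sum>x\<in>GF N. int (card {y \<in> GF N. y ^ (2 ^ m) + y = f x}))"
    using finN by (simp only:) (subst card_SigmaI; simp)
  also have "\<dots> = (\<Sum>x\<in>GF N. \<Sum>c\<in>GF m. psi (tr N (c * f x)))"
    by (intro sum.cong refl card_artin_schreier_in_GF f_GF)
  also have "\<dots> = (\<Sum>c\<in>GF m. \<Sum>x\<in>GF N. psi (tr N (c * f x)))" by (rule sum.swap)
  also have "\<dots> = (\<Sum>c\<in>GF m. if c = 0 then 2 ^ N else 2 ^ (m * e) * 2 ^ d)"
    by (intro sum.cong refl inner)
  also have "\<dots> = 2 ^ N + (\<Sum>c\<in>GF m - {0}. 2 ^ (m * e) * 2 ^ d)"
  proof -
    have "GF m = insert 0 (GF m - {0})" by (auto simp: power_0_left)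
    hence "(\<Sum>c\<in>GF m. if c = 0 then (2::int) ^ N else 2 ^ (m * e) * 2 ^ d)
       = (\<Sum>c\<in>insert 0 (GF m - {0}). if c = 0 then 2 ^ N else 2 ^ (m * e) * 2 ^ d)" by simp
    also have "\<dots> = 2 ^ N + (\<Sum>c\<in>GF m - {0}. if c = 0 then 2 ^ N else 2 ^ (m * e) * 2 ^ d)"
      using finm by (subst sum.insert) auto
    also have "(\<Sum>c\<in>GF m - {0}. if c = 0 then 2 ^ N else 2 ^ (m * e) * 2 ^ d)
       = (\<Sum>c\<in>GF m - {0}. (2::int) ^ (m * e) * 2 ^ d)" by (intro sum.cong) auto
    finally show ?thesis .
  qed
  also have "card (GF m - {0}) = 2 ^ m - 1"
    using card_GF[OF m] finm by (subst card_Diff_singleton) (auto simp: power_0_left)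
  hence "(\<Sum>c\<in>GF m - {0}. (2::int) ^ (m * e) * 2 ^ d) = (2 ^ m - 1) * 2 ^ (m * e) * 2 ^ d"
    by (simp add: of_nat_diff)
  finally show ?thesis .
qed

end

subsection \<open>Evaluation of bivariate polynomials\<close>

definition rhom :: "('b::comm_ring_1 \<Rightarrow> 'c::comm_ring_1) \<Rightarrow> bool" where
  "rhom \<phi> \<longleftrightarrow> \<phi> 1 = 1 \<and> (\<forall>x y. \<phi> (x + y) = \<phi> x + \<phi> y) \<and> (\<forall>x y. \<phi> (x * y) = \<phi> x * \<phi> y)"

lemma rhomD:
  assumes "rhom \<phi>"
  shows "\<phi> 1 = 1" "\<phi> (x + y) = \<phi> x + \<phi> y" "\<phi> (x * y) = \<phi> x * \<phi> y"
    "\<phi> 0 = 0" "\<phi> (- x) = - \<phi> x" "\<phi> (x - y) = \<phi> x - \<phi> y" "\<phi> (x ^ n) = \<phi> x ^ n"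
proof -
  show 1: "\<phi> 1 = 1" and 2: "\<And>x y. \<phi> (x + y) = \<phi> x + \<phi> y" and 3: "\<And>x y. \<phi> (x * y) = \<phi> x * \<phi> y"
    using assms by (auto simp: rhom_def)
  show 4: "\<phi> 0 = 0" using 2[of 0 0] by simp
  show 5: "\<phi> (- x) = - \<phi> x" for x using 2[of x "- x"] 4 by (simp add: eq_neg_iff_add_eq_0 add.commute)
  show "\<phi> (x - y) = \<phi> x - \<phi> y" using 2[of x "- y"] 5 by simp
  show "\<phi> (x ^ n) = \<phi> x ^ n" by (induction n) (auto simp: 1 3)
qed

lemma rhom_comp: "rhom \<phi> \<Longrightarrow> rhom \<psi> \<Longrightarrow> rhom (\<lambda>x. \<psi> (\<phi> x))"
  by (auto simp: rhom_def)

lemma rhom_sum: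
  assumes "rhom \<phi>"
  shows "\<phi> (\<Sum>i\<in>I. g i) = (\<Sum>i\<in>I. \<phi> (g i))"
  by (induction I rule: infinite_finite_induct) (auto simp: rhomD[OF assms])

text \<open>One evaluation serves for functions, power series expansions, values at points and
  leading forms; only the coefficient map \<phi> and the image of the outer variable change.\<close>

definition eval2 :: "('b::comm_ring_1 \<Rightarrow> 'c::comm_ring_1) \<Rightarrow> 'c \<Rightarrow> 'b poly \<Rightarrow> 'c" where
  "eval2 \<phi> y G = (\<Sum>i\<le>degree G. \<phi> (poly.coeff G i) * y ^ i)"

lemma eval2_bound:
  assumes "rhom \<phi>" "degree G < n"
  shows "eval2 \<phi> y G = (\<Sum>i<n. \<phi> (poly.coeff G i) * y ^ i)"
  unfolding eval2_def
  by (rule sum.mono_neutral_left) (use assms(2) in \<open>auto simp: rhomD[OF assms(1)] coeff_eq_0\<close>)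

lemma eval2_add:
  assumes "rhom \<phi>"
  shows "eval2 \<phi> y (G + H) = eval2 \<phi> y G + eval2 \<phi> y H"
proof -
  define n where "n = Suc (max (degree G) (degree H))"
  have "degree (G + H) < n" "degree G < n" "degree H < n"
    unfolding n_def using degree_add_le_max[of G H] by auto
  thus ?thesis by (simp add: eval2_bound[OF assms] rhomD[OF assms] sum.distrib distrib_right)
qed

lemma eval2_0 [simp]: "rhom \<phi> \<Longrightarrow> eval2 \<phi> y 0 = 0"
  using rhomD(4)[of \<phi>] by (simp add: eval2_def)

lemma eval2_pCons:
  assumes "rhom \<phi>"
  shows "eval2 \<phi> y (pCons a G) = \<phi> a + y * eval2 \<phi> y G"
proof -
  have "degree (pCons a G) < Suc (Suc (degree G))" by (cases "G = 0") auto
  hence "eval2 \<phi> y (pCons a G) = (\<Sum>i<Suc (Suc (degree G)). \<phi> (poly.coeff (pCons a G) i) * y ^ i)"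
    by (rule eval2_bound[OF assms])
  also have "\<dots> = \<phi> a + (\<Sum>i<Suc (degree G). \<phi> (poly.coeff G i) * y ^ Suc i)"
    by (subst sum.lessThan_Suc_shift) simp
  also have "(\<Sum>i<Suc (degree G). \<phi> (poly.coeff G i) * y ^ Suc i) = y * eval2 \<phi> y G"
    by (simp only: eval2_def sum_distrib_left lessThan_Suc_atMost) (simp add: mult_ac)
  finally show ?thesis .
qed

lemma eval2_smult:
  assumes "rhom \<phi>"
  shows "eval2 \<phi> y (Polynomial.smult c G) = \<phi> c * eval2 \<phi> y G"
  by (induction G) (auto simp: assms eval2_pCons[OF assms] rhomD[OF assms] algebra_simps)

lemma eval2_mult:
  assumes "rhom \<phi>"
  shows "eval2 \<phi> y (G * H) = eval2 \<phi> y G * eval2 \<phi> y H"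
  by (induction G)
     (auto simp: assms eval2_add[OF assms] eval2_smult[OF assms] eval2_pCons[OF assms]
        rhomD[OF assms] algebra_simps)

lemma eval2_const: "rhom \<phi> \<Longrightarrow> eval2 \<phi> y [:c:] = \<phi> c"
  by (simp add: eval2_pCons[of \<phi>])

lemma eval2_monom:
  assumes "rhom \<phi>"
  shows "eval2 \<phi> y (Polynomial.monom c n) = \<phi> c * y ^ n"
  by (induction n) (auto simp: assms eval2_pCons[OF assms] monom_0 monom_Suc rhomD[OF assms])

lemma rhom_eval2:
  assumes "rhom \<phi>"
  shows "rhom (eval2 \<phi> y)"
  unfolding rhom_def
  by (simp add: eval2_add[OF assms] eval2_mult[OF assms] one_pCons eval2_const[OF assms] rhomD(1)[OF assms])

lemma eval2_comp:
  assumes "rhom \<psi>"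
  shows "\<psi> (eval2 \<phi> y G) = eval2 (\<lambda>c. \<psi> (\<phi> c)) (\<psi> y) G"
  by (simp add: eval2_def rhom_sum[OF assms] rhomD[OF assms])

lemma rhom_poly: "rhom (\<lambda>c. poly c a)"
  by (simp add: rhom_def)

lemma rhom_pcompose: "rhom (\<lambda>c. pcompose c u)"
  by (simp add: rhom_def pcompose_add pcompose_mult pcompose_1)


subsection \<open>Polynomials with coefficients in a subring\<close>

definition coeffs_in :: "'b::comm_ring_1 set \<Rightarrow> 'b poly set" where
  "coeffs_in S = {P. \<forall>i. poly.coeff P i \<in> S}"

definition subring_set :: "'b::comm_ring_1 set \<Rightarrow> bool" where
  "subring_set S \<longleftrightarrow> 0 \<in> S \<and> 1 \<in> S \<and> (\<forall>x\<in>S. - x \<in> S) \<and> (\<forall>x\<in>S. \<forall>y\<in>S. x + y \<in> S \<and> x * y \<in> S)"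

lemma subring_setD:
  assumes "subring_set S"
  shows "0 \<in> S" "1 \<in> S" "x \<in> S \<Longrightarrow> - x \<in> S" "x \<in> S \<Longrightarrow> y \<in> S \<Longrightarrow> x + y \<in> S"
    "x \<in> S \<Longrightarrow> y \<in> S \<Longrightarrow> x * y \<in> S" "x \<in> S \<Longrightarrow> y \<in> S \<Longrightarrow> x - y \<in> S" "x \<in> S \<Longrightarrow> x ^ n \<in> S"
proof -
  show "x \<in> S \<Longrightarrow> y \<in> S \<Longrightarrow> x - y \<in> S"
    using assms unfolding subring_set_def by (metis diff_conv_add_uminus)
  show "x \<in> S \<Longrightarrow> x ^ n \<in> S"
    using assms by (induction n) (auto simp: subring_set_def)
qed (use assms in \<open>auto simp: subring_set_def\<close>)

lemma subring_set_sum: "subring_set S \<Longrightarrow> (\<And>i. i \<in> I \<Longrightarrow> g i \<in> S) \<Longrightarrow> (\<Sum>i\<in>I. g i) \<in> S"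
  by (induction I rule: infinite_finite_induct) (auto simp: subring_setD)

lemma subring_set_prod: "subring_set S \<Longrightarrow> (\<And>i. i \<in> I \<Longrightarrow> g i \<in> S) \<Longrightarrow> (\<Prod>i\<in>I. g i) \<in> S"
  by (induction I rule: infinite_finite_induct) (auto simp: subring_setD)

lemma coeffs_inD: "P \<in> coeffs_in S \<Longrightarrow> poly.coeff P i \<in> S"
  by (simp add: coeffs_in_def)

lemma monom_in_coeffs_in: "subring_set S \<Longrightarrow> c \<in> S \<Longrightarrow> Polynomial.monom c n \<in> coeffs_in S"
  by (auto simp: coeffs_in_def subring_setD)

lemma const_in_coeffs_in: "subring_set S \<Longrightarrow> c \<in> S \<Longrightarrow> [:c:] \<in> coeffs_in S"
  using monom_in_coeffs_in[of S c 0] by (simp add: monom_0)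

lemma subring_coeffs_in:
  assumes "subring_set S"
  shows "subring_set (coeffs_in S)"
proof -
  have "1 \<in> coeffs_in S" using const_in_coeffs_in[OF assms, of 1] assms by (simp add: one_pCons subring_setD)
  thus ?thesis
    using assms unfolding subring_set_def[of "coeffs_in S"]
    by (auto simp: coeffs_in_def coeff_mult subring_setD[OF assms] intro!: subring_set_sum[OF assms])
qed

lemma smult_in_coeffs_in:
  "subring_set S \<Longrightarrow> c \<in> S \<Longrightarrow> P \<in> coeffs_in S \<Longrightarrow> Polynomial.smult c P \<in> coeffs_in S"
  by (auto simp: coeffs_in_def subring_setD)

text \<open>Leading terms are cancelled after multiplication by the leading coefficient of
  \<open>G\<close>, so no inverses in \<open>S\<close> are taken. The bound on the quotient is kept
  because \<open>E_inj\<close> and \<open>E_inverse\<close> need a quotient of degree below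
  p.\<close>

lemma pseudo_division_coeffs_in:
  fixes G :: "'b::idom poly"
  assumes S: "subring_set S" and G: "G \<in> coeffs_in S" "G \<noteq> 0"
  shows "P \<in> coeffs_in S \<Longrightarrow> \<exists>c\<in>S - {0}. \<exists>Q\<in>coeffs_in S. \<exists>R\<in>coeffs_in S.
    Polynomial.smult c P = Q * G + R \<and> (R = 0 \<or> degree R < degree G) \<and> degree Q \<le> degree P - degree G"
proof (induction "degree P" arbitrary: P rule: less_induct)
  case less
  note R = subring_setD[OF S] and RX = subring_setD[OF subring_coeffs_in[OF S]]
  show ?case
  proof (cases "P = 0 \<or> degree P < degree G")
    case True
    thus ?thesis using less.prems R(1,2) RX(1)
      by (intro bexI[of _ 1] bexI[of _ 0] bexI[of _ P]) auto
  next
    case False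
    define u where "u = lead_coeff G"
    define M where "M = Polynomial.monom (lead_coeff P) (degree P - degree G)"
    define P' where "P' = Polynomial.smult u P - M * G"
    have u: "u \<in> S" "u \<noteq> 0" using G by (auto simp: u_def coeffs_inD)
    have M: "M \<in> coeffs_in S" unfolding M_def using less.prems by (intro monom_in_coeffs_in[OF S] coeffs_inD)
    have P': "P' \<in> coeffs_in S" unfolding P'_def
      by (rule RX(6)[OF smult_in_coeffs_in[OF S u(1) less.prems] RX(5)[OF M G(1)]])
    have degM: "degree M = degree P - degree G" unfolding M_def using False by (intro degree_monom_eq) auto
    have "M \<noteq> 0" unfolding M_def using False by auto
    hence degMG: "degree (M * G) = degree P" using degM False G by (simp add: degree_mult_eq)
    have le: "degree P' \<le> degree P" unfolding P'_def using degMG by (intro degree_diff_le) auto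
    have lc: "poly.coeff P' (degree P) = 0"
    proof -
      have "poly.coeff (M * G) (degree P) = lead_coeff (M * G)" by (simp add: degMG)
      also have "\<dots> = lead_coeff M * u" by (simp only: lead_coeff_mult u_def)
      also have "lead_coeff M = lead_coeff P" unfolding degM by (simp add: M_def)
      finally show ?thesis by (simp add: P'_def)
    qed
    show ?thesis
    proof (cases "degree P' < degree P")
      case True
      from less.hyps[OF this P'] obtain c Q R where
        *: "c \<in> S - {0}" "Q \<in> coeffs_in S" "R \<in> coeffs_in S" "Polynomial.smult c P' = Q * G + R"
          "R = 0 \<or> degree R < degree G" "degree Q \<le> degree P' - degree G" by blast
      have "Polynomial.smult (c * u) P = (Q + Polynomial.smult c M) * G + R"
      proof -
        have "Polynomial.smult c (Polynomial.smult u P - M * G) = Q * G + R" using *(4) by (simp only: P'_def)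
        hence "Polynomial.smult (c * u) P = Q * G + R + Polynomial.smult c (M * G)"
          by (simp add: smult_diff_right diff_eq_eq)
        thus ?thesis by (simp add: distrib_right)
      qed
      moreover have "degree Q \<le> degree P - degree G" using *(6) True by linarith
      hence "degree (Q + Polynomial.smult c M) \<le> degree P - degree G"
        using degree_smult_le[of c M] degM by (intro degree_add_le) auto
      moreover have "Q + Polynomial.smult c M \<in> coeffs_in S" 
        using * by (intro RX(4) smult_in_coeffs_in[OF S _ M]) auto
      ultimately show ?thesis using * u R(5)[of c u] by (intro bexI[of _ "c * u"] bexI[of _ "Q + Polynomial.smult c M"] bexI[of _ R]) auto
    next
      case False
      hence "degree P' = degree P" using le by simp
      hence "P' = 0" using lc by (metis leading_coeff_0_iff)
      hence "Polynomial.smult u P = M * G + 0" by (simp add: P'_def)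
      thus ?thesis using u M RX(1) degM by (intro bexI[of _ u] bexI[of _ M] bexI[of _ 0]) auto
    qed
  qed
qed

text \<open>Pseudo-division within \<open>S\<close> leaves a remainder that is a multiple of
  \<open>P\<close> of smaller degree, hence 0; inverting the multiplier in \<open>S\<close> recovers
  \<open>Q\<close>.\<close>

lemma quotient_in_coeffs_in:
  fixes S :: "'b::field set"
  assumes S: "subring_set S" "\<And>x. x \<in> S \<Longrightarrow> inverse x \<in> S"
    and "P * Q \<in> coeffs_in S" "P \<in> coeffs_in S" "P \<noteq> 0"
  shows "Q \<in> coeffs_in S"
proof -
  obtain c Q' R where *: "c \<in> S - {0}" "Q' \<in> coeffs_in S"
    "Polynomial.smult c (P * Q) = Q' * P + R" "R = 0 \<or> degree R < degree P"
    using pseudo_division_coeffs_in[OF S(1) assms(4,5,3)] by blast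
  have R: "R = P * (Polynomial.smult c Q - Q')" using *(3) by (simp add: algebra_simps)
  have "Polynomial.smult c Q - Q' = 0"
  proof (rule ccontr)
    assume "Polynomial.smult c Q - Q' \<noteq> 0"
    hence "R \<noteq> 0" "degree P \<le> degree R" unfolding R using assms(5) by (auto simp: degree_mult_eq)
    thus False using *(4) by auto
  qed
  hence "Q = Polynomial.smult (inverse c) Q'" using *(1) by (auto simp: field_simps)
  thus ?thesis using * S by (auto intro!: smult_in_coeffs_in)
qed

lemma poly_in_subring:
  assumes "subring_set S" "P \<in> coeffs_in S" "a \<in> S"
  shows "poly P a \<in> S"
  unfolding poly_altdef
  by (intro subring_set_sum[OF assms(1)] subring_setD(5)[OF assms(1)] subring_setD(7)[OF assms(1)]
      coeffs_inD[OF assms(2)] assms(3))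

subsection \<open>Artin--Schreier curves\<close>

text \<open>\<xi> is defined on polynomials over the whole algebraically closed field, while the
  curve has coefficients in \<open>GF J\<close>. Geometric points and vanishing arguments use the
  large ring; the function field \<open>KL\<close> is then restricted to \<open>GF J\<close>. By
  \<open>alg\<close>, every geometric point is defined over a finite extension of
  \<open>GF J\<close>.\<close>

locale as_curve = closed_char2 ty for ty :: "'a::field itself" +
  fixes m J :: nat and f :: "'a poly" and \<xi> :: "'a poly \<Rightarrow> 'l::field" and y :: 'l
  assumes m: "0 < m" and J: "0 < J" "m dvd J"
    and f_in: "f \<in> coeffs_in (GF J)" and odd_f: "odd (degree f)"
    and alg: "\<And>u::'a. \<exists>n>0. u \<in> GF (J * n)"
    and xi: "rhom \<xi>" and xi_inj: "\<And>c. \<xi> c = 0 \<Longrightarrow> c = 0"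
    and y: "y ^ (2 ^ m) + y = \<xi> f"
begin

abbreviation "p \<equiv> (2::nat) ^ m"
abbreviation "h \<equiv> degree f"
abbreviation "kX \<equiv> coeffs_in (GF J)"
abbreviation "kXY \<equiv> coeffs_in kX"
abbreviation "E \<equiv> eval2 \<xi> y"

lemma p: "2 \<le> p" "0 < p" "even p"
  using m power_increasing[of 1 m "2::nat"] by auto

lemma h: "0 < h" using odd_f by (cases h) auto

lemma two_poly: "(2::'a poly) = 0" "(2::'a poly poly) = 0"
  using two by (metis numeral_poly of_nat_numeral pCons_0_0 one_pCons mult_2 add_self one_add_one add_pCons)+

lemma two_l: "(2::'l) = 0"
  using rhomD(2)[OF xi, of 1 1] rhomD(1,4)[OF xi] two_poly by simp

lemma sub_k: "subring_set (GF J)"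
  unfolding subring_set_def using GF_0_1 GF_add GF_mult by (auto simp: neg_eq)

lemma sub_kX: "subring_set kX" by (rule subring_coeffs_in[OF sub_k])
lemma sub_kXY: "subring_set kXY" by (rule subring_coeffs_in[OF sub_kX])

lemmas RE = rhom_eval2[OF xi, of y]

definition \<Phi> :: "'a poly poly" where
  "\<Phi> = Polynomial.monom 1 p + Polynomial.monom 1 1 + [:f:]"

lemma \<Phi>_in: "\<Phi> \<in> kXY"
  unfolding \<Phi>_def by (intro subring_setD(4)[OF sub_kXY] monom_in_coeffs_in const_in_coeffs_in
      sub_kX f_in subring_setD(2)[OF sub_kX])

lemma E_\<Phi>: "E \<Phi> = 0"
  using y char2_add_self[OF two_l, of "\<xi> f"]
  by (simp add: \<Phi>_def eval2_add[OF xi] eval2_monom[OF xi] eval2_const[OF xi] rhomD[OF xi])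

text \<open>The function \<open>x\<^sup>j y\<^sup>i\<close> has a pole of order \<open>h i + p j\<close> at infinity.\<close>

definition wt :: "nat \<Rightarrow> nat \<Rightarrow> 'a poly poly \<Rightarrow> bool" where
  "wt N s G \<longleftrightarrow> (\<forall>i. poly.coeff G i \<noteq> 0 \<longrightarrow> h * (i + s) + p * degree (poly.coeff G i) \<le> N)"

lemma wt_add:
  assumes "wt N s G" "wt N s H"
  shows "wt N s (G + H)"
  unfolding wt_def
proof (intro allI impI)
  fix i assume nz: "poly.coeff (G + H) i \<noteq> 0"
  let ?a = "poly.coeff G i" and ?b = "poly.coeff H i"
  show "h * (i + s) + p * degree (poly.coeff (G + H) i) \<le> N"
  proof (cases "?a = 0 \<or> ?b = 0")
    case True
    thus ?thesis using assms nz by (auto simp: wt_def)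
  next
    case False
    have "degree (?a + ?b) \<le> degree ?a \<or> degree (?a + ?b) \<le> degree ?b"
      using degree_add_le_max[of ?a ?b] by (auto simp: max_def split: if_splits)
    hence "p * degree (?a + ?b) \<le> p * degree ?a \<or> p * degree (?a + ?b) \<le> p * degree ?b" by auto
    moreover have "h * (i + s) + p * degree ?a \<le> N" "h * (i + s) + p * degree ?b \<le> N"
      using assms False by (auto simp: wt_def)
    ultimately show ?thesis unfolding coeff_add by linarith
  qed
qed

lemma wt_0 [simp]: "wt N s 0" by (simp add: wt_def)

lemma wt_monom: "h * (n + s) + p * degree c \<le> N \<Longrightarrow> wt N s (Polynomial.monom c n)"
  by (auto simp: wt_def)

lemma wt_exists: "\<exists>N. wt N 0 G"
proof
  show "wt (\<Sum>i\<le>degree G. h * i + p * degree (poly.coeff G i)) 0 G"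
    unfolding wt_def
  proof (intro allI impI)
    fix i assume "poly.coeff G i \<noteq> 0"
    hence "i \<in> {..degree G}" by (simp add: le_degree)
    thus "h * (i + 0) + p * degree (poly.coeff G i) \<le> (\<Sum>i\<le>degree G. h * i + p * degree (poly.coeff G i))"
      using member_le_sum[of i "{..degree G}" "\<lambda>i. h * i + p * degree (poly.coeff G i)"] by simp
  qed
qed

lemma wt_mult:
  assumes "wt N 0 G" "wt M 0 H"
  shows "wt (N + M) 0 (G * H)"
proof -
  have "wt (N + M) 0 (\<Sum>i\<le>n. Polynomial.monom (poly.coeff G i * poly.coeff H (n - i)) n)" for n
  proof -
    have *: "wt (N + M) 0 (Polynomial.monom (poly.coeff G i * poly.coeff H (n - i)) n)" if "i \<le> n" for i
    proof (cases "poly.coeff G i * poly.coeff H (n - i) = 0")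
      case False
      hence "poly.coeff G i \<noteq> 0" "poly.coeff H (n - i) \<noteq> 0" by auto
      hence "h * i + p * degree (poly.coeff G i) \<le> N" "h * (n - i) + p * degree (poly.coeff H (n - i)) \<le> M"
        "degree (poly.coeff G i * poly.coeff H (n - i)) = degree (poly.coeff G i) + degree (poly.coeff H (n - i))"
        using assms by (auto simp: wt_def degree_mult_eq)
      moreover have "h * i + h * (n - i) = h * n" using that by (simp flip: distrib_left)
      ultimately show ?thesis by (intro wt_monom) (simp add: distrib_left)
    qed auto
    have "wt (N + M) 0 (\<Sum>i\<in>I. Polynomial.monom (poly.coeff G i * poly.coeff H (n - i)) n)" if "I \<subseteq> {..n}" "finite I" for I
      using that(2,1) by (induction I) (auto intro!: wt_add *)
    thus ?thesis by simp
  qed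
  hence "wt (N + M) 0 (Polynomial.monom (poly.coeff (G * H) n) n)" for n
    by (simp add: coeff_mult monom_sum)
  hence "poly.coeff (G * H) n \<noteq> 0 \<Longrightarrow> h * (n + 0) + p * degree (poly.coeff (G * H) n) \<le> N + M" for n
    unfolding wt_def by (metis coeff_monom)
  thus ?thesis unfolding wt_def by blast
qed

text \<open>Replacing y^p by y + f does not raise the weight, as y^p and the leading monomial of f
  both have weight h p. In this process the quotient is multiplied by y^p, hence its bound with the
  shift p.\<close>

lemma reduce_wt:
  "wt N 0 G \<Longrightarrow> \<exists>Q R. G = Q * \<Phi> + R \<and> degree R < p \<and> wt N p Q \<and> wt N 0 R
     \<and> (G \<in> kXY \<longrightarrow> Q \<in> kXY \<and> R \<in> kXY)"
proof (induction "degree G" arbitrary: G rule: less_induct)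
  case less
  show ?case
  proof (cases "degree G < p")
    case True
    thus ?thesis using less.prems subring_setD(1)[OF sub_kXY]
      by (intro exI[of _ 0] exI[of _ G]) auto
  next
    case False
    define n c where "n = degree G" and "c = lead_coeff G"
    have np: "p \<le> n" using False by (simp add: n_def)
    have "G \<noteq> 0" using False p by auto
    hence c0: "c \<noteq> 0" by (simp add: c_def)
    have wc: "h * n + p * degree c \<le> N" using less.prems c0 by (auto simp: wt_def n_def c_def)
    define M where "M = Polynomial.monom c (n - p)"
    define G' where "G' = G + M * \<Phi>"
    have M\<Phi>: "M * \<Phi> = Polynomial.monom c n + Polynomial.monom c (n - p + 1) + Polynomial.monom (c * f) (n - p)"
      using np by (simp add: M_def \<Phi>_def distrib_left mult_monom flip: monom_0)
    have hn: "h * n = h * (n - p) + h * p" using np by (simp flip: distrib_left)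
    have "n - p + 1 < n" using np p by linarith
    hence hn1: "h * (n - p + 1) \<le> h * n" by (intro mult_le_mono2) simp
    have "f \<noteq> 0" using h by auto
    have wM: "wt N p M" unfolding M_def using wc np by (intro wt_monom) simp
    have "p * degree (c * f) = p * degree c + h * p"
      using c0 \<open>f \<noteq> 0\<close> by (simp add: degree_mult_eq distrib_left)
    hence "h * (n - p) + p * degree (c * f) \<le> N" using wc hn by linarith
    moreover have "h * (n - p + 1) + p * degree c \<le> N" using wc hn1 by linarith
    ultimately have "wt N 0 (M * \<Phi>)"
      unfolding M\<Phi> using wc by (intro wt_add wt_monom) simp_all
    hence wG': "wt N 0 G'" unfolding G'_def using less.prems by (intro wt_add)
    have "degree G' < n"
    proof -
      have "degree G' \<le> n" unfolding G'_def M\<Phi> using \<open>n - p + 1 < n\<close>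
        by (intro degree_add_le order.trans[OF degree_monom_le]) (auto simp: n_def)
      moreover have "poly.coeff G' n = 0"
        unfolding G'_def M\<Phi> using \<open>n - p + 1 < n\<close> p np
        by (auto simp: c_def[symmetric] n_def[symmetric] char2_add_self[OF two_poly(1)])
           (simp add: c_def n_def char2_add_self[OF two_poly(1)])
      moreover have "0 < n" using np p by linarith
      ultimately show ?thesis by (metis le_neq_implies_less leading_coeff_0_iff degree_0)
    qed
    from less.hyps[OF this[unfolded n_def] wG'] obtain Q R where
      *: "G' = Q * \<Phi> + R" "degree R < p" "wt N p Q" "wt N 0 R" "G' \<in> kXY \<longrightarrow> Q \<in> kXY \<and> R \<in> kXY" by blast
    have "G = G' + M * \<Phi>" unfolding G'_def using char2_add_self[OF two_poly(2), of "M * \<Phi>"]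
      by (simp add: add.assoc)
    hence "G = (Q + M) * \<Phi> + R" using * by (simp add: algebra_simps)
    moreover have "G' \<in> kXY \<and> M \<in> kXY" if "G \<in> kXY"
    proof -
      have "M \<in> kXY" unfolding M_def c_def using that by (intro monom_in_coeffs_in sub_kX coeffs_inD)
      thus ?thesis unfolding G'_def using that \<Phi>_in
        by (auto intro!: subring_setD(4)[OF sub_kXY] subring_setD(5)[OF sub_kXY])
    qed
    hence "G \<in> kXY \<longrightarrow> Q + M \<in> kXY \<and> R \<in> kXY"
      using *(5) subring_setD(4)[OF sub_kXY, of Q M] by blast
    ultimately show ?thesis using *(2,4) wt_add[OF *(3) wM] by blast
  qed
qed

subsection \<open>The pole order at infinity\<close>

definition \<gamma>f :: 'a where "\<gamma>f = frob_root (2 ^ m) 1 (lead_coeff f)"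

lemma \<gamma>f: "\<gamma>f ^ p = lead_coeff f" "\<gamma>f \<noteq> 0"
proof -
  show *: "\<gamma>f ^ p = lead_coeff f" using frob_root_power[of m 1 "lead_coeff f"] by (simp add: \<gamma>f_def)
  show "\<gamma>f \<noteq> 0" using * h p by (auto simp: power_0_left)
qed

text \<open>
  Weights become degrees under \<open>x \<mapsto> T\<^sup>p\<close>, \<open>y \<mapsto> \<gamma>T\<^sup>h\<close>, where \<open>\<gamma>\<^sup>p\<close> is the leading coefficient
  of \<open>f\<close>, so that the leading form of the equation is mapped to 0.
\<close>

abbreviation "subT \<equiv> (\<lambda>c::'a poly. pcompose c (Polynomial.monom 1 p))"
abbreviation "\<sigma> \<equiv> eval2 subT (Polynomial.monom \<gamma>f h)"

lemma hom_subT: "rhom subT" by (rule rhom_pcompose)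
lemmas hom_\<sigma> = rhom_eval2[OF hom_subT, of "Polynomial.monom \<gamma>f h"]

lemma degree_subT: "degree (subT c) = p * degree c"
  by (subst degree_pcompose) (simp add: degree_monom_eq)

lemma subT_eq_0: "subT c = 0 \<longleftrightarrow> c = 0"
  using p by (intro pcompose_eq_0_iff) (simp add: degree_monom_eq)

lemma monom_\<gamma>_power: "Polynomial.monom \<gamma>f h ^ i = Polynomial.monom (\<gamma>f ^ i) (h * i)"
  by (simp add: monom_power mult.commute)

lemma degree_\<sigma>_term:
  assumes "c \<noteq> 0"
  shows "subT c * Polynomial.monom \<gamma>f h ^ i \<noteq> 0"
    and "degree (subT c * Polynomial.monom \<gamma>f h ^ i) = h * i + p * degree c"
  using assms \<gamma>f by (auto simp: monom_\<gamma>_power subT_eq_0 degree_mult_eq degree_subT degree_monom_eq simp del: degree_pcompose)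

lemma \<sigma>_degree_le:
  assumes "wt N s G"
  shows "\<sigma> G = 0 \<or> h * s + degree (\<sigma> G) \<le> N"
proof (cases "G = 0")
  case True
  thus ?thesis using hom_subT by simp
next
  case False
  hence hs: "h * s \<le> N" using assms unfolding wt_def
    by (metis (no_types, lifting) add_leD1 add_leD2 distrib_left leading_coeff_0_iff)
  have "degree (\<sigma> G) \<le> N - h * s"
    unfolding eval2_def
  proof (intro degree_sum_le)
    fix i
    show "degree (subT (poly.coeff G i) * Polynomial.monom \<gamma>f h ^ i) \<le> N - h * s"
    proof (cases "poly.coeff G i = 0")
      case False
      hence "h * (i + s) + p * degree (poly.coeff G i) \<le> N" using assms by (auto simp: wt_def)
      thus ?thesis using degree_\<sigma>_term(2)[OF False] by (simp add: distrib_left)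
    qed simp
  qed auto
  thus ?thesis using hs by linarith
qed

text \<open>The images of y^p and of f have the same leading term by the choice of
  \<open>\<gamma>f\<close>, and in characteristic two these cancel; the image of y has the smaller
  degree h.\<close>

lemma degree_\<sigma>_\<Phi>: "degree (\<sigma> \<Phi>) < h * p"
proof -
  have eq: "\<sigma> \<Phi> = Polynomial.monom (lead_coeff f) (h * p) + Polynomial.monom \<gamma>f h + subT f"
    unfolding \<Phi>_def
    by (simp add: eval2_add[OF hom_subT] eval2_monom[OF hom_subT] eval2_const[OF hom_subT]
        rhomD[OF hom_subT] monom_\<gamma>_power \<gamma>f)
  have hp: "h < h * p" using h p by (simp add: less_le_trans)
  have "degree (\<sigma> \<Phi>) \<le> h * p" unfolding eq using hp
    by (intro degree_add_le order.trans[OF degree_monom_le]) (auto simp: degree_subT mult.commute simp del: degree_pcompose)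
  moreover have "poly.coeff (subT f) (h * p) = lead_coeff f"
  proof -
    have "poly.coeff (subT f) (h * p) = lead_coeff (subT f)"
      by (simp only: degree_subT mult.commute)
    also have "\<dots> = lead_coeff f" using p by (subst lead_coeff_comp) (auto simp: degree_monom_eq)
    finally show ?thesis .
  qed
  hence "poly.coeff (\<sigma> \<Phi>) (h * p) = 0" unfolding eq using hp by (simp add: add_self)
  moreover have "0 < h * p" using h p by simp
  ultimately show ?thesis by (metis le_neq_implies_less leading_coeff_0_iff degree_0)
qed

text \<open>The odd number h is prime to p, a power of 2, so the weight determines i modulo
  p.\<close>

lemma weight_inj:
  assumes "i < p" "j < p" "h * i + p * a = h * j + p * b"
  shows "i = j"
  using assms
proof (induction j i arbitrary: a b rule: linorder_wlog)
  case (le j i)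
  have "(h * i) mod p = (h * j) mod p" using le(4) by (metis mod_mult_self2)
  hence "p dvd h * i - h * j" using le(1) by (subst (asm) mod_eq_dvd_iff_nat) auto
  hence "p dvd h * (i - j)" by (simp add: diff_mult_distrib2)
  moreover have "coprime p h" using odd_f by simp
  ultimately have "p dvd i - j" by (simp add: coprime_dvd_mult_right_iff)
  hence "\<not> 0 < i - j" using le(2) by (auto dest: dvd_imp_le)
  thus ?case using le(1) by simp
next
  case (sym j i)
  thus ?case by metis
qed

text \<open>The powers y^i with i < p have weights in distinct classes modulo p, so the images of
  the terms have different degrees and the largest cannot cancel.\<close>

lemma \<sigma>_reduced:
  assumes "G \<noteq> 0" "degree G < p"
  shows "\<sigma> G \<noteq> 0" "wt (degree (\<sigma> G)) 0 G"
proof -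
  define t where "t i = subT (poly.coeff G i) * Polynomial.monom \<gamma>f h ^ i" for i
  define w where "w i = h * i + p * degree (poly.coeff G i)" for i
  define S where "S = {i. i < p \<and> poly.coeff G i \<noteq> 0}"
  have S: "finite S" "S \<noteq> {}"
    using assms by (auto simp: S_def intro!: exI[of _ "degree G"])
  have \<sigma>G: "\<sigma> G = (\<Sum>i\<in>S. t i)"
    unfolding eval2_bound[OF hom_subT assms(2)] t_def
    by (intro sum.mono_neutral_right) (auto simp: S_def)
  define N where "N = Max (w ` S)"
  have "N \<in> w ` S" unfolding N_def using S by (intro Max_in) auto
  then obtain i0 where i0: "i0 \<in> S" "w i0 = N" by auto
  have le: "w i \<le> N" if "i \<in> S" for i unfolding N_def using S that by auto
  have deg: "degree (t i) = w i" if "i \<in> S" for i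
    using degree_\<sigma>_term(2)[of "poly.coeff G i" i] that by (simp add: t_def w_def S_def)
  have "poly.coeff (\<sigma> G) N = (\<Sum>i\<in>S. poly.coeff (t i) N)" by (simp add: \<sigma>G coeff_sum)
  also have "\<dots> = (\<Sum>i\<in>{i0}. poly.coeff (t i) N)"
  proof (rule sum.mono_neutral_right)
    show "\<forall>i\<in>S - {i0}. poly.coeff (t i) N = 0"
    proof
      fix i assume i: "i \<in> S - {i0}"
      have "w i \<noteq> N" using i i0 weight_inj[of i i0 "degree (poly.coeff G i)" "degree (poly.coeff G i0)"]
        by (auto simp: w_def S_def)
      hence "degree (t i) < N" using le[of i] deg i by auto
      thus "poly.coeff (t i) N = 0" by (rule coeff_eq_0)
    qed
  qed (use S i0 in auto)
  also have "\<dots> = lead_coeff (t i0)" using deg[OF i0(1)] i0(2) by simp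
  also have "\<dots> \<noteq> 0" using degree_\<sigma>_term(1)[of "poly.coeff G i0" i0] i0 by (simp add: t_def S_def)
  finally have nz: "poly.coeff (\<sigma> G) N \<noteq> 0" .
  thus "\<sigma> G \<noteq> 0" by auto
  have "N \<le> degree (\<sigma> G)" using nz by (rule le_degree)
  thus "wt (degree (\<sigma> G)) 0 G"
    unfolding wt_def using le assms(2) by (auto simp: S_def w_def) (meson le_degree le_less_trans le_trans)
qed

text \<open>\<sigma> is multiplicative, and the multiple of \<Phi> removed by reduction has an image
  that is 0 or of degree below the sum of the two degrees. The remainder therefore keeps the leading
  form of the product.\<close>

lemma \<sigma>_mult_reduced:
  assumes "G \<noteq> 0" "degree G < p" "H \<noteq> 0" "degree H < p"
  obtains Q R where "G * H = Q * \<Phi> + R" "degree R < p" "R \<noteq> 0"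
    "degree (\<sigma> R) = degree (\<sigma> G) + degree (\<sigma> H)"
    "G \<in> kXY \<and> H \<in> kXY \<longrightarrow> R \<in> kXY"
proof -
  define N where "N = degree (\<sigma> G) + degree (\<sigma> H)"
  have "wt N 0 (G * H)" unfolding N_def using assms by (intro wt_mult \<sigma>_reduced)
  from reduce_wt[OF this] obtain Q R where *: "G * H = Q * \<Phi> + R" "degree R < p" "wt N p Q" "wt N 0 R"
    "G * H \<in> kXY \<longrightarrow> Q \<in> kXY \<and> R \<in> kXY" by blast
  have "\<sigma> R = \<sigma> G * \<sigma> H - \<sigma> Q * \<sigma> \<Phi>"
    using arg_cong[OF *(1), of \<sigma>] by (simp add: eval2_add[OF hom_subT] eval2_mult[OF hom_subT])
  moreover have degN: "degree (\<sigma> G * \<sigma> H) = N" and nz: "\<sigma> G * \<sigma> H \<noteq> 0"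
    using \<sigma>_reduced[OF assms(1,2)] \<sigma>_reduced[OF assms(3,4)] by (auto simp: degree_mult_eq N_def)
  moreover have "\<sigma> Q * \<sigma> \<Phi> = 0 \<or> degree (\<sigma> Q * \<sigma> \<Phi>) < N"
  proof (cases "\<sigma> Q = 0 \<or> \<sigma> \<Phi> = 0")
    case False
    hence "degree (\<sigma> Q * \<sigma> \<Phi>) = degree (\<sigma> Q) + degree (\<sigma> \<Phi>)" by (intro degree_mult_eq) auto
    thus ?thesis using \<sigma>_degree_le[OF *(3)] degree_\<sigma>_\<Phi> False by linarith
  qed auto
  ultimately have "\<sigma> R \<noteq> 0 \<and> degree (\<sigma> R) = N"
  proof (cases "\<sigma> Q * \<sigma> \<Phi> = 0")
    case False
    hence lt: "degree (\<sigma> Q * \<sigma> \<Phi>) < N" using \<open>_ \<or> degree (\<sigma> Q * \<sigma> \<Phi>) < N\<close> by simp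
    have "degree (\<sigma> R) = N"
      unfolding \<open>\<sigma> R = _\<close> using lt degN degree_add_eq_left[of "- (\<sigma> Q * \<sigma> \<Phi>)" "\<sigma> G * \<sigma> H"] by simp
    thus ?thesis using lt by (metis degree_0 not_less0 bot_nat_0.not_eq_extremum)
  qed simp
  hence "R \<noteq> 0" "degree (\<sigma> R) = degree (\<sigma> G) + degree (\<sigma> H)" using hom_subT by (auto simp: N_def)
  moreover have "G \<in> kXY \<and> H \<in> kXY \<longrightarrow> R \<in> kXY" using *(5) subring_setD(5)[OF sub_kXY] by blast
  ultimately show ?thesis using that *(1,2) by blast
qed

lemma degree_\<Phi>: "degree \<Phi> = p" "\<Phi> \<noteq> 0"
proof -
  show *: "degree \<Phi> = p"
    unfolding \<Phi>_def add.assoc using p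
    by (subst degree_add_eq_left) (auto simp: degree_monom_eq intro!: le_less_trans[OF degree_add_le_max])
  show "\<Phi> \<noteq> 0" using * p by auto
qed

text \<open>A vanishing polynomial of minimal degree below \<open>p\<close> would divide a multiple of \<open>\<Phi>\<close>.\<close>

lemma E_inj: "degree G < p \<Longrightarrow> E G = 0 \<Longrightarrow> G = 0"
proof (induction "degree G" arbitrary: G rule: less_induct)
  case less
  show ?case
  proof (rule ccontr)
    assume "G \<noteq> 0"
    have "subring_set (UNIV :: 'a poly set)" by (simp add: subring_set_def)
    from pseudo_division_coeffs_in[OF this, of G \<Phi>] obtain c Q R where
      *: "c \<noteq> 0" "Polynomial.smult c \<Phi> = Q * G + R" "R = 0 \<or> degree R < degree G" "degree Q \<le> p - degree G"
      using \<open>G \<noteq> 0\<close> degree_\<Phi> by (auto simp: coeffs_in_def)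
    have "E (Polynomial.smult c \<Phi>) = 0" by (simp add: eval2_smult[OF xi] E_\<Phi>)
    hence "E R = 0" unfolding *(2) using less.prems by (simp add: eval2_add[OF xi] eval2_mult[OF xi])
    hence R: "R = 0" using less.hyps[of R] *(3) less.prems by auto
    have QG: "Q * G = [:c:] * \<Phi>" using *(2) R by simp
    hence "Q \<noteq> 0" using \<open>G \<noteq> 0\<close> *(1) degree_\<Phi> by auto
    have "degree G > 0"
    proof (rule ccontr)
      assume "\<not> degree G > 0"
      then obtain u where u: "G = [:u:]" by (metis degree_eq_zeroE gr0I)
      hence "\<xi> u = 0" using less.prems by (simp add: eval2_const[OF xi])
      thus False using xi_inj u \<open>G \<noteq> 0\<close> by auto
    qed
    hence "degree Q < p" using *(4) p by linarith
    from \<sigma>_mult_reduced[OF \<open>Q \<noteq> 0\<close> this \<open>G \<noteq> 0\<close> less.prems(1)]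
    obtain Q' R' where **: "Q * G = Q' * \<Phi> + R'" "degree R' < p" "R' \<noteq> 0" by blast
    have R': "R' = ([:c:] - Q') * \<Phi>" using ** QG by (simp add: algebra_simps)
    hence "[:c:] - Q' \<noteq> 0" using **(3) by auto
    hence "p \<le> degree R'" unfolding R' using degree_\<Phi> by (simp add: degree_mult_eq)
    thus False using ** by simp
  qed
qed


subsection \<open>The function field\<close>

text \<open>Denominators are polynomials in x alone, and coefficients are not yet confined to
  \<open>GF J\<close>. The fraction is not normalised; \<open>Rep_cross\<close> compares two of
  them.\<close>

definition Rep :: "'l \<Rightarrow> 'a poly poly \<Rightarrow> 'a poly \<Rightarrow> bool" where
  "Rep z G c \<longleftrightarrow> degree G < p \<and> c \<noteq> 0 \<and> z * \<xi> c = E G"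

definition KL :: "'l set" where
  "KL = {z. \<exists>G\<in>kXY. \<exists>c\<in>kX. Rep z G c}"

lemma KLE:
  assumes "z \<in> KL"
  obtains G c where "G \<in> kXY" "c \<in> kX" "Rep z G c"
  using assms by (auto simp: KL_def)

lemma KLI: "G \<in> kXY \<Longrightarrow> c \<in> kX \<Longrightarrow> Rep z G c \<Longrightarrow> z \<in> KL"
  by (auto simp: KL_def)

lemma xi_nz: "c \<noteq> 0 \<Longrightarrow> \<xi> c \<noteq> 0" using xi_inj by blast

lemma Rep_eq: "Rep z G c \<Longrightarrow> z = E G / \<xi> c"
  using xi_nz[of c] by (simp add: Rep_def field_simps)

lemma Rep_0: "Rep 0 G c \<Longrightarrow> G = 0" using E_inj[of G] by (simp add: Rep_def)

lemma Rep_nz: "Rep z G c \<Longrightarrow> z \<noteq> 0 \<Longrightarrow> G \<noteq> 0"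
  using xi xi_nz[of c] by (auto simp: Rep_def)

lemma Rep_cross:
  assumes "Rep z G c" "Rep z G' c'"
  shows "Polynomial.smult c' G = Polynomial.smult c G'"
proof -
  have "E (Polynomial.smult c' G - Polynomial.smult c G') = \<xi> c' * E G - \<xi> c * E G'"
    by (simp add: rhomD[OF RE] eval2_smult[OF xi])
  also have "E G = z * \<xi> c" using assms by (simp add: Rep_def)
  also have "E G' = z * \<xi> c'" using assms by (simp add: Rep_def)
  also have "\<xi> c' * (z * \<xi> c) - \<xi> c * (z * \<xi> c') = 0" by (simp add: mult_ac)
  finally have "Polynomial.smult c' G - Polynomial.smult c G' = 0"
    using assms by (intro E_inj degree_diff_less) (auto simp: Rep_def intro: le_less_trans[OF degree_smult_le])
  thus ?thesis by simp
qed

lemma reduce: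
  obtains Q R where "G = Q * \<Phi> + R" "degree R < p" "E R = E G" "G \<in> kXY \<longrightarrow> R \<in> kXY"
proof -
  obtain N where "wt N 0 G" using wt_exists by blast
  from reduce_wt[OF this] obtain Q R where *: "G = Q * \<Phi> + R" "degree R < p" "G \<in> kXY \<longrightarrow> R \<in> kXY" by blast
  have "E R = E G" unfolding *(1) by (simp add: eval2_add[OF xi] eval2_mult[OF xi] E_\<Phi>)
  thus ?thesis using that * by blast
qed

lemma E_KL: "G \<in> kXY \<Longrightarrow> c \<in> kX \<Longrightarrow> c \<noteq> 0 \<Longrightarrow> E G / \<xi> c \<in> KL"
proof -
  assume G: "G \<in> kXY" "c \<in> kX" "c \<noteq> 0"
  obtain Q R where "G = Q * \<Phi> + R" "degree R < p" "E R = E G" "G \<in> kXY \<longrightarrow> R \<in> kXY"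
    by (rule reduce[of G])
  thus ?thesis using G xi_nz by (intro KLI[of R c]) (auto simp: Rep_def)
qed

lemma E_in_KL: "G \<in> kXY \<Longrightarrow> E G \<in> KL"
  using E_KL[of G 1] subring_setD(2)[OF sub_kX] rhomD(1)[OF xi] by simp

lemma xi_in_KL: "c \<in> kX \<Longrightarrow> \<xi> c \<in> KL"
  using E_in_KL[of "[:c:]"] const_in_coeffs_in[OF sub_kX] by (simp add: eval2_const[OF xi])

lemma y_eq_E: "y = E (Polynomial.monom 1 1)"
  by (simp add: eval2_monom[OF xi] rhomD[OF xi])

lemma y_in_kXY: "Polynomial.monom 1 1 \<in> kXY"
  by (intro monom_in_coeffs_in sub_kX subring_setD(2))

lemma y_in_KL: "y \<in> KL"
  by (subst y_eq_E) (rule E_in_KL[OF y_in_kXY])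

lemma KL_add:
  assumes "z \<in> KL" "w \<in> KL"
  shows "z + w \<in> KL"
proof -
  obtain G c where 1: "G \<in> kXY" "c \<in> kX" "Rep z G c" using assms(1) by (rule KLE)
  obtain H u where 2: "H \<in> kXY" "u \<in> kX" "Rep w H u" using assms(2) by (rule KLE)
  have "z + w = E (Polynomial.smult u G + Polynomial.smult c H) / \<xi> (c * u)"
  proof -
    have "\<xi> c \<noteq> 0" "\<xi> u \<noteq> 0" using 1(3) 2(3) xi_nz by (auto simp: Rep_def)
    thus ?thesis unfolding Rep_eq[OF 1(3)] Rep_eq[OF 2(3)]
      by (simp add: eval2_add[OF xi] eval2_smult[OF xi] rhomD(3)[OF xi] add_frac_eq mult.commute)
  qed
  moreover have "Polynomial.smult u G + Polynomial.smult c H \<in> kXY" "c * u \<in> kX"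
    using 1 2 by (auto intro!: subring_setD(4)[OF sub_kXY] smult_in_coeffs_in sub_kX subring_setD(5)[OF sub_kX])
  ultimately show ?thesis using E_KL[of "Polynomial.smult u G + Polynomial.smult c H" "c * u"] 1(3) 2(3) by (simp add: Rep_def)
qed

lemma KL_mult:
  assumes "z \<in> KL" "w \<in> KL"
  shows "z * w \<in> KL"
proof -
  obtain G c where 1: "G \<in> kXY" "c \<in> kX" "Rep z G c" using assms(1) by (rule KLE)
  obtain H u where 2: "H \<in> kXY" "u \<in> kX" "Rep w H u" using assms(2) by (rule KLE)
  have "z * w = E (G * H) / \<xi> (c * u)"
    using Rep_eq[OF 1(3)] Rep_eq[OF 2(3)] by (simp add: eval2_mult[OF xi] rhomD[OF xi])
  moreover have "G * H \<in> kXY" "c * u \<in> kX"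
    using 1 2 by (auto intro!: subring_setD(5)[OF sub_kXY] subring_setD(5)[OF sub_kX])
  ultimately show ?thesis using E_KL[of "G * H" "c * u"] 1(3) 2(3) by (simp add: Rep_def)
qed

lemma KL_01: "0 \<in> KL" "1 \<in> KL"
  using xi_in_KL[of 0] xi_in_KL[of 1] subring_setD(1,2)[OF sub_kX] rhomD[OF xi] by auto

lemma KL_uminus: "z \<in> KL \<Longrightarrow> - z \<in> KL"
  by (simp add: char2_minus[OF two_l])

lemma KL_diff: "z \<in> KL \<Longrightarrow> w \<in> KL \<Longrightarrow> z - w \<in> KL"
  by (simp add: char2_diff[OF two_l] KL_add)

lemma KL_power: "z \<in> KL \<Longrightarrow> z ^ n \<in> KL"
  by (induction n) (auto simp: KL_01 KL_mult)

text \<open>The Euclidean algorithm against \<Phi>: division of a multiple of \<Phi> by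
  \<open>G\<close> expresses the inverse of E G through that of a remainder of smaller degree, which
  is not killed by E because of \<open>E_inj\<close>.\<close>

lemma E_inverse: "G \<in> kXY \<Longrightarrow> degree G < p \<Longrightarrow> inverse (E G) \<in> KL"
proof (induction "degree G" arbitrary: G rule: less_induct)
  case less
  show ?case
  proof (cases "degree G = 0")
    case True
    then obtain c where c: "G = [:c:]" by (rule degree_eq_zeroE)
    hence "c \<in> kX" using coeffs_inD[OF less.prems(1), of 0] by simp
    thus ?thesis
      using E_KL[of 1 c] KL_01(1) c subring_setD(2)[OF sub_kXY] rhomD(1,4)[OF RE] rhomD(4)[OF xi]
      by (cases "c = 0") (auto simp: eval2_const[OF xi] field_simps)
  next
    case False
    hence "G \<noteq> 0" by auto
    obtain c Q R where *: "c \<in> kX - {0}" "Q \<in> kXY" "R \<in> kXY" "Polynomial.smult c \<Phi> = Q * G + R"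
      "R = 0 \<or> degree R < degree G" "degree Q \<le> degree \<Phi> - degree G"
      using pseudo_division_coeffs_in[OF sub_kX less.prems(1) \<open>G \<noteq> 0\<close> \<Phi>_in] by blast
    have "E (Polynomial.smult c \<Phi>) = 0" by (simp add: eval2_smult[OF xi] E_\<Phi>)
    hence EQ: "E Q * E G = - E R" unfolding *(4) by (simp add: eval2_add[OF xi] eval2_mult[OF xi] eq_neg_iff_add_eq_0)
    have degQ: "degree Q < p" using *(6) False degree_\<Phi> p by simp
    have "R \<noteq> 0"
    proof
      assume "R = 0"
      hence "E Q = 0 \<or> E G = 0" using EQ xi by simp
      hence "Q = 0" using E_inj degQ less.prems(2) \<open>G \<noteq> 0\<close> by blast
      hence "Polynomial.smult c \<Phi> = 0" using *(4) \<open>R = 0\<close> by simp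
      thus False using *(1) degree_\<Phi> by simp
    qed
    hence degR: "degree R < degree G" using *(5) by simp
    hence "degree R < p" using less.prems by simp
    hence "inverse (E R) \<in> KL" "E R \<noteq> 0" using less.hyps degR *(3) E_inj \<open>R \<noteq> 0\<close> by auto
    moreover have "inverse (E G) = - E Q * inverse (E R)"
    proof -
      have "E G \<noteq> 0" using E_inj less.prems(2) \<open>G \<noteq> 0\<close> by blast
      thus ?thesis using EQ \<open>E R \<noteq> 0\<close> by (simp add: field_simps eq_neg_iff_add_eq_0)
    qed
    ultimately show ?thesis using KL_mult KL_uminus E_in_KL[OF *(2)] by metis
  qed
qed

lemma KL_inverse:
  assumes "z \<in> KL"
  shows "inverse z \<in> KL"
proof -
  obtain G c where 1: "G \<in> kXY" "c \<in> kX" "Rep z G c" using assms by (rule KLE)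
  have "inverse z = \<xi> c * inverse (E G)" using Rep_eq[OF 1(3)] by (simp add: field_simps)
  thus ?thesis using KL_mult[OF xi_in_KL[OF 1(2)] E_inverse[OF 1(1)]] 1(3) by (simp add: Rep_def)
qed

lemma KL_divide: "z \<in> KL \<Longrightarrow> w \<in> KL \<Longrightarrow> z / w \<in> KL"
  by (simp add: divide_inverse KL_mult KL_inverse)


subsection \<open>The place at infinity\<close>

text \<open>The pole order at infinity is the T-degree under \<sigma>. The description is meaningful
  because, by \<open>Rep_cross\<close>, passing to another fraction changes both degrees by the same
  amount.\<close>

definition vinf :: "'l \<Rightarrow> int" where
  "vinf z = (THE n. \<exists>G c. Rep z G c \<and> n = int (p * degree c) - int (degree (\<sigma> G)))"

lemma degree_\<sigma>_smult:
  assumes "c \<noteq> 0" "\<sigma> G \<noteq> 0"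
  shows "degree (\<sigma> (Polynomial.smult c G)) = p * degree c + degree (\<sigma> G)"
  using assms subT_eq_0[of c] by (simp only: eval2_smult[OF hom_subT]) (simp add: degree_mult_eq degree_subT del: degree_pcompose)

lemma vinf_eq:
  assumes "Rep z G c" "z \<noteq> 0"
  shows "vinf z = int (p * degree c) - int (degree (\<sigma> G))"
  unfolding vinf_def
proof (rule the_equality)
  fix n assume "\<exists>G c. Rep z G c \<and> n = int (p * degree c) - int (degree (\<sigma> G))"
  then obtain G' c' where *: "Rep z G' c'" "n = int (p * degree c') - int (degree (\<sigma> G'))" by blast
  have "G \<noteq> 0" "G' \<noteq> 0" using Rep_nz[OF _ assms(2)] assms(1) * by blast+
  hence nz: "\<sigma> G \<noteq> 0" "\<sigma> G' \<noteq> 0" using \<sigma>_reduced(1) assms(1) *(1) by (auto simp: Rep_def)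
  have "degree (\<sigma> (Polynomial.smult c' G)) = degree (\<sigma> (Polynomial.smult c G'))"
    using Rep_cross[OF assms(1) *(1)] by simp
  hence "p * degree c' + degree (\<sigma> G) = p * degree c + degree (\<sigma> G')"
    using nz assms(1) *(1) by (simp add: degree_\<sigma>_smult Rep_def)
  thus "n = int (p * degree c) - int (degree (\<sigma> G))" using *(2) by linarith
qed (use assms in blast)

lemma vinf_mult:
  assumes "z \<in> KL" "w \<in> KL" "z \<noteq> 0" "w \<noteq> 0"
  shows "vinf (z * w) = vinf z + vinf w"
proof -
  obtain G c where 1: "G \<in> kXY" "c \<in> kX" "Rep z G c" using assms(1) by (rule KLE)
  obtain H u where 2: "H \<in> kXY" "u \<in> kX" "Rep w H u" using assms(2) by (rule KLE)
  have nz: "G \<noteq> 0" "H \<noteq> 0" using Rep_nz 1 2 assms by blast+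
  have deg: "degree G < p" "degree H < p" "c \<noteq> 0" "u \<noteq> 0" using 1 2 by (auto simp: Rep_def)
  obtain Q R where *: "G * H = Q * \<Phi> + R" "degree R < p" "R \<noteq> 0"
    "degree (\<sigma> R) = degree (\<sigma> G) + degree (\<sigma> H)" "G \<in> kXY \<and> H \<in> kXY \<longrightarrow> R \<in> kXY"
    by (rule \<sigma>_mult_reduced[OF nz(1) deg(1) nz(2) deg(2)])
  have "E R = E G * E H" using arg_cong[OF *(1), of E] by (simp add: eval2_add[OF xi] eval2_mult[OF xi] E_\<Phi>)
  hence "Rep (z * w) R (c * u)"
    using * 1(3) 2(3) by (simp add: Rep_def rhomD(3)[OF xi] flip: mult.assoc) (simp add: mult_ac)
  from vinf_eq[OF this] show ?thesis
    using vinf_eq[OF 1(3)] vinf_eq[OF 2(3)] assms deg *(4) by (simp add: degree_mult_eq distrib_left)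
qed

lemma vinf_add:
  assumes "z \<in> KL" "w \<in> KL" "z \<noteq> 0" "w \<noteq> 0" "z + w \<noteq> 0"
  shows "min (vinf z) (vinf w) \<le> vinf (z + w)"
proof -
  obtain G c where 1: "G \<in> kXY" "c \<in> kX" "Rep z G c" using assms(1) by (rule KLE)
  obtain H u where 2: "H \<in> kXY" "u \<in> kX" "Rep w H u" using assms(2) by (rule KLE)
  have deg: "degree G < p" "degree H < p" "c \<noteq> 0" "u \<noteq> 0" using 1 2 by (auto simp: Rep_def)
  define A B where "A = Polynomial.smult u G" and "B = Polynomial.smult c H"
  have "E G = z * \<xi> c" "E H = w * \<xi> u" using 1(3) 2(3) by (simp_all add: Rep_def)
  hence "E (A + B) = (z + w) * \<xi> (c * u)"
    by (simp add: A_def B_def eval2_add[OF xi] eval2_smult[OF xi] rhomD(3)[OF xi] algebra_simps)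
  moreover have "degree (A + B) < p"
    unfolding A_def B_def using deg by (intro degree_add_less le_less_trans[OF degree_smult_le])
  ultimately have "Rep (z + w) (A + B) (c * u)" using deg by (simp add: Rep_def)
  from vinf_eq[OF this assms(5)]
  have "vinf (z + w) = int (p * degree c) + int (p * degree u) - int (degree (\<sigma> (A + B)))"
    using deg by (simp add: degree_mult_eq distrib_left)
  moreover have "degree (\<sigma> (A + B)) \<le> max (degree (\<sigma> A)) (degree (\<sigma> B))"
    by (simp only: eval2_add[OF hom_subT] degree_add_le_max)
  moreover have "degree (\<sigma> A) = p * degree u + degree (\<sigma> G)" "degree (\<sigma> B) = p * degree c + degree (\<sigma> H)"
    unfolding A_def B_def using \<sigma>_reduced(1) Rep_nz[OF 1(3)] Rep_nz[OF 2(3)] assms deg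
    by (simp_all add: degree_\<sigma>_smult)
  ultimately show ?thesis using vinf_eq[OF 1(3) assms(3)] vinf_eq[OF 2(3) assms(4)] by linarith
qed

lemma vinf_E: "degree G < p \<Longrightarrow> E G \<noteq> 0 \<Longrightarrow> vinf (E G) = - int (degree (\<sigma> G))"
  using vinf_eq[of "E G" G 1] by (simp add: Rep_def rhomD[OF xi])

lemma vinf_xi: "c \<noteq> 0 \<Longrightarrow> vinf (\<xi> c) = - int (p * degree c)"
  using vinf_E[of "[:c:]"] xi_nz[of c] p degree_subT[of c] by (simp add: eval2_const[OF xi] eval2_const[OF hom_subT])

lemma vinf_y: "vinf y = - int h" "y \<noteq> 0"
proof -
  have d: "degree (Polynomial.monom (1::'a poly) 1) < p" using p degree_monom_le[of "1::'a poly" 1] by linarith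
  have "E (Polynomial.monom 1 1) \<noteq> 0" using E_inj[OF d] by auto
  thus "y \<noteq> 0" using y_eq_E by metis
  have "\<sigma> (Polynomial.monom 1 1) = Polynomial.monom \<gamma>f h"
    by (simp only: eval2_monom[OF hom_subT] rhomD[OF hom_subT] mult_1 power_one_right)
  hence "vinf (E (Polynomial.monom 1 1)) = - int h"
    using vinf_E[OF d \<open>E (Polynomial.monom 1 1) \<noteq> 0\<close>] \<gamma>f(2) by (simp add: degree_monom_eq)
  thus "vinf y = - int h" using y_eq_E by metis
qed

lemma vinf_power:
  assumes "z \<in> KL" "z \<noteq> 0"
  shows "vinf (z ^ n) = int n * vinf z"
proof (induction n)
  case 0
  show ?case using vinf_xi[of 1] by (simp add: rhomD[OF xi])
next
  case (Suc n)
  thus ?case using vinf_mult[OF assms(1) KL_power[OF assms(1)]] assms by (simp add: algebra_simps)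
qed

text \<open>x and y have the coprime pole orders p and h, so a Bezout relation p i = h j + 1 gives
  y^j / x^i the order 1.\<close>

lemma vinf_uniformizer: obtains t where "t \<in> KL" "t \<noteq> 0" "vinf t = 1"
proof -
  have "gcd p h = 1" using odd_f by (simp add: coprime_iff_gcd_eq_1[symmetric])
  then obtain i j where ij: "p * i = h * j + 1" using bezout_nat[of p h] p by auto
  define x where "x = \<xi> [:0, 1:]"
  have x: "x \<in> KL" "x \<noteq> 0" "vinf x = - int p"
    using xi_in_KL[of "[:0,1:]"] xi_nz[of "[:0,1:]"] vinf_xi[of "[:0,1:]"] subring_setD(1,2)[OF sub_k]
    by (auto simp: x_def coeffs_in_def coeff_pCons power_0_left split: nat.split)
  define t where "t = y ^ j / x ^ i"
  have t: "t \<in> KL" "t \<noteq> 0" unfolding t_def using x y_in_KL vinf_y by (auto intro!: KL_divide KL_power)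
  have "y ^ j = t * x ^ i" unfolding t_def using x by simp
  hence "vinf (y ^ j) = vinf t + vinf (x ^ i)" using t x by (simp add: vinf_mult KL_power)
  hence "- (int j * int h) = vinf t - int i * int p"
    by (simp add: vinf_power[OF y_in_KL vinf_y(2)] vinf_power[OF x(1,2)] vinf_y x(3))
  moreover have "int i * int p = int j * int h + 1" using arg_cong[OF ij, of int] by (simp add: mult.commute del: of_nat_power)
  ultimately have "vinf t = 1" by linarith
  thus ?thesis using that t by blast
qed

lemma inverse_k: "u \<in> GF J \<Longrightarrow> inverse u \<in> GF J" by (rule GF_inverse)

text \<open>Among the monomials of weight at most p deg c only a power of x alone can attain the
  bound, by \<open>weight_inj\<close>. So the top coefficient of \<sigma> G comes from a coefficient
  in \<open>GF J\<close>, and subtracting a suitable constant from z removes it.\<close>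

lemma vinf_residue:
  assumes "z \<in> KL" "z \<noteq> 0" "vinf z \<ge> 0"
  obtains u where "u \<in> GF J" "z = \<xi> [:u:] \<or> vinf (z - \<xi> [:u:]) > 0"
proof -
  obtain G c where 1: "G \<in> kXY" "c \<in> kX" "Rep z G c" using assms(1) by (rule KLE)
  have deg: "degree G < p" "c \<noteq> 0" using 1 by (auto simp: Rep_def)
  have "G \<noteq> 0" using Rep_nz 1 assms by blast
  define N where "N = p * degree c"
  have le: "degree (\<sigma> G) \<le> N" using vinf_eq[OF 1(3) assms(2)] assms(3) unfolding N_def by linarith
  have wt: "h * i + p * degree (poly.coeff G i) \<le> N" if "poly.coeff G i \<noteq> 0" for i
  proof -
    have "h * (i + 0) + p * degree (poly.coeff G i) \<le> degree (\<sigma> G)"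
      using \<sigma>_reduced(2)[OF \<open>G \<noteq> 0\<close> deg(1)] that unfolding wt_def by blast
    thus ?thesis using le by simp
  qed
  \<comment> \<open>If the coefficient of y^0 has smaller degree than c, this quotient is 0, which
    is then the residue.\<close>
  define u where "u = poly.coeff (poly.coeff G 0) (degree c) / lead_coeff c"
  have u: "u \<in> GF J" unfolding u_def divide_inverse using 1
    by (intro subring_setD(5)[OF sub_k] GF_inverse coeffs_inD)
  have coeffN: "poly.coeff (\<sigma> G) N = poly.coeff (poly.coeff G 0) (degree c)"
  proof -
    have "poly.coeff (\<sigma> G) N = (\<Sum>i<p. poly.coeff (subT (poly.coeff G i) * Polynomial.monom \<gamma>f h ^ i) N)"
      by (simp add: eval2_bound[OF hom_subT deg(1)] coeff_sum)
    also have "\<dots> = (\<Sum>i\<in>{0}. poly.coeff (subT (poly.coeff G i) * Polynomial.monom \<gamma>f h ^ i) N)"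
    proof (rule sum.mono_neutral_right)
      show "\<forall>i\<in>{..<p} - {0}. poly.coeff (subT (poly.coeff G i) * Polynomial.monom \<gamma>f h ^ i) N = 0"
      proof
        fix i assume i: "i \<in> {..<p} - {0}"
        show "poly.coeff (subT (poly.coeff G i) * Polynomial.monom \<gamma>f h ^ i) N = 0"
        proof (cases "poly.coeff G i = 0")
          case False
          have "h * i + p * degree (poly.coeff G i) \<noteq> N"
            using weight_inj[of i 0 "degree (poly.coeff G i)" "degree c"] i p by (auto simp: N_def)
          hence "degree (subT (poly.coeff G i) * Polynomial.monom \<gamma>f h ^ i) < N"
            using wt[OF False] degree_\<sigma>_term(2)[OF False, of i] by simp
          thus ?thesis by (rule coeff_eq_0)
        qed simp
      qed
    qed (use p in auto)
    also have "\<dots> = poly.coeff (subT (poly.coeff G 0)) N" by simp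
    also have "\<dots> = poly.coeff (poly.coeff G 0) (degree c)"
    proof (cases "degree (poly.coeff G 0) = degree c")
      case True
      hence "poly.coeff (subT (poly.coeff G 0)) N = lead_coeff (subT (poly.coeff G 0))"
        by (simp only: degree_subT N_def)
      also have "\<dots> = lead_coeff (poly.coeff G 0)" using p by (subst lead_coeff_comp) (auto simp: degree_monom_eq)
      finally show ?thesis using True by simp
    next
      case False
      have "degree (poly.coeff G 0) < degree c \<or> poly.coeff G 0 = 0"
      proof (cases "poly.coeff G 0 = 0")
        case nz: False
        have "p * degree (poly.coeff G 0) \<le> p * degree c" using wt[OF nz] by (simp add: N_def)
        thus ?thesis using False p by simp
      qed simp
      thus ?thesis
      proof
        assume lt: "degree (poly.coeff G 0) < degree c"
        hence "degree (subT (poly.coeff G 0)) < N" unfolding degree_subT N_def using p by simp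
        thus ?thesis using lt by (simp add: coeff_eq_0 del: degree_pcompose)
      qed simp
    qed
    finally show ?thesis .
  qed
  define G' where "G' = G - [:Polynomial.smult u c:]"
  have "E G' = (z - \<xi> [:u:]) * \<xi> c"
    using 1(3) rhomD(3)[OF xi, of "[:u:]" c] by (simp add: G'_def rhomD[OF RE] eval2_const[OF xi] Rep_def left_diff_distrib)
  moreover have degG': "degree G' < p" unfolding G'_def using deg(1) p by (intro degree_diff_less) auto
  ultimately have rep: "Rep (z - \<xi> [:u:]) G' c" using deg by (simp add: Rep_def)
  show ?thesis
  proof (cases "z = \<xi> [:u:]")
    case False
    hence nz: "z - \<xi> [:u:] \<noteq> 0" by simp
    hence G': "\<sigma> G' \<noteq> 0" using \<sigma>_reduced(1)[OF Rep_nz[OF rep]] rep by (simp add: Rep_def)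
    have eq: "\<sigma> G' = \<sigma> G - Polynomial.smult u (subT c)"
      by (simp add: G'_def rhomD[OF hom_\<sigma>] eval2_const[OF hom_subT] pcompose_smult)
    have "degree (\<sigma> G') \<le> N" unfolding eq using le
      by (intro degree_diff_le order.trans[OF degree_smult_le]) (auto simp: degree_subT N_def simp del: degree_pcompose)
    moreover have "poly.coeff (\<sigma> G') N = 0"
    proof -
      have "poly.coeff (subT c) N = lead_coeff (subT c)" by (simp only: degree_subT N_def)
      also have "\<dots> = lead_coeff c" using p by (subst lead_coeff_comp) (auto simp: degree_monom_eq)
      finally show ?thesis unfolding eq using coeffN deg by (simp add: u_def)
    qed
    ultimately have "degree (\<sigma> G') < N" using G' by (metis le_neq_implies_less leading_coeff_0_iff)
    hence "vinf (z - \<xi> [:u:]) > 0" using vinf_eq[OF rep nz] unfolding N_def by linarith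
    thus ?thesis using that u by blast
  qed (use that u in blast)
qed

end

text \<open>The solution is the sum of all \<phi>^(p^i) with p = 2^m, which telescopes. As \<phi>
  has no constant term, only the powers with i at most n affect the coefficient of index n.\<close>

lemma char2_artin_schreier_fps:
  fixes \<phi> :: "'b::field fps"
  assumes "(2::'b) = 0" "fps_nth \<phi> 0 = 0" "0 < m"
  obtains W where "W ^ (2 ^ m) + W = \<phi>" "fps_nth W 0 = 0"
proof -
  have two: "(2::'b fps) = 0" using assms(1) by (simp add: fps_numeral_fps_const)
  have zero: "fps_nth (\<phi> ^ ((2 ^ m) ^ i)) n = 0" if "n < i" for n i
  proof -
    have "i < (2 ^ m) ^ i" using assms(3)
      by (metis less_exp less_le_trans power_mult power_increasing mult_le_mono1 mult_1 Suc_leI One_nat_def one_le_numeral)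
    thus ?thesis using that startsby_zero_power_prefix[OF assms(2), of "(2 ^ m) ^ i"] by auto
  qed
  define W where "W = Abs_fps (\<lambda>n. \<Sum>i\<le>n. fps_nth (\<phi> ^ ((2 ^ m) ^ i)) n)"
  have "fps_nth (W ^ (2 ^ m) + W) M = fps_nth \<phi> M" for M
  proof -
    \<comment> \<open>Comparison with a partial sum: the error \<open>D\<close> vanishes up to index
      M, and so does the coefficient of index M of its p-th power.\<close>
    define S where "S = (\<Sum>i\<le>M. \<phi> ^ ((2 ^ m) ^ i))"
    define D where "D = W - S"
    have D: "fps_nth D n = 0" if "n \<le> M" for n
    proof -
      have "(\<Sum>i\<le>M. fps_nth (\<phi> ^ ((2 ^ m) ^ i)) n) = (\<Sum>i\<le>n. fps_nth (\<phi> ^ ((2 ^ m) ^ i)) n)"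
        using that zero by (intro sum.mono_neutral_right) auto
      thus ?thesis by (simp add: D_def S_def W_def fps_sum_nth)
    qed
    have "fps_nth (D ^ (2 ^ m)) M = fps_nth (D * D ^ (2 ^ m - 1)) M" by (simp flip: power_Suc)
    also have "\<dots> = 0" unfolding fps_mult_nth using D by (intro sum.neutral) auto
    finally have Dp: "fps_nth (D ^ (2 ^ m)) M = 0" .
    have "S ^ (2 ^ m) = (\<Sum>i\<le>M. \<phi> ^ ((2 ^ m) ^ Suc i))"
      by (simp add: S_def char2_power_sum[OF two] power_mult[symmetric] mult.commute)
    moreover have "\<phi> + (\<Sum>i\<le>M. \<phi> ^ ((2 ^ m) ^ Suc i)) = S + \<phi> ^ ((2 ^ m) ^ Suc M)"
      using sum.atMost_Suc_shift[of "\<lambda>i. \<phi> ^ ((2 ^ m) ^ i)" M] by (simp add: S_def)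
    ultimately have *: "S ^ (2 ^ m) + \<phi> = S + \<phi> ^ ((2 ^ m) ^ Suc M)"
      by (simp only: add.commute)
    have "S ^ (2 ^ m) + S = S ^ (2 ^ m) + (\<phi> + \<phi>) + S"
      by (simp only: char2_add_self[OF two] add_0_right)
    also have "\<dots> = (S ^ (2 ^ m) + \<phi>) + \<phi> + S" by (simp only: add.assoc)
    also have "\<dots> = \<phi> + \<phi> ^ ((2 ^ m) ^ Suc M) + (S + S)" unfolding * by (simp only: add_ac)
    finally have "S ^ (2 ^ m) + S = \<phi> + \<phi> ^ ((2 ^ m) ^ Suc M)" by (simp add: char2_add_self[OF two])
    moreover have "W = S + D" by (simp add: D_def)
    hence "W ^ (2 ^ m) + W = (S ^ (2 ^ m) + S) + D ^ (2 ^ m) + D" by (simp add: char2_power[OF two])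
    ultimately show ?thesis using Dp D[of M] zero[of M "Suc M"] by (simp del: power_Suc)
  qed
  hence "W ^ (2 ^ m) + W = \<phi>" by (intro fps_ext)
  moreover have "fps_nth W 0 = 0" using assms(2) by (simp add: W_def)
  ultimately show ?thesis using that by blast
qed

context as_curve
begin

subsection \<open>Expansions at the finite points\<close>

definition pt :: "'a \<Rightarrow> 'a \<Rightarrow> bool" where "pt a b \<longleftrightarrow> b ^ p + b = poly f a"

abbreviation shiftp :: "'a \<Rightarrow> 'a poly \<Rightarrow> 'a fps" where
  "shiftp a \<equiv> (\<lambda>c. fps_of_poly (pcompose c [:a, 1:]))"

lemma hom_shiftp: "rhom (shiftp a)"
  by (rule rhom_comp[OF rhom_pcompose]) (simp add: rhom_def fps_of_poly_add fps_of_poly_mult)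

lemma shiftp_0: "fps_nth (shiftp a c) 0 = poly c a"
  by (simp add: poly_0_coeff_0[symmetric] poly_pcompose)

lemma shiftp_eq_0: "shiftp a c = 0 \<longleftrightarrow> c = 0"
  using pcompose_eq_0_iff[of "[:a, 1:]" c] fps_of_poly_eq_iff[of _ 0] by simp

text \<open>The expansion of y in the parameter x - a. It exists at every point because Y^p + Y has
  derivative 1: the covering of the x-line is unramified over all finite a.\<close>

definition Yp :: "'a \<Rightarrow> 'a \<Rightarrow> 'a fps" where
  "Yp a b = (SOME Y. Y ^ p + Y = shiftp a f \<and> fps_nth Y 0 = b)"

lemma Yp:
  assumes "pt a b"
  shows "Yp a b ^ p + Yp a b = shiftp a f" "fps_nth (Yp a b) 0 = b"
proof -
  have twof: "(2::'a fps) = 0" using two by (simp add: fps_numeral_fps_const)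
  have "fps_nth (shiftp a f - fps_const (poly f a)) 0 = 0" by (simp add: shiftp_0 del: fps_of_poly_nth)
  then obtain W where W: "W ^ p + W = shiftp a f - fps_const (poly f a)" "fps_nth W 0 = 0"
    by (rule char2_artin_schreier_fps[OF two _ m])
  have "(fps_const b + W) ^ p + (fps_const b + W) = fps_const (b ^ p + b) + (W ^ p + W)"
    unfolding char2_power[OF twof] fps_const_power fps_const_add[symmetric] by (simp only: add_ac)
  also have "\<dots> = shiftp a f" using assms unfolding W(1) pt_def by simp
  finally have "\<exists>Y. Y ^ p + Y = shiftp a f \<and> fps_nth Y 0 = b" using W(2)
    by (intro exI[of _ "fps_const b + W"] conjI) simp_all
  from someI_ex[OF this]
  show "Yp a b ^ p + Yp a b = shiftp a f" "fps_nth (Yp a b) 0 = b"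
    unfolding Yp_def by blast+
qed

definition pev :: "'a \<Rightarrow> 'a \<Rightarrow> 'a poly poly \<Rightarrow> 'a" where
  "pev a b = eval2 (\<lambda>c. poly c a) b"

definition ev :: "'a \<Rightarrow> 'a \<Rightarrow> 'a poly poly \<Rightarrow> 'a fps" where
  "ev a b = eval2 (shiftp a) (Yp a b)"

lemma hom_ev: "rhom (ev a b)" unfolding ev_def by (rule rhom_eval2[OF hom_shiftp])
lemma hom_pev: "rhom (pev a b)" unfolding pev_def by (rule rhom_eval2[OF rhom_poly])

lemma ev_const: "ev a b [:c:] = shiftp a c"
  unfolding ev_def by (rule eval2_const[OF hom_shiftp])

lemma pev_const: "pev a b [:c:] = poly c a"
  unfolding pev_def by (rule eval2_const[OF rhom_poly])

lemma pev_y: "pev a b (Polynomial.monom 1 1) = b"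
  unfolding pev_def by (simp add: eval2_monom[OF rhom_poly])

lemma ev_nth_0: "pt a b \<Longrightarrow> fps_nth (ev a b G) 0 = pev a b G"
proof -
  assume pt: "pt a b"
  have "rhom (\<lambda>u::'a fps. fps_nth u 0)" by (simp add: rhom_def)
  from eval2_comp[OF this, of "shiftp a" "Yp a b" G] show ?thesis
    by (simp only: ev_def pev_def shiftp_0 Yp(2)[OF pt])
qed

lemma ev_\<Phi>: "pt a b \<Longrightarrow> ev a b \<Phi> = 0"
proof -
  assume pt: "pt a b"
  have two: "(2::'a fps) = 0" using two by (simp add: fps_numeral_fps_const)
  have "ev a b \<Phi> = Yp a b ^ p + Yp a b + shiftp a f"
    by (simp only: ev_def \<Phi>_def eval2_add[OF hom_shiftp] eval2_monom[OF hom_shiftp] eval2_const[OF hom_shiftp]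
        rhomD(1)[OF hom_shiftp] mult_1 power_one_right)
  thus ?thesis by (simp only: Yp(1)[OF pt] char2_add_self[OF two])
qed

text \<open>Modulo \<Phi> the difference reduces to a polynomial of degree below p killed by E,
  hence to 0; and \<Phi> has expansion 0.\<close>

lemma E_eq_imp_ev_eq:
  assumes "pt a b" "E G = E H"
  shows "ev a b G = ev a b H"
proof -
  obtain Q R where *: "G - H = Q * \<Phi> + R" "degree R < p" "E R = E (G - H)" "G - H \<in> kXY \<longrightarrow> R \<in> kXY"
    by (rule reduce[of "G - H"])
  have "E R = 0" using *(3) assms(2) by (simp only: rhomD(6)[OF RE] diff_self)
  hence "R = 0" by (rule E_inj[OF *(2)])
  hence "ev a b (G - H) = 0" using *(1) ev_\<Phi>[OF assms(1)] by (simp add: rhomD[OF hom_ev])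
  thus ?thesis by (simp add: rhomD[OF hom_ev])
qed

text \<open>The description ranges over all fractions with denominator in x, reduced or not, so that
  products and sums of fractions can be fed to \<open>loc_eq\<close> without a further
  reduction.\<close>

definition loc :: "'a \<Rightarrow> 'a \<Rightarrow> 'l \<Rightarrow> 'a fls" where
  "loc a b z = (THE u. \<forall>G c. c \<noteq> 0 \<longrightarrow> z * \<xi> c = E G \<longrightarrow> u * fps_to_fls (shiftp a c) = fps_to_fls (ev a b G))"

lemma loc_eq:
  assumes "pt a b" "z \<in> KL" "c \<noteq> 0" "z * \<xi> c = E G"
  shows "loc a b z * fps_to_fls (shiftp a c) = fps_to_fls (ev a b G)"
proof -
  obtain G0 c0 where 0: "Rep z G0 c0" using assms(2) by (rule KLE)
  have c0: "c0 \<noteq> 0" "z * \<xi> c0 = E G0" using 0 by (auto simp: Rep_def)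
  define u where "u = fps_to_fls (ev a b G0) / fps_to_fls (shiftp a c0)"
  have *: "u * fps_to_fls (shiftp a c) = fps_to_fls (ev a b G)" if "c \<noteq> 0" "z * \<xi> c = E G" for G c
  proof -
    have "E ([:c0:] * G) = E ([:c:] * G0)"
      unfolding eval2_mult[OF xi] eval2_const[OF xi] c0(2)[symmetric] that(2)[symmetric] by (simp add: mult_ac)
    from E_eq_imp_ev_eq[OF assms(1) this]
    have "shiftp a c0 * ev a b G = shiftp a c * ev a b G0" by (simp only: rhomD(3)[OF hom_ev] ev_const)
    hence "fps_to_fls (shiftp a c0) * fps_to_fls (ev a b G) = fps_to_fls (shiftp a c) * fps_to_fls (ev a b G0)"
      by (simp only: fls_times_fps_to_fls[symmetric])
    moreover have "fps_to_fls (shiftp a c0) \<noteq> 0" using c0(1) by (simp add: shiftp_eq_0)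
    ultimately show ?thesis by (simp add: u_def field_simps)
  qed
  have "loc a b z = u"
    unfolding loc_def
  proof (rule the_equality)
    fix u' assume "\<forall>G c. c \<noteq> 0 \<longrightarrow> z * \<xi> c = E G \<longrightarrow> u' * fps_to_fls (shiftp a c) = fps_to_fls (ev a b G)"
    hence "u' * fps_to_fls (shiftp a c0) = u * fps_to_fls (shiftp a c0)" using c0 * by simp
    thus "u' = u" using c0(1) by (simp add: shiftp_eq_0)
  qed (use * in blast)
  thus ?thesis using *[OF assms(3,4)] by simp
qed

lemma loc_E: "pt a b \<Longrightarrow> G \<in> kXY \<Longrightarrow> loc a b (E G) = fps_to_fls (ev a b G)"
  using loc_eq[of a b "E G" 1 G] E_in_KL rhomD(1)[OF xi] rhomD(1)[OF hom_shiftp] by simp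

lemma loc_mult:
  assumes pt: "pt a b" and "z \<in> KL" "w \<in> KL"
  shows "loc a b (z * w) = loc a b z * loc a b w"
proof -
  obtain G c where 1: "Rep z G c" using assms(2) by (rule KLE)
  obtain H u where 2: "Rep w H u" using assms(3) by (rule KLE)
  have nz: "c \<noteq> 0" "u \<noteq> 0" and e: "z * \<xi> c = E G" "w * \<xi> u = E H" using 1 2 by (auto simp: Rep_def)
  have "(z * w) * \<xi> (c * u) = E (G * H)"
    unfolding eval2_mult[OF xi] rhomD(3)[OF xi] e[symmetric] by (simp add: mult_ac)
  from loc_eq[OF pt KL_mult[OF assms(2,3)] _ this] nz
  have "loc a b (z * w) * fps_to_fls (shiftp a (c * u)) = fps_to_fls (ev a b (G * H))" by simp
  also have "\<dots> = (loc a b z * loc a b w) * fps_to_fls (shiftp a (c * u))"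
    unfolding rhomD(3)[OF hom_ev] rhomD(3)[OF hom_shiftp] fls_times_fps_to_fls
      loc_eq[OF pt assms(2) nz(1) e(1), symmetric] loc_eq[OF pt assms(3) nz(2) e(2), symmetric] by (simp add: mult_ac)
  finally show ?thesis using nz by (simp add: shiftp_eq_0)
qed

lemma loc_add:
  assumes pt: "pt a b" and "z \<in> KL" "w \<in> KL"
  shows "loc a b (z + w) = loc a b z + loc a b w"
proof -
  obtain G c where 1: "Rep z G c" using assms(2) by (rule KLE)
  obtain H u where 2: "Rep w H u" using assms(3) by (rule KLE)
  have nz: "c \<noteq> 0" "u \<noteq> 0" and e: "z * \<xi> c = E G" "w * \<xi> u = E H" using 1 2 by (auto simp: Rep_def)
  have "(z + w) * \<xi> (c * u) = E ([:u:] * G + [:c:] * H)"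
    unfolding eval2_mult[OF xi] eval2_add[OF xi] eval2_const[OF xi] rhomD(3)[OF xi] e[symmetric] by (simp add: algebra_simps)
  from loc_eq[OF pt KL_add[OF assms(2,3)] _ this] nz
  have "loc a b (z + w) * fps_to_fls (shiftp a (c * u)) = fps_to_fls (ev a b ([:u:] * G + [:c:] * H))" by simp
  also have "\<dots> = (loc a b z + loc a b w) * fps_to_fls (shiftp a (c * u))"
    unfolding rhomD(2,3)[OF hom_ev] rhomD(3)[OF hom_shiftp] fls_times_fps_to_fls fps_to_fls_plus ev_const
      loc_eq[OF pt assms(2) nz(1) e(1), symmetric] loc_eq[OF pt assms(3) nz(2) e(2), symmetric] by (simp add: algebra_simps)
  finally show ?thesis using nz by (simp add: shiftp_eq_0)
qed

lemma loc_1: "pt a b \<Longrightarrow> loc a b 1 = 1"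
  using loc_E[of a b 1] subring_setD(2)[OF sub_kXY] rhomD(1)[OF RE] rhomD(1)[OF hom_ev] by simp

lemma loc_nz: "pt a b \<Longrightarrow> z \<in> KL \<Longrightarrow> z \<noteq> 0 \<Longrightarrow> loc a b z \<noteq> 0"
  using loc_mult[of a b z "inverse z"] KL_inverse[of z] loc_1[of a b] by auto

lemma loc_0: "pt a b \<Longrightarrow> loc a b 0 = 0"
  using loc_E[of a b 0] subring_setD(1)[OF sub_kXY] rhomD(4)[OF RE] rhomD(4)[OF hom_ev] by simp

definition vpt :: "'a \<Rightarrow> 'a \<Rightarrow> 'l \<Rightarrow> int" where
  "vpt a b z = fls_subdegree (loc a b z)"

lemma vpt_mult:
  "pt a b \<Longrightarrow> z \<in> KL \<Longrightarrow> w \<in> KL \<Longrightarrow> z \<noteq> 0 \<Longrightarrow> w \<noteq> 0 \<Longrightarrow> vpt a b (z * w) = vpt a b z + vpt a b w"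
  by (simp add: vpt_def loc_mult loc_nz)

lemma vpt_add:
  "pt a b \<Longrightarrow> z \<in> KL \<Longrightarrow> w \<in> KL \<Longrightarrow> z + w \<noteq> 0 \<Longrightarrow> min (vpt a b z) (vpt a b w) \<le> vpt a b (z + w)"
  using loc_nz[of a b "z + w"] KL_add[of z w] by (simp add: vpt_def loc_add fls_plus_subdegree)

lemma vpt_E: "pt a b \<Longrightarrow> G \<in> kXY \<Longrightarrow> vpt a b (E G) = int (subdegree (ev a b G))"
  by (simp add: vpt_def loc_E fls_subdegree_fls_to_fps)

lemma vpt_E_ge_0: "pt a b \<Longrightarrow> G \<in> kXY \<Longrightarrow> 0 \<le> vpt a b (E G)"
  by (simp add: vpt_E)

lemma vpt_E_pos_iff:
  assumes "pt a b" "G \<in> kXY" "E G \<noteq> 0"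
  shows "0 < vpt a b (E G) \<longleftrightarrow> pev a b G = 0"
proof -
  have "ev a b G \<noteq> 0" using loc_nz[OF assms(1) E_in_KL[OF assms(2)] assms(3)] loc_E[OF assms(1,2)] by auto
  thus ?thesis using vpt_E[OF assms(1,2)] ev_nth_0[OF assms(1), of G] by (auto simp: subdegree_eq_0_iff zero_less_iff_neq_zero)
qed

text \<open>The value of a function at a point; only used where the function is regular.\<close>

definition val :: "'a \<Rightarrow> 'a \<Rightarrow> 'l \<Rightarrow> 'a" where
  "val a b z = fps_nth (fls_regpart (loc a b z)) 0"

lemma regular_expansion:
  assumes "z = 0 \<or> vpt a b z \<ge> 0" "pt a b"
  shows "fps_to_fls (fls_regpart (loc a b z)) = loc a b z"
  using assms loc_0 by (auto simp: vpt_def)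

lemma val_mult:
  assumes pt: "pt a b" and "z \<in> KL" "w \<in> KL" "z = 0 \<or> vpt a b z \<ge> 0" "w = 0 \<or> vpt a b w \<ge> 0"
  shows "val a b (z * w) = val a b z * val a b w"
proof -
  have "fps_to_fls (fls_regpart (loc a b z) * fls_regpart (loc a b w)) = loc a b (z * w)"
    using assms by (simp add: fls_times_fps_to_fls regular_expansion loc_mult)
  hence "fls_regpart (loc a b (z * w)) = fls_regpart (loc a b z) * fls_regpart (loc a b w)"
    by (metis fls_regpart_fps_trivial)
  thus ?thesis by (simp add: val_def)
qed

lemma val_add:
  assumes pt: "pt a b" and "z \<in> KL" "w \<in> KL"
  shows "val a b (z + w) = val a b z + val a b w"
  using assms by (simp add: val_def loc_add)

lemma val_E: "pt a b \<Longrightarrow> G \<in> kXY \<Longrightarrow> val a b (E G) = pev a b G"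
  by (simp add: val_def loc_E ev_nth_0)

lemma val_eq_0_iff:
  assumes pt: "pt a b" and "z \<in> KL" "z \<noteq> 0" "vpt a b z \<ge> 0"
  shows "val a b z = 0 \<longleftrightarrow> vpt a b z > 0"
proof -
  define u where "u = fls_regpart (loc a b z)"
  have u: "fps_to_fls u = loc a b z" unfolding u_def using assms by (intro regular_expansion) auto
  hence "u \<noteq> 0" using loc_nz[OF assms(1-3)] by auto
  moreover have "vpt a b z = int (subdegree u)" by (simp add: vpt_def u[symmetric] fls_subdegree_fls_to_fps)
  moreover have "val a b z = fps_nth u 0" by (simp add: val_def u_def)
  ultimately show ?thesis by (auto simp: subdegree_eq_0_iff zero_less_iff_neq_zero)
qed


subsection \<open>Places\<close>

abbreviation cst :: "'a \<Rightarrow> 'l" where "cst c \<equiv> \<xi> [:c:]"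
abbreviation x :: 'l where "x \<equiv> \<xi> [:0, 1:]"

text \<open>The conditions of \<open>places\<close>, for subsets of the ambient field;
  \<open>places_iff\<close> matches the two.\<close>

definition tplace :: "'l set \<Rightarrow> bool" where
  "tplace V \<longleftrightarrow> subring_set V \<and> V \<subset> KL \<and> cst ` GF J \<subseteq> V \<and> (\<forall>z\<in>KL - {0}. z \<in> V \<or> inverse z \<in> V)"

definition mideal :: "'l set \<Rightarrow> 'l set" where
  "mideal V = {z \<in> V. z = 0 \<or> inverse z \<notin> V}"

definition vring :: "('l \<Rightarrow> int) \<Rightarrow> 'l set" where
  "vring w = {z \<in> KL. z = 0 \<or> 0 \<le> w z}"

text \<open>Nothing is required of the value at 0, which \<open>vring\<close> treats
  separately.\<close>

definition dval :: "('l \<Rightarrow> int) \<Rightarrow> bool" where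
  "dval w \<longleftrightarrow> (\<forall>z\<in>KL - {0}. \<forall>u\<in>KL - {0}. w (z * u) = w z + w u)
    \<and> (\<forall>z\<in>KL - {0}. \<forall>u\<in>KL - {0}. z + u \<noteq> 0 \<longrightarrow> min (w z) (w u) \<le> w (z + u))
    \<and> (\<exists>t\<in>KL - {0}. w t = 1) \<and> (\<forall>c\<in>GF J - {0}. w (cst c) = 0)"

lemma cst_0: "cst 0 = 0" using rhomD(4)[OF xi] by simp
lemma cst_1: "cst 1 = 1" using rhomD(1)[OF xi] by (simp add: one_pCons)
lemma cst_add: "cst (c + u) = cst c + cst u" using rhomD(2)[OF xi, of "[:c:]" "[:u:]"] by simp
lemma cst_mult: "cst (c * u) = cst c * cst u" using rhomD(3)[OF xi, of "[:c:]" "[:u:]"] by (simp add: mult_ac)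

lemma cst_in_KL: "c \<in> GF J \<Longrightarrow> cst c \<in> KL"
  by (intro xi_in_KL const_in_coeffs_in sub_k)

lemma x_in_kX: "[:0, 1:] \<in> kX"
  using monom_in_coeffs_in[OF sub_k, of 1 1] by (simp add: monom_altdef)

lemma x_in_KL: "x \<in> KL" by (intro xi_in_KL x_in_kX)

lemma x_nz: "x \<noteq> 0" by (rule xi_nz) simp

lemma dval_mult: "dval w \<Longrightarrow> z \<in> KL \<Longrightarrow> u \<in> KL \<Longrightarrow> z \<noteq> 0 \<Longrightarrow> u \<noteq> 0 \<Longrightarrow> w (z * u) = w z + w u"
  unfolding dval_def by blast

lemma dval_1: "dval w \<Longrightarrow> w 1 = 0"
  using dval_mult[of w 1 1] KL_01(2) by simp

lemma dval_inverse:
  assumes "dval w" "z \<in> KL" "z \<noteq> 0"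
  shows "w (inverse z) = - w z"
proof -
  have "w (z * inverse z) = w z + w (inverse z)"
    by (rule dval_mult[OF assms(1,2) KL_inverse[OF assms(2)] assms(3)]) (use assms(3) in simp)
  thus ?thesis using assms dval_1[OF assms(1)] by simp
qed

lemma dval_power:
  assumes "dval w" "z \<in> KL" "z \<noteq> 0"
  shows "w (z ^ n) = int n * w z"
proof (induction n)
  case 0
  show ?case using dval_1[OF assms(1)] by simp
next
  case (Suc n)
  have "w (z * z ^ n) = w z + w (z ^ n)"
    by (rule dval_mult[OF assms(1,2) KL_power[OF assms(2)] assms(3)]) (use assms(3) in simp)
  thus ?case using Suc by (simp add: algebra_simps)
qed

lemma vring_subring:
  assumes "dval w"
  shows "subring_set (vring w)"
proof -
  have "z + u \<in> vring w" "z * u \<in> vring w" if "z \<in> vring w" "u \<in> vring w" for z u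
  proof -
    have K: "z \<in> KL" "u \<in> KL" using that by (auto simp: vring_def)
    show "z + u \<in> vring w"
    proof (cases "z = 0 \<or> u = 0 \<or> z + u = 0")
      case True
      thus ?thesis using that KL_01 by (auto simp: vring_def)
    next
      case False
      hence "min (w z) (w u) \<le> w (z + u)" using assms K unfolding dval_def by blast
      thus ?thesis using that False KL_add[OF K] by (auto simp: vring_def)
    qed
    show "z * u \<in> vring w" using that dval_mult[OF assms K] KL_mult[OF K] by (auto simp: vring_def)
  qed
  moreover have "0 \<in> vring w" "1 \<in> vring w" using KL_01 dval_1[OF assms] by (simp_all add: vring_def)
  ultimately show ?thesis unfolding subring_set_def by (simp add: char2_minus[OF two_l])
qed

lemma tplace_vring:
  assumes "dval w"
  shows "tplace (vring w)"
proof -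
  obtain t where t: "t \<in> KL" "t \<noteq> 0" "w t = 1" using assms unfolding dval_def by blast
  have "inverse t \<notin> vring w" using dval_inverse[OF assms t(1,2)] t by (simp add: vring_def)
  moreover have "inverse t \<in> KL" using t KL_inverse by blast
  moreover have "vring w \<subseteq> KL" by (auto simp: vring_def)
  ultimately have "vring w \<subset> KL" by blast
  moreover have "cst c \<in> vring w" if "c \<in> GF J" for c
  proof (cases "c = 0")
    case False
    hence "w (cst c) = 0" using assms that unfolding dval_def by blast
    thus ?thesis using cst_in_KL[OF that] by (simp add: vring_def)
  qed (simp add: vring_def rhomD(4)[OF xi] KL_01)
  moreover have "z \<in> vring w \<or> inverse z \<in> vring w" if "z \<in> KL - {0}" for z
    using that dval_inverse[OF assms, of z] KL_inverse[of z] by (auto simp: vring_def)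
  ultimately show ?thesis using vring_subring[OF assms] by (auto simp: tplace_def)
qed

lemma mideal_vring:
  assumes "dval w"
  shows "mideal (vring w) = {z \<in> KL. z = 0 \<or> 0 < w z}"
proof -
  have "inverse z \<notin> vring w \<longleftrightarrow> 0 < w z" if "z \<in> KL" "z \<noteq> 0" for z
    using dval_inverse[OF assms that] KL_inverse[OF that(1)] that by (auto simp: vring_def)
  thus ?thesis unfolding mideal_def by (auto simp: vring_def[of w])
qed

text \<open>An element z of negative order would bring every function into \<open>V\<close>: a
  sufficient power of z compensates any pole.\<close>

lemma vring_maximal:
  assumes "dval w" "tplace V" "vring w \<subseteq> V"
  shows "V = vring w"
proof (rule ccontr)
  assume "V \<noteq> vring w"
  then obtain z where z: "z \<in> V" "z \<notin> vring w" using assms(3) by blast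
  have sub: "subring_set V" and VK: "V \<subset> KL" using assms(2) by (auto simp: tplace_def)
  have zK: "z \<in> KL" "z \<noteq> 0" "w z < 0" using z VK KL_01 by (auto simp: vring_def)
  have "u \<in> V" if u: "u \<in> KL" for u
  proof (cases "u = 0")
    case False
    define n where "n = nat (- w u)"
    define v where "v = u * inverse z ^ n"
    have v: "v \<in> KL" "v \<noteq> 0" using u False zK KL_inverse KL_power KL_mult by (auto simp: v_def)
    have "w v = w u - int n * w z"
      unfolding v_def using u False zK KL_inverse[OF zK(1)] KL_power[OF KL_inverse[OF zK(1)]]
      by (subst dval_mult[OF assms(1)]) (auto simp: dval_power[OF assms(1)] dval_inverse[OF assms(1)] algebra_simps)
    moreover have "int n * 1 \<le> int n * (- w z)" using zK by (intro mult_left_mono) auto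
    moreover have "- w u \<le> int n" by (simp add: n_def)
    ultimately have "0 \<le> w v" by linarith
    hence "v \<in> V" using v assms(3) by (auto simp: vring_def)
    hence "v * z ^ n \<in> V" using z by (intro subring_setD(5,7)[OF sub])
    moreover have "v * z ^ n = u" using zK by (simp add: v_def power_mult_distrib[symmetric] mult.assoc)
    ultimately show ?thesis by (simp only:)
  qed (simp add: subring_setD[OF sub])
  thus False using VK by blast
qed

lemma tplaceD:
  assumes "tplace V"
  shows "subring_set V" "V \<subseteq> KL" "V \<noteq> KL" "c \<in> GF J \<Longrightarrow> cst c \<in> V"
    "z \<in> KL \<Longrightarrow> z \<notin> V \<Longrightarrow> inverse z \<in> V"
proof -
  show "z \<in> KL \<Longrightarrow> z \<notin> V \<Longrightarrow> inverse z \<in> V"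
    using assms subring_setD(1) by (cases "z = 0") (auto simp: tplace_def)
qed (use assms in \<open>auto simp: tplace_def\<close>)

text \<open>Valuation rings are integrally closed: if z is not in \<open>V\<close>, its inverse is,
  and then z = z^n (1/z)^(n-1) lies in \<open>V\<close> after all.\<close>

lemma power_in_tplace:
  assumes V: "tplace V" and "z \<in> KL" "z ^ n \<in> V" "0 < n"
  shows "z \<in> V"
proof (rule ccontr)
  assume nz: "z \<notin> V"
  hence i: "inverse z \<in> V" using tplaceD(5)[OF V] assms by blast
  have "z \<noteq> 0" using nz subring_setD(1)[OF tplaceD(1)[OF V]] by auto
  obtain k where k: "n = Suc k" using assms(4) by (cases n) auto
  have "z ^ n * inverse z ^ k \<in> V" 
    by (rule subring_setD(5)[OF tplaceD(1)[OF V] assms(3) subring_setD(7)[OF tplaceD(1)[OF V] i]])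
  moreover have "z ^ n * inverse z ^ k = z" using \<open>z \<noteq> 0\<close> by (simp add: k mult.assoc power_mult_distrib[symmetric])
  ultimately have "z \<in> V" by (simp only:)
  thus False using nz by simp
qed

lemma mideal_mult:
  assumes V: "tplace V" and "z \<in> mideal V" "u \<in> V"
  shows "z * u \<in> mideal V"
proof -
  note R = subring_setD[OF tplaceD(1)[OF V]]
  have "z * u = 0" if "inverse (z * u) \<in> V"
  proof (rule ccontr)
    assume nz: "z * u \<noteq> 0"
    have "u * inverse (z * u) \<in> V" using assms(3) that by (rule R(5))
    moreover have "u * inverse (z * u) = inverse z" using nz by (simp add: field_simps)
    ultimately have "inverse z \<in> V" by (simp only:)
    thus False using assms(2) nz by (auto simp: mideal_def)
  qed
  thus ?thesis using assms R(5) by (auto simp: mideal_def)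
qed

text \<open>One of z/u and u/z lies in \<open>V\<close>, so the sum is a multiple of u or of z by an
  element of \<open>V\<close>.\<close>

lemma mideal_add:
  assumes V: "tplace V" and "z \<in> mideal V" "u \<in> mideal V"
  shows "z + u \<in> mideal V"
proof -
  note R = subring_setD[OF tplaceD(1)[OF V]]
  have *: "z + u \<in> mideal V" if "z \<in> mideal V" "u \<noteq> 0" "u \<in> mideal V" "z / u \<in> V" for z u
  proof -
    have "u * (z / u + 1) \<in> mideal V" using that by (intro mideal_mult[OF V] R) auto
    thus ?thesis using that by (simp add: distrib_left)
  qed
  show ?thesis
  proof (cases "z = 0 \<or> u = 0")
    case False
    have "z \<in> KL" "u \<in> KL" using assms tplaceD(2)[OF V] by (auto simp: mideal_def)
    hence "z / u \<in> V \<or> u / z \<in> V" using tplaceD(5)[OF V, of "z / u"] KL_divide by auto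
    thus ?thesis using *[of z u] *[of u z] False assms by (auto simp: add.commute)
  qed (use assms in auto)
qed

lemma one_notin_mideal: "tplace V \<Longrightarrow> 1 \<notin> mideal V"
  using subring_setD(2)[OF tplaceD(1)] by (auto simp: mideal_def)

lemma mideal_prime:
  assumes V: "tplace V" and "z * u \<in> mideal V" "z \<in> V" "u \<in> V"
  shows "z \<in> mideal V \<or> u \<in> mideal V"
proof (rule ccontr)
  assume "\<not> ?thesis"
  hence "inverse z \<in> V" "inverse u \<in> V" "z \<noteq> 0" "u \<noteq> 0" using assms by (auto simp: mideal_def)
  hence "inverse (z * u) \<in> V" using subring_setD(5)[OF tplaceD(1)[OF V]] by (simp add: mult.commute)
  thus False using assms(2) \<open>z \<noteq> 0\<close> \<open>u \<noteq> 0\<close> by (auto simp: mideal_def)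
qed

lemma mideal_power:
  assumes V: "tplace V" and "z ^ n \<in> mideal V" "z \<in> V"
  shows "z \<in> mideal V"
  using assms(2)
proof (induction n)
  case 0
  thus ?case using one_notin_mideal[OF V] by simp
next
  case (Suc n)
  thus ?case using mideal_prime[OF V, of z "z ^ n"] assms(3) subring_setD(7)[OF tplaceD(1)[OF V]] by auto
qed

lemma one_plus_mideal:
  assumes V: "tplace V" and "z \<in> mideal V"
  shows "1 + z \<in> V" "1 + z \<notin> mideal V"
proof -
  note R = subring_setD[OF tplaceD(1)[OF V]]
  show "1 + z \<in> V" using assms by (intro R) (auto simp: mideal_def)
  show "1 + z \<notin> mideal V"
  proof
    assume "1 + z \<in> mideal V"
    from mideal_add[OF V this assms(2)] have "1 + (z + z) \<in> mideal V" by (simp only: add.assoc)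
    thus False using one_notin_mideal[OF V] by (simp only: char2_add_self[OF two_l] add_0_right)
  qed
qed

lemma mideal_subset: "mideal V \<subseteq> V" by (auto simp: mideal_def)

lemma unit_inverse: "z \<in> V \<Longrightarrow> z \<notin> mideal V \<Longrightarrow> inverse z \<in> V \<and> z \<noteq> 0"
  by (auto simp: mideal_def)

text \<open>y is integral over the polynomials in x: were 1/y in \<open>V\<close> but not y,
  dividing the equation by y^(p-1) would express y through 1/y and f.\<close>

lemma O_subset:
  assumes V: "tplace V" and x: "x \<in> V" and G: "G \<in> kXY"
  shows "E G \<in> V"
proof -
  note R = subring_setD[OF tplaceD(1)[OF V]]
  have xi: "\<xi> c \<in> V" if "c \<in> kX" for c
    using that
  proof (induction c)
    case 0
    show ?case using R(1) by (simp add: rhomD(4)[OF xi])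
  next
    case (pCons a c)
    have "a \<in> GF J" "c \<in> kX" using pCons.prems coeffs_inD[of "pCons a c" _ 0] coeffs_inD[of "pCons a c" _ "Suc _"]
      by (auto simp: coeffs_in_def coeff_pCons split: nat.splits)
    moreover have "pCons a c = [:a:] + [:0, 1:] * c" by simp
    hence "\<xi> (pCons a c) = cst a + x * \<xi> c" by (simp only: rhomD[OF xi])
    ultimately show ?case using pCons.IH x tplaceD(4)[OF V] R(4,5) by simp
  qed
  have y: "y \<in> V"
  proof (rule ccontr)
    assume nV: "y \<notin> V"
    hence i: "inverse y \<in> V" using tplaceD(5)[OF V y_in_KL] by blast
    obtain k where k: "p = Suc (Suc k)" using p(1) by (metis Suc_le_D numeral_2_eq_2 Suc_le_mono)
    have "\<xi> f * inverse y ^ Suc k - inverse y ^ k \<in> V"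
      using i xi[OF f_in] by (intro R)
    also have "\<xi> f * inverse y ^ Suc k - inverse y ^ k = y"
    proof -
      have "\<xi> f = y ^ Suc (Suc k) + y" using y by (simp only: k)
      thus ?thesis using vinf_y(2) by (simp add: field_simps power_inverse)
    qed
    finally show False using nV by simp
  qed
  show ?thesis unfolding eval2_def using xi y coeffs_inD[OF G]
    by (intro subring_set_sum[OF tplaceD(1)[OF V]] R(5,7)) auto
qed


subsection \<open>Frobenius on the affine coordinate ring\<close>

text \<open>X^R - X with R = 2^(J N), the product of all X - a with a in \<open>GF (J * N)\<close>.
  Its coefficients lie in \<open>GF J\<close> and its zeros are simple, so it is a common
  uniformizer at all points above these a.\<close>

definition PR :: "nat \<Rightarrow> 'a poly" where
  "PR N = Polynomial.monom 1 (2 ^ (J * N)) + Polynomial.monom 1 1"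

lemma PR_in: "PR N \<in> kX"
  unfolding PR_def by (intro subring_setD(4)[OF sub_kX] monom_in_coeffs_in[OF sub_k] subring_setD(2)[OF sub_k])

lemma poly_PR: "poly (PR N) a = 0 \<longleftrightarrow> a \<in> GF (J * N)"
  by (simp add: PR_def poly_monom eq_iff_add_eq_0[symmetric])

lemma R_ge: "0 < N \<Longrightarrow> 2 \<le> (2::nat) ^ (J * N)"
  using J power_increasing[of 1 "J * N" "2::nat"] by simp

lemma degree_PR: "0 < N \<Longrightarrow> degree (PR N) = 2 ^ (J * N)" "0 < N \<Longrightarrow> PR N \<noteq> 0"
proof -
  show *: "degree (PR N) = 2 ^ (J * N)" if "0 < N"
    unfolding PR_def using R_ge[OF that] by (subst degree_add_eq_left) (auto simp: degree_monom_eq)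
  show "PR N \<noteq> 0" if "0 < N" using *[OF that] by auto
qed

text \<open>z is fixed by the power 2^M modulo \<open>PR N\<close> in the affine coordinate ring.
  This bounds the field of values at all points over \<open>GF (J * N)\<close> at once, and it
  produces the complements in \<open>place_complement\<close>.\<close>

definition rel :: "nat \<Rightarrow> nat \<Rightarrow> 'l \<Rightarrow> bool" where
  "rel N M z \<longleftrightarrow> (\<exists>H\<in>kXY. z ^ (2 ^ M) + z = \<xi> (PR N) * E H)"

lemma relI: "H \<in> kXY \<Longrightarrow> z ^ (2 ^ M) + z = \<xi> (PR N) * E H \<Longrightarrow> rel N M z"
  by (auto simp: rel_def)

lemma rel_add:
  assumes "rel N M z" "rel N M u"
  shows "rel N M (z + u)"
proof -
  obtain H K where *: "H \<in> kXY" "K \<in> kXY" "z ^ (2 ^ M) + z = \<xi> (PR N) * E H" "u ^ (2 ^ M) + u = \<xi> (PR N) * E K"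
    using assms by (auto simp: rel_def)
  have "(z + u) ^ (2 ^ M) + (z + u) = (z ^ (2 ^ M) + z) + (u ^ (2 ^ M) + u)"
    by (simp add: char2_power[OF two_l])
  also have "\<dots> = \<xi> (PR N) * E (H + K)" unfolding *(3,4) eval2_add[OF xi] by (simp add: distrib_left)
  finally show ?thesis by (rule relI[OF subring_setD(4)[OF sub_kXY *(1,2)]])
qed

lemma rel_mult:
  assumes "rel N M z" "rel N M (E G)" "G \<in> kXY" "z = E K" "K \<in> kXY"
  shows "rel N M (z * E G)"
proof -
  obtain H H' where *: "H \<in> kXY" "H' \<in> kXY" "z ^ (2 ^ M) + z = \<xi> (PR N) * E H" "E G ^ (2 ^ M) + E G = \<xi> (PR N) * E H'"
    using assms by (auto simp: rel_def)
  define T where "T = K ^ (2 ^ M) * H' + G * H"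
  have "(z * E G) ^ (2 ^ M) + z * E G = z ^ (2 ^ M) * (E G ^ (2 ^ M) + E G) + E G * (z ^ (2 ^ M) + z)
      - (z ^ (2 ^ M) * E G + z ^ (2 ^ M) * E G)"
    by (simp add: power_mult_distrib algebra_simps)
  also have "\<dots> = \<xi> (PR N) * E T"
    unfolding *(3,4) char2_add_self[OF two_l] T_def eval2_add[OF xi] eval2_mult[OF xi] rhomD(7)[OF RE] assms(4)[symmetric]
    by (simp add: algebra_simps)
  finally show ?thesis
    by (rule relI[rotated]) (unfold T_def, intro subring_setD(4,5,7)[OF sub_kXY] * assms(3,5))
qed

lemma rel_cst: "c \<in> GF M \<Longrightarrow> rel N M (cst c)"
proof -
  assume "c \<in> GF M"
  hence "cst c ^ (2 ^ M) = cst c" unfolding rhomD(7)[OF xi, symmetric] by (simp add: poly_const_pow)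
  thus ?thesis using subring_setD(1)[OF sub_kXY] rhomD(4)[OF RE]
    by (intro relI[of 0]) (auto simp: char2_add_self[OF two_l])
qed

lemma rel_x: "rel N (J * N) x"
proof (rule relI[of 1])
  show "x ^ (2 ^ (J * N)) + x = \<xi> (PR N) * E 1"
    by (simp only: PR_def rhomD(2,7)[OF xi] rhomD(1)[OF RE] monom_altdef smult_1_left power_one_right mult_1_right)
qed (rule subring_setD(2)[OF sub_kXY])

lemma rel_xi:
  assumes "c \<in> kX"
  shows "rel N (J * N) (\<xi> c)"
  using assms
proof (induction c)
  case 0
  show ?case using rel_cst[of 0 "J * N" N] cst_0 rhomD(4)[OF xi] by simp
next
  case (pCons a c)
  have ac: "a \<in> GF J" "c \<in> kX" using pCons.prems
    by (auto simp: coeffs_in_def coeff_pCons split: nat.splits)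
  have "pCons a c = [:a:] + [:0, 1:] * c" by simp
  hence eq: "\<xi> (pCons a c) = cst a + x * \<xi> c" by (simp only: rhomD[OF xi])
  have "a \<in> GF (J * N)" using GF_mono[of J "J * N"] ac(1) by auto
  moreover have "rel N (J * N) (E [:c:])" unfolding eval2_const[OF xi] by (rule pCons.IH[OF ac(2)])
  from rel_mult[OF rel_x this const_in_coeffs_in[OF sub_kX ac(2)] eval2_const[OF xi, symmetric]
      const_in_coeffs_in[OF sub_kX x_in_kX]]
  have "rel N (J * N) (x * \<xi> c)" unfolding eval2_const[OF xi] .
  ultimately show ?case unfolding eq by (intro rel_add rel_cst)
qed

lemma rel_double:
  assumes "rel N M z"
  shows "rel N (2 * M) z"
proof -
  obtain H where *: "H \<in> kXY" "z ^ (2 ^ M) + z = \<xi> (PR N) * E H" using assms by (auto simp: rel_def)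
  have "z ^ (2 ^ (2 * M)) = (z ^ (2 ^ M)) ^ (2 ^ M)" by (simp add: mult_2 power_add power_mult)
  moreover have "z ^ (2 ^ M) = z + \<xi> (PR N) * E H"
    using *(2) char2_add_self[OF two_l, of z] by (metis add.commute add.left_commute add_0_right)
  ultimately have "z ^ (2 ^ (2 * M)) = z + \<xi> (PR N) * E H + (\<xi> (PR N) * E H) ^ (2 ^ M)"
    by (simp add: char2_power[OF two_l])
  also have "(\<xi> (PR N) * E H) ^ (2 ^ M) = \<xi> (PR N) * (\<xi> (PR N) ^ (2 ^ M - 1) * E H ^ (2 ^ M))"
    by (simp add: power_mult_distrib flip: mult.assoc power_Suc)
  finally have "z ^ (2 ^ (2 * M)) + z = \<xi> (PR N) * (E H + \<xi> (PR N) ^ (2 ^ M - 1) * E H ^ (2 ^ M)) + (z + z)"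
    by (simp add: algebra_simps)
  also have "\<dots> = \<xi> (PR N) * E (H + [:PR N:] ^ (2 ^ M - 1) * H ^ (2 ^ M))"
    unfolding char2_add_self[OF two_l] eval2_add[OF xi] eval2_mult[OF xi] rhomD(7)[OF RE] eval2_const[OF xi] by simp
  finally show ?thesis
    by (rule relI[rotated]) (intro subring_setD(4,5,7)[OF sub_kXY] const_in_coeffs_in sub_kX PR_in *(1))
qed

text \<open>With R = 2^(J N), y^R = y + s for a polynomial s in x, and s is itself fixed by the R-th
  power modulo \<open>PR N\<close>. A second R-th power adds s again, which cancels it; hence the
  exponent 2 J N in \<open>rel_E\<close>.\<close>

lemma rel_y: "rel N (2 * (J * N)) y"
proof -
  obtain k where k: "J * N = m * k" using J by (auto simp: dvd_def mult.assoc)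
  define s where "s = (\<Sum>i<k. f ^ (2 ^ (m * i)))"
  have s: "s \<in> kX" unfolding s_def by (intro subring_set_sum[OF sub_kX] subring_setD(7)[OF sub_kX] f_in)
  have "y ^ (2 ^ (m * k)) = y + \<xi> (\<Sum>i<k. f ^ (2 ^ (m * i)))" for k
  proof (induction k)
    case 0
    show ?case by (simp add: rhomD(4)[OF xi])
  next
    case (Suc k)
    have "y ^ (2 ^ m) = y + \<xi> f" using y char2_add_self[OF two_l, of y]
      by (metis add.commute add.left_commute add_0_right)
    moreover have "y ^ (2 ^ (m * Suc k)) = (y ^ (2 ^ m)) ^ (2 ^ (m * k))"
      by (simp add: power_mult[symmetric] power_add[symmetric])
    ultimately show ?case using Suc
      by (simp add: char2_power[OF two_l] rhomD[OF xi] add.assoc)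
  qed
  hence yR: "y ^ (2 ^ (J * N)) = y + \<xi> s" unfolding k s_def .
  obtain H where H: "H \<in> kXY" "\<xi> s ^ (2 ^ (J * N)) + \<xi> s = \<xi> (PR N) * E H"
    using rel_xi[OF s, of N] by (auto simp: rel_def)
  have "y ^ (2 ^ (2 * (J * N))) = (y ^ (2 ^ (J * N))) ^ (2 ^ (J * N))" by (simp add: mult_2 power_add power_mult)
  also have "\<dots> = y + (\<xi> s ^ (2 ^ (J * N)) + \<xi> s)"
    unfolding yR char2_power[OF two_l] yR by (simp add: add_ac)
  finally have "y ^ (2 ^ (2 * (J * N))) + y = \<xi> (PR N) * E H + (y + y)" unfolding H(2) by (simp only: add_ac)
  thus ?thesis using H(1) by (intro relI) (auto simp: char2_add_self[OF two_l])
qed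

lemma rel_E:
  assumes "G \<in> kXY"
  shows "rel N (2 * (J * N)) (E G)"
  using assms
proof (induction G)
  case 0
  show ?case using rel_cst[of 0 "2 * (J * N)" N] cst_0 rhomD(4)[OF RE] by simp
next
  case (pCons c G)
  have cG: "c \<in> kX" "G \<in> kXY" using pCons.prems
    by (auto simp: coeffs_in_def[of kX] coeff_pCons split: nat.splits)
  have "rel N (2 * (J * N)) (y * E G)"
    using rel_mult[OF rel_y pCons.IH[OF cG(2)] cG(2) y_eq_E y_in_kXY] .
  thus ?case unfolding eval2_pCons[OF xi] by (rule rel_add[OF rel_double[OF rel_xi[OF cG(1)]]])
qed


subsection \<open>Classification of the places\<close>

lemma dval_vinf: "dval vinf"
  unfolding dval_def
proof (intro conjI ballI impI)
  obtain t where "t \<in> KL" "t \<noteq> 0" "vinf t = 1" by (rule vinf_uniformizer)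
  thus "\<exists>t\<in>KL - {0}. vinf t = 1" by blast
  show "vinf (cst c) = 0" if "c \<in> GF J - {0}" for c using that vinf_xi[of "[:c:]"] by simp
qed (auto intro: vinf_mult vinf_add)

lemma shiftp_PR: "fps_nth (shiftp a (PR N)) 1 = 1" if "0 < N"
proof -
  have "pcompose (PR N) [:a, 1:] = [:a, 1:] ^ (2 ^ (J * N)) + [:a, 1:]"
    by (simp add: PR_def pcompose_add monom_altdef pcompose_smult rhomD(7)[OF rhom_pcompose] pcompose_pCons)
  also have "[:a, 1:] ^ (2 ^ (J * N)) = [:a ^ (2 ^ (J * N)):] + Polynomial.monom 1 (2 ^ (J * N))"
  proof -
    have "[:a, 1:] = [:a:] + Polynomial.monom 1 1" by (simp add: monom_altdef)
    thus ?thesis by (simp add: char2_power[OF two_poly(1)] poly_const_pow monom_power)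
  qed
  finally show ?thesis using R_ge[OF that] J that by (simp add: coeff_pCons)
qed

lemma vpt_PR:
  assumes "pt a b" "0 < N"
  shows "vpt a b (\<xi> (PR N)) = (if a \<in> GF (J * N) then 1 else 0)"
proof -
  have "vpt a b (\<xi> (PR N)) = int (subdegree (shiftp a (PR N)))"
    using vpt_E[OF assms(1) const_in_coeffs_in[OF sub_kX PR_in[of N]]] unfolding eval2_const[OF xi] ev_const .
  moreover have "subdegree (shiftp a (PR N)) = (if a \<in> GF (J * N) then 1 else 0)"
  proof (cases "a \<in> GF (J * N)")
    case True
    hence "fps_nth (shiftp a (PR N)) 0 = 0" using poly_PR by (simp only: shiftp_0)
    thus ?thesis using True shiftp_PR[OF assms(2), of a] by (auto intro!: subdegreeI simp del: fps_of_poly_nth)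
  next
    case False
    hence "fps_nth (shiftp a (PR N)) 0 \<noteq> 0" using poly_PR by (simp only: shiftp_0) blast
    thus ?thesis using False by (simp add: subdegree_eq_0_iff del: fps_of_poly_nth)
  qed
  ultimately show ?thesis by simp
qed

lemma kX_quotient: "c * u \<in> kX \<Longrightarrow> c \<in> kX \<Longrightarrow> c \<noteq> 0 \<Longrightarrow> u \<in> kX"
  by (rule quotient_in_coeffs_in[OF sub_k, of c]) (auto simp: power_inverse)

lemma common_GF:
  obtains N where "0 < N" "a \<in> GF (J * N)"
  using alg[of a] by blast

lemma dval_vpt:
  assumes pt: "pt a b"
  shows "dval (vpt a b)"
  unfolding dval_def
proof (intro conjI ballI impI)
  obtain N where N: "0 < N" "a \<in> GF (J * N)" by (rule common_GF)
  have "\<xi> (PR N) \<in> KL - {0}" using xi_in_KL[OF PR_in] xi_nz degree_PR(2)[OF N(1)] by simp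
  thus "\<exists>t\<in>KL - {0}. vpt a b t = 1" using vpt_PR[OF pt N(1)] N(2) by auto
  show "vpt a b (cst c) = 0" if "c \<in> GF J - {0}" for c
  proof -
    have "[:[:c:]:] \<in> kXY" using that by (intro const_in_coeffs_in sub_kX sub_k) auto
    from vpt_E[OF pt this] have "vpt a b (cst c) = int (subdegree (shiftp a [:c:]))"
      unfolding eval2_const[OF xi] ev_const .
    thus ?thesis using that by (simp add: fps_of_poly_const)
  qed
qed (auto intro: vpt_mult[OF pt] vpt_add[OF pt])

abbreviation Vpt :: "'a \<Rightarrow> 'a \<Rightarrow> 'l set" where "Vpt a b \<equiv> vring (vpt a b)"
abbreviation Vinf :: "'l set" where "Vinf \<equiv> vring vinf"

lemma tplace_Vpt: "pt a b \<Longrightarrow> tplace (Vpt a b)" by (intro tplace_vring dval_vpt)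
lemma tplace_Vinf: "tplace Vinf" by (intro tplace_vring dval_vinf)

lemma x_in_Vpt: "pt a b \<Longrightarrow> x \<in> Vpt a b"
  using vpt_E_ge_0[of a b "[:[:0, 1:]:]"] const_in_coeffs_in[OF sub_kX x_in_kX] x_in_KL
  by (simp add: vring_def eval2_const[OF xi])

lemma x_notin_Vinf: "x \<notin> Vinf"
  using vinf_xi[of "[:0, 1:]"] x_nz p by (simp add: vring_def)

lemma mideal_Vpt_E:
  assumes "pt a b" "G \<in> kXY"
  shows "E G \<in> mideal (Vpt a b) \<longleftrightarrow> pev a b G = 0"
proof (cases "E G = 0")
  case True
  hence "ev a b G = ev a b 0" using E_eq_imp_ev_eq[OF assms(1), of G 0] rhomD(4)[OF RE] by simp
  hence "pev a b G = 0" using ev_nth_0[OF assms(1), of G] rhomD(4)[OF hom_ev] by simp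
  thus ?thesis using True KL_01 by (simp add: mideal_vring[OF dval_vpt[OF assms(1)]])
next
  case False
  thus ?thesis using vpt_E_pos_iff[OF assms False] E_in_KL[OF assms(2)]
    by (simp add: mideal_vring[OF dval_vpt[OF assms(1)]])
qed

lemma PR_dvd:
  assumes "0 < N" "\<And>a. a \<in> GF (J * N) \<Longrightarrow> poly c a = 0"
  shows "PR N dvd c"
proof -
  define r where "r = c mod PR N"
  have "r = 0"
  proof (rule ccontr)
    assume nz: "r \<noteq> 0"
    have "GF (J * N) \<subseteq> {a. poly r a = 0}"
    proof
      fix a assume a: "a \<in> GF (J * N)"
      have "c = PR N * (c div PR N) + r" by (simp add: r_def)
      from arg_cong[OF this, of "\<lambda>u. poly u a"]
      have "poly c a = poly (PR N) a * poly (c div PR N) a + poly r a" by (simp only: poly_add poly_mult)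
      moreover have "poly (PR N) a = 0" using poly_PR a by blast
      ultimately show "a \<in> {a. poly r a = 0}" using assms(2)[OF a] by simp
    qed
    hence "card (GF (J * N)) \<le> card {a. poly r a = 0}" by (rule card_mono[OF poly_roots_finite[OF nz]])
    also have "\<dots> \<le> degree r" by (rule card_poly_roots_bound) fact
    also have "\<dots> < degree (PR N)" unfolding r_def
      by (rule degree_mod_less'[OF degree_PR(2)[OF assms(1)] nz[unfolded r_def]])
    also have "\<dots> = card (GF (J * N))"
      using degree_PR(1)[OF assms(1)] card_GF[of "J * N"] J(1) assms(1) by simp
    finally show False by simp
  qed
  thus ?thesis by (simp add: r_def mod_eq_0_iff_dvd)
qed

text \<open>There are p points above each a, while the polynomial in y obtained by setting x = a has
  degree below p; vanishing at all of them makes it 0.\<close>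

lemma coeffs_vanish:
  assumes "degree G < p" "\<And>b. pt a b \<Longrightarrow> pev a b G = 0"
  shows "poly (poly.coeff G i) a = 0"
proof -
  define g where "g = (\<Sum>i<p. Polynomial.monom (poly (poly.coeff G i) a) i)"
  have g: "poly g b = pev a b G" for b
    by (simp add: g_def pev_def eval2_bound[OF rhom_poly assms(1)] poly_sum poly_monom)
  have "g = 0"
  proof (rule ccontr)
    assume nz: "g \<noteq> 0"
    have "degree g \<le> p - 1" unfolding g_def
      by (intro degree_sum_le order.trans[OF degree_monom_le]) auto
    moreover have "{b. pt a b} \<subseteq> {b. poly g b = 0}" using assms(2) g by auto
    hence "card {b. pt a b} \<le> card {b. poly g b = 0}" by (rule card_mono[OF poly_roots_finite[OF nz]])
    moreover have "card {b. pt a b} = p" unfolding pt_def by (rule card_artin_schreier_roots[OF m])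
    moreover have "card {b. poly g b = 0} \<le> degree g" by (rule card_poly_roots_bound) fact
    ultimately show False using p by linarith
  qed
  hence "poly.coeff g i = 0" by simp
  moreover have "poly.coeff g i = (if i < p then poly (poly.coeff G i) a else 0)"
    by (simp add: g_def coeff_sum)
  ultimately show ?thesis using assms(1) by (cases "i < p") (auto simp: coeff_eq_0)
qed

text \<open>A Nullstellensatz over finitely many abscissas: after reduction modulo \<Phi> every
  coefficient vanishes on \<open>GF (J * N)\<close>, so \<open>PR N\<close>, which has only simple
  roots there, divides it.\<close>

lemma vanish_imp_in_PR:
  assumes N: "0 < N" and D: "D \<in> kXY"
    and van: "\<And>a b. pt a b \<Longrightarrow> a \<in> GF (J * N) \<Longrightarrow> pev a b D = 0"
  obtains H where "H \<in> kXY" "E D = \<xi> (PR N) * E H"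
proof -
  obtain Q R where R: "D = Q * \<Phi> + R" "degree R < p" "E R = E D" "D \<in> kXY \<longrightarrow> R \<in> kXY"
    by (rule reduce[of D])
  have RkXY: "R \<in> kXY" using R(4) D by simp
  have pev: "pev a b R = pev a b D" if "pt a b" for a b
    unfolding ev_nth_0[OF that, symmetric] E_eq_imp_ev_eq[OF that R(3)] by (rule refl)
  have dvd: "PR N dvd poly.coeff R i" for i
    using van pev by (intro PR_dvd[OF N] coeffs_vanish[OF R(2)]) simp
  define H where "H = (\<Sum>i<p. Polynomial.monom (poly.coeff R i div PR N) i)"
  have in_kX: "poly.coeff R i div PR N \<in> kX" for i
  proof (rule kX_quotient[OF _ PR_in degree_PR(2)[OF N]])
    show "PR N * (poly.coeff R i div PR N) \<in> kX" using dvd coeffs_inD[OF RkXY] by simp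
  qed
  have "H \<in> kXY" unfolding H_def by (intro subring_set_sum[OF sub_kXY] monom_in_coeffs_in sub_kX in_kX)
  moreover have "R = [:PR N:] * H"
  proof (rule poly_eqI)
    fix i
    have "poly.coeff ([:PR N:] * H) i = (if i < p then PR N * (poly.coeff R i div PR N) else 0)"
      by (simp add: H_def coeff_sum)
    also have "\<dots> = poly.coeff R i" using dvd R(2) by (auto simp: coeff_eq_0)
    finally show "poly.coeff R i = poly.coeff ([:PR N:] * H) i" by simp
  qed
  hence "E D = \<xi> (PR N) * E H" using R(3) by (simp only: eval2_mult[OF xi] eval2_const[OF xi])
  ultimately show ?thesis by (rule that)
qed

text \<open>The roots of c all lie in \<open>GF (J * M)\<close> once M is divisible enough, and the
  exponent absorbs multiplicities. Allowing every multiple M of N lets several conditions share one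
  M.\<close>

lemma divides_PR_power:
  "c \<noteq> 0 \<Longrightarrow> \<exists>N>0. \<forall>M>0. N dvd M \<longrightarrow> c dvd PR M ^ degree c"
proof (induction "degree c" arbitrary: c)
  case 0
  then obtain u where "c = [:u:]" "u \<noteq> 0" by (metis degree_eq_zeroE pCons_0_0)
  hence "c dvd 1" by (intro dvdI[of _ _ "[:inverse u:]"]) (simp add: one_pCons)
  thus ?case using 0 by (intro exI[of _ 1]) simp
next
  case (Suc n)
  then obtain a where a: "poly c a = 0" using closed[of c] by auto
  then obtain c1 where c1: "c = [:-a, 1:] * c1" by (metis dvd_def poly_eq_0_iff_dvd)
  have nz: "c1 \<noteq> 0" using c1 Suc by auto
  have deg: "degree c = Suc (degree c1)" unfolding c1 using nz by (subst degree_mult_eq) auto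
  obtain N1 where N1: "0 < N1" "\<forall>M>0. N1 dvd M \<longrightarrow> c1 dvd PR M ^ degree c1"
    using Suc.hyps(1)[of c1] deg Suc.hyps(2) nz by auto
  obtain N2 where N2: "0 < N2" "a \<in> GF (J * N2)" by (rule common_GF)
  show ?case
  proof (intro exI[of _ "N2 * N1"] conjI allI impI)
    fix M assume M: "0 < M" "N2 * N1 dvd M"
    have "a \<in> GF (J * M)" using N2(2) GF_mono[of "J * N2" "J * M"] M dvd_mult_left by auto
    hence "[:-a, 1:] dvd PR M" using poly_PR poly_eq_0_iff_dvd by blast
    moreover have "c1 dvd PR M ^ degree c1" using N1 M dvd_mult_right by blast
    ultimately show "c dvd PR M ^ degree c" unfolding deg unfolding c1 power_Suc by (rule mult_dvd_mono)
  qed (use N1 N2 in auto)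
qed

lemma finite_points: "0 < N \<Longrightarrow> finite {(a, b). pt a b \<and> a \<in> GF (J * N)}"
  and card_points_le: "0 < N \<Longrightarrow> card {(a, b). pt a b \<and> a \<in> GF (J * N)} = p * 2 ^ (J * N)"
proof -
  assume N: "0 < N"
  have JN: "0 < J * N" using J N by simp
  have eq: "{(a, b). pt a b \<and> a \<in> GF (J * N)} = (SIGMA a:GF (J * N). {b. b ^ p + b = poly f a})"
    by (auto simp: pt_def)
  show "finite {(a, b). pt a b \<and> a \<in> GF (J * N)}" unfolding eq
    by (intro finite_SigmaI finite_GF JN finite_artin_schreier_roots m)
  show "card {(a, b). pt a b \<and> a \<in> GF (J * N)} = p * 2 ^ (J * N)" unfolding eq
    using card_artin_schreier_roots[OF m] card_GF[OF JN] finite_GF[OF JN]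
      finite_artin_schreier_roots[OF m] by (subst card_SigmaI) auto
qed

lemma pev_GF:
  assumes "pt a b" "a \<in> GF (J * N)" "G \<in> kXY"
  shows "pev a b G \<in> GF (2 * (J * N))"
proof -
  obtain H where H: "H \<in> kXY" "E G ^ (2 ^ (2 * (J * N))) + E G = \<xi> (PR N) * E H"
    using rel_E[OF assms(3), of N] by (auto simp: rel_def)
  hence "E (G ^ (2 ^ (2 * (J * N))) + G) = E ([:PR N:] * H)"
    by (simp only: eval2_add[OF xi] rhomD(7)[OF RE] eval2_mult[OF xi] eval2_const[OF xi])
  from E_eq_imp_ev_eq[OF assms(1) this]
  have "pev a b (G ^ (2 ^ (2 * (J * N))) + G) = pev a b ([:PR N:] * H)"
    unfolding ev_nth_0[OF assms(1), symmetric] by (simp only:)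
  hence "pev a b G ^ (2 ^ (2 * (J * N))) + pev a b G = poly (PR N) a * pev a b H"
    by (simp only: rhomD[OF hom_pev] pev_const)
  moreover have "poly (PR N) a = 0" using poly_PR assms(2) by blast
  ultimately have "pev a b G ^ (2 ^ (2 * (J * N))) + pev a b G = 0" by (simp only: mult_zero_left)
  thus ?thesis by (simp add: eq_iff_add_eq_0[symmetric])
qed

text \<open>If no nonzero polynomial in x were in the maximal ideal, all denominators would be
  invertible in \<open>V\<close> and \<open>V\<close> would be everything. So some c lies in the
  ideal, and a power of \<open>PR M\<close> is a multiple of c.\<close>

lemma mideal_PR:
  assumes V: "tplace V" "x \<in> V"
  obtains N where "0 < N" "\<And>M. 0 < M \<Longrightarrow> N dvd M \<Longrightarrow> \<xi> (PR M) \<in> mideal V"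
proof -
  have xiV: "\<xi> c \<in> V" if "c \<in> kX" for c
    using O_subset[OF V const_in_coeffs_in[OF sub_kX that]] by (simp add: eval2_const[OF xi])
  have "\<exists>c\<in>kX - {0}. \<xi> c \<in> mideal V"
  proof (rule ccontr)
    assume neg: "\<not> ?thesis"
    have "z \<in> V" if z: "z \<in> KL" for z
    proof -
      obtain G c where 1: "G \<in> kXY" "c \<in> kX" "Rep z G c" using z by (rule KLE)
      hence "inverse (\<xi> c) \<in> V" using neg unit_inverse xiV by (auto simp: Rep_def)
      thus ?thesis unfolding Rep_eq[OF 1(3)] divide_inverse
        by (intro subring_setD(5)[OF tplaceD(1)[OF V(1)]] O_subset[OF V 1(1)])
    qed
    thus False using tplaceD(2,3)[OF V(1)] by blast
  qed
  then obtain c where c: "c \<in> kX" "c \<noteq> 0" "\<xi> c \<in> mideal V" by blast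
  obtain N where N: "0 < N" "\<forall>M>0. N dvd M \<longrightarrow> c dvd PR M ^ degree c" using divides_PR_power[OF c(2)] by blast
  have "\<xi> (PR M) \<in> mideal V" if M: "0 < M" "N dvd M" for M
  proof -
    obtain u where u: "PR M ^ degree c = c * u" using N(2) M by (auto elim: dvdE)
    have "c * u \<in> kX" unfolding u[symmetric] by (intro subring_setD(7)[OF sub_kX] PR_in)
    hence "u \<in> kX" using c(1,2) by (rule kX_quotient)
    hence "\<xi> c * \<xi> u \<in> mideal V" using c(3) xiV by (intro mideal_mult[OF V(1)])
    moreover have "\<xi> (PR M) ^ degree c = \<xi> c * \<xi> u"
      using arg_cong[OF u, of \<xi>] by (simp only: rhomD(3,7)[OF xi])
    ultimately have "\<xi> (PR M) ^ degree c \<in> mideal V" by (simp only:)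
    thus ?thesis using mideal_power[OF V(1)] xiV[OF PR_in] by blast
  qed
  thus ?thesis using that N(1) by blast
qed

text \<open>
  The residue field of a place with \<open>x\<close> integral embeds into the algebraic closure. Otherwise
  choose at every point over the roots of \<open>X\<^sup>R - X\<close> some \<open>g\<close> in the maximal ideal not vanishing
  there. The product of the \<open>1 - g\<^bsup>R^2-1\<^esup>\<close> then vanishes at all these points, so it is a multiple
  of \<open>x\<^sup>R - x\<close>, although it is congruent to 1.
\<close>

lemma place_point:
  assumes V: "tplace V" "x \<in> V"
  shows "\<exists>a b. pt a b \<and> (\<forall>G\<in>kXY. E G \<in> mideal V \<longrightarrow> pev a b G = 0)"
proof (rule ccontr)
  assume neg: "\<not> ?thesis"
  obtain N where N: "0 < N" "\<And>M. 0 < M \<Longrightarrow> N dvd M \<Longrightarrow> \<xi> (PR M) \<in> mideal V"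
    using mideal_PR[OF V] by blast
  have PV: "\<xi> (PR N) \<in> mideal V" using N by simp
  define Z where "Z = {(a, b). pt a b \<and> a \<in> GF (J * N)}"
  have finZ: "finite Z" unfolding Z_def by (rule finite_points) fact
  have "\<exists>g. g \<in> kXY \<and> E g \<in> mideal V \<and> pev (fst ab) (snd ab) g \<noteq> 0" if "ab \<in> Z" for ab
    using neg that unfolding Z_def by (cases ab) auto
  hence "\<exists>g. \<forall>ab\<in>Z. g ab \<in> kXY \<and> E (g ab) \<in> mideal V \<and> pev (fst ab) (snd ab) (g ab) \<noteq> 0"
    by (intro bchoice) blast
  then obtain g where g: "\<And>ab. ab \<in> Z \<Longrightarrow> g ab \<in> kXY \<and> E (g ab) \<in> mideal V \<and> pev (fst ab) (snd ab) (g ab) \<noteq> 0"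
    by blast
  define K where "K = (2::nat) ^ (2 * (J * N)) - 1"
  have "2 \<le> (2::nat) ^ (2 * (J * N))" using N J power_increasing[of 1 "2 * (J * N)" "2::nat"] by simp
  hence K: "Suc K = 2 ^ (2 * (J * N))" "0 < K" by (auto simp: K_def)
  define D where "D = (\<Prod>ab\<in>Z. 1 + g ab ^ K)"
  have D: "D \<in> kXY" unfolding D_def using g
    by (intro subring_set_prod[OF sub_kXY] subring_setD(4)[OF sub_kXY] subring_setD(2,7)[OF sub_kXY]) auto
  have "pev a b D = 0" if "pt a b" "a \<in> GF (J * N)" for a b
  proof -
    have ab: "(a, b) \<in> Z" using that by (simp add: Z_def)
    define u where "u = pev a b (g (a, b))"
    have "u \<noteq> 0" using g[OF ab] by (simp add: u_def)
    moreover have "u ^ Suc K = u" unfolding K u_def using pev_GF[OF that] g[OF ab] by auto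
    ultimately have "u ^ K = 1" by simp
    hence "pev a b (1 + g (a, b) ^ K) = 0"
      unfolding rhomD[OF hom_pev] u_def[symmetric] by (simp add: add_self)
    moreover have "pev a b D = (\<Prod>ab\<in>Z. pev a b (1 + g ab ^ K))"
      unfolding D_def by (induction Z rule: infinite_finite_induct) (auto simp: rhomD(1,3)[OF hom_pev])
    ultimately show ?thesis using finZ ab by (auto intro!: prod_zero)
  qed
  from vanish_imp_in_PR[OF N(1) D this] obtain H where H: "H \<in> kXY" "E D = \<xi> (PR N) * E H" by blast
  have "E D \<in> mideal V" unfolding H(2) by (intro mideal_mult[OF V(1) PV] O_subset[OF V H(1)])
  moreover have "E (\<Prod>ab\<in>Y. 1 + g ab ^ K) \<in> V \<and> E (\<Prod>ab\<in>Y. 1 + g ab ^ K) \<notin> mideal V" if "Y \<subseteq> Z" for Y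
    using finite_subset[OF that finZ] that
  proof (induction Y)
    case empty
    show ?case using one_notin_mideal[OF V(1)] subring_setD(2)[OF tplaceD(1)[OF V(1)]] rhomD(1)[OF RE] by simp
  next
    case (insert ab Y)
    have "E (g ab) \<in> mideal V" using g insert by blast
    hence "E (g ab) * E (g ab) ^ (K - 1) \<in> mideal V"
      using mideal_subset by (intro mideal_mult[OF V(1)] subring_setD(7)[OF tplaceD(1)[OF V(1)]]) auto
    hence "E (g ab) ^ K \<in> mideal V" using K(2) by (cases K) auto
    note u = one_plus_mideal[OF V(1) this]
    have "E (\<Prod>ab\<in>insert ab Y. 1 + g ab ^ K) = (1 + E (g ab) ^ K) * E (\<Prod>ab\<in>Y. 1 + g ab ^ K)"
      using insert by (simp add: eval2_mult[OF xi] eval2_add[OF xi] rhomD(1,7)[OF RE])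
    thus ?case using u insert mideal_prime[OF V(1)] subring_setD(5)[OF tplaceD(1)[OF V(1)]] by (metis insert_subset)
  qed
  hence "E D \<notin> mideal V" unfolding D_def by blast
  ultimately show False by blast
qed


section \<open>A place compared with a point at which its maximal ideal vanishes\<close>

context
  fixes V a b N
  assumes V: "tplace V" and x_V: "x \<in> V" and pt: "pt a b"
    and sub: "\<And>G. G \<in> kXY \<Longrightarrow> E G \<in> mideal V \<Longrightarrow> pev a b G = 0"
    and N: "0 < N" and PV: "\<xi> (PR N) \<in> mideal V"
begin

text \<open>With K = 2^(2JN) - 1, the element 1 + G^K is complementary to G: the product G^(K+1) + G
  is a multiple of \<open>PR N\<close>, while 1 + G^K is a unit wherever G vanishes.\<close>

lemma place_complement:
  assumes G: "G \<in> kXY"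
  obtains e H where "e \<in> kXY" "H \<in> kXY" "E G * E e = \<xi> (PR N) * E H"
    "pev a b G = 0 \<longrightarrow> pev a b e = 1" "E G \<in> mideal V \<longrightarrow> E e \<notin> mideal V"
proof -
  define K where "K = (2::nat) ^ (2 * (J * N)) - 1"
  have "2 \<le> (2::nat) ^ (2 * (J * N))" using N J power_increasing[of 1 "2 * (J * N)" "2::nat"] by simp
  hence K: "Suc K = 2 ^ (2 * (J * N))" "0 < K" by (auto simp: K_def)
  obtain H where H: "H \<in> kXY" "E G ^ (2 ^ (2 * (J * N))) + E G = \<xi> (PR N) * E H"
    using rel_E[OF G, of N] by (auto simp: rel_def)
  define e where "e = 1 + G ^ K"
  have e: "e \<in> kXY" unfolding e_def by (intro subring_setD(4)[OF sub_kXY] subring_setD(2,7)[OF sub_kXY] G)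
  have Ee: "E e = 1 + E G ^ K" by (simp only: e_def eval2_add[OF xi] rhomD(1,7)[OF RE])
  have "E G * E e = E G ^ Suc K + E G" unfolding Ee by (simp add: distrib_left)
  hence 1: "E G * E e = \<xi> (PR N) * E H" unfolding K(1) H(2) .
  have 2: "pev a b G = 0 \<longrightarrow> pev a b e = 1"
    using K(2) by (auto simp: e_def rhomD(1,2,7)[OF hom_pev] power_0_left)
  have 3: "E e \<notin> mideal V" if m: "E G \<in> mideal V"
  proof -
    have "E G * E G ^ (K - 1) \<in> mideal V"
      using m mideal_subset by (intro mideal_mult[OF V] subring_setD(7)[OF tplaceD(1)[OF V]]) auto
    moreover have "E G * E G ^ (K - 1) = E G ^ K" using K(2) by (cases K) auto
    ultimately have "E G ^ K \<in> mideal V" by (simp only:)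
    thus ?thesis unfolding Ee by (rule one_plus_mideal[OF V])
  qed
  show ?thesis by (rule that[OF e H(1) 1 2]) (use 3 in blast)
qed

text \<open>The converse of \<open>sub\<close>. If G vanished at the point without lying in the
  maximal ideal, its complement would lie in the ideal and yet have value 1 at the point.\<close>

lemma place_unit_pev:
  assumes G: "G \<in> kXY" "E G \<notin> mideal V"
  shows "pev a b G \<noteq> 0"
proof
  assume 0: "pev a b G = 0"
  obtain e H where *: "e \<in> kXY" "H \<in> kXY" "E G * E e = \<xi> (PR N) * E H"
    "pev a b G = 0 \<longrightarrow> pev a b e = 1" "E G \<in> mideal V \<longrightarrow> E e \<notin> mideal V"
    by (rule place_complement[OF G(1)])
  have "E G * E e \<in> mideal V" unfolding *(3) by (intro mideal_mult[OF V PV] O_subset[OF V x_V *(2)])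
  hence "E e \<in> mideal V"
    using mideal_prime[OF V _ O_subset[OF V x_V G(1)] O_subset[OF V x_V *(1)]] G(2) by blast
  hence "pev a b e = 0" by (rule sub[OF *(1)])
  thus False using * 0 by simp
qed

text \<open>Up to units of \<open>V\<close> every nonzero polynomial is a power of
  \<open>PR N\<close>: for G in the maximal ideal the complement is a unit, so a factor
  \<open>PR N\<close> is split off and G is traded for \<open>H\<close>, whose order at the point is
  smaller.\<close>

lemma place_decomposition:
  "G \<in> kXY \<Longrightarrow> E G \<noteq> 0 \<Longrightarrow> \<exists>n U W. U \<in> kXY \<and> W \<in> kXY \<and> E U \<notin> mideal V \<and> E W \<notin> mideal V
     \<and> E G * E W = \<xi> (PR N) ^ n * E U"
proof (induction "nat (vpt a b (E G))" arbitrary: G rule: less_induct)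
  case less
  note R = subring_setD[OF sub_kXY]
  show ?case
  proof (cases "E G \<in> mideal V")
    case False
    have "1 \<in> kXY" "E 1 \<notin> mideal V" "E G * E 1 = \<xi> (PR N) ^ 0 * E G"
      using R(2) one_notin_mideal[OF V] by (simp_all add: rhomD(1)[OF RE])
    thus ?thesis using less.prems(1) False by blast
  next
    case True
    obtain e H where *: "e \<in> kXY" "H \<in> kXY" "E G * E e = \<xi> (PR N) * E H"
      "pev a b G = 0 \<longrightarrow> pev a b e = 1" "E G \<in> mideal V \<longrightarrow> E e \<notin> mideal V"
      by (rule place_complement[OF less.prems(1)])
    have e: "E e \<notin> mideal V" using * True by blast
    hence e0: "E e \<noteq> 0" using subring_setD(1)[OF tplaceD(1)[OF V]] by (auto simp: mideal_def)
    have H0: "E H \<noteq> 0" using *(3) less.prems(2) e0 by auto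
    have P0: "\<xi> (PR N) \<noteq> 0" using xi_nz degree_PR(2)[OF N] by blast
    have PK: "\<xi> (PR N) \<in> KL" by (intro xi_in_KL PR_in)
    have "0 < vpt a b (E G)" using vpt_E_pos_iff[OF pt less.prems] sub[OF less.prems(1) True] by simp
    moreover have "vpt a b (E e) = 0"
      using vpt_E_pos_iff[OF pt *(1) e0] vpt_E_ge_0[OF pt *(1)] place_unit_pev[OF *(1) e] by simp
    moreover have "0 < vpt a b (\<xi> (PR N))"
    proof -
      have "E [:PR N:] \<in> mideal V" using PV by (simp add: eval2_const[OF xi])
      hence "pev a b [:PR N:] = 0" by (intro sub const_in_coeffs_in sub_kX PR_in)
      hence "a \<in> GF (J * N)" unfolding pev_const using poly_PR by blast
      thus ?thesis using vpt_PR[OF pt N] by simp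
    qed
    moreover have "vpt a b (E G * E e) = vpt a b (E G) + vpt a b (E e)"
      by (rule vpt_mult[OF pt E_in_KL[OF less.prems(1)] E_in_KL[OF *(1)] less.prems(2) e0])
    moreover have "vpt a b (\<xi> (PR N) * E H) = vpt a b (\<xi> (PR N)) + vpt a b (E H)"
      by (rule vpt_mult[OF pt PK E_in_KL[OF *(2)] P0 H0])
    ultimately have "vpt a b (E H) < vpt a b (E G)" "0 < vpt a b (E G)" unfolding *(3) by linarith+
    hence "nat (vpt a b (E H)) < nat (vpt a b (E G))" by simp
    from less.hyps[OF this *(2) H0] obtain n U W where IH: "U \<in> kXY" "W \<in> kXY" "E U \<notin> mideal V" "E W \<notin> mideal V"
      "E H * E W = \<xi> (PR N) ^ n * E U" by blast
    have "E G * E (e * W) = (E G * E e) * E W" by (simp add: eval2_mult[OF xi] mult.assoc)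
    also have "\<dots> = \<xi> (PR N) * (E H * E W)" unfolding *(3) by (simp only: mult.assoc)
    finally have "E G * E (e * W) = \<xi> (PR N) ^ Suc n * E U" unfolding IH(5) by (simp add: mult.assoc)
    moreover have "E (e * W) \<notin> mideal V" unfolding eval2_mult[OF xi]
      using mideal_prime[OF V _ O_subset[OF V x_V *(1)] O_subset[OF V x_V IH(2)]] e IH(4) by blast
    moreover have "e * W \<in> kXY" using *(1) IH(2) by (rule R(5))
    ultimately show ?thesis using IH(1,3) by blast
  qed
qed

lemma place_decomposition_KL:
  assumes "z \<in> KL" "z \<noteq> 0"
  obtains n l U W where "U \<in> kXY" "W \<in> kXY" "E U \<notin> mideal V" "E W \<notin> mideal V"
    "z * \<xi> (PR N) ^ l * E W = \<xi> (PR N) ^ n * E U"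
proof -
  obtain G c where 1: "G \<in> kXY" "c \<in> kX" "Rep z G c" using assms(1) by (rule KLE)
  have "c \<noteq> 0" using 1(3) by (simp add: Rep_def)
  hence c: "E [:c:] \<noteq> 0" "[:c:] \<in> kXY"
    unfolding eval2_const[OF xi] using xi_nz const_in_coeffs_in[OF sub_kX 1(2)] by blast+
  have zc: "z * E [:c:] = E G" using 1(3) by (simp add: Rep_def eval2_const[OF xi])
  hence "E G \<noteq> 0" using c(1) assms(2) by (metis mult_eq_0_iff)
  from place_decomposition[OF 1(1) this] obtain n U W where
    A: "U \<in> kXY" "W \<in> kXY" "E U \<notin> mideal V" "E W \<notin> mideal V" "E G * E W = \<xi> (PR N) ^ n * E U" by blast
  from place_decomposition[OF c(2,1)] obtain l U' W' where
    B: "U' \<in> kXY" "W' \<in> kXY" "E U' \<notin> mideal V" "E W' \<notin> mideal V" "E [:c:] * E W' = \<xi> (PR N) ^ l * E U'" by blast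
  have prime: "E (G * H) \<notin> mideal V" if "G \<in> kXY" "H \<in> kXY" "E G \<notin> mideal V" "E H \<notin> mideal V" for G H
    unfolding eval2_mult[OF xi]
    using mideal_prime[OF V _ O_subset[OF V x_V that(1)] O_subset[OF V x_V that(2)]] that by blast
  have "z * \<xi> (PR N) ^ l * E (U' * W) = z * (\<xi> (PR N) ^ l * E U') * E W" by (simp only: eval2_mult[OF xi] mult_ac)
  also have "\<dots> = (z * E [:c:]) * E W * E W'" unfolding B(5)[symmetric] by (simp only: mult_ac)
  also have "\<dots> = \<xi> (PR N) ^ n * E (U * W')" unfolding zc A(5) by (simp only: eval2_mult[OF xi] mult_ac)
  finally have *: "z * \<xi> (PR N) ^ l * E (U' * W) = \<xi> (PR N) ^ n * E (U * W')" .
  show ?thesis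
    by (rule that[OF subring_setD(5)[OF sub_kXY A(1) B(2)] subring_setD(5)[OF sub_kXY B(1) A(2)]
        prime[OF A(1) B(2) A(3) B(4)] prime[OF B(1) A(2) B(3) A(4)] *])
qed

lemma unit_E:
  assumes "U \<in> kXY" "E U \<notin> mideal V"
  shows "E U \<noteq> 0" "inverse (E U) \<in> V" "vpt a b (E U) = 0"
proof -
  show nz: "E U \<noteq> 0" and "inverse (E U) \<in> V" using unit_inverse[OF O_subset[OF V x_V assms(1)] assms(2)] by auto
  have "\<not> 0 < vpt a b (E U)" using vpt_E_pos_iff[OF pt assms(1) nz] place_unit_pev[OF assms] by blast
  thus "vpt a b (E U) = 0" using vpt_E_ge_0[OF pt assms(1)] by linarith
qed

lemma a_in_GF: "a \<in> GF (J * N)"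
proof -
  have "E [:PR N:] \<in> mideal V" using PV by (simp add: eval2_const[OF xi])
  hence "pev a b [:PR N:] = 0" by (intro sub const_in_coeffs_in sub_kX PR_in)
  thus ?thesis unfolding pev_const using poly_PR by blast
qed

lemma P_facts: "\<xi> (PR N) \<in> KL" "\<xi> (PR N) \<noteq> 0" "vpt a b (\<xi> (PR N)) = 1"
  using xi_in_KL[OF PR_in[of N]] xi_nz[OF degree_PR(2)[OF N]] vpt_PR[OF pt N] a_in_GF by simp_all

lemma vpt_decomposition:
  assumes "z \<in> KL" "z \<noteq> 0" "U \<in> kXY" "W \<in> kXY" "E U \<notin> mideal V" "E W \<notin> mideal V"
    "z * \<xi> (PR N) ^ l * E W = \<xi> (PR N) ^ n * E U"
  shows "vpt a b z = int n - int l"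
proof -
  note d = dval_vpt[OF pt]
  have K: "\<xi> (PR N) ^ i \<in> KL" "\<xi> (PR N) ^ i \<noteq> 0" "vpt a b (\<xi> (PR N) ^ i) = int i" for i
    using KL_power[OF P_facts(1)] P_facts dval_power[OF d P_facts(1,2)] by simp_all
  have "vpt a b (z * \<xi> (PR N) ^ l * E W) = vpt a b z + int l"
    using dval_mult[OF d KL_mult[OF assms(1) K(1)] E_in_KL[OF assms(4)], of l]
      dval_mult[OF d assms(1) K(1)[of l]] unit_E[OF assms(4,6)] K[of l] assms(2) by simp
  moreover have "vpt a b (\<xi> (PR N) ^ n * E U) = int n"
    using dval_mult[OF d K(1) E_in_KL[OF assms(3)]] unit_E[OF assms(3,5)] K[of n] by simp
  ultimately show ?thesis using assms(7) by simp
qed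

text \<open>In the decomposition the order at the point is n - l. If it is not negative, the
  function is a power of \<open>PR N\<close> times a quotient of units of \<open>V\<close>;
  maximality of discrete valuation rings gives the equality.\<close>

lemma place_eq_Vpt_aux: "V = Vpt a b"
proof (rule vring_maximal[OF dval_vpt[OF pt] V])
  show "Vpt a b \<subseteq> V"
  proof
    fix z assume z: "z \<in> Vpt a b"
    show "z \<in> V"
    proof (cases "z = 0")
      case False
      have zK: "z \<in> KL" and ge: "0 \<le> vpt a b z" using z False by (auto simp: vring_def)
      obtain n l U W where *: "U \<in> kXY" "W \<in> kXY" "E U \<notin> mideal V" "E W \<notin> mideal V"
        "z * \<xi> (PR N) ^ l * E W = \<xi> (PR N) ^ n * E U" by (rule place_decomposition_KL[OF zK False])
      have "l \<le> n" using vpt_decomposition[OF zK False *] ge by simp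
      hence "\<xi> (PR N) ^ n = \<xi> (PR N) ^ l * \<xi> (PR N) ^ (n - l)" by (simp flip: power_add)
      hence "z * \<xi> (PR N) ^ l * E W = \<xi> (PR N) ^ l * \<xi> (PR N) ^ (n - l) * E U" using *(5) by simp
      hence "z = \<xi> (PR N) ^ (n - l) * E U * inverse (E W)"
        using P_facts(2) unit_E(1)[OF *(2,4)] by (simp add: field_simps)
      moreover have "\<xi> (PR N) \<in> V" using PV mideal_subset by blast
      ultimately show ?thesis
        using O_subset[OF V x_V *(1)] unit_E(2)[OF *(2,4)]
        by (simp only:) (intro subring_setD(5,7)[OF tplaceD(1)[OF V]])
    qed (simp add: subring_setD(1)[OF tplaceD(1)[OF V]])
  qed
qed

text \<open>A function of order 0 is a quotient of two polynomials that do not vanish at the point,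
  so its value lies in any of the fields \<open>GF k\<close> that contain the coordinates and
  \<open>GF J\<close>.\<close>

lemma val_in_GF_aux:
  assumes "z \<in> V" "a \<in> GF k" "b \<in> GF k" "J dvd k"
  shows "val a b z \<in> GF k"
proof -
  have pev: "pev a b G \<in> GF k" if "G \<in> kXY" for G
  proof -
    have sub_GF: "subring_set (GF k)" unfolding subring_set_def using GF_0_1 GF_add GF_mult by (auto simp: neg_eq)
    have "GF J \<subseteq> GF k" by (rule GF_mono) fact
    hence "c \<in> coeffs_in (GF k)" if "c \<in> kX" for c using that unfolding coeffs_in_def by blast
    thus ?thesis unfolding pev_def eval2_def
      using assms that by (intro subring_set_sum[OF sub_GF] subring_setD(5,7)[OF sub_GF] poly_in_subring[OF sub_GF])
         (auto simp del: mem_Collect_eq intro: coeffs_inD)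
  qed
  have VV: "V = Vpt a b" by (rule place_eq_Vpt_aux)
  show ?thesis
  proof (cases "z = 0")
    case True
    have "val a b (E 0) = pev a b 0" by (rule val_E[OF pt subring_setD(1)[OF sub_kXY]])
    thus ?thesis using True rhomD(4)[OF RE] rhomD(4)[OF hom_pev] by simp
  next
    case False
    have zK: "z \<in> KL" and ge: "0 \<le> vpt a b z" using assms(1) False VV by (auto simp: vring_def)
    show ?thesis
    proof (cases "vpt a b z > 0")
      case True
      thus ?thesis using val_eq_0_iff[OF pt zK False ge] GF_0_1 by simp
    next
      case F: False
      obtain n l U W where *: "U \<in> kXY" "W \<in> kXY" "E U \<notin> mideal V" "E W \<notin> mideal V"
        "z * \<xi> (PR N) ^ l * E W = \<xi> (PR N) ^ n * E U" by (rule place_decomposition_KL[OF zK False])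
      have "n = l" using vpt_decomposition[OF zK False *] ge F by simp
      hence "z * E W = E U" using *(5) P_facts(2) by simp
      moreover have "val a b (z * E W) = val a b z * val a b (E W)"
        using ge vpt_E_ge_0[OF pt *(2)] by (intro val_mult[OF pt zK E_in_KL[OF *(2)]]) auto
      ultimately have "val a b z * pev a b W = pev a b U" using val_E[OF pt] * by simp
      hence "val a b z = pev a b U * inverse (pev a b W)" using place_unit_pev[OF *(2,4)] by (simp add: field_simps)
      thus ?thesis using GF_mult[OF pev[OF *(1)] GF_inverse[OF pev[OF *(2)]]] by simp
    qed
  qed
qed

end

lemma place_eq_Vpt:
  assumes "tplace V" "x \<in> V" "pt a b" "\<And>G. G \<in> kXY \<Longrightarrow> E G \<in> mideal V \<Longrightarrow> pev a b G = 0"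
  shows "V = Vpt a b"
proof -
  obtain N where "0 < N" "\<And>M. 0 < M \<Longrightarrow> N dvd M \<Longrightarrow> \<xi> (PR M) \<in> mideal V"
    using mideal_PR[OF assms(1,2)] by blast
  thus ?thesis using place_eq_Vpt_aux[OF assms, of N] by simp
qed

lemma place_x_cases:
  assumes "tplace V" "x \<in> V"
  shows "\<exists>a b. pt a b \<and> V = Vpt a b"
  using place_point[OF assms] place_eq_Vpt[OF assms] by blast

lemma val_in_GF:
  assumes "pt a b" "z \<in> Vpt a b" "a \<in> GF k" "b \<in> GF k" "J dvd k"
  shows "val a b z \<in> GF k"
proof -
  note V = tplace_Vpt[OF assms(1)] and x = x_in_Vpt[OF assms(1)]
  obtain N where "0 < N" "\<And>M. 0 < M \<Longrightarrow> N dvd M \<Longrightarrow> \<xi> (PR M) \<in> mideal (Vpt a b)"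
    using mideal_PR[OF V x] by blast
  thus ?thesis using val_in_GF_aux[OF V x assms(1) _ _ _ assms(2-5), of N] mideal_Vpt_E[OF assms(1)] by simp
qed

text \<open>The coefficients in \<open>GF J\<close> are fixed by this power, so the same polynomials
  vanish at both points; by \<open>place_eq_Vpt\<close> the places coincide.\<close>

lemma Vpt_frobenius:
  assumes "pt a b"
  shows "pt (a ^ (2 ^ (J * j))) (b ^ (2 ^ (J * j)))" "Vpt (a ^ (2 ^ (J * j))) (b ^ (2 ^ (J * j))) = Vpt a b"
proof -
  let ?F = "\<lambda>u::'a. u ^ (2 ^ (J * j))"
  have fix_k: "?F c = c" if "c \<in> GF J" for c using that power_frob_mod[of c J "J * j"] by simp
  have poly_F: "poly c (?F u) = ?F (poly c u)" if "c \<in> kX" for c u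
  proof -
    have "?F (poly c u) = (\<Sum>i\<le>degree c. ?F (poly.coeff c i) * ?F u ^ i)"
      by (simp add: poly_altdef frob_sum power_mult_distrib power_mult[symmetric] mult.commute)
    thus ?thesis by (simp add: poly_altdef fix_k[OF coeffs_inD[OF that]])
  qed
  show pt': "pt (?F a) (?F b)"
    using assms unfolding pt_def poly_F[OF f_in] by (metis frob_add power_mult mult.commute)
  have pevF: "pev (?F a) (?F b) G = ?F (pev a b G)" if "G \<in> kXY" for G
    unfolding pev_def eval2_def
    by (simp add: frob_sum power_mult_distrib power_mult[symmetric] mult.commute[of _ "2 ^ _"] poly_F[OF coeffs_inD[OF that]])
  have "Vpt (?F a) (?F b) = Vpt a b"
    by (rule place_eq_Vpt[OF tplace_Vpt[OF pt'] x_in_Vpt[OF pt'] assms])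
       (simp add: mideal_Vpt_E[OF pt'] pevF)
  thus "Vpt (?F a) (?F b) = Vpt a b" .
qed

text \<open>With t = 1/x in the maximal ideal, a polynomial of degree n in x is a unit times t^(-n),
  and the equation makes y^p a unit times t^(-h). So weights again measure poles, and every term of
  a function in \<open>Vinf\<close> has its p-th power in \<open>V\<close>.\<close>

lemma place_x_notin:
  assumes V: "tplace V" and xV: "x \<notin> V"
  shows "V = Vinf"
proof (rule vring_maximal[OF dval_vinf V], rule subsetI)
  note R = subring_setD[OF tplaceD(1)[OF V]]
  define t where "t = inverse x"
  have t: "t \<in> V" "t \<noteq> 0" using tplaceD(5)[OF V x_in_KL xV] x_nz by (auto simp: t_def)
  have tm: "t \<in> mideal V" using t xV by (simp add: mideal_def t_def)
  have xt: "x * t = 1" using x_nz by (simp add: t_def)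
  define un where "un z \<longleftrightarrow> z \<in> V \<and> z \<noteq> 0 \<and> inverse z \<in> V" for z
  have un_mult: "un (z * u)" if "un z" "un u" for z u using that R(5) by (auto simp: un_def)
  have un_inv: "un (inverse z)" if "un z" for z using that by (auto simp: un_def)
  have un_pow: "un (z ^ n)" if "un z" for z n using that R(7) by (auto simp: un_def power_inverse[symmetric])
  have un_poly: "un (\<xi> c * t ^ degree c)" if "c \<in> kX" "c \<noteq> 0" for c
    using that
  proof (induction c)
    case (pCons u c)
    have ac: "u \<in> GF J" "c \<in> kX" using pCons.prems by (auto simp: coeffs_in_def coeff_pCons split: nat.splits)
    have "pCons u c = [:u:] + [:0, 1:] * c" by simp
    hence eq: "\<xi> (pCons u c) = cst u + x * \<xi> c" by (simp only: rhomD[OF xi])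
    show ?case
    proof (cases "c = 0")
      case True
      hence "u \<noteq> 0" using pCons.prems by simp
      have "cst u * cst (inverse u) = 1" unfolding cst_mult[symmetric] using \<open>u \<noteq> 0\<close> cst_1 by simp
      hence "inverse (cst u) = cst (inverse u)" "cst u \<noteq> 0" by (auto intro: inverse_unique)
      thus ?thesis using True tplaceD(4)[OF V ac(1)] tplaceD(4)[OF V GF_inverse[OF ac(1)]] by (simp add: un_def)
    next
      case False
      hence IH: "un (\<xi> c * t ^ degree c)" using pCons ac by blast
      define w where "w = \<xi> c * t ^ degree c"
      have "\<xi> (pCons u c) * t ^ degree (pCons u c) = t * (cst u * t ^ degree c) + (x * t) * w"
        unfolding eq using False by (simp add: w_def algebra_simps)
      hence eq': "\<xi> (pCons u c) * t ^ degree (pCons u c) = w + t * (cst u * t ^ degree c)" unfolding xt by simp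
      have s: "t * (cst u * t ^ degree c) \<in> mideal V" by (intro mideal_mult[OF V tm] R(5,7) tplaceD(4)[OF V] ac t)
      have wV: "w \<in> V" "w \<notin> mideal V" using IH by (auto simp: un_def w_def mideal_def)
      have "w + t * (cst u * t ^ degree c) \<in> V" using wV(1) s mideal_subset by (intro R(4)) auto
      moreover have "w + t * (cst u * t ^ degree c) \<notin> mideal V"
      proof
        assume "w + t * (cst u * t ^ degree c) \<in> mideal V"
        from mideal_add[OF V this s] have "w \<in> mideal V" by (simp add: add.assoc char2_add_self[OF two_l])
        thus False using wV by simp
      qed
      ultimately show ?thesis unfolding eq' un_def by (auto simp: mideal_def)
    qed
  qed simp
  have un_f: "un (\<xi> f * t ^ h)" using h by (intro un_poly f_in) auto
  have yV: "y \<notin> V"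
  proof
    assume "y \<in> V"
    hence "\<xi> f \<in> V" unfolding y[symmetric] by (intro R(4,7))
    hence "\<xi> f * inverse (\<xi> f * t ^ h) \<in> V" using un_f by (intro R(5)) (auto simp: un_def)
    moreover have "\<xi> f * inverse (\<xi> f * t ^ h) = x ^ h"
      using un_f by (auto simp: un_def t_def field_simps power_inverse)
    ultimately have "x ^ h \<in> V" by (simp only:)
    thus False using power_in_tplace[OF V x_in_KL _ h] xV by blast
  qed
  define s where "s = inverse y"
  have s: "s \<in> mideal V" "s \<in> V" using tplaceD(5)[OF V y_in_KL yV] yV by (auto simp: s_def mideal_def)
  obtain k where k: "p = Suc (Suc k)" using p(1) by (metis Suc_le_D numeral_2_eq_2 Suc_le_mono)
  have "s * s ^ k \<in> mideal V" by (intro mideal_mult[OF V s(1)] R(7) s)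
  from one_plus_mideal[OF V this] have un1: "un (1 + s * s ^ k)" by (auto simp: un_def mideal_def)
  \<comment> \<open>y^p + y = y^p (1 + s^(p-1)) with s = 1/y in the maximal ideal, so the second
    factor is a unit.\<close>
  have "y ^ p * (1 + s * s ^ k) = \<xi> f"
    unfolding y[symmetric] k s_def using vinf_y(2) by (simp add: distrib_left field_simps power_inverse)
  hence "y ^ p * t ^ h = (\<xi> f * t ^ h) * inverse (1 + s * s ^ k)"
    using un1 by (auto simp: un_def field_simps)
  hence un_y: "un (y ^ p * t ^ h)" using un_mult[OF un_f un_inv[OF un1]] by (simp only:)
  fix z assume z: "z \<in> Vinf"
  show "z \<in> V"
  proof (cases "z = 0")
    case False
    have zK: "z \<in> KL" and ge: "0 \<le> vinf z" using z False by (auto simp: vring_def)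
    obtain G c where 1: "G \<in> kXY" "c \<in> kX" "Rep z G c" using zK by (rule KLE)
    have deg: "degree G < p" "c \<noteq> 0" using 1 by (auto simp: Rep_def)
    have "G \<noteq> 0" using Rep_nz 1 False by blast
    have "degree (\<sigma> G) \<le> p * degree c" using vinf_eq[OF 1(3) False] ge by linarith
    hence wt: "h * i + p * degree (poly.coeff G i) \<le> p * degree c" if "poly.coeff G i \<noteq> 0" for i
    proof -
      have "h * (i + 0) + p * degree (poly.coeff G i) \<le> degree (\<sigma> G)"
        using \<sigma>_reduced(2)[OF \<open>G \<noteq> 0\<close> deg(1)] that unfolding wt_def by blast
      thus ?thesis using \<open>degree (\<sigma> G) \<le> p * degree c\<close> by simp
    qed
    have "\<xi> (poly.coeff G i) * y ^ i / \<xi> c \<in> V" for i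
    proof (cases "poly.coeff G i = 0")
      case True
      thus ?thesis using R(1) by (simp add: rhomD(4)[OF xi])
    next
      case nz: False
      define g where "g = poly.coeff G i"
      have g: "g \<in> kX" "g \<noteq> 0" using coeffs_inD[OF 1(1)] nz by (auto simp: g_def)
      define w where "w = \<xi> g * y ^ i / \<xi> c"
      have wK: "w \<in> KL" unfolding w_def using g 1(2)
        by (intro KL_divide KL_mult xi_in_KL KL_power y_in_KL)
      define A B C where "A = \<xi> g * t ^ degree g" and "B = y ^ p * t ^ h" and "C = \<xi> c * t ^ degree c"
      have ABC: "un A" "un B" "un C" using un_poly g 1(2) deg(2) un_y by (auto simp: A_def B_def C_def)
      \<comment> \<open>The weight inequality leaves a nonnegative exponent l, and w^p becomes a
        unit times t^l. Powers of exponent p are taken because p does not divide the pole order h of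
        y.\<close>
      obtain l where l: "p * degree c = h * i + p * degree g + l"
        using wt[OF nz] unfolding g_def by (metis le_add_diff_inverse)
      have "w ^ p * (t ^ (p * degree g) * t ^ (h * i) * C ^ p) = (A ^ p * B ^ i) * t ^ (p * degree c)"
        using xi_nz[OF deg(2)] by (simp add: w_def A_def B_def C_def power_mult_distrib power_divide power_mult[symmetric] mult_ac)
      also have "t ^ (p * degree c) = t ^ (p * degree g) * t ^ (h * i) * t ^ l" unfolding l by (simp add: power_add)
      finally have "w ^ p * C ^ p = A ^ p * B ^ i * t ^ l" using t(2) by simp
      hence "w ^ p = A ^ p * B ^ i * t ^ l * inverse (C ^ p)"
        using un_pow[OF ABC(3), of p] by (auto simp: un_def field_simps)
      moreover have "A ^ p * B ^ i * t ^ l * inverse (C ^ p) \<in> V"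
      proof -
        have "un (A ^ p * B ^ i)" "un (inverse (C ^ p))"
          by (intro un_mult un_pow un_inv ABC)+
        hence AB: "A ^ p * B ^ i \<in> V" and C: "inverse (C ^ p) \<in> V" unfolding un_def by blast+
        show ?thesis by (rule R(5)[OF R(5)[OF AB R(7)[OF t(1)]] C])
      qed
      ultimately have "w ^ p \<in> V" by (simp only:)
      from power_in_tplace[OF V wK this p(2)] show ?thesis unfolding w_def g_def .
    qed
    moreover have "z = (\<Sum>i\<le>degree G. \<xi> (poly.coeff G i) * y ^ i / \<xi> c)"
      using Rep_eq[OF 1(3)] by (simp add: eval2_def sum_divide_distrib)
    moreover have "(\<Sum>i\<le>degree G. \<xi> (poly.coeff G i) * y ^ i / \<xi> c) \<in> V"
      by (rule subring_set_sum[OF tplaceD(1)[OF V]]) (rule calculation(1))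
    ultimately show ?thesis by (simp only:)
  qed (simp add: R(1))
qed

lemma tplace_cases:
  assumes "tplace V"
  shows "V = Vinf \<or> (\<exists>a b. pt a b \<and> V = Vpt a b)"
  using place_x_cases[OF assms] place_x_notin[OF assms] by blast


subsection \<open>Global sections\<close>

text \<open>The roots a of c are removed one at a time: vanishing at all points above a forces X - a
  to divide every coefficient of G.\<close>

lemma dvd_ev_imp_dvd:
  "c \<noteq> 0 \<Longrightarrow> degree G < p \<Longrightarrow> (\<And>a b. pt a b \<Longrightarrow> shiftp a c dvd ev a b G) \<Longrightarrow> \<exists>H. G = Polynomial.smult c H"
proof (induction "degree c" arbitrary: c G)
  case 0
  then obtain u where u: "c = [:u:]" "u \<noteq> 0" by (metis degree_eq_zeroE pCons_0_0)
  have "Polynomial.smult c (Polynomial.smult [:inverse u:] G) = G" using u by (simp add: one_pCons[symmetric])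
  thus ?case by metis
next
  case (Suc n)
  then obtain a where a: "poly c a = 0" using closed[of c] by auto
  then obtain c1 where c1: "c = [:-a, 1:] * c1" by (metis dvd_def poly_eq_0_iff_dvd)
  have nz: "c1 \<noteq> 0" using c1 Suc.prems by auto
  have deg: "degree c = Suc (degree c1)" unfolding c1 using nz by (subst degree_mult_eq) auto
  have "pev a b G = 0" if ptb: "pt a b" for b
  proof -
    obtain u where "ev a b G = shiftp a c * u" using Suc.prems(3)[OF ptb] by (rule dvdE)
    hence "fps_nth (ev a b G) 0 = fps_nth (shiftp a c) 0 * fps_nth u 0" by simp
    thus ?thesis unfolding ev_nth_0[OF ptb] shiftp_0 using a by simp
  qed
  hence "[:-a, 1:] dvd poly.coeff G i" for i
    using coeffs_vanish[OF Suc.prems(2)] poly_eq_0_iff_dvd by blast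
  hence dvd: "[:-a, 1:] * (poly.coeff G i div [:-a, 1:]) = poly.coeff G i" for i
    by (rule dvd_mult_div_cancel)
  define H where "H = map_poly (\<lambda>u. u div [:-a, 1:]) G"
  have "poly.coeff (Polynomial.smult [:-a, 1:] H) i = poly.coeff G i" for i
    unfolding coeff_smult H_def by (subst coeff_map_poly) (rule div_0, rule dvd)
  hence H: "G = Polynomial.smult [:-a, 1:] H" by (metis poly_eqI)
  have degH: "degree H < p" using Suc.prems(2) unfolding H by simp
  have "shiftp u c1 dvd ev u v H" if "pt u v" for u v
  proof -
    have "shiftp u c = shiftp u [:-a, 1:] * shiftp u c1" unfolding c1 by (rule rhomD(3)[OF hom_shiftp])
    moreover have "ev u v G = shiftp u [:-a, 1:] * ev u v H"
    proof -
      have "G = [:[:-a, 1:]:] * H" unfolding H by simp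
      thus ?thesis by (simp only: rhomD(3)[OF hom_ev] ev_const)
    qed
    moreover have "shiftp u [:-a, 1:] \<noteq> 0" unfolding shiftp_eq_0 by simp
    ultimately show ?thesis using Suc.prems(3)[OF that] dvd_mult_cancel_left[of "shiftp u [:-a, 1:]"]
      by (simp only:) blast
  qed
  from Suc.hyps(1)[OF _ nz degH this] deg Suc.hyps(2) obtain H' where "H = Polynomial.smult c1 H'" by auto
  hence "G = Polynomial.smult c H'" unfolding H c1 by (simp only: smult_smult)
  thus ?case by blast
qed

text \<open>Regularity at all points says that the denominator divides the numerator in every
  expansion; by \<open>dvd_ev_imp_dvd\<close> it then divides it as a polynomial.\<close>

lemma global_section:
  assumes z: "z \<in> KL" and reg: "\<And>a b. pt a b \<Longrightarrow> z \<in> Vpt a b"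
  shows "\<exists>G\<in>kXY. degree G < p \<and> z = E G"
proof -
  obtain G c where 1: "G \<in> kXY" "c \<in> kX" "Rep z G c" using z by (rule KLE)
  have deg: "degree G < p" "c \<noteq> 0" "z * \<xi> c = E G" using 1 by (auto simp: Rep_def)
  have "shiftp a c dvd ev a b G" if pt: "pt a b" for a b
  proof -
    define u where "u = fls_regpart (loc a b z)"
    have "z = 0 \<or> vpt a b z \<ge> 0" using reg[OF pt] by (auto simp: vring_def)
    hence "fps_to_fls u = loc a b z" unfolding u_def by (rule regular_expansion[OF _ pt])
    hence "fps_to_fls (u * shiftp a c) = fps_to_fls (ev a b G)"
      using loc_eq[OF pt z deg(2,3)] by (simp only: fls_times_fps_to_fls)
    hence "ev a b G = u * shiftp a c" by (simp only: fps_to_fls_eq_iff)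
    thus ?thesis by (metis dvd_triv_right)
  qed
  from dvd_ev_imp_dvd[OF deg(2,1) this] obtain H where H: "G = Polynomial.smult c H" by blast
  have "poly.coeff H i \<in> kX" for i
    using coeffs_inD[OF 1(1), of i] kX_quotient[OF _ 1(2) deg(2)] unfolding H by simp
  hence "H \<in> kXY" by (simp add: coeffs_in_def[of kX])
  moreover have "degree H < p" using deg(1,2) unfolding H by simp
  moreover have "z = E H" using deg(3) xi_nz[OF deg(2)] unfolding H by (simp add: eval2_smult[OF xi])
  ultimately show ?thesis by blast
qed

end

subsection \<open>Finite vector spaces\<close>

lemma (in ring) card_dimension:
  assumes K: "subfield K R" "finite K" and "dimension n K E"
  shows "finite E \<and> card E = card K ^ n"
  using assms(3,1,2)
proof (induction n K E rule: dimension.induct)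
  case (Suc_dim v E n K)
  note K = Suc_dim.prems
  note E = space_subgroup_props[OF K(1) Suc_dim.hyps(3)]
  have Kc: "K \<subseteq> carrier R" by (rule subfieldE(3)[OF K(1)])
  have inj: "inj_on (\<lambda>(k, u). k \<otimes> v \<oplus> u) (K \<times> E)"
  proof (rule inj_onI)
    fix ku ku' assume ku: "ku \<in> K \<times> E" "ku' \<in> K \<times> E"
      "(\<lambda>(k, u). k \<otimes> v \<oplus> u) ku = (\<lambda>(k, u). k \<otimes> v \<oplus> u) ku'"
    obtain k u k' u' where eq: "ku = (k, u)" "ku' = (k', u')" by (cases ku; cases ku')
    have h: "k \<in> K" "u \<in> E" "k' \<in> K" "u' \<in> E" "k \<otimes> v \<oplus> u = k' \<otimes> v \<oplus> u'" using ku eq by auto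
    have c: "k \<in> carrier R" "k' \<in> carrier R" "u \<in> carrier R" "u' \<in> carrier R" using h Kc E(1) by auto
    have "(k \<ominus> k') \<otimes> v = u' \<oplus> (\<ominus> u)"
    proof -
      have "(k \<ominus> k') \<otimes> v = (k \<otimes> v \<oplus> u) \<ominus> k' \<otimes> v \<ominus> u" using c Suc_dim(1) by algebra
      also have "\<dots> = u' \<oplus> (\<ominus> u)" unfolding h(5) using c Suc_dim(1) by algebra
      finally show ?thesis .
    qed
    hence kv: "(k \<ominus> k') \<otimes> v \<in> E" using E(3)[OF h(4) E(4)[OF h(2)]] by simp
    have "k \<ominus> k' \<in> K" using subringE(5,7)[OF subfieldE(1)[OF K(1)]] h by (simp add: a_minus_def)
    hence "k \<ominus> k' = \<zero>" using E(6)[of "k \<ominus> k'" v] kv Suc_dim(1,2) by blast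
    hence kk: "k = k'" using c by simp
    thus "ku = ku'" using h(5) c Suc_dim(1) eq by simp
  qed
  have "line_extension K v E = (\<lambda>(k, u). k \<otimes> v \<oplus> u) ` (K \<times> E)"
  proof (rule equalityI; rule subsetI)
    fix z assume "z \<in> line_extension K v E"
    then obtain k u where "k \<in> K" "u \<in> E" "z = k \<otimes> v \<oplus> u" unfolding line_extension_mem_iff by blast
    thus "z \<in> (\<lambda>(k, u). k \<otimes> v \<oplus> u) ` (K \<times> E)" by (intro image_eqI[of _ _ "(k, u)"]) auto
  next
    fix z assume "z \<in> (\<lambda>(k, u). k \<otimes> v \<oplus> u) ` (K \<times> E)"
    then obtain k u where "k \<in> K" "u \<in> E" "z = k \<otimes> v \<oplus> u" by auto
    thus "z \<in> line_extension K v E" unfolding line_extension_mem_iff by blast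
  qed
  thus ?case using card_image[OF inj] Suc_dim K(2) by (simp add: card_cartesian_product)
qed auto

lemma (in ring) card_finite_subalgebra:
  assumes K: "subfield K R" "finite K" and E: "subalgebra K E R" "finite E"
  shows "finite_dimension K E" "card E = card K ^ dim K E"
proof -
  obtain Us where Us: "set Us = E" using finite_list[OF E(2)] by blast
  have "E = Span K Us" by (rule Span_subalgebraI[OF K(1) E(1)]) (use Us in auto)
  thus fd: "finite_dimension K E"
    using Span_finite_dimension[OF K(1), of Us] Us subalgebra_in_carrier[OF E(1)] by simp
  show "card E = card K ^ dim K E"
    using card_dimension[OF K finite_dimensionE[OF K(1) fd]] by (simp add: over_def)
qed

lemma type_ring_simps [simp]:
  "carrier type_ring = UNIV" "monoid.mult type_ring = (*)" "ring.add type_ring = (+)"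
  "monoid.one type_ring = 1" "ring.zero type_ring = 0"
  by (auto simp: ring_of_type_algebra_def)

lemma field_type_ring: "field (type_ring :: 'b::field ring)"
  by (rule field_from_type_algebra)

lemma type_ring_uminus: "a_inv (type_ring :: 'b::field ring) z = - z"
proof -
  interpret field "type_ring :: 'b ring" by (rule field_type_ring)
  show ?thesis using add.inv_equality[of "- z" z] by simp
qed

lemma type_ring_inv: "z \<noteq> 0 \<Longrightarrow> m_inv (type_ring :: 'b::field ring) z = inverse z"
proof -
  assume "z \<noteq> 0"
  interpret field "type_ring :: 'b ring" by (rule field_type_ring)
  show ?thesis using \<open>z \<noteq> 0\<close> by (intro comm_inv_char) auto
qed

lemma subfield_type_ring:
  assumes "subring_set S" "\<And>z. z \<in> S \<Longrightarrow> inverse z \<in> (S :: 'b::field set)"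
  shows "subfield S type_ring"
proof -
  interpret field "type_ring :: 'b ring" by (rule field_type_ring)
  show ?thesis
    by (rule subfieldI') (auto intro!: subringI simp: subring_setD[OF assms(1)] type_ring_uminus type_ring_inv assms(2))
qed

lemma card_finite_subspace:
  fixes S E :: "'b::field set"
  assumes "subring_set S" "\<And>z. z \<in> S \<Longrightarrow> inverse z \<in> S" "finite S" "finite E" "0 \<in> E"
    "\<And>u v. u \<in> E \<Longrightarrow> v \<in> E \<Longrightarrow> u + v \<in> E" "\<And>u c. c \<in> S \<Longrightarrow> u \<in> E \<Longrightarrow> c * u \<in> E"
  shows "\<exists>n. card E = card S ^ n"
proof -
  interpret field "type_ring :: 'b ring" by (rule field_type_ring)
  have "- u \<in> E" if "u \<in> E" for u
    using assms(7)[of "- 1" u] subring_setD(2,3)[OF assms(1)] that by simp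
  hence "subgroup E (add_monoid type_ring)" using assms(5,6)
    by (intro add.subgroupI) (auto simp: type_ring_uminus)
  hence "subalgebra S E type_ring" using assms(7) by (intro subalgebra.intro subalgebra_axioms.intro) auto
  thus ?thesis using card_finite_subalgebra(2)[OF subfield_type_ring[OF assms(1,2)] assms(3) _ assms(4)] by blast
qed

lemma card_poly_coeffs:
  fixes A :: "nat \<Rightarrow> 'b::comm_ring_1 set"
  shows "card {P. (\<forall>i<n. poly.coeff P i \<in> A i) \<and> (\<forall>i\<ge>n. poly.coeff P i = 0)} = (\<Prod>i<n. card (A i))"
    (is "card ?S = _")
proof -
  have co: "poly.coeff (\<Sum>i<n. Polynomial.monom (g i) i) j = (if j < n then g j else 0)" for g :: "nat \<Rightarrow> 'b" and j
    by (simp add: coeff_sum)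
  have S: "P \<in> ?S \<longleftrightarrow> (\<forall>i<n. poly.coeff P i \<in> A i) \<and> (\<forall>i\<ge>n. poly.coeff P i = 0)" for P
    by simp
  have "bij_betw (\<lambda>P. restrict (poly.coeff P) {..<n}) ?S (PiE {..<n} A)"
  proof (rule bij_betw_byWitness[where f' = "\<lambda>g. \<Sum>i<n. Polynomial.monom (g i) i"])
    show "\<forall>P\<in>?S. (\<Sum>i<n. Polynomial.monom (restrict (poly.coeff P) {..<n} i) i) = P"
    proof
      fix P assume P: "P \<in> ?S"
      show "(\<Sum>i<n. Polynomial.monom (restrict (poly.coeff P) {..<n} i) i) = P"
      proof (rule poly_eqI)
        fix j
        show "poly.coeff (\<Sum>i<n. Polynomial.monom (restrict (poly.coeff P) {..<n} i) i) j = poly.coeff P j"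
          unfolding co using P[unfolded S] by (cases "j < n") simp_all
      qed
    qed
    show "\<forall>g\<in>PiE {..<n} A. restrict (poly.coeff (\<Sum>i<n. Polynomial.monom (g i) i)) {..<n} = g"
    proof
      fix g assume "g \<in> PiE {..<n} A"
      thus "restrict (poly.coeff (\<Sum>i<n. Polynomial.monom (g i) i)) {..<n} = g"
        by (intro ext) (simp add: co restrict_def PiE_def extensional_def)
    qed
    show "(\<lambda>P. restrict (poly.coeff P) {..<n}) ` ?S \<subseteq> PiE {..<n} A"
    proof (rule image_subsetI)
      fix P assume "P \<in> ?S"
      thus "restrict (poly.coeff P) {..<n} \<in> PiE {..<n} A" unfolding S by (intro restrict_PiE_iff[THEN iffD2]) simp
    qed
    show "(\<lambda>g. \<Sum>i<n. Polynomial.monom (g i) i) ` PiE {..<n} A \<subseteq> ?S"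
    proof (rule image_subsetI)
      fix g assume "g \<in> PiE {..<n} A"
      thus "(\<Sum>i<n. Polynomial.monom (g i) i) \<in> ?S" unfolding S co by auto
    qed
  qed
  from bij_betw_same_card[OF this] show ?thesis by (simp add: card_PiE)
qed

context as_curve
begin

subsection \<open>Residue fields and degrees of places\<close>

definition rep :: "'l set \<Rightarrow> 'a \<times> 'a" where
  "rep V = (SOME ab. pt (fst ab) (snd ab) \<and> V = Vpt (fst ab) (snd ab))"

definition wv :: "'l set \<Rightarrow> 'l \<Rightarrow> int" where
  "wv V = (if V = Vinf then vinf else vpt (fst (rep V)) (snd (rep V)))"

text \<open>A model of the residue map: the congruent constant at \<open>Vinf\<close>, elsewhere the
  value at the representative point. Only its fibres matter, and by \<open>rv_eq_iff\<close> these
  are the residue classes.\<close>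

definition rv :: "'l set \<Rightarrow> 'l \<Rightarrow> 'a" where
  "rv V z = (if V = Vinf then (THE c. c \<in> GF J \<and> z - cst c \<in> mideal Vinf)
     else val (fst (rep V)) (snd (rep V)) z)"

abbreviation "r \<equiv> (2::nat) ^ J"

text \<open>The degree is read off the cardinality of the residue field; the exponent exists by
  \<open>rv_image\<close> and is unique because \<open>r\<close> is at least 2.\<close>

definition dg :: "'l set \<Rightarrow> nat" where
  "dg V = (SOME n. card (rv V ` V) = r ^ n)"

lemma r: "2 \<le> r" using J power_increasing[of 1 J "2::nat"] by simp

lemma rep:
  assumes "tplace V" "V \<noteq> Vinf"
  obtains a b where "rep V = (a, b)" "pt a b" "V = Vpt a b"
proof -
  have "\<exists>ab. pt (fst ab) (snd ab) \<and> V = Vpt (fst ab) (snd ab)" using tplace_cases[OF assms(1)] assms(2) by auto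
  from someI_ex[OF this] have "pt (fst (rep V)) (snd (rep V))" "V = Vpt (fst (rep V)) (snd (rep V))"
    unfolding rep_def by blast+
  thus ?thesis by (rule that[OF prod.collapse[symmetric]])
qed

lemma wv:
  assumes "tplace V"
  shows "dval (wv V)" "V = vring (wv V)"
proof -
  have "dval (wv V) \<and> V = vring (wv V)"
  proof (cases "V = Vinf")
    case True
    hence "wv V = vinf" by (simp add: wv_def)
    thus ?thesis using dval_vinf True by (simp only:)
  next
    case False
    obtain a b where "rep V = (a, b)" "pt a b" "V = Vpt a b" by (rule rep[OF assms False])
    moreover have "wv V = vpt a b" unfolding wv_def \<open>rep V = (a, b)\<close> using False by simp
    ultimately show ?thesis using dval_vpt[of a b] by (simp only:)
  qed
  thus "dval (wv V)" "V = vring (wv V)" by auto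
qed

lemma mideal_wv: "tplace V \<Longrightarrow> mideal V = {z \<in> KL. z = 0 \<or> 0 < wv V z}"
proof -
  assume V: "tplace V"
  have "mideal (vring (wv V)) = {z \<in> KL. z = 0 \<or> 0 < wv V z}" by (rule mideal_vring[OF wv(1)[OF V]])
  thus ?thesis by (simp only: wv(2)[OF V, symmetric])
qed

lemma cst_mideal:
  assumes V: "tplace V" and "c \<in> GF J" "cst c \<in> mideal V"
  shows "c = 0"
proof (rule ccontr)
  assume nz: "c \<noteq> 0"
  have "cst c * cst (inverse c) \<in> mideal V" by (intro mideal_mult[OF V assms(3)] tplaceD(4)[OF V] GF_inverse assms(2))
  moreover have "cst c * cst (inverse c) = 1" unfolding cst_mult[symmetric] using nz cst_1 by simp
  ultimately show False using one_notin_mideal[OF V] by simp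
qed

lemma mideal_diff: "tplace V \<Longrightarrow> z \<in> mideal V \<Longrightarrow> u \<in> mideal V \<Longrightarrow> z - u \<in> mideal V"
  unfolding char2_diff[OF two_l] by (rule mideal_add)

lemma cst_diff: "cst (c - u) = cst c - cst u"
  using rhomD(6)[OF xi, of "[:c:]" "[:u:]"] by simp

lemma rv_inf:
  assumes "z \<in> Vinf"
  shows "rv Vinf z \<in> GF J" "z - cst (rv Vinf z) \<in> mideal Vinf"
proof -
  have K: "z \<in> KL" using assms by (simp add: vring_def)
  have ex: "\<exists>c. c \<in> GF J \<and> z - cst c \<in> mideal Vinf"
  proof (cases "z = 0")
    case True
    thus ?thesis using cst_0 KL_01 GF_0_1 by (intro exI[of _ 0]) (simp add: mideal_vring[OF dval_vinf])
  next
    case False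
    hence "0 \<le> vinf z" using assms by (simp add: vring_def)
    then obtain u where u: "u \<in> GF J" "z = cst u \<or> vinf (z - cst u) > 0" by (rule vinf_residue[OF K False])
    have "z - cst u \<in> KL" by (intro KL_diff K cst_in_KL u)
    thus ?thesis using u by (intro exI[of _ u]) (auto simp: mideal_vring[OF dval_vinf])
  qed
  have uniq: "c = c'" if "c \<in> GF J" "z - cst c \<in> mideal Vinf" "c' \<in> GF J" "z - cst c' \<in> mideal Vinf" for c c'
  proof -
    have "(z - cst c') - (z - cst c) \<in> mideal Vinf" by (intro mideal_diff tplace_Vinf that)
    hence "cst (c - c') \<in> mideal Vinf" by (simp add: cst_diff)
    hence "c - c' = 0" using that by (intro cst_mideal[OF tplace_Vinf] subring_setD(6)[OF sub_k])
    thus ?thesis by simp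
  qed
  obtain c where c: "c \<in> GF J" "z - cst c \<in> mideal Vinf" using ex by blast
  have "(THE c. c \<in> GF J \<and> z - cst c \<in> mideal Vinf) = c"
    by (rule the_equality) (use c uniq in blast)+
  hence "rv Vinf z = c" by (simp only: rv_def if_True simp_thms)
  thus "rv Vinf z \<in> GF J" "z - cst (rv Vinf z) \<in> mideal Vinf" using c by (simp_all only:)
qed

lemma val_eq_iff:
  assumes pt: "pt a b" and "z \<in> Vpt a b" "u \<in> Vpt a b"
  shows "val a b z = val a b u \<longleftrightarrow> z - u \<in> mideal (Vpt a b)"
proof -
  note m = mideal_vring[OF dval_vpt[OF pt]]
  have K: "z \<in> KL" "u \<in> KL" using assms(2,3) unfolding vring_def by blast+
  have dK: "z - u \<in> KL" by (rule KL_diff[OF K])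
  have d: "z - u \<in> Vpt a b" by (rule subring_setD(6)[OF tplaceD(1)[OF tplace_Vpt[OF pt]] assms(2,3)])
  have "val a b (u + (z - u)) = val a b u + val a b (z - u)" by (rule val_add[OF pt K(2) dK])
  moreover have "u + (z - u) = z" by simp
  ultimately have "val a b z = val a b u \<longleftrightarrow> val a b (z - u) = 0" by (simp only: add_cancel_left_right)
  also have "\<dots> \<longleftrightarrow> z - u \<in> mideal (Vpt a b)"
  proof (cases "z - u = 0")
    case True
    have "val a b (E 0) = pev a b 0" by (rule val_E[OF pt subring_setD(1)[OF sub_kXY]])
    hence "val a b 0 = 0" by (simp only: rhomD(4)[OF RE] rhomD(4)[OF hom_pev])
    moreover have "0 \<in> mideal (Vpt a b)" unfolding m using KL_01(1) by blast
    ultimately show ?thesis unfolding True by blast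
  next
    case nz: False
    have "0 \<le> vpt a b (z - u)" using d nz unfolding vring_def by blast
    from val_eq_0_iff[OF pt dK nz this] show ?thesis unfolding m using dK nz by blast
  qed
  finally show ?thesis .
qed

lemma rv_eq_iff:
  assumes V: "tplace V" and zu: "z \<in> V" "u \<in> V"
  shows "rv V z = rv V u \<longleftrightarrow> z - u \<in> mideal V"
proof (cases "V = Vinf")
  case True
  note z = rv_inf[OF zu(1)[unfolded True]] and u = rv_inf[OF zu(2)[unfolded True]]
  define A where "A = (z - cst (rv Vinf z)) - (u - cst (rv Vinf u))"
  have A: "A \<in> mideal Vinf" unfolding A_def by (rule mideal_diff[OF tplace_Vinf z(2) u(2)])
  have eq: "cst (rv Vinf z - rv Vinf u) = (z - u) - A" unfolding A_def cst_diff by (simp add: algebra_simps)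
  show ?thesis unfolding True
  proof
    assume "rv Vinf z = rv Vinf u"
    hence "cst (rv Vinf z - rv Vinf u) = 0" using cst_0 by simp
    hence "z - u = A" using eq by simp
    thus "z - u \<in> mideal Vinf" using A by (simp only:)
  next
    assume "z - u \<in> mideal Vinf"
    from mideal_diff[OF tplace_Vinf this A] have "cst (rv Vinf z - rv Vinf u) \<in> mideal Vinf" unfolding eq .
    from cst_mideal[OF tplace_Vinf subring_setD(6)[OF sub_k z(1) u(1)] this]
    show "rv Vinf z = rv Vinf u" by simp
  qed
next
  case False
  obtain a b where ab: "rep V = (a, b)" "pt a b" "V = Vpt a b" by (rule rep[OF V False])
  have "rv V w = val a b w" for w using False unfolding rv_def ab(1) by simp
  thus ?thesis using val_eq_iff[OF ab(2)] zu ab(3) by (metis (no_types))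
qed

lemma val_cst:
  assumes "pt a b" "c \<in> GF J"
  shows "val a b (cst c) = c"
  using val_E[OF assms(1) const_in_coeffs_in[OF sub_kX const_in_coeffs_in[OF sub_k assms(2)]]]
  unfolding eval2_const[OF xi] pev_const by simp

lemma card_GF_J: "card (GF J) = r" "finite (GF J)"
  using card_GF[OF J(1)] finite_GF[OF J(1)] by blast+

lemma rv_inf_image: "rv Vinf ` Vinf = GF J"
proof
  show "rv Vinf ` Vinf \<subseteq> GF J" using rv_inf(1) by blast
  show "GF J \<subseteq> rv Vinf ` Vinf"
  proof
    fix c assume c: "c \<in> GF J"
    have cV: "cst c \<in> Vinf" by (rule tplaceD(4)[OF tplace_Vinf c])
    have "cst (c - rv Vinf (cst c)) \<in> mideal Vinf" unfolding cst_diff by (rule rv_inf(2)[OF cV])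
    hence "c - rv Vinf (cst c) = 0" by (intro cst_mideal[OF tplace_Vinf] subring_setD(6)[OF sub_k] c rv_inf(1) cV)
    thus "c \<in> rv Vinf ` Vinf" using cV by (intro image_eqI[of _ _ "cst c"]) auto
  qed
qed

lemma rv_image:
  assumes V: "tplace V"
  shows "finite (rv V ` V)" "card (rv V ` V) = r ^ dg V"
proof -
  have "finite (rv V ` V) \<and> (\<exists>n. card (rv V ` V) = r ^ n)"
  proof (cases "V = Vinf")
    case True
    thus ?thesis using rv_inf_image card_GF_J by (auto intro!: exI[of _ 1])
  next
    case False
    obtain a b where ab: "rep V = (a, b)" "pt a b" "V = Vpt a b" by (rule rep[OF V False])
    have rv: "rv V = val a b" using False by (auto simp: rv_def ab(1) fun_eq_iff)
    obtain n1 where n1: "0 < n1" "a \<in> GF (J * n1)" by (rule common_GF)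
    obtain n2 where n2: "0 < n2" "b \<in> GF (J * n2)" by (rule common_GF)
    let ?k = "J * (n1 * n2)"
    have "J * n1 dvd ?k" "J * n2 dvd ?k" by (simp_all add: mult.left_commute)
    hence ab_k: "a \<in> GF ?k" "b \<in> GF ?k" using n1(2) n2(2) GF_mono by blast+
    have "val a b ` V \<subseteq> GF ?k"
    proof (rule image_subsetI)
      fix z assume "z \<in> V"
      hence "z \<in> Vpt a b" using ab(3) by (simp only:)
      thus "val a b z \<in> GF ?k" by (rule val_in_GF[OF ab(2) _ ab_k dvd_triv_left])
    qed
    moreover have "0 < ?k" using J(1) n1(1) n2(1) by simp
    ultimately have fin: "finite (val a b ` V)" using finite_subset[OF _ finite_GF] by blast
    note R = subring_setD[OF tplaceD(1)[OF V]]
    have reg: "z \<in> KL" "z = 0 \<or> 0 \<le> vpt a b z" if "z \<in> V" for z using that unfolding ab(3) by (auto simp: vring_def)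
    have "\<exists>n. card (val a b ` V) = card (GF J) ^ n"
    proof (rule card_finite_subspace[OF sub_k GF_inverse card_GF_J(2) fin])
      show "0 \<in> val a b ` V"
        using val_cst[OF ab(2) GF_0_1(1)] tplaceD(4)[OF V GF_0_1(1)] by (intro image_eqI[of _ _ "cst 0"]) auto
      show "u + v \<in> val a b ` V" if uv: "u \<in> val a b ` V" "v \<in> val a b ` V" for u v
      proof -
        obtain z w where "u = val a b z" "v = val a b w" "z \<in> V" "w \<in> V" using uv by auto
        thus ?thesis using val_add[OF ab(2) reg(1) reg(1), of z w] R(4)[of z w] by (intro image_eqI[of _ _ "z + w"]) auto
      qed
      show "c * u \<in> val a b ` V" if cu: "c \<in> GF J" "u \<in> val a b ` V" for u c
      proof -
        obtain z where "u = val a b z" "z \<in> V" using cu by auto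
        moreover have cV: "cst c \<in> V" by (rule tplaceD(4)[OF V cu(1)])
        ultimately show ?thesis
          using val_mult[OF ab(2) reg(1) reg(1) reg(2) reg(2), of "cst c" z] R(5)[of "cst c" z] val_cst[OF ab(2) cu(1)]
          by (intro image_eqI[of _ _ "cst c * z"]) auto
      qed
    qed
    thus ?thesis using fin rv card_GF_J by simp
  qed
  thus "finite (rv V ` V)" "card (rv V ` V) = r ^ dg V" unfolding dg_def by (auto intro: someI_ex)
qed

lemma r_power_eq: "r ^ i = r ^ j \<longleftrightarrow> i = j" using r by (auto intro: power_inject_exp[THEN iffD1])

lemma dg_Vinf: "dg Vinf = 1"
  using rv_image(2)[OF tplace_Vinf] rv_inf_image card_GF_J r_power_eq[of "dg Vinf" 1] by simp

text \<open>The point (a, b) need not be the one chosen in \<open>rep\<close>, but both value maps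
  have the residue classes as fibres, so their images have equal size. All values at (a, b) lie in
  \<open>GF (J * j)\<close>.\<close>

lemma dg_le:
  assumes "pt a b" "0 < j" "a \<in> GF (J * j)" "b \<in> GF (J * j)"
  shows "dg (Vpt a b) \<le> j"
proof -
  let ?V = "Vpt a b"
  note V = tplace_Vpt[OF assms(1)]
  have "card (rv ?V ` ?V) = card (val a b ` ?V)"
  proof (rule bij_betw_same_card)
    have iff: "val a b z = val a b u \<longleftrightarrow> rv ?V z = rv ?V u" if zu: "z \<in> ?V" "u \<in> ?V" for z u
      unfolding rv_eq_iff[OF V zu] by (rule val_eq_iff[OF assms(1) zu])
    show "bij_betw (\<lambda>c. val a b (SOME z. z \<in> ?V \<and> rv ?V z = c)) (rv ?V ` ?V) (val a b ` ?V)"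
    proof -
      have some: "(SOME z. z \<in> ?V \<and> rv ?V z = rv ?V u) \<in> ?V" "rv ?V (SOME z. z \<in> ?V \<and> rv ?V z = rv ?V u) = rv ?V u"
        if "u \<in> ?V" for u
        using someI_ex[of "\<lambda>z. z \<in> ?V \<and> rv ?V z = rv ?V u"] that by blast+
      have eq: "val a b (SOME z. z \<in> ?V \<and> rv ?V z = rv ?V u) = val a b u" if "u \<in> ?V" for u
        using iff[OF some(1)[OF that] that] some(2)[OF that] by blast
      show ?thesis
        unfolding bij_betw_def
      proof
        show "inj_on (\<lambda>c. val a b (SOME z. z \<in> ?V \<and> rv ?V z = c)) (rv ?V ` ?V)"
          using eq iff by (auto simp: inj_on_def)
        show "(\<lambda>c. val a b (SOME z. z \<in> ?V \<and> rv ?V z = c)) ` rv ?V ` ?V = val a b ` ?V"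
          unfolding image_image using eq by (intro image_cong) auto
      qed
    qed
  qed
  also have "val a b ` ?V \<subseteq> GF (J * j)" using val_in_GF[OF assms(1) _ assms(3,4)] by auto
  hence "card (val a b ` ?V) \<le> card (GF (J * j))" using J assms(2) by (intro card_mono finite_GF) auto
  also have "\<dots> = r ^ j" using card_GF[of "J * j"] J assms(2) by (simp add: power_mult)
  finally have "r ^ dg ?V \<le> r ^ j" using rv_image(2)[OF V] by simp
  thus ?thesis using r by (subst (asm) power_increasing_iff) auto
qed


text \<open>A place of degree n accounts for at least n points, the conjugates of one of them under
  powers of exponent r^j: if two of the first n coincided, the coordinates would lie in a field too
  small for the degree, by \<open>dg_le\<close>. For the places in \<open>TN\<close> all these
  points lie above \<open>GF (J * N)\<close>.\<close>

lemma sum_dg_le: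
  assumes N: "0 < N"
  defines "TN \<equiv> {V. tplace V \<and> V \<noteq> Vinf \<and> \<xi> (PR N) \<in> mideal V}"
  shows "finite TN" "(\<Sum>V\<in>TN. dg V) \<le> p * 2 ^ (J * N)"
proof -
  define Z where "Z = {(a, b). pt a b \<and> a \<in> GF (J * N)}"
  have finZ: "finite Z" and cardZ: "card Z = p * 2 ^ (J * N)"
    unfolding Z_def by (rule finite_points[OF N] card_points_le[OF N])+
  have PR: "\<xi> (PR N) \<in> mideal (Vpt a b) \<longleftrightarrow> a \<in> GF (J * N)" if "pt a b" for a b
    using mideal_Vpt_E[OF that const_in_coeffs_in[OF sub_kX PR_in[of N]]] unfolding eval2_const[OF xi] pev_const poly_PR .
  have fibre: "dg V \<le> card {ab \<in> Z. Vpt (fst ab) (snd ab) = V}" and ne: "V \<in> (\<lambda>ab. Vpt (fst ab) (snd ab)) ` Z"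
    if V: "V \<in> TN" for V
  proof -
    obtain a b where ab: "pt a b" "V = Vpt a b" using tplace_cases[of V] V unfolding TN_def mem_Collect_eq by blast
    have "\<xi> (PR N) \<in> mideal V" using V unfolding TN_def by blast
    hence aN: "a \<in> GF (J * N)" unfolding ab(2) PR[OF ab(1)] .
    have inZ: "(c, d) \<in> Z \<longleftrightarrow> pt c d \<and> c \<in> GF (J * N)" for c d unfolding Z_def by blast
    have "(a, b) \<in> Z" unfolding inZ using ab(1) aN by (rule conjI)
    thus "V \<in> (\<lambda>ab. Vpt (fst ab) (snd ab)) ` Z" by (rule image_eqI[rotated]) (simp only: ab(2) fst_conv snd_conv)
    define g where "g j = (a ^ (2 ^ (J * j)), b ^ (2 ^ (J * j)))" for j
    have "g ` {..<dg V} \<subseteq> {ab \<in> Z. Vpt (fst ab) (snd ab) = V}"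
    proof (rule image_subsetI)
      fix j
      have "g j \<in> Z" unfolding g_def inZ using Vpt_frobenius(1)[OF ab(1)] GF_power[OF aN] by (rule conjI)
      moreover have "Vpt (fst (g j)) (snd (g j)) = V" unfolding g_def fst_conv snd_conv ab(2) by (rule Vpt_frobenius(2)[OF ab(1)])
      ultimately show "g j \<in> {ab \<in> Z. Vpt (fst ab) (snd ab) = V}" by blast
    qed
    moreover have "inj_on g {..<dg V}"
    proof (rule linorder_inj_onI')
      fix i j assume ij: "i \<in> {..<dg V}" "j \<in> {..<dg V}" "i < j"
      show "g i \<noteq> g j"
      proof
        assume eq: "g i = g j"
        have *: "u \<in> GF (J * (j - i))" if "u ^ (2 ^ (J * i)) = u ^ (2 ^ (J * j))" for u :: 'a
        proof -
          have "J * j = J * (j - i) + J * i" using ij(3) by (simp flip: distrib_left)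
          hence "u ^ (2 ^ (J * j)) = (u ^ (2 ^ (J * (j - i)))) ^ (2 ^ (J * i))"
            by (simp add: power_add flip: power_mult)
          hence "u = u ^ (2 ^ (J * (j - i)))" using that by (intro frob_inj[of u "J * i"]) simp
          thus ?thesis by simp
        qed
        have "a \<in> GF (J * (j - i))" "b \<in> GF (J * (j - i))" using eq unfolding g_def prod.inject by (intro *; blast)+
        hence "dg V \<le> j - i" unfolding ab(2) using ij(3) by (intro dg_le[OF ab(1)]; simp)
        thus False using ij by auto
      qed
    qed
    ultimately have "card {..<dg V} \<le> card {ab \<in> Z. Vpt (fst ab) (snd ab) = V}"
      using finZ by (intro card_inj_on_le) auto
    thus "dg V \<le> card {ab \<in> Z. Vpt (fst ab) (snd ab) = V}" by simp
  qed
  show fin: "finite TN" by (rule finite_subset[OF subsetI finite_imageI[OF finZ]]) (erule ne)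
  have "(\<Sum>V\<in>TN. dg V) \<le> (\<Sum>V\<in>TN. card {ab \<in> Z. Vpt (fst ab) (snd ab) = V})"
    by (intro sum_mono fibre)
  also have "\<dots> = card (\<Union>V\<in>TN. {ab \<in> Z. Vpt (fst ab) (snd ab) = V})"
  proof (rule card_UN_disjoint[symmetric, OF fin])
    show "\<forall>V\<in>TN. finite {ab \<in> Z. Vpt (fst ab) (snd ab) = V}" by (intro ballI finite_subset[OF _ finZ]) blast
    show "\<forall>V\<in>TN. \<forall>W\<in>TN. V \<noteq> W \<longrightarrow> {ab \<in> Z. Vpt (fst ab) (snd ab) = V} \<inter> {ab \<in> Z. Vpt (fst ab) (snd ab) = W} = {}" by blast
  qed
  also have "\<dots> \<le> card Z" by (rule card_mono[OF finZ]) blast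
  finally show "(\<Sum>V\<in>TN. dg V) \<le> p * 2 ^ (J * N)" unfolding cardZ .
qed

subsection \<open>Rational places\<close>

text \<open>x - a and y - b have coefficients in \<open>GF J\<close> and vanish at (a, b), so they
  vanish at any point giving the same place.\<close>

lemma Vpt_inj:
  assumes "pt a b" "pt a' b'" "a \<in> GF J" "b \<in> GF J" "Vpt a b = Vpt a' b'"
  shows "a' = a \<and> b' = b"
proof -
  have kk: "[:[:c:]:] \<in> kXY" if "c \<in> GF J" for c by (intro const_in_coeffs_in sub_kX sub_k that)
  have "pev a b ([:[:0, 1:]:] - [:[:a:]:]) = 0" "pev a b (Polynomial.monom 1 1 - [:[:b:]:]) = 0"
    unfolding rhomD[OF hom_pev] pev_const pev_y by simp_all
  moreover have in1: "[:[:0, 1:]:] - [:[:a:]:] \<in> kXY" and in2: "Polynomial.monom 1 1 - [:[:b:]:] \<in> kXY"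
    using assms by (intro subring_setD(6)[OF sub_kXY] kk const_in_coeffs_in[OF sub_kX x_in_kX] y_in_kXY; simp)+
  ultimately have "E ([:[:0, 1:]:] - [:[:a:]:]) \<in> mideal (Vpt a' b')" "E (Polynomial.monom 1 1 - [:[:b:]:]) \<in> mideal (Vpt a' b')"
    using mideal_Vpt_E[OF assms(1)] unfolding assms(5) by blast+
  hence "pev a' b' ([:[:0, 1:]:] - [:[:a:]:]) = 0" "pev a' b' (Polynomial.monom 1 1 - [:[:b:]:]) = 0"
    using mideal_Vpt_E[OF assms(2)] in1 in2 by blast+
  thus ?thesis unfolding rhomD[OF hom_pev] pev_const pev_y by simp
qed

text \<open>Degree 1 means that all values lie in \<open>GF J\<close>, and the coordinates of the
  representative point are themselves the values of x and y.\<close>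

lemma dg_1_iff:
  assumes "tplace V"
  shows "dg V = 1 \<longleftrightarrow> V = Vinf \<or> (\<exists>a b. pt a b \<and> a \<in> GF J \<and> b \<in> GF J \<and> V = Vpt a b)"
proof
  assume "V = Vinf \<or> (\<exists>a b. pt a b \<and> a \<in> GF J \<and> b \<in> GF J \<and> V = Vpt a b)"
  thus "dg V = 1"
  proof
    assume "\<exists>a b. pt a b \<and> a \<in> GF J \<and> b \<in> GF J \<and> V = Vpt a b"
    then obtain a b where "pt a b" "a \<in> GF J" "b \<in> GF J" "V = Vpt a b" by blast
    hence "dg V \<le> 1" using dg_le[of a b 1] by simp
    moreover have "dg V \<noteq> 0"
    proof
      assume "dg V = 0"
      hence "card (rv V ` V) = 1" using rv_image(2)[OF assms] by simp
      then obtain c where c: "rv V ` V = {c}" by (auto simp: card_1_singleton_iff)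
      have "0 \<in> V" "1 \<in> V" using subring_setD(1,2)[OF tplaceD(1)[OF assms]] by auto
      hence "rv V 1 \<in> {c}" "rv V 0 \<in> {c}" unfolding c[symmetric] by blast+
      hence "rv V 1 = rv V 0" by simp
      hence "1 - 0 \<in> mideal V" using rv_eq_iff[OF assms \<open>1 \<in> V\<close> \<open>0 \<in> V\<close>] by blast
      thus False using one_notin_mideal[OF assms] by simp
    qed
    ultimately show ?thesis by simp
  qed (simp add: dg_Vinf)
next
  assume 1: "dg V = 1"
  show "V = Vinf \<or> (\<exists>a b. pt a b \<and> a \<in> GF J \<and> b \<in> GF J \<and> V = Vpt a b)"
  proof (cases "V = Vinf")
    case False
    obtain a b where ab: "rep V = (a, b)" "pt a b" "V = Vpt a b" by (rule rep[OF assms False])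
    have rv: "rv V = val a b" using False by (auto simp: rv_def ab(1) fun_eq_iff)
    have "GF J \<subseteq> rv V ` V"
    proof
      fix c assume c: "c \<in> GF J"
      show "c \<in> rv V ` V" unfolding rv
        using val_cst[OF ab(2) c] tplaceD(4)[OF assms c] by (intro image_eqI[of _ _ "cst c"]) auto
    qed
    moreover have "card (rv V ` V) = card (GF J)" using rv_image(2)[OF assms] 1 card_GF_J by simp
    ultimately have eq: "rv V ` V = GF J" by (metis card_subset_eq[OF rv_image(1)[OF assms]])
    have valJ: "val a b (E G) \<in> GF J" if "G \<in> kXY" for G
    proof -
      have "x \<in> V" unfolding ab(3) by (rule x_in_Vpt[OF ab(2)])
      from O_subset[OF assms this that] have "val a b (E G) \<in> rv V ` V" unfolding rv by (rule imageI)
      thus ?thesis unfolding eq .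
    qed
    have pev: "pev a b G \<in> GF J" if "G \<in> kXY" for G using val_E[OF ab(2) that] valJ[OF that] by (simp only:)
    have "a \<in> GF J" using pev[OF const_in_coeffs_in[OF sub_kX x_in_kX]] unfolding pev_const by simp
    moreover have "b \<in> GF J" using pev[OF y_in_kXY] unfolding pev_y .
    ultimately show ?thesis using ab by blast
  qed simp
qed

lemma card_rational_places:
  "card {V. tplace V \<and> dg V = 1} = 1 + card {(a, b). a \<in> GF J \<and> b \<in> GF J \<and> b ^ p + b = poly f a}"
proof -
  define A where "A = {(a, b). a \<in> GF J \<and> b \<in> GF J \<and> b ^ p + b = poly f a}"
  have fin: "finite A" by (rule finite_subset[OF _ finite_cartesian_product[OF card_GF_J(2) card_GF_J(2)]]) (auto simp: A_def)
  have A: "pt a b \<and> a \<in> GF J \<and> b \<in> GF J \<longleftrightarrow> (a, b) \<in> A" for a b by (auto simp: A_def pt_def)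
  have "{V. tplace V \<and> dg V = 1} = insert Vinf ((\<lambda>(a, b). Vpt a b) ` A)"
  proof (rule equalityI; rule subsetI)
    fix V assume "V \<in> {V. tplace V \<and> dg V = 1}"
    thus "V \<in> insert Vinf ((\<lambda>(a, b). Vpt a b) ` A)" using dg_1_iff[of V] A unfolding image_iff mem_Collect_eq insert_iff by (metis (no_types, lifting) prod.case)
  next
    fix V assume "V \<in> insert Vinf ((\<lambda>(a, b). Vpt a b) ` A)"
    then consider "V = Vinf" | a b where "(a, b) \<in> A" "V = Vpt a b" by auto
    thus "V \<in> {V. tplace V \<and> dg V = 1}"
    proof cases
      case 2
      thus ?thesis using A dg_1_iff[of V] tplace_Vpt[of a b] by blast
    qed (use tplace_Vinf dg_Vinf in simp)
  qed
  moreover have "inj_on (\<lambda>(a, b). Vpt a b) A"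
  proof (rule inj_onI)
    fix u v assume uv: "u \<in> A" "v \<in> A" and eq: "(\<lambda>(a, b). Vpt a b) u = (\<lambda>(a, b). Vpt a b) v"
    obtain a b a' b' where "u = (a, b)" "v = (a', b')" by (cases u; cases v)
    thus "u = v" using uv eq A[of a b] A[of a' b'] Vpt_inj[of a b a' b'] by (simp only: prod.case simp_thms prod.inject)
  qed
  moreover have "Vinf \<notin> (\<lambda>(a, b). Vpt a b) ` A"
  proof
    assume "Vinf \<in> (\<lambda>(a, b). Vpt a b) ` A"
    then obtain a b where ab: "Vinf = Vpt a b" "(a, b) \<in> A" by (elim imageE) (simp split: prod.splits)
    hence "pt a b" using A by blast
    from x_in_Vpt[OF this] show False using x_notin_Vinf unfolding ab(1) by (rule notE[rotated])
  qed
  ultimately have "card {V. tplace V \<and> dg V = 1} = Suc (card A)"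
    using card_insert_disjoint[OF finite_imageI[OF fin]] card_image by (metis (no_types, lifting))
  thus ?thesis unfolding A_def by simp
qed


subsection \<open>Riemann--Roch spaces\<close>

definition RR :: "('l set \<Rightarrow> int) \<Rightarrow> 'l set" where
  "RR D = {z \<in> KL. z \<noteq> 0 \<longrightarrow> (\<forall>V. tplace V \<longrightarrow> - D V \<le> wv V z)}"

definition ddeg :: "('l set \<Rightarrow> int) \<Rightarrow> int" where
  "ddeg D = (\<Sum>V | D V \<noteq> 0. D V * int (dg V))"

lemma RR_D: "z \<in> RR D \<Longrightarrow> z \<in> KL" "z \<in> RR D \<Longrightarrow> z \<noteq> 0 \<Longrightarrow> tplace V \<Longrightarrow> - D V \<le> wv V z"
  unfolding RR_def by blast+

lemma RR_I: "z \<in> KL \<Longrightarrow> (\<And>V. z \<noteq> 0 \<Longrightarrow> tplace V \<Longrightarrow> - D V \<le> wv V z) \<Longrightarrow> z \<in> RR D"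
  unfolding RR_def by blast

lemma RR_mono:
  assumes "\<And>V. tplace V \<Longrightarrow> D V \<le> D' V"
  shows "RR D \<subseteq> RR D'"
proof
  fix z assume z: "z \<in> RR D"
  show "z \<in> RR D'"
  proof (rule RR_I)
    fix V assume V: "z \<noteq> 0" "tplace V"
    show "- D' V \<le> wv V z" using RR_D(2)[OF z V] assms[OF V(2)] by linarith
  qed (rule RR_D(1)[OF z])
qed

lemma wv_mult: "tplace V \<Longrightarrow> z \<in> KL \<Longrightarrow> u \<in> KL \<Longrightarrow> z \<noteq> 0 \<Longrightarrow> u \<noteq> 0 \<Longrightarrow> wv V (z * u) = wv V z + wv V u"
  by (rule dval_mult[OF wv(1)])

lemma wv_add: "tplace V \<Longrightarrow> z \<in> KL \<Longrightarrow> u \<in> KL \<Longrightarrow> z \<noteq> 0 \<Longrightarrow> u \<noteq> 0 \<Longrightarrow> z + u \<noteq> 0 \<Longrightarrow>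
    min (wv V z) (wv V u) \<le> wv V (z + u)"
  using wv(1)[of V] unfolding dval_def by blast

lemma wv_exists:
  assumes "tplace V"
  shows "\<exists>s\<in>KL - {0}. wv V s = n"
proof -
  obtain t where t: "t \<in> KL" "t \<noteq> 0" "wv V t = 1" using wv(1)[OF assms] unfolding dval_def by blast
  show ?thesis
  proof (cases "0 \<le> n")
    case True
    have "wv V (t ^ nat n) = n" using dval_power[OF wv(1)[OF assms] t(1,2), of "nat n"] True t(3) by simp
    thus ?thesis using t KL_power[OF t(1)] by (intro bexI[of _ "t ^ nat n"]) auto
  next
    case False
    have "wv V (inverse t ^ nat (- n)) = n"
      using dval_power[OF wv(1)[OF assms] KL_inverse[OF t(1)], of "nat (- n)"] dval_inverse[OF wv(1)[OF assms] t(1,2)] False t(2,3) by simp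
    thus ?thesis using t KL_power[OF KL_inverse[OF t(1)]] by (intro bexI[of _ "inverse t ^ nat (- n)"]) auto
  qed
qed

lemma wv_nonneg_iff: "tplace V \<Longrightarrow> z \<in> KL \<Longrightarrow> z \<noteq> 0 \<Longrightarrow> z \<in> V \<longleftrightarrow> 0 \<le> wv V z"
proof -
  assume V: "tplace V" and z: "z \<in> KL" "z \<noteq> 0"
  have "z \<in> vring (wv V) \<longleftrightarrow> 0 \<le> wv V z" unfolding vring_def using z by blast
  thus ?thesis by (simp only: wv(2)[OF V, symmetric])
qed

lemma RR_diff:
  assumes "z \<in> RR D" "u \<in> RR D"
  shows "z - u \<in> RR D"
  unfolding char2_diff[OF two_l]
proof (cases "z = 0 \<or> u = 0")
  case True
  thus "z + u \<in> RR D" using assms by auto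
next
  case False
  show "z + u \<in> RR D"
  proof (rule RR_I)
    fix V assume V: "z + u \<noteq> 0" "tplace V"
    have "min (wv V z) (wv V u) \<le> wv V (z + u)" using False V by (intro wv_add RR_D(1)[OF assms(1)] RR_D(1)[OF assms(2)]) auto
    moreover have "- D V \<le> wv V z" "- D V \<le> wv V u" using RR_D(2)[OF assms(1)] RR_D(2)[OF assms(2)] False V by auto
    ultimately show "- D V \<le> wv V (z + u)" by linarith
  qed (intro KL_add RR_D(1)[OF assms(1)] RR_D(1)[OF assms(2)])
qed

lemma card_le_fibres:
  assumes "finite B" "\<And>z. z \<in> A \<Longrightarrow> \<psi> z \<in> B" "\<And>c. c \<in> B \<Longrightarrow> finite {z \<in> A. \<psi> z = c} \<and> card {z \<in> A. \<psi> z = c} \<le> n"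
  shows "finite A \<and> card A \<le> n * card B"
proof -
  have A: "A = (\<Union>c\<in>B. {z \<in> A. \<psi> z = c})" using assms(2) by blast
  have "finite A" by (subst A) (use assms(1,3) in blast)
  moreover have "card A \<le> (\<Sum>c\<in>B. card {z \<in> A. \<psi> z = c})" by (subst A) (rule card_UN_le[OF assms(1)])
  moreover have "(\<Sum>c\<in>B. card {z \<in> A. \<psi> z = c}) \<le> (\<Sum>c\<in>B. n)" by (intro sum_mono) (use assms(3) in blast)
  ultimately show ?thesis by (simp add: mult.commute)
qed

text \<open>Multiplication by \<open>s\<close>, of order D V0 + 1 at \<open>V0\<close>, makes the
  members of the larger space regular there, and two with the same residue differ by a member of the
  smaller space. So the cardinality grows at most by the size of the residue field.\<close>

lemma RR_step:
  assumes V0: "tplace V0" and fin: "finite (RR D)"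
  shows "finite (RR (D(V0 := D V0 + 1))) \<and> card (RR (D(V0 := D V0 + 1))) \<le> card (RR D) * r ^ dg V0"
proof -
  define D' where "D' = D(V0 := D V0 + 1)"
  obtain s where s: "s \<in> KL" "s \<noteq> 0" "wv V0 s = D V0 + 1" using wv_exists[OF V0] by blast
  have zs: "z * s \<in> V0" if z: "z \<in> RR D'" for z
  proof (cases "z = 0")
    case True
    thus ?thesis using subring_setD(1)[OF tplaceD(1)[OF V0]] by simp
  next
    case False
    have "- D' V0 \<le> wv V0 z" by (rule RR_D(2)[OF z False V0])
    hence "0 \<le> wv V0 (z * s)" using wv_mult[OF V0 RR_D(1)[OF z] s(1) False s(2)] s(3) by (simp add: D'_def)
    thus ?thesis using wv_nonneg_iff[OF V0 KL_mult[OF RR_D(1)[OF z] s(1)]] False s(2) by simp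
  qed
  have diff: "z - u \<in> RR D" if z: "z \<in> RR D'" and u: "u \<in> RR D'" and eq: "rv V0 (z * s) = rv V0 (u * s)" for z u
  proof (rule RR_I)
    have d: "z - u \<in> RR D'" by (rule RR_diff[OF z u])
    show K: "z - u \<in> KL" by (rule RR_D(1)[OF d])
    fix V assume nz: "z - u \<noteq> 0" and V: "tplace V"
    show "- D V \<le> wv V (z - u)"
    proof (cases "V = V0")
      case True
      have "z * s - u * s \<in> mideal V0" using rv_eq_iff[OF V0 zs[OF z] zs[OF u]] eq by blast
      hence "(z - u) * s \<in> mideal V0" by (simp only: left_diff_distrib)
      hence "0 < wv V0 ((z - u) * s)" unfolding mideal_wv[OF V0] using nz s(2) by (simp only: mem_Collect_eq mult_eq_0_iff) blast
      thus ?thesis using wv_mult[OF V0 K s(1) nz s(2)] s(3) unfolding True by linarith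
    next
      case False
      thus ?thesis using RR_D(2)[OF d nz V] by (simp add: D'_def)
    qed
  qed
  have "finite (RR D') \<and> card (RR D') \<le> card (RR D) * card (rv V0 ` V0)"
  proof (rule card_le_fibres[where \<psi> = "\<lambda>z. rv V0 (z * s)"])
    show "finite (rv V0 ` V0)" by (rule rv_image(1)[OF V0])
    show "rv V0 (z * s) \<in> rv V0 ` V0" if "z \<in> RR D'" for z by (rule imageI[OF zs[OF that]])
    fix c
    show "finite {z \<in> RR D'. rv V0 (z * s) = c} \<and> card {z \<in> RR D'. rv V0 (z * s) = c} \<le> card (RR D)"
    proof (cases "{z \<in> RR D'. rv V0 (z * s) = c} = {}")
      case False
      then obtain u where u: "u \<in> RR D'" "rv V0 (u * s) = c" by blast
      have "{z \<in> RR D'. rv V0 (z * s) = c} \<subseteq> (\<lambda>v. v + u) ` RR D"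
      proof
        fix z assume "z \<in> {z \<in> RR D'. rv V0 (z * s) = c}"
        hence "z - u \<in> RR D" using u by (intro diff) auto
        thus "z \<in> (\<lambda>v. v + u) ` RR D" by (rule image_eqI[rotated]) simp
      qed
      from finite_subset[OF this finite_imageI[OF fin]] card_mono[OF finite_imageI[OF fin] this] card_image_le[OF fin, of "\<lambda>v. v + u"]
      show ?thesis by linarith
    qed (simp only: finite.emptyI card.empty le0 simp_thms)
  qed
  thus ?thesis unfolding D'_def rv_image(2)[OF V0] .
qed

lemma RR_steps:
  assumes V0: "tplace V0" and fin: "finite (RR D)"
  shows "finite (RR (D(V0 := D V0 + int k))) \<and> card (RR (D(V0 := D V0 + int k))) \<le> card (RR D) * r ^ (k * dg V0)"
proof (induction k)
  case (Suc k)
  let ?D = "D(V0 := D V0 + int k)"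
  have eq: "?D(V0 := ?D V0 + 1) = D(V0 := D V0 + int (Suc k))" by auto
  have "finite (RR (?D(V0 := ?D V0 + 1))) \<and> card (RR (?D(V0 := ?D V0 + 1))) \<le> card (RR ?D) * r ^ dg V0"
    using Suc by (intro RR_step[OF V0]) blast
  moreover have "card (RR ?D) * r ^ dg V0 \<le> card (RR D) * r ^ (k * dg V0) * r ^ dg V0"
    by (rule mult_right_mono[OF conjunct2[OF Suc] le0])
  moreover have "card (RR D) * r ^ (k * dg V0) * r ^ dg V0 = card (RR D) * r ^ (Suc k * dg V0)"
    unfolding mult.assoc power_add[symmetric] by (simp only: mult_Suc add.commute)
  ultimately show ?case unfolding eq by linarith
qed (use fin in simp)

lemma RR_card_le:
  assumes "finite S" "\<And>V. V \<in> S \<Longrightarrow> tplace V" "finite (RR D)" "\<And>V. V \<in> S \<Longrightarrow> D V \<le> D' V" "\<And>V. V \<notin> S \<Longrightarrow> D V = D' V"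
  shows "finite (RR D') \<and> card (RR D') \<le> card (RR D) * r ^ (\<Sum>V\<in>S. nat (D' V - D V) * dg V)"
  using assms
proof (induction S arbitrary: D' rule: finite_induct)
  case empty
  hence eq: "D' = D" by auto
  show ?case unfolding eq using empty.prems(2) by simp
next
  case (insert V0 S)
  define D1 where "D1 = D'(V0 := D V0)"
  have IH: "finite (RR D1) \<and> card (RR D1) \<le> card (RR D) * r ^ (\<Sum>V\<in>S. nat (D1 V - D V) * dg V)"
  proof (rule insert.IH)
    show "D V \<le> D1 V" if "V \<in> S" for V
      using insert.prems(3)[of V] that unfolding D1_def by simp
    show "D V = D1 V" if "V \<notin> S" for V
      using insert.prems(4)[of V] that unfolding D1_def by simp
  qed (use insert.prems in blast)+
  have S: "(\<Sum>V\<in>S. nat (D1 V - D V) * dg V) = (\<Sum>V\<in>S. nat (D' V - D V) * dg V)"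
    using insert.hyps by (intro sum.cong) (auto simp: D1_def)
  define k where "k = nat (D' V0 - D V0)"
  have "D V0 \<le> D' V0" by (rule insert.prems(3)) simp
  hence D': "D1(V0 := D1 V0 + int k) = D'" by (auto simp: D1_def k_def)
  have V0: "tplace V0" by (rule insert.prems(1)) simp
  have "finite (RR D') \<and> card (RR D') \<le> card (RR D1) * r ^ (k * dg V0)"
    using RR_steps[OF V0, of D1 k] IH unfolding D' by blast
  moreover have "card (RR D1) * r ^ (k * dg V0) \<le> card (RR D) * r ^ (\<Sum>V\<in>S. nat (D' V - D V) * dg V) * r ^ (k * dg V0)"
    by (rule mult_right_mono[OF conjunct2[OF IH[unfolded S]] le0])
  moreover have "card (RR D) * r ^ (\<Sum>V\<in>S. nat (D' V - D V) * dg V) * r ^ (k * dg V0) = card (RR D) * r ^ (\<Sum>V\<in>insert V0 S. nat (D' V - D V) * dg V)"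
    unfolding mult.assoc power_add[symmetric] sum.insert[OF insert.hyps] k_def by (simp only: add.commute)
  ultimately show ?case by linarith
qed

subsection \<open>The spaces of multiples of the place at infinity\<close>

lemma E_inj_on: "inj_on E {G. degree G < p}"
proof (rule inj_onI)
  fix G H assume GH: "G \<in> {G. degree G < p}" "H \<in> {G. degree G < p}" "E G = E H"
  have "degree (G - H) < p" using degree_diff_le_max[of G H] GH(1,2) by simp
  moreover have "E (G - H) = 0" using GH(3) rhomD(6)[OF RE] by simp
  ultimately show "G = H" using E_inj[of "G - H"] by simp
qed

text \<open>\<open>global_section\<close> turns functions with poles only at infinity into reduced
  polynomials, and on these \<open>\<sigma>_reduced\<close> reads the pole order as the
  weight.\<close>

lemma RR_Vinf:
  "RR (\<lambda>V. if V = Vinf then int n else 0) = E ` {G \<in> kXY. degree G < p \<and> wt n 0 G}"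
proof (rule equalityI; rule subsetI)
  fix z assume z: "z \<in> RR (\<lambda>V. if V = Vinf then int n else 0)"
  have K: "z \<in> KL" by (rule RR_D(1)[OF z])
  have "z \<in> Vpt a b" if "pt a b" for a b
  proof (cases "z = 0")
    case True
    thus ?thesis using KL_01(1) by (simp add: vring_def)
  next
    case False
    have "Vpt a b \<noteq> Vinf" using x_in_Vpt[OF that] x_notin_Vinf by (rule_tac notI) (simp only:)
    thus ?thesis using RR_D(2)[OF z False tplace_Vpt[OF that]] wv_nonneg_iff[OF tplace_Vpt[OF that] K False] by simp
  qed
  from global_section[OF K this] obtain G where G: "G \<in> kXY" "degree G < p" "z = E G" by blast
  have "wt n 0 G"
  proof (cases "z = 0")
    case True
    have "G = 0" by (rule E_inj[OF G(2)]) (simp only: G(3)[symmetric] True)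
    thus ?thesis by simp
  next
    case False
    have G0: "G \<noteq> 0" using False G(3) rhomD(4)[OF RE] by auto
    have "- int n \<le> wv Vinf z" using RR_D(2)[OF z False tplace_Vinf] by (simp only: if_True simp_thms)
    hence "- int n \<le> vinf z" by (simp only: wv_def if_True simp_thms)
    hence "degree (\<sigma> G) \<le> n" using vinf_E[OF G(2)] False G(3) by simp
    with \<sigma>_reduced(2)[OF G0 G(2)] show ?thesis unfolding wt_def by (meson order_trans)
  qed
  thus "z \<in> E ` {G \<in> kXY. degree G < p \<and> wt n 0 G}" using G by blast
next
  fix z assume "z \<in> E ` {G \<in> kXY. degree G < p \<and> wt n 0 G}"
  then obtain G where G: "G \<in> kXY" "degree G < p" "wt n 0 G" "z = E G" by blast
  show "z \<in> RR (\<lambda>V. if V = Vinf then int n else 0)"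
  proof (rule RR_I)
    show K: "z \<in> KL" unfolding G(4) by (rule E_in_KL[OF G(1)])
    fix V assume nz: "z \<noteq> 0" and V: "tplace V"
    show "- (if V = Vinf then int n else 0) \<le> wv V z"
    proof (cases "V = Vinf")
      case True
      have "degree (\<sigma> G) \<le> n" using \<sigma>_degree_le[OF G(3)] by auto
      hence "- int n \<le> vinf z" using vinf_E[OF G(2)] nz G(4) by simp
      thus ?thesis unfolding wv_def using True by (simp only: if_True simp_thms)
    next
      case False
      hence "x \<in> V" using place_x_notin[OF V] by blast
      hence "z \<in> V" unfolding G(4) by (rule O_subset[OF V _ G(1)])
      thus ?thesis using wv_nonneg_iff[OF V K nz] False by simp
    qed
  qed
qed

end

subsection \<open>The theorem of Riemann\<close>

text \<open>The i-th summand counts the coefficients available to the factor of y^i: with h = p l +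
  1 this number drops by l for each i, and once more by 1 when i > 0. The deficit l (1 + ... + q) is
  the genus for q = p - 1.\<close>

lemma sum_gap_dimensions:
  fixes M l q :: nat
  shows "l * q \<le> M \<Longrightarrow> (\<Sum>i<Suc q. if i = 0 then M + 1 else M - l * i) + l * (q * Suc q div 2) = Suc q * M + 1"
proof (induction q)
  case (Suc q)
  have "Suc q * Suc (Suc q) = q * Suc q + 2 * Suc q" by (simp add: algebra_simps)
  hence "Suc q * Suc (Suc q) div 2 = q * Suc q div 2 + Suc q" by (metis add.commute div_mult_self2 zero_neq_numeral)
  hence *: "l * (Suc q * Suc (Suc q) div 2) = l * (q * Suc q div 2) + l * Suc q" by (simp only: distrib_left)
  have "l * q \<le> M" using Suc.prems by simp
  from Suc.IH[OF this] show ?case unfolding * sum.lessThan_Suc[of _ "Suc q"] using Suc.prems by simp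
qed simp

lemma coeff_vanish_iff: "(\<forall>j\<ge>n. poly.coeff c j = 0) \<longleftrightarrow> c = 0 \<or> degree c < n"
proof
  assume "\<forall>j\<ge>n. poly.coeff c j = 0"
  thus "c = 0 \<or> degree c < n" using leading_coeff_0_iff[of c] by (metis not_less)
next
  assume "c = 0 \<or> degree c < n"
  thus "\<forall>j\<ge>n. poly.coeff c j = 0" by (auto intro: coeff_eq_0)
qed

text \<open>For the curves of the theorem l = p^(e-1). That h is 1 modulo p makes the monomials of
  bounded weight easy to count.\<close>

locale as_curve_genus = as_curve +
  fixes l :: nat
  assumes hl: "degree f = 2 ^ m * l + 1"
begin

text \<open>This is (p - 1)(h - 1) / 2, in view of h - 1 = p l.\<close>

definition genus_g :: nat where "genus_g = l * (p * (p - 1) div 2)"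

text \<open>The weight is p (l i + d) + i with i < p, so for i > 0 the quotient l i + d must stay
  strictly below M.\<close>

lemma weight_le_iff:
  assumes "i < p"
  shows "h * i + p * d \<le> p * M \<longleftrightarrow> d < (if i = 0 then M + 1 else M - l * i)"
proof (cases "i = 0")
  case True
  thus ?thesis using p(2) by auto
next
  case False
  have eq: "h * i + p * d = p * (l * i + d) + i" unfolding hl by (simp add: algebra_simps)
  have "p * (l * i + d) + i \<le> p * M \<longleftrightarrow> l * i + d < M"
  proof
    assume le: "p * (l * i + d) + i \<le> p * M"
    show "l * i + d < M"
    proof (rule ccontr)
      assume "\<not> l * i + d < M"
      hence "p * M \<le> p * (l * i + d)" by (intro mult_left_mono) auto
      thus False using le False by linarith
    qed
  next
    assume "l * i + d < M"
    hence "p * (l * i + d + 1) \<le> p * M" by (intro mult_left_mono) auto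
    moreover have "p * (l * i + d + 1) = p * (l * i + d) + p" by (simp only: distrib_left mult_1_right)
    ultimately show "p * (l * i + d) + i \<le> p * M" using assms by linarith
  qed
  thus ?thesis unfolding eq using False by auto
qed

text \<open>The lower bound on M makes the truncated differences M - l i exact for i < p; the genus
  is added on the left in order to avoid one more subtraction.\<close>

lemma card_RR_Vinf:
  assumes "l * (p - 1) \<le> M"
  shows "\<exists>d. card (RR (\<lambda>V. if V = Vinf then int (p * M) else 0)) = r ^ d \<and> d + genus_g = p * M + 1"
    and "finite (RR (\<lambda>V. if V = Vinf then int (p * M) else 0))"
proof -
  define N where "N i = (if i = 0 then M + 1 else M - l * i)" for i
  define A where "A i = {c. (\<forall>j<N i. poly.coeff c j \<in> GF J) \<and> (\<forall>j\<ge>N i. poly.coeff c j = 0)}" for i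
  have A: "c \<in> A i \<longleftrightarrow> c \<in> kX \<and> (c \<noteq> 0 \<longrightarrow> h * i + p * degree c \<le> p * M)" if "i < p" for c i
  proof -
    have 0: "0 \<in> GF J" by (rule GF_0_1)
    have "c \<in> A i \<longleftrightarrow> c \<in> kX \<and> (\<forall>j\<ge>N i. poly.coeff c j = 0)"
    proof
      assume c: "c \<in> A i"
      have "poly.coeff c j \<in> GF J" for j
      proof (cases "j < N i")
        case True
        thus ?thesis using c unfolding A_def by blast
      next
        case False
        hence "poly.coeff c j = 0" using c unfolding A_def by simp
        thus ?thesis using 0 by (simp only:)
      qed
      thus "c \<in> kX \<and> (\<forall>j\<ge>N i. poly.coeff c j = 0)" using c unfolding A_def coeffs_in_def by blast
    next
      assume "c \<in> kX \<and> (\<forall>j\<ge>N i. poly.coeff c j = 0)"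
      thus "c \<in> A i" unfolding A_def coeffs_in_def by blast
    qed
    thus ?thesis unfolding coeff_vanish_iff weight_le_iff[OF that] N_def by blast
  qed
  have S: "{G \<in> kXY. degree G < p \<and> wt (p * M) 0 G} = {P. (\<forall>i<p. poly.coeff P i \<in> A i) \<and> (\<forall>i\<ge>p. poly.coeff P i = 0)}" (is "?S = ?T")
  proof (rule equalityI; rule subsetI)
    fix G assume G: "G \<in> ?S"
    have "poly.coeff G i \<in> A i" if "i < p" for i
      unfolding A[OF that] using G by (auto simp: wt_def intro: coeffs_inD)
    moreover have "poly.coeff G i = 0" if "i \<ge> p" for i using G that by (auto intro: coeff_eq_0)
    ultimately show "G \<in> ?T" by blast
  next
    fix G assume G: "G \<in> ?T"
    have lt: "i < p" if "poly.coeff G i \<noteq> 0" for i using G that by (metis (mono_tags, lifting) mem_Collect_eq not_less)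
    have "G = 0 \<or> degree G < p" using G coeff_vanish_iff[of p G] by blast
    hence "degree G < p" using p by auto
    moreover have "wt (p * M) 0 G" unfolding wt_def add_0_right
    proof (intro allI impI)
      fix i assume i: "poly.coeff G i \<noteq> 0"
      have "poly.coeff G i \<in> A i" using G lt[OF i] by blast
      thus "h * i + p * degree (poly.coeff G i) \<le> p * M" unfolding A[OF lt[OF i]] using i by blast
    qed
    moreover have "G \<in> kXY"
      unfolding coeffs_in_def[of kX] mem_Collect_eq
    proof
      fix i show "poly.coeff G i \<in> kX"
      proof (cases "poly.coeff G i = 0")
        case True
        thus ?thesis using subring_setD(1)[OF sub_kX] by simp
      next
        case False
        have "poly.coeff G i \<in> A i" using G lt[OF False] by blast
        thus ?thesis unfolding A[OF lt[OF False]] by blast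
      qed
    qed
    ultimately show "G \<in> ?S" by blast
  qed
  have cardA: "card (A i) = r ^ N i" for i
    unfolding A_def card_poly_coeffs using card_GF_J by simp
  have "card ?T = r ^ (\<Sum>i<p. N i)" unfolding card_poly_coeffs cardA by (simp only: power_sum)
  moreover have "inj_on E ?S" by (rule inj_on_subset[OF E_inj_on]) blast
  ultimately have card: "card (RR (\<lambda>V. if V = Vinf then int (p * M) else 0)) = r ^ (\<Sum>i<p. N i)"
    unfolding RR_Vinf S by (simp only: card_image)
  have "(\<Sum>i<p. N i) + genus_g = p * M + 1"
  proof -
    have "Suc (p - 1) = p" using p by simp
    thus ?thesis using sum_gap_dimensions[OF assms] unfolding N_def genus_g_def by (simp only: mult.commute)
  qed
  thus "\<exists>d. card (RR (\<lambda>V. if V = Vinf then int (p * M) else 0)) = r ^ d \<and> d + genus_g = p * M + 1"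
    using card by blast
  show "finite (RR (\<lambda>V. if V = Vinf then int (p * M) else 0))"
    by (rule card_ge_0_finite) (simp only: card, simp)
qed

section \<open>Divisors of the functions \<open>PR N\<close> and Riemann's inequality\<close>

lemma wv_PR:
  assumes V: "tplace V" "V \<noteq> Vinf" and N: "0 < N"
  shows "wv V (\<xi> (PR N)) = (if \<xi> (PR N) \<in> mideal V then 1 else 0)"
proof -
  obtain a b where ab: "rep V = (a, b)" "pt a b" "V = Vpt a b" by (rule rep[OF V])
  have w: "wv V = vpt a b" unfolding wv_def ab(1) using V(2) by simp
  have *: "\<xi> (PR N) \<in> KL" "\<xi> (PR N) \<noteq> 0" using xi_in_KL[OF PR_in] xi_nz degree_PR(2)[OF N] by auto
  have "\<xi> (PR N) \<in> mideal V \<longleftrightarrow> 0 < wv V (\<xi> (PR N))" unfolding mideal_wv[OF V(1)] using * by blast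
  thus ?thesis unfolding w vpt_PR[OF ab(2) N] by auto
qed

lemma common_PR:
  assumes "finite S" "\<And>V. V \<in> S \<Longrightarrow> tplace V \<and> V \<noteq> Vinf"
  shows "\<exists>N>0. \<forall>V\<in>S. \<xi> (PR N) \<in> mideal V"
proof -
  have "\<exists>N>0. \<forall>M>0. N dvd M \<longrightarrow> \<xi> (PR M) \<in> mideal V" if V: "V \<in> S" for V
  proof -
    have V: "tplace V" "V \<noteq> Vinf" using assms(2)[OF V] by blast+
    hence x: "x \<in> V" using place_x_notin by blast
    obtain N where "0 < N" "\<And>M. 0 < M \<Longrightarrow> N dvd M \<Longrightarrow> \<xi> (PR M) \<in> mideal V" by (rule mideal_PR[OF V(1) x]) blast
    thus ?thesis by blast
  qed
  then obtain n where n: "\<And>V. V \<in> S \<Longrightarrow> 0 < n V \<and> (\<forall>M>0. n V dvd M \<longrightarrow> \<xi> (PR M) \<in> mideal V)" by metis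
  have "0 < prod n S" using n by (intro prod_pos) blast
  moreover have "n V dvd prod n S" if "V \<in> S" for V using dvd_prodI[OF assms(1) that] .
  ultimately show ?thesis using n by (intro exI[of _ "prod n S"]) blast
qed

text \<open>\<open>PR N\<close> has simple zeros along \<open>TN\<close> and a pole of order p 2^(J
  N) at infinity; multiplication by its k-th power therefore moves the poles allowed on
  \<open>TN\<close> to infinity.\<close>

lemma RR_translate:
  assumes N: "0 < N" and n': "n' = n + k * (p * 2 ^ (J * N))"
  defines "TN \<equiv> {V. tplace V \<and> V \<noteq> Vinf \<and> \<xi> (PR N) \<in> mideal V}"
  shows "RR (\<lambda>V. if V = Vinf then int n else if V \<in> TN then int k else 0) =
    (\<lambda>w. w / \<xi> (PR N) ^ k) ` RR (\<lambda>V. if V = Vinf then int n' else 0)" (is "RR ?D = _ ` RR ?D'")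
proof -
  let ?P = "\<xi> (PR N) ^ k"
  have K0: "\<xi> (PR N) \<in> KL" "\<xi> (PR N) \<noteq> 0" using xi_in_KL[OF PR_in] xi_nz degree_PR(2)[OF N] by auto
  have K: "?P \<in> KL" "?P \<noteq> 0" using KL_power[OF K0(1)] K0(2) by auto
  have wP: "wv V ?P = ?D V - ?D' V" if V: "tplace V" for V
  proof -
    have pw: "wv V ?P = int k * wv V (\<xi> (PR N))" by (rule dval_power[OF wv(1)[OF V] K0])
    show ?thesis
    proof (cases "V = Vinf")
      case True
      have "wv V (\<xi> (PR N)) = vinf (\<xi> (PR N))" unfolding wv_def using True by (simp only: if_True simp_thms)
      also have "\<dots> = - int (p * 2 ^ (J * N))" using vinf_xi[OF degree_PR(2)[OF N]] degree_PR(1)[OF N] by (simp only:)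
      finally show ?thesis unfolding pw n' using True by (simp only: if_True simp_thms) simp
    next
      case False
      show ?thesis unfolding pw wv_PR[OF V False N] TN_def using V False by auto
    qed
  qed
  show ?thesis
  proof (rule equalityI; rule subsetI)
    fix z assume z: "z \<in> RR ?D"
    have "z * ?P \<in> RR ?D'"
    proof (rule RR_I)
      show "z * ?P \<in> KL" by (intro KL_mult RR_D(1)[OF z] K)
      fix V assume nz: "z * ?P \<noteq> 0" and V: "tplace V"
      have z0: "z \<noteq> 0" using nz by auto
      show "- ?D' V \<le> wv V (z * ?P)"
        using RR_D(2)[OF z z0 V] unfolding wv_mult[OF V RR_D(1)[OF z] K(1) z0 K(2)] wP[OF V] by linarith
    qed
    thus "z \<in> (\<lambda>w. w / ?P) ` RR ?D'" by (rule image_eqI[rotated]) (use K(2) in simp)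
  next
    fix z assume "z \<in> (\<lambda>w. w / ?P) ` RR ?D'"
    then obtain w where w: "w \<in> RR ?D'" "z = w / ?P" by blast
    have zK: "z \<in> KL" unfolding w(2) by (intro KL_divide RR_D(1)[OF w(1)] K)
    have wz: "w = z * ?P" using w(2) K(2) by simp
    show "z \<in> RR ?D"
    proof (rule RR_I[OF zK])
      fix V assume nz: "z \<noteq> 0" and V: "tplace V"
      have "w \<noteq> 0" using nz w(2) by auto
      from RR_D(2)[OF w(1) this V] show "- ?D V \<le> wv V z"
        unfolding wz wv_mult[OF V zK K(1) nz K(2)] wP[OF V] by linarith
    qed
  qed
qed

text \<open>D lies below p M times infinity plus k times \<open>TN\<close>, a divisor that
  \<open>RR_translate\<close> relates to a multiple of infinity of known dimension. Enlarging D to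
  it raises the dimension at most by the difference of the degrees, which \<open>sum_dg_le\<close>
  bounds.\<close>

lemma riemann:
  assumes fin: "finite {V. D V \<noteq> 0}" and pl: "{V. D V \<noteq> 0} \<subseteq> {V. tplace V}"
  shows "finite (RR D)" "card (RR D) = r ^ d \<Longrightarrow> ddeg D + 1 - int d \<le> int genus_g"
proof -
  let ?S = "{V. D V \<noteq> 0}"
  obtain N where N: "0 < N" "\<And>V. V \<in> ?S - {Vinf} \<Longrightarrow> \<xi> (PR N) \<in> mideal V"
    using common_PR[of "?S - {Vinf}"] fin pl by blast
  define TN where "TN = {V. tplace V \<and> V \<noteq> Vinf \<and> \<xi> (PR N) \<in> mideal V}"
  have TN: "finite TN" "(\<Sum>V\<in>TN. dg V) \<le> p * 2 ^ (J * N)"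
    unfolding TN_def by (rule sum_dg_le[OF N(1)])+
  have VinfTN: "Vinf \<notin> TN" unfolding TN_def by blast
  define k where "k = nat (\<Sum>V\<in>?S. \<bar>D V\<bar>)"
  have k: "D V \<le> int k" for V
  proof (cases "D V = 0")
    case False
    have "\<bar>D V\<bar> \<le> (\<Sum>V\<in>?S. \<bar>D V\<bar>)" by (rule member_le_sum[OF _ _ fin]) (use False in auto)
    thus ?thesis unfolding k_def by linarith
  qed simp
  \<comment> \<open>The first summand makes \<open>card_RR_Vinf\<close> applicable, the second makes
    p M dominate D at infinity.\<close>
  define M where "M = l * (p - 1) + k"
  define M' where "M' = M + k * 2 ^ (J * N)"
  have n': "p * M' = p * M + k * (p * 2 ^ (J * N))" by (simp only: M'_def distrib_left mult.left_commute)
  have "k \<le> M" unfolding M_def by simp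
  also have "M \<le> p * M" using p(2) by simp
  finally have kM: "k \<le> p * M" .
  define D2 where "D2 = (\<lambda>V. if V = Vinf then int (p * M) else if V \<in> TN then int k else 0)"
  define S2 where "S2 = insert Vinf TN"
  have S2: "finite S2" "\<And>V. V \<in> S2 \<Longrightarrow> tplace V" using TN(1) tplace_Vinf unfolding S2_def TN_def by blast+
  have SS2: "?S \<subseteq> S2" using N(2) pl unfolding S2_def TN_def by blast
  have le: "D V \<le> D2 V" if "V \<in> S2" for V
  proof (cases "V = Vinf")
    case True
    have "int k \<le> int (p * M)" using kM by (simp only: of_nat_le_iff)
    thus ?thesis unfolding D2_def using k[of V] True by (simp only: if_True simp_thms)
  next
    case False
    thus ?thesis using k[of V] that unfolding D2_def S2_def by simp
  qed
  have eq: "D V = D2 V" if "V \<notin> S2" for V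
  proof -
    have "D V = 0" using SS2 that by blast
    thus ?thesis using that unfolding D2_def S2_def by auto
  qed
  have "l * (p - 1) \<le> M'" unfolding M'_def M_def by linarith
  note Vinf = card_RR_Vinf[OF this]
  obtain d' where d': "card (RR (\<lambda>V. if V = Vinf then int (p * M') else 0)) = r ^ d'" "d' + genus_g = p * M' + 1"
    using Vinf(1) by blast
  have D2: "RR D2 = (\<lambda>w. w / \<xi> (PR N) ^ k) ` RR (\<lambda>V. if V = Vinf then int (p * M') else 0)"
    unfolding D2_def TN_def by (rule RR_translate[OF N(1) n'])
  have nz: "\<xi> (PR N) ^ k \<noteq> 0" using xi_nz[OF degree_PR(2)[OF N(1)]] by simp
  have inj: "inj_on (\<lambda>w. w / \<xi> (PR N) ^ k) A" for A using nz by (auto simp: inj_on_def)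
  have cardD2: "card (RR D2) = r ^ d'" unfolding D2 card_image[OF inj] by (rule d'(1))
  have finD2: "finite (RR D2)" unfolding D2 by (intro finite_imageI Vinf(2))
  have "RR D \<subseteq> RR D2" by (rule RR_mono) (metis le eq order_refl)
  thus finD: "finite (RR D)" using finD2 by (rule finite_subset)
  define \<Sigma> where "\<Sigma> = (\<Sum>V\<in>S2. nat (D2 V - D V) * dg V)"
  have card_le: "card (RR D2) \<le> card (RR D) * r ^ \<Sigma>"
    unfolding \<Sigma>_def using RR_card_le[OF S2 finD le eq] by blast
  have "int \<Sigma> = (\<Sum>V\<in>S2. (D2 V - D V) * int (dg V))"
    unfolding \<Sigma>_def of_nat_sum of_nat_mult using le by (intro sum.cong) auto
  also have "\<dots> = (\<Sum>V\<in>S2. D2 V * int (dg V)) - (\<Sum>V\<in>S2. D V * int (dg V))"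
    by (simp only: left_diff_distrib sum_subtractf)
  also have "(\<Sum>V\<in>S2. D V * int (dg V)) = ddeg D"
    unfolding ddeg_def by (rule sum.mono_neutral_right[OF S2(1) SS2]) auto
  also have "(\<Sum>V\<in>S2. D2 V * int (dg V)) = int (p * M) + (\<Sum>V\<in>TN. D2 V * int (dg V))"
    unfolding S2_def sum.insert[OF TN(1) VinfTN] by (simp only: D2_def if_True simp_thms dg_Vinf of_nat_1 mult_1_right)
  also have "(\<Sum>V\<in>TN. D2 V * int (dg V)) = (\<Sum>V\<in>TN. int k * int (dg V))"
    using VinfTN by (intro sum.cong refl) (auto simp: D2_def)
  also have "\<dots> = int (k * (\<Sum>V\<in>TN. dg V))" by (simp only: of_nat_mult of_nat_sum sum_distrib_left)
  also have "int (p * M) + int (k * (\<Sum>V\<in>TN. dg V)) \<le> int (p * M')"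
    unfolding n' using mult_left_mono[OF TN(2), of k] by linarith
  finally have \<Sigma>: "int \<Sigma> \<le> int (p * M') - ddeg D" by linarith
  assume "card (RR D) = r ^ d"
  hence "r ^ d' \<le> r ^ (d + \<Sigma>)" using card_le cardD2 by (simp only: power_add)
  hence "d' \<le> d + \<Sigma>" using power_increasing_iff[of r d' "d + \<Sigma>"] r by linarith
  thus "ddeg D + 1 - int d \<le> int genus_g" using \<Sigma> d'(2) by linarith
qed

text \<open>The smallest multiple of infinity to which \<open>card_RR_Vinf\<close> applies already
  attains the bound.\<close>

lemma riemann_equality:
  "\<exists>D d. finite {V. D V \<noteq> 0} \<and> {V. D V \<noteq> 0} \<subseteq> {V. tplace V} \<and> card (RR D) = r ^ d
    \<and> ddeg D + 1 - int d = int genus_g"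
proof -
  define M where "M = l * (p - 1)"
  define D where "D = (\<lambda>V. if V = Vinf then int (p * M) else 0)"
  obtain d where d: "card (RR D) = r ^ d" "d + genus_g = p * M + 1"
    using card_RR_Vinf(1)[of M] unfolding M_def D_def by blast
  have sub: "{V. D V \<noteq> 0} \<subseteq> {Vinf}" unfolding D_def by auto
  have "ddeg D = (\<Sum>V\<in>{Vinf}. D V * int (dg V))"
    unfolding ddeg_def by (rule sum.mono_neutral_left[OF _ sub]) auto
  also have "\<dots> = int (p * M)" using dg_Vinf by (simp add: D_def)
  finally have "ddeg D + 1 - int d = int genus_g" using d(2) by linarith
  moreover have "finite {V. D V \<noteq> 0}" by (rule finite_subset[OF sub]) simp
  moreover have "{V. D V \<noteq> 0} \<subseteq> {V. tplace V}" using sub tplace_Vinf by blast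
  ultimately show ?thesis using d(1) by blast
qed

end

subsection \<open>Transport to an isomorphic function field\<close>

lemma card_image_cong_iff:
  assumes "\<And>a b. a \<in> V \<Longrightarrow> b \<in> V \<Longrightarrow> h a = h b \<longleftrightarrow> g a = g b" and "finite (g ` V)"
  shows "finite (h ` V)" "card (h ` V) = card (g ` V)"
proof -
  define s where "s = (\<lambda>c. h (inv_into V g c))"
  have s: "s (g a) = h a" if "a \<in> V" for a
    unfolding s_def using assms(1)[of "inv_into V g (g a)" a] inv_into_into[of "g a" g V] f_inv_into_f[of "g a" g V] that by blast
  have "inj_on s (g ` V)" using s assms(1) by (auto simp: inj_on_def)
  moreover have im: "h ` V = s ` g ` V" unfolding image_image using s by (intro image_cong) auto
  ultimately show "card (h ` V) = card (g ` V)" by (simp only: card_image)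
  show "finite (h ` V)" unfolding im using assms(2) by (rule finite_imageI)
qed

text \<open>The ring K is left abstract, so that everything shown inside \<open>KL\<close> is
  carried by one isomorphism to the ring in which the function field was defined.\<close>

locale curve_transport = as_curve_genus ty m J f \<xi> y l
  for ty :: "'a::field itself" and m J :: nat and f :: "'a poly" and \<xi> :: "'a poly \<Rightarrow> 'l::field" and y :: 'l and l :: nat +
  fixes K :: "('c, 'd) ring_scheme" and kk :: "'c set" and \<phi> :: "'c \<Rightarrow> 'l"
  assumes field_K: "field K"
    and phi_hom: "\<phi> \<in> ring_hom K type_ring"
    and phi_bij: "bij_betw \<phi> (carrier K) KL"
    and kk: "kk \<subseteq> carrier K" "\<phi> ` kk = cst ` GF J"
begin

lemma phi_mult: "a \<in> carrier K \<Longrightarrow> b \<in> carrier K \<Longrightarrow> \<phi> (a \<otimes>\<^bsub>K\<^esub> b) = \<phi> a * \<phi> b"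
  using ring_hom_mult[OF phi_hom] by simp

lemma phi_add: "a \<in> carrier K \<Longrightarrow> b \<in> carrier K \<Longrightarrow> \<phi> (a \<oplus>\<^bsub>K\<^esub> b) = \<phi> a + \<phi> b"
  using ring_hom_add[OF phi_hom] by simp

lemma phi_one: "\<phi> \<one>\<^bsub>K\<^esub> = 1"
  using ring_hom_one[OF phi_hom] by simp

lemma ring_K: "ring K"
  using field_K by (simp add: field_def domain_def cring_def)
lemma domain_K: "domain K"
  using field_K by (simp add: field_def)

lemma carr: "\<one>\<^bsub>K\<^esub> \<in> carrier K" "\<zero>\<^bsub>K\<^esub> \<in> carrier K"
  "a \<in> carrier K \<Longrightarrow> b \<in> carrier K \<Longrightarrow> a \<otimes>\<^bsub>K\<^esub> b \<in> carrier K"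
  "a \<in> carrier K \<Longrightarrow> b \<in> carrier K \<Longrightarrow> a \<oplus>\<^bsub>K\<^esub> b \<in> carrier K"
  "a \<in> carrier K \<Longrightarrow> \<ominus>\<^bsub>K\<^esub> a \<in> carrier K"
proof -
  interpret K: field K by (rule field_K)
  show "\<one>\<^bsub>K\<^esub> \<in> carrier K" "\<zero>\<^bsub>K\<^esub> \<in> carrier K"
    "a \<in> carrier K \<Longrightarrow> b \<in> carrier K \<Longrightarrow> a \<otimes>\<^bsub>K\<^esub> b \<in> carrier K"
    "a \<in> carrier K \<Longrightarrow> b \<in> carrier K \<Longrightarrow> a \<oplus>\<^bsub>K\<^esub> b \<in> carrier K"
    "a \<in> carrier K \<Longrightarrow> \<ominus>\<^bsub>K\<^esub> a \<in> carrier K" by simp_all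
qed

lemma phi_zero: "\<phi> \<zero>\<^bsub>K\<^esub> = 0"
proof -
  interpret K: field K by (rule field_K)
  have "\<phi> (\<zero>\<^bsub>K\<^esub> \<oplus>\<^bsub>K\<^esub> \<zero>\<^bsub>K\<^esub>) = \<phi> \<zero>\<^bsub>K\<^esub> + \<phi> \<zero>\<^bsub>K\<^esub>" by (rule phi_add) simp_all
  hence "\<phi> \<zero>\<^bsub>K\<^esub> = \<phi> \<zero>\<^bsub>K\<^esub> + \<phi> \<zero>\<^bsub>K\<^esub>" by (simp only: K.l_zero[OF carr(2)])
  thus ?thesis by (simp only: add_cancel_right_right)
qed

lemma phi_inj: "a \<in> carrier K \<Longrightarrow> b \<in> carrier K \<Longrightarrow> \<phi> a = \<phi> b \<longleftrightarrow> a = b"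
  using bij_betw_imp_inj_on[OF phi_bij] by (auto simp: inj_on_def)

lemma phi_eq_0: "a \<in> carrier K \<Longrightarrow> \<phi> a = 0 \<longleftrightarrow> a = \<zero>\<^bsub>K\<^esub>"
  using phi_inj[OF _ carr(2), of a] phi_zero by simp

lemma phi_KL: "a \<in> carrier K \<Longrightarrow> \<phi> a \<in> KL"
  using bij_betwE[OF phi_bij] by blast

lemma phi_surj: "z \<in> KL \<Longrightarrow> \<exists>a\<in>carrier K. \<phi> a = z"
  using bij_betw_imp_surj_on[OF phi_bij] by (metis imageE)

lemma phi_uminus: "a \<in> carrier K \<Longrightarrow> \<ominus>\<^bsub>K\<^esub> a = a"
proof -
  assume a: "a \<in> carrier K"
  interpret K: field K by (rule field_K)
  have "\<phi> (a \<oplus>\<^bsub>K\<^esub> a) = 0" using phi_add[OF a a] char2_add_self[OF two_l] by simp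
  hence "a \<oplus>\<^bsub>K\<^esub> a = \<zero>\<^bsub>K\<^esub>" using phi_eq_0 a by simp
  thus ?thesis using K.minus_equality a by simp
qed

lemma phi_inv: "a \<in> carrier K \<Longrightarrow> a \<noteq> \<zero>\<^bsub>K\<^esub> \<Longrightarrow> inv\<^bsub>K\<^esub> a \<in> carrier K \<and> \<phi> (inv\<^bsub>K\<^esub> a) = inverse (\<phi> a)"
proof -
  assume a: "a \<in> carrier K" "a \<noteq> \<zero>\<^bsub>K\<^esub>"
  interpret K: field K by (rule field_K)
  have u: "a \<in> Units K" using a K.field_Units by blast
  have "\<phi> (a \<otimes>\<^bsub>K\<^esub> inv\<^bsub>K\<^esub> a) = \<phi> a * \<phi> (inv\<^bsub>K\<^esub> a)" by (rule phi_mult) (use a u in simp_all)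
  hence "\<phi> a * \<phi> (inv\<^bsub>K\<^esub> a) = 1" using u phi_one by simp
  thus ?thesis using u by (simp add: inverse_unique)
qed

lemma phi_img: "V \<subseteq> carrier K \<Longrightarrow> a \<in> carrier K \<Longrightarrow> \<phi> a \<in> \<phi> ` V \<longleftrightarrow> a \<in> V"
  using phi_inj by blast

lemma phi_img_KL: "V \<subseteq> carrier K \<Longrightarrow> \<phi> ` V \<subseteq> KL"
  using phi_KL by blast

definition pull :: "'l set \<Rightarrow> 'c set" where "pull W = {a \<in> carrier K. \<phi> a \<in> W}"

lemma pull: "W \<subseteq> KL \<Longrightarrow> \<phi> ` pull W = W" "V \<subseteq> carrier K \<Longrightarrow> pull (\<phi> ` V) = V" "pull W \<subseteq> carrier K"
proof -
  show "W \<subseteq> KL \<Longrightarrow> \<phi> ` pull W = W" unfolding pull_def using phi_surj by blast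
  show "V \<subseteq> carrier K \<Longrightarrow> pull (\<phi> ` V) = V" unfolding pull_def using phi_img by blast
  show "pull W \<subseteq> carrier K" unfolding pull_def by blast
qed

lemma subring_transport:
  assumes V: "V \<subseteq> carrier K"
  shows "subring V K \<longleftrightarrow> subring_set (\<phi> ` V)"
proof
  assume S: "subring V K"
  note S = subringE[OF S]
  have 0: "0 \<in> \<phi> ` V" using imageI[OF S(2), of \<phi>] phi_zero by simp
  have 1: "1 \<in> \<phi> ` V" using imageI[OF S(3), of \<phi>] phi_one by simp
  have neg: "- u \<in> \<phi> ` V" if "u \<in> \<phi> ` V" for u using that by (simp only: char2_minus[OF two_l])
  have add: "u + v \<in> \<phi> ` V" if uv: "u \<in> \<phi> ` V" "v \<in> \<phi> ` V" for u v
  proof -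
    obtain a b where ab: "a \<in> V" "b \<in> V" "u = \<phi> a" "v = \<phi> b" using uv by blast
    have "u + v = \<phi> (a \<oplus>\<^bsub>K\<^esub> b)" unfolding ab(3,4) using phi_add ab(1,2) V by (metis subsetD)
    thus ?thesis using S(7)[OF ab(1,2)] by blast
  qed
  have mult: "u * v \<in> \<phi> ` V" if uv: "u \<in> \<phi> ` V" "v \<in> \<phi> ` V" for u v
  proof -
    obtain a b where ab: "a \<in> V" "b \<in> V" "u = \<phi> a" "v = \<phi> b" using uv by blast
    have "u * v = \<phi> (a \<otimes>\<^bsub>K\<^esub> b)" unfolding ab(3,4) using phi_mult ab(1,2) V by (metis subsetD)
    thus ?thesis using S(6)[OF ab(1,2)] by blast
  qed
  show "subring_set (\<phi> ` V)" unfolding subring_set_def by (intro conjI ballI 0 1 neg add mult)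
next
  assume S: "subring_set (\<phi> ` V)"
  note S = subring_setD[OF S]
  interpret K: field K by (rule field_K)
  show "subring V K"
  proof (rule K.subringI)
    show "V \<subseteq> carrier K" by (rule V)
    show "\<one>\<^bsub>K\<^esub> \<in> V" using phi_img[OF V carr(1)] phi_one S(2) by simp
    show "\<ominus>\<^bsub>K\<^esub> a \<in> V" if "a \<in> V" for a using phi_uminus V that by (metis subsetD)
    show "a \<otimes>\<^bsub>K\<^esub> b \<in> V" if ab: "a \<in> V" "b \<in> V" for a b
    proof -
      have c: "a \<in> carrier K" "b \<in> carrier K" using ab V by blast+
      show ?thesis using phi_img[OF V carr(3)[OF c]] phi_mult[OF c] S(5)[OF imageI[OF ab(1)] imageI[OF ab(2)]] by simp
    qed
    show "a \<oplus>\<^bsub>K\<^esub> b \<in> V" if ab: "a \<in> V" "b \<in> V" for a b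
    proof -
      have c: "a \<in> carrier K" "b \<in> carrier K" using ab V by blast+
      show ?thesis using phi_img[OF V carr(4)[OF c]] phi_add[OF c] S(4)[OF imageI[OF ab(1)] imageI[OF ab(2)]] by simp
    qed
  qed
qed

lemma subfield_kk: "subfield kk K"
proof -
  interpret K: field K by (rule field_K)
  have sub: "subring_set (cst ` GF J)"
  proof -
    have 0: "0 \<in> cst ` GF J" using imageI[OF subring_setD(1)[OF sub_k], of cst] cst_0 by (simp only:)
    have 1: "1 \<in> cst ` GF J" using imageI[OF subring_setD(2)[OF sub_k], of cst] cst_1 by (simp only:)
    have neg: "- u \<in> cst ` GF J" if "u \<in> cst ` GF J" for u using that by (simp only: char2_minus[OF two_l])
    have add: "u + v \<in> cst ` GF J" if uv: "u \<in> cst ` GF J" "v \<in> cst ` GF J" for u v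
    proof -
      obtain c d where "c \<in> GF J" "u = cst c" "d \<in> GF J" "v = cst d" using uv by blast
      thus ?thesis using imageI[OF subring_setD(4)[OF sub_k], of c d cst] by (simp only: cst_add)
    qed
    have mult: "u * v \<in> cst ` GF J" if uv: "u \<in> cst ` GF J" "v \<in> cst ` GF J" for u v
    proof -
      obtain c d where "c \<in> GF J" "u = cst c" "d \<in> GF J" "v = cst d" using uv by blast
      thus ?thesis using imageI[OF subring_setD(5)[OF sub_k], of c d cst] by (simp only: cst_mult)
    qed
    show ?thesis unfolding subring_set_def by (intro conjI ballI 0 1 neg add mult)
  qed
  show ?thesis
  proof (rule K.subfieldI')
    show "subring kk K" unfolding subring_transport[OF kk(1)] kk(2) by (rule sub)
    fix a assume a: "a \<in> kk - {\<zero>\<^bsub>K\<^esub>}"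
    hence c: "a \<in> carrier K" "a \<noteq> \<zero>\<^bsub>K\<^esub>" using kk(1) by blast+
    have "\<phi> a \<in> cst ` GF J" using a kk(2) by blast
    then obtain u where u: "u \<in> GF J" "\<phi> a = cst u" by blast
    have "u \<noteq> 0" using u(2) cst_0 phi_eq_0[OF c(1)] c(2) by auto
    hence "cst u * cst (inverse u) = 1" unfolding cst_mult[symmetric] using cst_1 by simp
    hence "inverse (\<phi> a) = cst (inverse u)" unfolding u(2) by (rule inverse_unique)
    hence e: "\<phi> (inv\<^bsub>K\<^esub> a) = cst (inverse u)" using conjunct2[OF phi_inv[OF c]] by (simp only:)
    have "\<phi> (inv\<^bsub>K\<^esub> a) \<in> \<phi> ` kk" unfolding kk(2) e by (rule imageI[OF GF_inverse[OF u(1)]])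
    thus "inv\<^bsub>K\<^esub> a \<in> kk" using phi_img[OF kk(1)] phi_inv[OF c] by blast
  qed
qed

lemma places_iff: "V \<in> places K kk \<longleftrightarrow> V \<subseteq> carrier K \<and> tplace (\<phi> ` V)"
proof -
  have im: "\<phi> ` carrier K = KL" by (rule bij_betw_imp_surj_on[OF phi_bij])
  have main: "subring V K \<and> kk \<subseteq> V \<and> V \<noteq> carrier K \<and> (\<forall>z \<in> carrier K - {\<zero>\<^bsub>K\<^esub>}. z \<in> V \<or> inv\<^bsub>K\<^esub> z \<in> V) \<longleftrightarrow> tplace (\<phi> ` V)"
    if V: "V \<subseteq> carrier K"
  proof -
    note inj = bij_betw_imp_inj_on[OF phi_bij]
    have "\<phi> ` V = KL \<longleftrightarrow> V = carrier K" using inj_on_image_eq_iff[OF inj V order_refl] unfolding im .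
    hence 1: "V \<noteq> carrier K \<longleftrightarrow> \<phi> ` V \<subset> KL" using phi_img_KL[OF V] by (simp only: psubset_eq simp_thms)
    have "\<phi> ` kk \<subseteq> \<phi> ` V \<longleftrightarrow> kk \<subseteq> V"
    proof
      assume s: "\<phi> ` kk \<subseteq> \<phi> ` V"
      show "kk \<subseteq> V"
      proof
        fix a assume a: "a \<in> kk"
        have "\<phi> a \<in> \<phi> ` V" by (rule subsetD[OF s imageI[OF a]])
        thus "a \<in> V" by (rule iffD1[OF phi_img[OF V subsetD[OF kk(1) a]]])
      qed
    qed (rule image_mono)
    hence 2: "kk \<subseteq> V \<longleftrightarrow> cst ` GF J \<subseteq> \<phi> ` V" unfolding kk(2) by (rule sym)
    have 3: "(\<forall>z \<in> carrier K - {\<zero>\<^bsub>K\<^esub>}. z \<in> V \<or> inv\<^bsub>K\<^esub> z \<in> V) \<longleftrightarrow> (\<forall>z\<in>KL - {0}. z \<in> \<phi> ` V \<or> inverse z \<in> \<phi> ` V)"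
    proof
      assume L: "\<forall>z \<in> carrier K - {\<zero>\<^bsub>K\<^esub>}. z \<in> V \<or> inv\<^bsub>K\<^esub> z \<in> V"
      show "\<forall>z\<in>KL - {0}. z \<in> \<phi> ` V \<or> inverse z \<in> \<phi> ` V"
      proof
        fix z assume z: "z \<in> KL - {0}"
        then obtain a where a: "a \<in> carrier K" "\<phi> a = z" using phi_surj by blast
        have a0: "a \<noteq> \<zero>\<^bsub>K\<^esub>" using a z phi_zero by auto
        have "a \<in> V \<or> inv\<^bsub>K\<^esub> a \<in> V" using L a(1) a0 by blast
        thus "z \<in> \<phi> ` V \<or> inverse z \<in> \<phi> ` V"
        proof
          assume "a \<in> V"
          from imageI[OF this, of \<phi>] show ?thesis unfolding a(2) by (rule disjI1)
        next
          assume "inv\<^bsub>K\<^esub> a \<in> V"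
          from imageI[OF this, of \<phi>] show ?thesis unfolding conjunct2[OF phi_inv[OF a(1) a0]] a(2) by (rule disjI2)
        qed
      qed
    next
      assume R: "\<forall>z\<in>KL - {0}. z \<in> \<phi> ` V \<or> inverse z \<in> \<phi> ` V"
      show "\<forall>z \<in> carrier K - {\<zero>\<^bsub>K\<^esub>}. z \<in> V \<or> inv\<^bsub>K\<^esub> z \<in> V"
      proof
        fix a assume "a \<in> carrier K - {\<zero>\<^bsub>K\<^esub>}"
        hence a: "a \<in> carrier K" "a \<noteq> \<zero>\<^bsub>K\<^esub>" by blast+
        have nz: "\<phi> a \<in> KL - {0}" using phi_KL[OF a(1)] phi_eq_0[OF a(1)] a(2) by blast
        have "\<phi> a \<in> \<phi> ` V \<or> \<phi> (inv\<^bsub>K\<^esub> a) \<in> \<phi> ` V"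
          unfolding conjunct2[OF phi_inv[OF a]] by (rule bspec[OF R nz])
        thus "a \<in> V \<or> inv\<^bsub>K\<^esub> a \<in> V" unfolding phi_img[OF V a(1)] phi_img[OF V conjunct1[OF phi_inv[OF a]]] .
      qed
    qed
    show ?thesis unfolding tplace_def subring_transport[OF V] 1 2 3 by (simp only: conj_ac)
  qed
  show ?thesis
  proof (cases "V \<subseteq> carrier K")
    case True
    show ?thesis unfolding places_def mem_Collect_eq main[OF True] using True by (simp only: simp_thms)
  next
    case False
    hence "\<not> subring V K" using subringE(1)[of V K] by (rule contrapos_nn)
    thus ?thesis unfolding places_def mem_Collect_eq using False by (simp only: simp_thms)
  qed
qed

lemma placeD:
  assumes "V \<in> places K kk"
  shows "V \<subseteq> carrier K" "tplace (\<phi> ` V)" "subring V K" "kk \<subseteq> V"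
  using assms places_iff unfolding places_def by blast+

lemma places_pull: "tplace W \<Longrightarrow> pull W \<in> places K kk" "tplace W \<Longrightarrow> \<phi> ` pull W = W"
  using places_iff[of "pull W"] pull(1,3)[of W] tplaceD(2)[of W] by auto

lemma place_ideal_iff:
  assumes V: "V \<in> places K kk" and a: "a \<in> carrier K"
  shows "a \<in> place_ideal K V \<longleftrightarrow> \<phi> a \<in> mideal (\<phi> ` V)"
    and "a \<in> place_units K V \<longleftrightarrow> \<phi> a \<noteq> 0 \<and> \<phi> a \<in> \<phi> ` V \<and> inverse (\<phi> a) \<in> \<phi> ` V"
proof -
  note P = placeD[OF V]
  show units: "a \<in> place_units K V \<longleftrightarrow> \<phi> a \<noteq> 0 \<and> \<phi> a \<in> \<phi> ` V \<and> inverse (\<phi> a) \<in> \<phi> ` V"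
  proof
    assume "a \<in> place_units K V"
    then obtain b where b: "a \<in> V" "b \<in> V" "a \<otimes>\<^bsub>K\<^esub> b = \<one>\<^bsub>K\<^esub>" unfolding place_units_def Units_def by auto
    have "\<phi> a * \<phi> b = 1" using phi_mult[OF a, of b] b P(1) phi_one by (metis subsetD)
    hence "inverse (\<phi> a) = \<phi> b" "\<phi> a \<noteq> 0" using inverse_unique by auto
    thus "\<phi> a \<noteq> 0 \<and> \<phi> a \<in> \<phi> ` V \<and> inverse (\<phi> a) \<in> \<phi> ` V" using b by blast
  next
    assume *: "\<phi> a \<noteq> 0 \<and> \<phi> a \<in> \<phi> ` V \<and> inverse (\<phi> a) \<in> \<phi> ` V"
    then obtain b where b: "b \<in> V" "inverse (\<phi> a) = \<phi> b" by blast
    have bc: "b \<in> carrier K" using b P(1) by blast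
    have "\<phi> (a \<otimes>\<^bsub>K\<^esub> b) = \<phi> \<one>\<^bsub>K\<^esub>" "\<phi> (b \<otimes>\<^bsub>K\<^esub> a) = \<phi> \<one>\<^bsub>K\<^esub>"
      unfolding phi_mult[OF a bc] phi_mult[OF bc a] b(2)[symmetric] phi_one using * by simp_all
    hence "a \<otimes>\<^bsub>K\<^esub> b = \<one>\<^bsub>K\<^esub>" "b \<otimes>\<^bsub>K\<^esub> a = \<one>\<^bsub>K\<^esub>" using phi_inj carr a bc by blast+
    thus "a \<in> place_units K V" using * b(1) phi_img[OF P(1) a] unfolding place_units_def Units_def by auto
  qed
  show "a \<in> place_ideal K V \<longleftrightarrow> \<phi> a \<in> mideal (\<phi> ` V)"
    unfolding place_ideal_def mideal_def Diff_iff units mem_Collect_eq using phi_img[OF P(1) a] by blast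
qed

lemma place_ideal_subset: "place_ideal K V \<subseteq> V"
  unfolding place_ideal_def by blast

lemma phi_pow: "t \<in> carrier K \<Longrightarrow> t [^]\<^bsub>K\<^esub> (k::nat) \<in> carrier K \<and> \<phi> (t [^]\<^bsub>K\<^esub> k) = \<phi> t ^ k"
proof (induction k)
  case 0
  interpret K: field K by (rule field_K)
  show ?case using phi_one by simp
next
  case (Suc k)
  interpret K: field K by (rule field_K)
  show ?case using Suc phi_mult by simp
qed

lemma wv_int_pow:
  assumes W: "tplace W" and t: "t \<in> carrier K" "t \<noteq> \<zero>\<^bsub>K\<^esub>"
  shows "t [^]\<^bsub>K\<^esub> (i::int) \<in> carrier K \<and> t [^]\<^bsub>K\<^esub> i \<noteq> \<zero>\<^bsub>K\<^esub> \<and> wv W (\<phi> (t [^]\<^bsub>K\<^esub> i)) = i * wv W (\<phi> t)"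
proof -
  have tn: "t [^]\<^bsub>K\<^esub> k \<in> carrier K \<and> t [^]\<^bsub>K\<^esub> k \<noteq> \<zero>\<^bsub>K\<^esub> \<and> wv W (\<phi> (t [^]\<^bsub>K\<^esub> k)) = int k * wv W (\<phi> t)" for k :: nat
  proof -
    have 0: "\<phi> t \<noteq> 0" using phi_eq_0[OF t(1)] t(2) by blast
    note pk = phi_pow[OF t(1), of k]
    have "t [^]\<^bsub>K\<^esub> k \<noteq> \<zero>\<^bsub>K\<^esub>" using phi_eq_0[OF conjunct1[OF pk]] pk 0 by simp
    moreover have "wv W (\<phi> t ^ k) = int k * wv W (\<phi> t)" by (rule dval_power[OF wv(1)[OF W] phi_KL[OF t(1)] 0])
    ultimately show ?thesis using pk by simp
  qed
  show ?thesis
  proof (cases "i < 0")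
    case True
    let ?u = "t [^]\<^bsub>K\<^esub> nat (- i)"
    have eq: "t [^]\<^bsub>K\<^esub> i = inv\<^bsub>K\<^esub> ?u" by (subst int_pow_def2) (simp only: True if_True)
    have k: "int (nat (- i)) = - i" using True by simp
    note u0 = tn[of "nat (- i)", unfolded k]
    have u: "?u \<in> carrier K" "?u \<noteq> \<zero>\<^bsub>K\<^esub>" "wv W (\<phi> ?u) = - i * wv W (\<phi> t)" using u0 by blast+
    note iu = phi_inv[OF u(1,2)]
    have nzu: "\<phi> ?u \<noteq> 0" using phi_eq_0[OF u(1)] u(2) by (simp only: simp_thms)
    have w: "wv W (inverse (\<phi> ?u)) = - wv W (\<phi> ?u)" by (rule dval_inverse[OF wv(1)[OF W] phi_KL[OF u(1)] nzu])
    have inz: "\<phi> (inv\<^bsub>K\<^esub> ?u) \<noteq> 0"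
      unfolding conjunct2[OF iu] using nzu by (simp only: inverse_nonzero_iff_nonzero simp_thms)
    have inu: "inv\<^bsub>K\<^esub> ?u \<noteq> \<zero>\<^bsub>K\<^esub>"
    proof
      assume "inv\<^bsub>K\<^esub> ?u = \<zero>\<^bsub>K\<^esub>"
      hence "\<phi> (inv\<^bsub>K\<^esub> ?u) = 0" by (simp only: phi_zero)
      with inz show False by (rule notE)
    qed
    have "wv W (\<phi> (inv\<^bsub>K\<^esub> ?u)) = i * wv W (\<phi> t)"
      unfolding conjunct2[OF iu] w u(3) by (simp only: minus_mult_left minus_minus)
    thus ?thesis unfolding eq using conjunct1[OF iu] inu by blast
  next
    case False
    have eq: "t [^]\<^bsub>K\<^esub> i = t [^]\<^bsub>K\<^esub> nat i" by (subst int_pow_def2) (simp only: False if_False)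
    have k: "int (nat i) = i" using False by simp
    show ?thesis unfolding eq by (rule tn[of "nat i", unfolded k])
  qed
qed

lemma place_ideal_wv:
  assumes V: "V \<in> places K kk" and a: "a \<in> carrier K"
  shows "a \<in> place_ideal K V \<longleftrightarrow> a = \<zero>\<^bsub>K\<^esub> \<or> 0 < wv (\<phi> ` V) (\<phi> a)"
  unfolding place_ideal_iff(1)[OF V a] mideal_wv[OF placeD(2)[OF V]] using phi_KL[OF a] phi_eq_0[OF a] by blast

lemma place_mem_wv:
  assumes V: "V \<in> places K kk" and a: "a \<in> carrier K" "a \<noteq> \<zero>\<^bsub>K\<^esub>"
  shows "a \<in> V \<longleftrightarrow> 0 \<le> wv (\<phi> ` V) (\<phi> a)"
  using wv_nonneg_iff[OF placeD(2)[OF V] phi_KL[OF a(1)]] phi_eq_0[OF a(1)] a(2) phi_img[OF placeD(1)[OF V] a(1)] by blast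

section \<open>Orders, degrees and divisors under the isomorphism\<close>

lemma uniformizer_iff:
  assumes V: "V \<in> places K kk" and a: "a \<in> carrier K"
  shows "uniformizer K V a \<longleftrightarrow> a \<noteq> \<zero>\<^bsub>K\<^esub> \<and> wv (\<phi> ` V) (\<phi> a) = 1"
proof -
  interpret K: field K by (rule field_K)
  note P = placeD[OF V]
  let ?w = "\<lambda>a. wv (\<phi> ` V) (\<phi> a)"
  have PIdl: "PIdl\<^bsub>K\<lparr>carrier := V\<rparr>\<^esub> a = {b \<otimes>\<^bsub>K\<^esub> a |b. b \<in> V}" unfolding cgenideal_def by simp
  have wm: "?w (b \<otimes>\<^bsub>K\<^esub> c) = ?w b + ?w c" if "b \<in> carrier K" "c \<in> carrier K" "b \<noteq> \<zero>\<^bsub>K\<^esub>" "c \<noteq> \<zero>\<^bsub>K\<^esub>" for b c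
    unfolding phi_mult[OF that(1,2)] by (intro wv_mult P phi_KL that; use phi_eq_0 that in blast)
  have V1: "\<one>\<^bsub>K\<^esub> \<in> V" by (rule subringE(3)[OF P(3)])
  show ?thesis
  proof
    assume u: "uniformizer K V a"
    hence eq: "{b \<otimes>\<^bsub>K\<^esub> a |b. b \<in> V} = place_ideal K V" unfolding uniformizer_def PIdl by blast
    obtain s where s: "s \<in> KL" "s \<noteq> 0" "wv (\<phi> ` V) s = 1" using wv_exists[OF P(2), of 1] by blast
    obtain c where c: "c \<in> carrier K" "\<phi> c = s" using phi_surj[OF s(1)] by blast
    have "c \<in> place_ideal K V" unfolding place_ideal_wv[OF V c(1)] c(2) s(3) by simp
    then obtain b where b: "b \<in> V" "c = b \<otimes>\<^bsub>K\<^esub> a" unfolding eq[symmetric] by blast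
    have bc: "b \<in> carrier K" using b P(1) by blast
    have c0: "c \<noteq> \<zero>\<^bsub>K\<^esub>" using c s(2) phi_zero by auto
    have nz: "b \<noteq> \<zero>\<^bsub>K\<^esub>" "a \<noteq> \<zero>\<^bsub>K\<^esub>" using c0 b(2) a bc by auto
    have "?w b + ?w a = 1" using wm[OF bc a nz] b(2) c(2) s(3) by simp
    moreover have "0 \<le> ?w b" using place_mem_wv[OF V bc nz(1)] b(1) by blast
    moreover have "a \<in> place_ideal K V" unfolding eq[symmetric] using V1 a by (intro CollectI exI[of _ "\<one>\<^bsub>K\<^esub>"]) simp
    hence "0 < ?w a" using place_ideal_wv[OF V a] nz(2) by blast
    ultimately show "a \<noteq> \<zero>\<^bsub>K\<^esub> \<and> ?w a = 1" using nz(2) by linarith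
  next
    assume u: "a \<noteq> \<zero>\<^bsub>K\<^esub> \<and> ?w a = 1"
    have aV: "a \<in> V" using place_mem_wv[OF V a] u by simp
    have "{b \<otimes>\<^bsub>K\<^esub> a |b. b \<in> V} = place_ideal K V"
    proof (rule equalityI; rule subsetI)
      fix c assume "c \<in> {b \<otimes>\<^bsub>K\<^esub> a |b. b \<in> V}"
      then obtain b where b: "b \<in> V" "c = b \<otimes>\<^bsub>K\<^esub> a" by blast
      have bc: "b \<in> carrier K" using b P(1) by blast
      have cc: "c \<in> carrier K" unfolding b(2) by (rule carr(3)[OF bc a])
      show "c \<in> place_ideal K V"
      proof (cases "b = \<zero>\<^bsub>K\<^esub>")
        case True
        hence "c = \<zero>\<^bsub>K\<^esub>" using b(2) a by simp
        thus ?thesis using place_ideal_wv[OF V cc] by blast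
      next
        case False
        have "0 \<le> ?w b" using place_mem_wv[OF V bc False] b(1) by blast
        hence "0 < ?w c" unfolding b(2) using wm[OF bc a False] u by simp
        thus ?thesis using place_ideal_wv[OF V cc] by blast
      qed
    next
      fix c assume c: "c \<in> place_ideal K V"
      have cc: "c \<in> carrier K" using c place_ideal_subset P(1) by blast
      have ia: "inv\<^bsub>K\<^esub> a \<in> carrier K" "\<phi> (inv\<^bsub>K\<^esub> a) = inverse (\<phi> a)" using phi_inv[OF a] u by blast+
      define b where "b = c \<otimes>\<^bsub>K\<^esub> inv\<^bsub>K\<^esub> a"
      have bc: "b \<in> carrier K" unfolding b_def by (rule carr(3)[OF cc ia(1)])
      have "\<phi> (b \<otimes>\<^bsub>K\<^esub> a) = \<phi> c" unfolding b_def phi_mult[OF carr(3)[OF cc ia(1)] a] phi_mult[OF cc ia(1)] ia(2)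
        using phi_eq_0[OF a] u by simp
      hence eq: "c = b \<otimes>\<^bsub>K\<^esub> a" using phi_inj[OF carr(3)[OF bc a] cc] by simp
      have "b \<in> V"
      proof (cases "b = \<zero>\<^bsub>K\<^esub>")
        case True
        thus ?thesis using subringE(2)[OF P(3)] by simp
      next
        case False
        have "c \<noteq> \<zero>\<^bsub>K\<^esub>"
        proof
          assume "c = \<zero>\<^bsub>K\<^esub>"
          hence "b \<otimes>\<^bsub>K\<^esub> a = \<zero>\<^bsub>K\<^esub>" unfolding eq .
          from K.integral[OF this bc a] show False using False u by blast
        qed
        hence "0 < ?w c" using c place_ideal_wv[OF V cc] by blast
        hence "0 \<le> ?w b" using wm[OF bc a False] u eq by simp
        thus ?thesis using place_mem_wv[OF V bc False] by blast
      qed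
      thus "c \<in> {b \<otimes>\<^bsub>K\<^esub> a |b. b \<in> V}" using eq by blast
    qed
    thus "uniformizer K V a" unfolding uniformizer_def PIdl using aV by blast
  qed
qed

text \<open>Uniformizers are the elements of order 1 and units those of order 0, so any
  factorisation of z into a unit and a power of a uniformizer has the order of z as its
  exponent.\<close>

lemma place_ord_eq:
  assumes V: "V \<in> places K kk" and z: "z \<in> carrier K" "z \<noteq> \<zero>\<^bsub>K\<^esub>"
  shows "place_ord K V z = wv (\<phi> ` V) (\<phi> z)"
  unfolding place_ord_def
proof (rule the_equality)
  interpret K: field K by (rule field_K)
  note P = placeD[OF V]
  let ?w = "\<lambda>a. wv (\<phi> ` V) (\<phi> a)"
  have wm: "?w (b \<otimes>\<^bsub>K\<^esub> c) = ?w b + ?w c" if "b \<in> carrier K" "c \<in> carrier K" "b \<noteq> \<zero>\<^bsub>K\<^esub>" "c \<noteq> \<zero>\<^bsub>K\<^esub>" for b c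
    unfolding phi_mult[OF that(1,2)] by (intro wv_mult P phi_KL that; use phi_eq_0 that in blast)
  have unit: "a \<in> place_units K V \<longleftrightarrow> a \<noteq> \<zero>\<^bsub>K\<^esub> \<and> ?w a = 0" if a: "a \<in> carrier K" for a
  proof (cases "a = \<zero>\<^bsub>K\<^esub>")
    case True
    thus ?thesis using place_ideal_iff(2)[OF V a] phi_zero by simp
  next
    case False
    have nz: "\<phi> a \<noteq> 0" using phi_eq_0[OF a] False by blast
    have "\<phi> a \<in> \<phi> ` V \<longleftrightarrow> 0 \<le> ?w a" by (rule wv_nonneg_iff[OF P(2) phi_KL[OF a] nz])
    moreover have "inverse (\<phi> a) \<in> \<phi> ` V \<longleftrightarrow> 0 \<le> wv (\<phi> ` V) (inverse (\<phi> a))"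
      by (rule wv_nonneg_iff[OF P(2) KL_inverse[OF phi_KL[OF a]]]) (use nz in simp)
    moreover have "wv (\<phi> ` V) (inverse (\<phi> a)) = - ?w a" by (rule dval_inverse[OF wv(1)[OF P(2)] phi_KL[OF a] nz])
    ultimately show ?thesis using place_ideal_iff(2)[OF V a] False nz by auto
  qed
  obtain s where s: "s \<in> KL" "s \<noteq> 0" "wv (\<phi> ` V) s = 1" using wv_exists[OF P(2), of 1] by blast
  obtain t where t: "t \<in> carrier K" "\<phi> t = s" using phi_surj[OF s(1)] by blast
  have t0: "t \<noteq> \<zero>\<^bsub>K\<^esub>" using t s(2) phi_zero by auto
  define w where "w = t [^]\<^bsub>K\<^esub> (?w z)"
  have w: "w \<in> carrier K" "w \<noteq> \<zero>\<^bsub>K\<^esub>" "?w w = ?w z" using wv_int_pow[OF P(2) t(1) t0, of "?w z"] t(2) s(3) unfolding w_def by simp_all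
  have iw: "inv\<^bsub>K\<^esub> w \<in> carrier K" "\<phi> (inv\<^bsub>K\<^esub> w) = inverse (\<phi> w)" using phi_inv[OF w(1,2)] by blast+
  define u where "u = z \<otimes>\<^bsub>K\<^esub> inv\<^bsub>K\<^esub> w"
  have uc: "u \<in> carrier K" unfolding u_def by (rule carr(3)[OF z(1) iw(1)])
  have "\<phi> (u \<otimes>\<^bsub>K\<^esub> w) = \<phi> z" unfolding u_def phi_mult[OF carr(3)[OF z(1) iw(1)] w(1)] phi_mult[OF z(1) iw(1)] iw(2)
    using phi_eq_0[OF w(1)] w(2) by simp
  hence eq: "z = u \<otimes>\<^bsub>K\<^esub> w" using phi_inj[OF carr(3)[OF uc w(1)] z(1)] by simp
  have u0: "u \<noteq> \<zero>\<^bsub>K\<^esub>" using eq z(2) w(1) by auto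
  have "?w u = 0" using wm[OF uc w(1) u0 w(2)] w(3) eq by simp
  hence "u \<in> place_units K V" using unit[OF uc] u0 by blast
  moreover have "uniformizer K V t" unfolding uniformizer_iff[OF V t(1)] using t0 t(2) s(3) by simp
  ultimately show "\<exists>t u. uniformizer K V t \<and> u \<in> place_units K V \<and> z = u \<otimes>\<^bsub>K\<^esub> t [^]\<^bsub>K\<^esub> (?w z)" using eq unfolding w_def by blast
  fix i :: int assume "\<exists>t u. uniformizer K V t \<and> u \<in> place_units K V \<and> z = u \<otimes>\<^bsub>K\<^esub> t [^]\<^bsub>K\<^esub> i"
  then obtain t u where tu: "uniformizer K V t" "u \<in> place_units K V" "z = u \<otimes>\<^bsub>K\<^esub> t [^]\<^bsub>K\<^esub> i" by blast
  have tc: "t \<in> carrier K" using tu(1) P(1) unfolding uniformizer_def by blast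
  have t1: "t \<noteq> \<zero>\<^bsub>K\<^esub>" "?w t = 1" using uniformizer_iff[OF V tc] tu(1) by blast+
  have uc: "u \<in> carrier K" using tu(2) P(1) unfolding place_units_def Units_def by auto
  have u1: "u \<noteq> \<zero>\<^bsub>K\<^esub>" "?w u = 0" using unit[OF uc] tu(2) by blast+
  note ti = wv_int_pow[OF P(2) tc t1(1), of i]
  show "i = ?w z" unfolding tu(3) using wm[OF uc _ u1(1), of "t [^]\<^bsub>K\<^esub> i"] ti u1(2) t1(2) by simp
qed

lemma card_kk: "finite kk" "card kk = r"
proof -
  have inj: "inj_on cst (GF J)"
  proof (rule inj_onI)
    fix u v assume uv: "u \<in> GF J" "v \<in> GF J" "cst u = cst v"
    hence "cst (u - v) = 0" unfolding cst_diff by simp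
    hence "[:u - v:] = 0" using xi_inj by blast
    thus "u = v" by simp
  qed
  have ik: "inj_on \<phi> kk" by (rule inj_on_subset[OF bij_betw_imp_inj_on[OF phi_bij] kk(1)])
  have "finite (\<phi> ` kk)" unfolding kk(2) by (rule finite_imageI[OF card_GF_J(2)])
  thus "finite kk" using ik by (rule finite_imageD)
  show "card kk = r" using card_image[OF ik] card_image[OF inj] unfolding kk(2) card_GF_J by simp
qed

text \<open>\<open>h'\<close> and \<open>rv\<close> have the same fibres on \<open>V\<close>, so the
  residue ring has r^n elements with n = dg; over the image of \<open>kk\<close>, which has r
  elements, the cardinality determines the dimension.\<close>

lemma place_degree_eq:
  assumes V: "V \<in> places K kk"
  shows "place_degree K kk V = dg (\<phi> ` V)"
proof -
  interpret K: field K by (rule field_K)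
  note P = placeD[OF V]
  define A where "A = K\<lparr>carrier := V\<rparr>"
  define I where "I = place_ideal K V"
  define \<kappa> where "\<kappa> = A Quot I"
  define h' where "h' = (\<lambda>c. I +>\<^bsub>A\<^esub> c)"
  have A: "carrier A = V" "monoid.mult A = monoid.mult K" "ring.add A = ring.add K" "\<one>\<^bsub>A\<^esub> = \<one>\<^bsub>K\<^esub>" "\<zero>\<^bsub>A\<^esub> = \<zero>\<^bsub>K\<^esub>"
    unfolding A_def by simp_all
  interpret A: ring A unfolding A_def by (rule K.subring_is_ring[OF P(3)])
  have car: "a \<in> carrier K" if "a \<in> V" for a using P(1) that by blast
  have Am: "\<ominus>\<^bsub>A\<^esub> a = a" if a: "a \<in> V" for a
  proof -
    have "a \<oplus>\<^bsub>K\<^esub> a = \<zero>\<^bsub>K\<^esub>" using K.l_neg[OF car[OF a]] phi_uminus[OF car[OF a]] by simp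
    thus ?thesis using A.minus_equality[of a a] a unfolding A by simp
  qed
  have IV: "I \<subseteq> V" unfolding I_def by (rule place_ideal_subset)
  have Iiff: "a \<in> I \<longleftrightarrow> \<phi> a \<in> mideal (\<phi> ` V)" if "a \<in> V" for a unfolding I_def by (rule place_ideal_iff(1)[OF V car[OF that]])
  note S = subringE[OF P(3)]
  have I0: "\<zero>\<^bsub>K\<^esub> \<in> I" unfolding Iiff[OF S(2)] phi_zero mideal_wv[OF P(2)] using KL_01(1) by blast
  have Iadd: "a \<oplus>\<^bsub>K\<^esub> b \<in> I" if ab: "a \<in> I" "b \<in> I" for a b
  proof -
    have ab': "a \<in> V" "b \<in> V" using ab IV by blast+
    show ?thesis unfolding Iiff[OF S(7)[OF ab']] phi_add[OF car[OF ab'(1)] car[OF ab'(2)]]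
      using ab Iiff ab' by (intro mideal_add[OF P(2)]) blast+
  qed
  have Imult: "a \<otimes>\<^bsub>K\<^esub> b \<in> I" "b \<otimes>\<^bsub>K\<^esub> a \<in> I" if ab: "a \<in> I" "b \<in> V" for a b
  proof -
    have a: "a \<in> V" using ab IV by blast
    have "\<phi> a * \<phi> b \<in> mideal (\<phi> ` V)" by (rule mideal_mult[OF P(2)]) (use ab Iiff[OF a] in blast)+
    thus "a \<otimes>\<^bsub>K\<^esub> b \<in> I" unfolding Iiff[OF S(6)[OF a ab(2)]] phi_mult[OF car[OF a] car[OF ab(2)]] .
    thus "b \<otimes>\<^bsub>K\<^esub> a \<in> I" using K.m_comm[OF car[OF a] car[OF ab(2)]] by simp
  qed
  have ideal: "ideal I A"
  proof (rule idealI)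
    show "ring A" by (rule A.ring_axioms)
    show "subgroup I (add_monoid A)"
    proof (rule A.add.subgroupI)
      show "I \<subseteq> carrier A" "I \<noteq> {}" using IV I0 unfolding A by blast+
      show "\<ominus>\<^bsub>A\<^esub> a \<in> I" if "a \<in> I" for a using Am[of a] that IV by auto
      show "a \<oplus>\<^bsub>A\<^esub> b \<in> I" if "a \<in> I" "b \<in> I" for a b unfolding A by (rule Iadd[OF that])
    qed
    show "b \<otimes>\<^bsub>A\<^esub> a \<in> I" "a \<otimes>\<^bsub>A\<^esub> b \<in> I" if "a \<in> I" "b \<in> carrier A" for a b using Imult that unfolding A by blast+
  qed
  interpret hh: ring_hom_ring A \<kappa> h' unfolding \<kappa>_def h'_def by (rule ideal.rcos_ring_hom_ring[OF ideal])
  have carr\<kappa>: "carrier \<kappa> = h' ` V" unfolding \<kappa>_def h'_def FactRing_def A_RCOSETS_def' A by auto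
  have heq: "h' a = h' b \<longleftrightarrow> rv (\<phi> ` V) (\<phi> a) = rv (\<phi> ` V) (\<phi> b)" if ab: "a \<in> V" "b \<in> V" for a b
  proof -
    have e1: "a \<ominus>\<^bsub>A\<^esub> b \<in> I \<longleftrightarrow> h' a = h' b" unfolding h'_def
      by (rule A.quotient_eq_iff_same_a_r_cos[OF ideal]) (use ab A in simp_all)
    have e2: "a \<ominus>\<^bsub>A\<^esub> b = a \<oplus>\<^bsub>K\<^esub> b" unfolding a_minus_def Am[OF ab(2)] A ..
    have e3: "a \<oplus>\<^bsub>K\<^esub> b \<in> I \<longleftrightarrow> \<phi> a - \<phi> b \<in> mideal (\<phi> ` V)"
      unfolding Iiff[OF S(7)[OF ab]] phi_add[OF car[OF ab(1)] car[OF ab(2)]] char2_diff[OF two_l] ..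
    show ?thesis
      by (rule trans[OF e1[symmetric, unfolded e2] trans[OF e3 rv_eq_iff[OF P(2) imageI[OF ab(1)] imageI[OF ab(2)], symmetric]]])
  qed
  have imV: "(\<lambda>a. rv (\<phi> ` V) (\<phi> a)) ` V = rv (\<phi> ` V) ` \<phi> ` V" by (simp add: image_image)
  have fin: "finite ((\<lambda>a. rv (\<phi> ` V) (\<phi> a)) ` V)" unfolding imV by (rule rv_image(1)[OF P(2)])
  have card\<kappa>: "finite (carrier \<kappa>)" "card (carrier \<kappa>) = r ^ dg (\<phi> ` V)"
    unfolding carr\<kappa> using card_image_cong_iff[OF heq fin] unfolding imV rv_image(2)[OF P(2)] by blast+
  have kkinj: "inj_on h' kk"
  proof (rule inj_onI)
    fix a b assume ab: "a \<in> kk" "b \<in> kk" "h' a = h' b"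
    have abV: "a \<in> V" "b \<in> V" using ab P(4) by blast+
    obtain u v where uv: "u \<in> GF J" "v \<in> GF J" "\<phi> a = cst u" "\<phi> b = cst v" using kk(2) ab by blast
    have "\<phi> a - \<phi> b \<in> mideal (\<phi> ` V)" using heq[OF abV] ab(3) rv_eq_iff[OF P(2) imageI[OF abV(1)] imageI[OF abV(2)]] by blast
    hence "u - v = 0" unfolding uv(3,4) cst_diff[symmetric] by (intro cst_mideal[OF P(2)] subring_setD(6)[OF sub_k] uv)
    hence "\<phi> a = \<phi> b" using uv by simp
    thus "a = b" using phi_inj car abV by blast
  qed
  have "field (A\<lparr>carrier := kk\<rparr>)" unfolding A_def using K.subfield_iff(2)[OF subfield_kk] by simp
  hence sA: "subfield kk A" using A.subfield_iff(1)[of kk] P(4) A(1) by simp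
  have "h' \<one>\<^bsub>A\<^esub> \<noteq> h' \<zero>\<^bsub>A\<^esub>"
  proof
    assume "h' \<one>\<^bsub>A\<^esub> = h' \<zero>\<^bsub>A\<^esub>"
    hence "\<one>\<^bsub>K\<^esub> \<in> kk \<Longrightarrow> \<zero>\<^bsub>K\<^esub> \<in> kk \<Longrightarrow> \<one>\<^bsub>K\<^esub> = \<zero>\<^bsub>K\<^esub>" unfolding A using inj_onD[OF kkinj] by blast
    thus False using subringE(2,3)[OF subfieldE(1)[OF subfield_kk]] K.one_not_zero by blast
  qed
  hence "\<one>\<^bsub>\<kappa>\<^esub> \<noteq> \<zero>\<^bsub>\<kappa>\<^esub>" using hh.hom_one hh.hom_zero by simp
  hence s\<kappa>: "subfield (h' ` kk) \<kappa>" using hh.img_is_subfield(2)[OF sA] by blast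
  have "card (carrier \<kappa>) = card (h' ` kk) ^ ring.dim \<kappa> (h' ` kk) (carrier \<kappa>)"
    by (rule ring.card_finite_subalgebra(2)[OF hh.S.ring_axioms s\<kappa> finite_imageI[OF card_kk(1)]
        hh.S.carrier_is_subalgebra[OF subfieldE(3)[OF s\<kappa>]] card\<kappa>(1)])
  hence "r ^ dg (\<phi> ` V) = r ^ ring.dim \<kappa> (h' ` kk) (carrier \<kappa>)"
    unfolding card\<kappa>(2) card_image[OF kkinj] card_kk(2) .
  hence "dg (\<phi> ` V) = ring.dim \<kappa> (h' ` kk) (carrier \<kappa>)" using r_power_eq by blast
  thus ?thesis unfolding place_degree_def Let_def \<kappa>_def h'_def I_def A_def by simp
qed

lemma inj_on_places: "inj_on ((`) \<phi>) (places K kk)"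
  by (rule inj_on_inverseI[of _ pull]) (use pull(2) placeD(1) in blast)

lemma image_places: "(`) \<phi> ` places K kk = {W. tplace W}"
proof (rule equalityI; rule subsetI)
  fix W assume "W \<in> (`) \<phi> ` places K kk"
  thus "W \<in> {W. tplace W}" using placeD(2) by auto
next
  fix W assume "W \<in> {W. tplace W}"
  hence "pull W \<in> places K kk" "W = \<phi> ` pull W" using places_pull by auto
  thus "W \<in> (`) \<phi> ` places K kk" by blast
qed

lemma card_rational_points: "card (rational_points K kk) = card {W. tplace W \<and> dg W = 1}"
proof -
  have "(`) \<phi> ` rational_points K kk = {W. tplace W \<and> dg W = 1}"
  proof (rule equalityI; rule subsetI)
    fix W assume "W \<in> (`) \<phi> ` rational_points K kk"
    then obtain V where "V \<in> places K kk" "place_degree K kk V = 1" "W = \<phi> ` V" unfolding rational_points_def by blast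
    thus "W \<in> {W. tplace W \<and> dg W = 1}" using placeD(2) place_degree_eq by auto
  next
    fix W assume "W \<in> {W. tplace W \<and> dg W = 1}"
    hence W: "pull W \<in> places K kk" "W = \<phi> ` pull W" "dg W = 1" using places_pull by auto
    hence "place_degree K kk (pull W) = 1" using place_degree_eq[OF W(1)] by simp
    thus "W \<in> (`) \<phi> ` rational_points K kk" unfolding rational_points_def using W(1,2) by blast
  qed
  moreover have "inj_on ((`) \<phi>) (rational_points K kk)"
    by (rule inj_on_subset[OF inj_on_places]) (auto simp: rational_points_def)
  ultimately show ?thesis using card_image by metis
qed

lemma RR_cst:
  assumes "z \<in> RR D" "u \<in> GF J"
  shows "cst u * z \<in> RR D"
proof (rule RR_I)
  show "cst u * z \<in> KL" by (intro KL_mult cst_in_KL assms RR_D(1)[OF assms(1)])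
  fix V assume nz: "cst u * z \<noteq> 0" and V: "tplace V"
  have nz': "cst u \<noteq> 0" "z \<noteq> 0" "u \<noteq> 0" using nz cst_0 by auto
  have "wv V (cst u) = 0" using wv(1)[OF V] assms(2) nz'(3) unfolding dval_def by blast
  thus "- D V \<le> wv V (cst u * z)"
    using wv_mult[OF V cst_in_KL[OF assms(2)] RR_D(1)[OF assms(1)] nz'(1,2)] RR_D(2)[OF assms(1) nz'(2) V] by simp
qed

text \<open>The cut-off matters because \<open>pull\<close> may also send sets that stick out of
  \<open>KL\<close> to places.\<close>

definition tD :: "('c set \<Rightarrow> int) \<Rightarrow> 'l set \<Rightarrow> int" where
  "tD D W = (if tplace W then D (pull W) else 0)"

lemma tD_image: "V \<in> places K kk \<Longrightarrow> tD D (\<phi> ` V) = D V"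
  unfolding tD_def using placeD(2) pull(2)[OF placeD(1)] by simp

lemma riemann_roch_image: "\<phi> ` riemann_roch_space K kk D = RR (tD D)"
proof (rule equalityI; rule subsetI)
  fix z assume "z \<in> \<phi> ` riemann_roch_space K kk D"
  then obtain a where a: "a \<in> carrier K" "a \<noteq> \<zero>\<^bsub>K\<^esub> \<longrightarrow> (\<forall>V \<in> places K kk. place_ord K V a \<ge> - D V)" "z = \<phi> a"
    unfolding riemann_roch_space_def by blast
  show "z \<in> RR (tD D)"
  proof (rule RR_I)
    show "z \<in> KL" unfolding a(3) by (rule phi_KL[OF a(1)])
    fix W assume z: "z \<noteq> 0" and W: "tplace W"
    have a0: "a \<noteq> \<zero>\<^bsub>K\<^esub>" using z a(3) phi_zero by auto
    note PW = places_pull(1)[OF W]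
    have "- D (pull W) \<le> place_ord K (pull W) a" using a(2) a0 PW by blast
    thus "- tD D W \<le> wv W z" unfolding place_ord_eq[OF PW a(1) a0] places_pull(2)[OF W] tD_def a(3) using W by simp
  qed
next
  fix z assume z: "z \<in> RR (tD D)"
  obtain a where a: "a \<in> carrier K" "\<phi> a = z" using phi_surj[OF RR_D(1)[OF z]] by blast
  have "- D V \<le> place_ord K V a" if a0: "a \<noteq> \<zero>\<^bsub>K\<^esub>" and V: "V \<in> places K kk" for V
  proof -
    have "z \<noteq> 0" using a phi_eq_0[OF a(1)] a0 by simp
    from RR_D(2)[OF z this placeD(2)[OF V]] show ?thesis unfolding place_ord_eq[OF V a(1) a0] tD_image[OF V] a(2) .
  qed
  hence "a \<in> riemann_roch_space K kk D" unfolding riemann_roch_space_def using a(1) by blast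
  thus "z \<in> \<phi> ` riemann_roch_space K kk D" using a(2) by blast
qed

lemma divisor_tD:
  assumes D: "D \<in> divisors K kk"
  shows "finite {W. tD D W \<noteq> 0}" "{W. tD D W \<noteq> 0} \<subseteq> {W. tplace W}" "ddeg (tD D) = divisor_degree K kk D"
proof -
  have D: "finite {V. D V \<noteq> 0}" "{V. D V \<noteq> 0} \<subseteq> places K kk" using D unfolding divisors_def by blast+
  have im: "{W. tD D W \<noteq> 0} = (`) \<phi> ` {V. D V \<noteq> 0}"
  proof (rule equalityI; rule subsetI)
    fix W assume W: "W \<in> {W. tD D W \<noteq> 0}"
    hence W': "tplace W" "D (pull W) \<noteq> 0" unfolding tD_def by (auto split: if_splits)
    thus "W \<in> (`) \<phi> ` {V. D V \<noteq> 0}" using places_pull(2)[OF W'(1)] by (intro image_eqI[of _ _ "pull W"]) auto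
  next
    fix W assume "W \<in> (`) \<phi> ` {V. D V \<noteq> 0}"
    then obtain V where V: "D V \<noteq> 0" "W = \<phi> ` V" by blast
    hence "tD D W = D V" using tD_image D(2) by blast
    thus "W \<in> {W. tD D W \<noteq> 0}" using V(1) by simp
  qed
  show "finite {W. tD D W \<noteq> 0}" unfolding im by (rule finite_imageI[OF D(1)])
  show "{W. tD D W \<noteq> 0} \<subseteq> {W. tplace W}" unfolding tD_def by auto
  have "ddeg (tD D) = (\<Sum>V | D V \<noteq> 0. tD D (\<phi> ` V) * int (dg (\<phi> ` V)))"
    unfolding ddeg_def im by (subst sum.reindex[OF inj_on_subset[OF inj_on_places D(2)]]) simp
  also have "\<dots> = divisor_degree K kk D"
    unfolding divisor_degree_def
  proof (rule sum.cong[OF refl])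
    fix V assume "V \<in> {V. D V \<noteq> 0}"
    hence V: "V \<in> places K kk" using D(2) by blast
    show "tD D (\<phi> ` V) * int (dg (\<phi> ` V)) = D V * int (place_degree K kk V)"
      unfolding tD_image[OF V] place_degree_eq[OF V] ..
  qed
  finally show "ddeg (tD D) = divisor_degree K kk D" .
qed

lemma card_RR_dim:
  assumes "finite (RR (tD D))"
  shows "card (RR (tD D)) = r ^ ring.dim K kk (riemann_roch_space K kk D)"
proof -
  interpret K: field K by (rule field_K)
  define S where "S = riemann_roch_space K kk D"
  have Sc: "S \<subseteq> carrier K" unfolding S_def riemann_roch_space_def by blast
  have im: "\<phi> ` S = RR (tD D)" unfolding S_def by (rule riemann_roch_image)
  have mem: "a \<in> S \<longleftrightarrow> \<phi> a \<in> RR (tD D)" if "a \<in> carrier K" for a unfolding im[symmetric] using phi_img[OF Sc that] by blast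
  have inj: "inj_on \<phi> S" by (rule inj_on_subset[OF bij_betw_imp_inj_on[OF phi_bij] Sc])
  have fin: "finite S" using assms unfolding im[symmetric] by (rule finite_imageD[OF _ inj])
  have "subgroup S (add_monoid K)"
  proof (rule K.add.subgroupI)
    show "S \<subseteq> carrier K" by (rule Sc)
    have "\<zero>\<^bsub>K\<^esub> \<in> S" unfolding S_def riemann_roch_space_def by simp
    thus "S \<noteq> {}" by blast
    show "\<ominus>\<^bsub>K\<^esub> a \<in> S" if "a \<in> S" for a using phi_uminus[of a] that Sc by auto
    show "a \<oplus>\<^bsub>K\<^esub> b \<in> S" if ab: "a \<in> S" "b \<in> S" for a b
    proof -
      have c: "a \<in> carrier K" "b \<in> carrier K" using ab Sc by blast+
      have "\<phi> a - \<phi> b \<in> RR (tD D)" by (rule RR_diff) (use mem c ab in blast)+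
      thus ?thesis unfolding mem[OF carr(4)[OF c]] phi_add[OF c] char2_diff[OF two_l] .
    qed
  qed
  moreover have "c \<otimes>\<^bsub>K\<^esub> a \<in> S" if ca: "c \<in> kk" "a \<in> S" for a c
  proof -
    have cc: "c \<in> carrier K" "a \<in> carrier K" using ca Sc kk(1) by blast+
    obtain u where u: "u \<in> GF J" "\<phi> c = cst u" using ca(1) kk(2) by blast
    show ?thesis unfolding mem[OF carr(3)[OF cc]] phi_mult[OF cc] u(2)
      by (rule RR_cst[OF _ u(1)]) (use mem[OF cc(2)] ca in blast)
  qed
  ultimately have "subalgebra kk S K" by (intro subalgebra.intro subalgebra_axioms.intro)
  from K.card_finite_subalgebra(2)[OF subfield_kk card_kk(1) this fin]
  have "card S = r ^ ring.dim K kk S" unfolding card_kk(2) .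
  thus ?thesis unfolding im[symmetric] card_image[OF inj] unfolding S_def .
qed

text \<open>The greatest value exists because \<open>riemann\<close> bounds all candidates and
  \<open>riemann_equality\<close> attains the bound.\<close>

lemma genus_eq: "genus K kk = int genus_g"
  unfolding genus_def
proof (rule Greatest_equality)
  obtain D' d where D': "finite {V. D' V \<noteq> 0}" "{V. D' V \<noteq> 0} \<subseteq> {V. tplace V}" "card (RR D') = r ^ d"
    "ddeg D' + 1 - int d = int genus_g"
    using riemann_equality by blast
  define D where "D V = (if V \<in> places K kk then D' (\<phi> ` V) else 0)" for V
  have tD: "tD D = D'"
  proof
    fix W
    show "tD D W = D' W"
    proof (cases "tplace W")
      case True
      thus ?thesis unfolding tD_def D_def using places_pull[OF True] by simp
    next
      case False
      hence "D' W = 0" using D'(2) by blast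
      thus ?thesis unfolding tD_def using False by simp
    qed
  qed
  have sub: "{V. D V \<noteq> 0} \<subseteq> places K kk" unfolding D_def by auto
  have "(`) \<phi> ` {V. D V \<noteq> 0} \<subseteq> {V. D' V \<noteq> 0}" unfolding D_def by auto
  hence "finite {V. D V \<noteq> 0}"
    using finite_imageD[OF finite_subset[OF _ D'(1)] inj_on_subset[OF inj_on_places sub]] by blast
  hence DD: "D \<in> divisors K kk" unfolding divisors_def using sub by blast
  have "r ^ d = r ^ ring.dim K kk (riemann_roch_space K kk D)"
    using card_RR_dim[of D] riemann(1)[OF D'(1,2)] D'(3) unfolding tD by simp
  hence "d = ring.dim K kk (riemann_roch_space K kk D)" using r_power_eq by blast
  hence "int genus_g = divisor_degree K kk D + 1 - int (ring.dim K kk (riemann_roch_space K kk D))"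
    using D'(4) divisor_tD(3)[OF DD] unfolding tD by simp
  thus "\<exists>D\<in>divisors K kk. int genus_g = divisor_degree K kk D + 1 - int (ring.dim K kk (riemann_roch_space K kk D))"
    using DD by (rule bexI)
next
  fix g assume "\<exists>D\<in>divisors K kk. g = divisor_degree K kk D + 1 - int (ring.dim K kk (riemann_roch_space K kk D))"
  then obtain D where D: "D \<in> divisors K kk" "g = divisor_degree K kk D + 1 - int (ring.dim K kk (riemann_roch_space K kk D))" by blast
  note t = divisor_tD[OF D(1)]
  show "g \<le> int genus_g"
    using riemann(2)[OF t(1,2) card_RR_dim[OF riemann(1)[OF t(1,2)]]] D(2) t(3) by simp
qed

text \<open>The powers of t lie in a finite set, so two of them agree, and their orders at infinity
  can agree only if the order of t is 0.\<close>

lemma vinf_finite_subring: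
  assumes "finite T" "subring_set T" "t \<in> T" "t \<in> KL" "t \<noteq> 0"
  shows "vinf t = 0"
proof -
  have "(\<lambda>i. t ^ i) ` UNIV \<subseteq> T" using subring_setD(7)[OF assms(2,3)] by blast
  hence "finite ((\<lambda>i::nat. t ^ i) ` UNIV)" using assms(1) by (rule finite_subset)
  hence "\<not> inj (\<lambda>i::nat. t ^ i)" using finite_imageD infinite_UNIV_nat by blast
  then obtain i j where ij: "i \<noteq> j" "t ^ i = t ^ j" unfolding inj_on_def by blast
  have "int i * vinf t = vinf (t ^ i)" by (rule vinf_power[OF assms(4,5), symmetric])
  also have "\<dots> = vinf (t ^ j)" by (simp only: ij(2))
  also have "\<dots> = int j * vinf t" by (rule vinf_power[OF assms(4,5)])
  finally have "int i * vinf t = int j * vinf t" .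
  thus ?thesis using ij(1) by simp
qed

text \<open>An algebraic z generates a finite ring, whose nonzero elements all have order 0 at
  infinity. The residue field there consists of the constants, so z minus its residue would have
  positive order unless it is 0.\<close>

lemma connected: "geometrically_connected K kk"
  unfolding geometrically_connected_def
proof (intro ballI impI)
  interpret K: field K by (rule field_K)
  fix z assume z: "z \<in> carrier K" and alg: "(ring.algebraic K over kk) z"
  define T where "T = ring.simple_extension K kk z"
  have "K.finite_dimension kk T" unfolding T_def using K.finite_dimension_simple_extension[OF subfield_kk z] alg by blast
  then obtain n where "K.dimension n kk T" unfolding K.finite_dimension_def by blast
  hence fin: "finite T" using K.card_dimension[OF subfield_kk card_kk(1)] by blast
  have sub: "subring T K" unfolding T_def by (rule K.simple_extension_is_subring[OF subfieldE(1)[OF subfield_kk] z])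
  have zT: "z \<in> T" unfolding T_def by (rule K.simple_extension_mem[OF subfieldE(1)[OF subfield_kk] z])
  have kT: "kk \<subseteq> T" unfolding T_def by (rule K.simple_extension_incl[OF kk(1) z])
  have Tc: "T \<subseteq> carrier K" by (rule subringE(1)[OF sub])
  have S: "subring_set (\<phi> ` T)" using subring_transport[OF Tc] sub by blast
  have v0: "vinf t = 0" if "t \<in> \<phi> ` T" "t \<noteq> 0" for t
    using vinf_finite_subring[OF finite_imageI[OF fin] S that(1) _ that(2)] that(1) phi_img_KL[OF Tc] by blast
  have zK: "\<phi> z \<in> KL" by (rule phi_KL[OF z])
  have "\<phi> z \<in> cst ` GF J"
  proof (cases "\<phi> z = 0")
    case True
    thus ?thesis using imageI[OF subring_setD(1)[OF sub_k], of cst] cst_0 by (simp only:)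
  next
    case False
    have "0 \<le> vinf (\<phi> z)" using v0[OF imageI[OF zT] False] by simp
    then obtain u where u: "u \<in> GF J" "\<phi> z = cst u \<or> 0 < vinf (\<phi> z - cst u)" by (rule vinf_residue[OF zK False])
    have "cst u \<in> \<phi> ` T" using u(1) kk(2) kT by blast
    hence "\<phi> z - cst u \<in> \<phi> ` T" by (rule subring_setD(6)[OF S imageI[OF zT]])
    hence "\<phi> z - cst u = 0" using v0[of "\<phi> z - cst u"] u(2) by force
    hence "\<phi> z = cst u" by simp
    thus ?thesis using u(1) by blast
  qed
  thus "z \<in> kk" unfolding kk(2)[symmetric] using phi_img[OF kk(1) z] by blast
qed

lemma function_field_K: "function_field K kk"
proof -
  interpret K: field K by (rule field_K)
  obtain x' where x': "x' \<in> carrier K" "\<phi> x' = x" using phi_surj[OF xi_in_KL[OF x_in_kX]] by blast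
  obtain y' where y': "y' \<in> carrier K" "\<phi> y' = y" using phi_surj[OF y_in_KL] by blast
  have "x' \<notin> kk"
  proof
    assume "x' \<in> kk"
    hence "\<phi> x' \<in> cst ` GF J" unfolding kk(2)[symmetric] by (rule imageI)
    then obtain u where "\<phi> x' = cst u" by blast
    hence "x = cst u" unfolding x'(2) .
    hence "\<xi> ([:0, 1:] - [:u:]) = 0" unfolding rhomD(6)[OF xi] by simp
    hence "[:0, 1:] - [:u:] = 0" by (rule xi_inj)
    thus False by simp
  qed
  \<comment> \<open>Algebraic elements are constants by \<open>connected\<close>, so x is
    transcendental as soon as it is not a constant.\<close>
  hence tr: "(ring.transcendental K over kk) x'"
    using connected x'(1) unfolding geometrically_connected_def over_def by blast
  define F where "F = generate_field K (insert x' kk)"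
  have sub: "insert x' kk \<subseteq> carrier K" using x'(1) kk(1) by blast
  have F: "subfield F K" unfolding F_def by (rule K.generate_field_is_subfield[OF sub])
  note FE = subringE[OF subfieldE(1)[OF F]]
  have Finc: "a \<in> F" if "a \<in> insert x' kk" for a unfolding F_def using that by (rule generate_field.incl)
  have FS: "subring_set (\<phi> ` F)" using subring_transport[OF FE(1)] subfieldE(1)[OF F] by blast
  have kF: "\<phi> ` kk \<subseteq> \<phi> ` F"
  proof (rule image_mono, rule subsetI)
    fix a assume "a \<in> kk"
    thus "a \<in> F" by (intro Finc insertI2)
  qed
  have cF: "cst u \<in> \<phi> ` F" if u: "u \<in> GF J" for u
  proof (rule subsetD[OF kF])
    show "cst u \<in> \<phi> ` kk" unfolding kk(2) by (rule imageI[OF u])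
  qed
  have xF: "x \<in> \<phi> ` F" using imageI[OF Finc[OF insertI1], of \<phi>] unfolding x'(2) .
  have xiF: "\<xi> c \<in> \<phi> ` F" if "c \<in> kX" for c
    using that
  proof (induction c)
    case 0
    show ?case unfolding rhomD(4)[OF xi] by (rule subring_setD(1)[OF FS])
  next
    case (pCons a c)
    have a: "a \<in> GF J" using coeffs_inD[OF pCons.prems, of 0] by simp
    have c: "c \<in> kX" unfolding coeffs_in_def
    proof (rule CollectI, rule allI)
      fix i show "poly.coeff c i \<in> GF J" using coeffs_inD[OF pCons.prems, of "Suc i"] by simp
    qed
    have "pCons a c = [:a:] + [:0, 1:] * c" by simp
    hence "\<xi> (pCons a c) = cst a + x * \<xi> c" by (simp only: rhomD(2)[OF xi] rhomD(3)[OF xi])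
    thus ?case using subring_setD(4)[OF FS cF[OF a] subring_setD(5)[OF FS xF pCons.IH[OF c]]] by (simp only:)
  qed
  have divF: "u / v \<in> \<phi> ` F" if uv: "u \<in> \<phi> ` F" "v \<in> \<phi> ` F" "v \<noteq> 0" for u v
  proof -
    obtain a where a: "a \<in> F" "v = \<phi> a" using uv(2) by blast
    have ac: "a \<in> carrier K" using a FE(1) by blast
    have a0: "a \<noteq> \<zero>\<^bsub>K\<^esub>" using a(2) uv(3) phi_zero by auto
    have "inv\<^bsub>K\<^esub> a \<in> F" using K.subfield_m_inv(1)[OF F] a(1) a0 by blast
    from imageI[OF this, of \<phi>] have "inverse v \<in> \<phi> ` F" unfolding conjunct2[OF phi_inv[OF ac a0]] a(2) .
    thus ?thesis unfolding divide_inverse by (rule subring_setD(5)[OF FS uv(1)])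
  qed
  \<comment> \<open>The powers 1, y, ..., y^(p-1) span the function field over the rational
    functions, by the reduced form of its elements.\<close>
  define Us where "Us = map (\<lambda>i::nat. y' [^]\<^bsub>K\<^esub> i) [0..<p]"
  have Us: "set Us \<subseteq> carrier K" unfolding Us_def using phi_pow[OF y'(1)] by auto
  have span: "z \<in> K.Span F Us" if "z \<in> carrier K" "\<phi> z = (\<Sum>i<j. g i * y ^ i)" "\<And>i. g i \<in> \<phi> ` F" "j \<le> p" for z g j
    using that
  proof (induction j arbitrary: z)
    case 0
    hence "z = \<zero>\<^bsub>K\<^esub>" using phi_eq_0[OF 0(1)] by simp
    thus ?case using K.Span_subgroup_props(2)[OF F Us] by simp
  next
    case (Suc j)
    obtain a where a: "a \<in> F" "g j = \<phi> a" using Suc.prems(3)[of j] by blast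
    have ac: "a \<in> carrier K" using a FE(1) by blast
    note yj = phi_pow[OF y'(1), of j]
    define w where "w = a \<otimes>\<^bsub>K\<^esub> (y' [^]\<^bsub>K\<^esub> j)"
    have wc: "w \<in> carrier K" unfolding w_def using carr(3)[OF ac] yj by blast
    have wphi: "\<phi> w = g j * y ^ j" by (simp only: w_def phi_mult[OF ac conjunct1[OF yj]] conjunct2[OF yj] a(2) y'(2))
    have "y' [^]\<^bsub>K\<^esub> j \<in> set Us" unfolding Us_def using Suc.prems(4) by simp
    hence "y' [^]\<^bsub>K\<^esub> j \<in> K.Span F Us" using K.Span_base_incl[OF F Us] by blast
    hence wS: "w \<in> K.Span F Us" unfolding w_def by (rule K.Span_smult_closed[OF F Us a(1)])
    define v where "v = z \<oplus>\<^bsub>K\<^esub> w"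
    have vc: "v \<in> carrier K" unfolding v_def by (rule carr(4)[OF Suc.prems(1) wc])
    have "\<phi> v = (\<Sum>i<j. g i * y ^ i) + (g j * y ^ j + g j * y ^ j)"
      unfolding v_def phi_add[OF Suc.prems(1) wc] Suc.prems(2) wphi by (simp only: sum.lessThan_Suc add.assoc)
    hence "\<phi> v = (\<Sum>i<j. g i * y ^ i)" unfolding char2_add_self[OF two_l] by simp
    hence vS: "v \<in> K.Span F Us" by (rule Suc.IH[OF vc]) (use Suc.prems in simp_all)
    have "\<phi> (v \<oplus>\<^bsub>K\<^esub> w) = \<phi> z + (\<phi> w + \<phi> w)" unfolding phi_add[OF vc wc] unfolding v_def phi_add[OF Suc.prems(1) wc] by (simp only: add.assoc)
    hence "\<phi> (v \<oplus>\<^bsub>K\<^esub> w) = \<phi> z" unfolding char2_add_self[OF two_l] by simp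
    hence "z = v \<oplus>\<^bsub>K\<^esub> w" using phi_inj[OF carr(4)[OF vc wc] Suc.prems(1)] by simp
    thus ?case using K.Span_subgroup_props(3)[OF F Us vS wS] by simp
  qed
  have "carrier K \<subseteq> K.Span F Us"
  proof
    fix z assume z: "z \<in> carrier K"
    obtain G c where G: "G \<in> kXY" "c \<in> kX" "Rep (\<phi> z) G c" using phi_KL[OF z] by (rule KLE)
    have G': "degree G < p" "c \<noteq> 0" using G(3) unfolding Rep_def by blast+
    have EG: "E G = (\<Sum>i<p. \<xi> (poly.coeff G i) * y ^ i)" using eval2_bound[OF xi, of G p] G'(1) by simp
    have "\<phi> z = (\<Sum>i<p. (\<xi> (poly.coeff G i) / \<xi> c) * y ^ i)"
      unfolding Rep_eq[OF G(3)] EG sum_divide_distrib by (intro sum.cong refl) simp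
    thus "z \<in> K.Span F Us"
      by (rule span[OF z]) (intro divF xiF coeffs_inD[OF G(1)] G(2) xi_nz[OF G'(2)], simp)
  qed
  hence "K.Span F Us = carrier K" using K.Span_subgroup_props(1)[OF F Us] by blast
  hence fd: "K.finite_dimension F (carrier K)" using K.Span_finite_dimension[OF F Us] by simp
  thus ?thesis unfolding function_field_def using field_K subfield_kk x'(1) tr fd[unfolded F_def] by blast
qed

theorem maximal_curve_iff:
  "maximal_curve K kk \<longleftrightarrow> real (1 + card {(a, b). a \<in> GF J \<and> b \<in> GF J \<and> b ^ p + b = poly f a})
     = real r + 1 + 2 * real genus_g * sqrt (real r)"
  unfolding maximal_curve_def Let_def card_rational_points genus_eq card_rational_places card_kk(2)
  using card_kk(1) function_field_K connected by simp

end

subsection \<open>The plane model\<close>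

lemma type_ring_pow: "z [^]\<^bsub>(type_ring :: 'b::field ring)\<^esub> (k::nat) = z ^ k"
proof -
  interpret field "type_ring :: 'b ring" by (rule field_type_ring)
  show ?thesis by (induction k) (simp_all add: mult.commute)
qed

lemma poly_Poly_sum: "poly (Poly xs) z = (\<Sum>i<length xs. xs ! i * z ^ i)" for z :: "'b::comm_ring_1"
proof (induction xs)
  case (Cons a xs)
  have "(\<Sum>i<length (a # xs). (a # xs) ! i * z ^ i) = a + z * (\<Sum>i<length xs. xs ! i * z ^ i)"
    unfolding list.size(4) add_Suc_right add_0_right sum.lessThan_Suc_shift
    by (simp add: sum_distrib_left mult_ac)
  thus ?case using Cons by simp
qed simp

lemma eval_type_ring: "ring.eval (type_ring :: 'b::field ring) q z = poly (Poly (rev q)) z"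
proof -
  interpret field "type_ring :: 'b ring" by (rule field_type_ring)
  show ?thesis
    by (induction q) (simp_all add: Poly_append poly_monom type_ring_pow add.commute)
qed

lemma eval_type_ring_sum: "ring.eval (type_ring :: 'b::field ring) q z = (\<Sum>i<length q. rev q ! i * z ^ i)"
  unfolding eval_type_ring poly_Poly_sum by simp

lemma rhom_sum_lessThan: "rhom g \<Longrightarrow> g (\<Sum>i<(n::nat). a i) = (\<Sum>i<n. g (a i))"
  by (induction n) (simp_all add: rhomD(2,4))

text \<open>\<theta> extends \<xi> to fractions, so that the coefficient field of the rupture ring,
  taken inside the fraction field, maps into the ambient field of \<open>KL\<close>.\<close>

locale rupture_model = as_curve_genus ty m J f \<xi> y l
  for ty :: "'a::field itself" and m J :: nat and f :: "'a poly" and \<xi> :: "'a poly \<Rightarrow> 'l::field" and y :: 'l and l :: nat +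
  fixes \<theta> :: "'a poly fract \<Rightarrow> 'l"
  assumes theta: "rhom \<theta>" and xi_theta: "\<And>c. \<xi> c = \<theta> (to_fract c)"
begin

abbreviation "QF \<equiv> (type_ring :: 'a poly fract ring)"
abbreviation "LF \<equiv> (type_ring :: 'l ring)"
definition S :: "'a poly fract set" where "S = rational_functions (GF J)"
definition UP :: "'a poly fract list ring" where "UP = univ_poly QF S"
definition fp :: "'a poly fract list" where "fp = curve_equation \<Phi>"
definition Ev :: "'a poly fract list \<Rightarrow> 'l" where "Ev q = ring.eval LF (map \<theta> q) y"

lemma theta_nz: "z \<noteq> 0 \<Longrightarrow> \<theta> z \<noteq> 0"
proof
  assume z: "z \<noteq> 0" "\<theta> z = 0"
  have "\<theta> (z * inverse z) = 1" using z(1) rhomD(1)[OF theta] by simp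
  thus False using z(2) unfolding rhomD(3)[OF theta] by simp
qed

lemma theta_divide: "\<theta> (u / v) = \<theta> u / \<theta> v"
proof (cases "v = 0")
  case True
  thus ?thesis using rhomD(4)[OF theta] by simp
next
  case False
  have "\<theta> (u / v) * \<theta> v = \<theta> u" unfolding rhomD(3)[OF theta, symmetric] using False by simp
  thus ?thesis using theta_nz[OF False] by (simp add: field_simps)
qed

lemma generators: "insert (to_fract [:0, 1:]) ((\<lambda>c. to_fract [:c:]) ` GF J) \<subseteq> carrier QF" by simp

lemma S_subfield: "subfield S QF"
  unfolding S_def rational_functions_def by (rule field.generate_field_is_subfield[OF field_type_ring generators])

lemma S_subring_set: "subring_set S" and S_inverse: "z \<in> S \<Longrightarrow> inverse z \<in> S"
proof -
  note E = subringE[OF subfieldE(1)[OF S_subfield], simplified]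
  show "subring_set S" unfolding subring_set_def using E(2,3,5,6,7) type_ring_uminus by (metis (no_types, lifting))
  show "inverse z \<in> S" if z: "z \<in> S" for z
  proof (cases "z = 0")
    case False
    interpret Q: field QF by (rule field_type_ring)
    have "inv\<^bsub>QF\<^esub> z \<in> S" using Q.subfield_m_inv(1)[OF S_subfield] z False by simp
    thus ?thesis using type_ring_inv[OF False] by simp
  qed (use z in simp)
qed

lemma S_gen: "u \<in> kX \<Longrightarrow> to_fract u \<in> S"
proof (induction u)
  case 0
  show ?case using subring_setD(1)[OF S_subring_set] by simp
next
  case (pCons a c)
  have a: "a \<in> GF J" using coeffs_inD[OF pCons.prems, of 0] by simp
  have c: "c \<in> kX" unfolding coeffs_in_def
  proof (rule CollectI, rule allI)
    fix i show "poly.coeff c i \<in> GF J" using coeffs_inD[OF pCons.prems, of "Suc i"] by simp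
  qed
  have gS: "g \<in> S" if "g \<in> insert (to_fract [:0, 1:]) ((\<lambda>c. to_fract [:c:]) ` GF J)" for g
    unfolding S_def rational_functions_def using that by (rule generate_field.incl)
  have g1: "to_fract [:0, 1:] \<in> S" by (rule gS[OF insertI1])
  have g2: "to_fract [:a:] \<in> S" by (rule gS[OF insertI2[OF imageI[OF a]]])
  have "to_fract [:a:] + to_fract [:0, 1:] * to_fract c \<in> S"
    by (rule subring_setD(4)[OF S_subring_set g2 subring_setD(5)[OF S_subring_set g1 pCons.IH[OF c]]])
  moreover have "to_fract (pCons a c) = to_fract [:a:] + to_fract [:0, 1:] * to_fract c"
    unfolding to_fract_mult[symmetric] to_fract_add[symmetric] by simp
  ultimately show ?case by (simp only:)
qed

text \<open>Such fractions form a subfield that contains the generators, hence all of the field they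
  generate.\<close>

lemma S_fraction: "z \<in> S \<Longrightarrow> \<exists>u\<in>kX. \<exists>v\<in>kX. v \<noteq> 0 \<and> z = to_fract u / to_fract v"
proof -
  define E0 where "E0 = {z. \<exists>u\<in>kX. \<exists>v\<in>kX. v \<noteq> 0 \<and> z = to_fract u / to_fract v}"
  note R = subring_setD[OF sub_kX]
  have mem: "to_fract u / to_fract v \<in> E0" if "u \<in> kX" "v \<in> kX" "v \<noteq> 0" for u v unfolding E0_def using that by blast
  have mem1: "to_fract u \<in> E0" if "u \<in> kX" for u using mem[OF that R(2)] by simp
  have neg: "- w \<in> E0" if "w \<in> E0" for w
  proof -
    have "(2 :: 'a poly) = [:2:]" by (simp add: numeral_poly)
    hence two_p: "(1 + 1 :: 'a poly) = 0" using two by simp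
    have "(2 :: 'a poly fract) = to_fract 1 + to_fract 1" by simp
    also have "\<dots> = to_fract (1 + 1)" by (simp only: to_fract_add)
    finally have "(2 :: 'a poly fract) = 0" unfolding two_p by simp
    hence "- w = w" by (rule char2_minus)
    thus ?thesis using that by (simp only:)
  qed
  have add: "z + w \<in> E0" if zw: "z \<in> E0" "w \<in> E0" for z w
  proof -
    obtain u v u' v' where uv: "u \<in> kX" "v \<in> kX" "v \<noteq> 0" "z = to_fract u / to_fract v" "u' \<in> kX" "v' \<in> kX" "v' \<noteq> 0" "w = to_fract u' / to_fract v'"
      using zw unfolding E0_def by blast
    have "z + w = to_fract (u * v' + u' * v) / to_fract (v * v')"
      unfolding uv(4,8) to_fract_add to_fract_mult using uv(3,7) by (simp add: add_frac_eq)
    thus ?thesis using mem[of "u * v' + u' * v" "v * v'"] R(4)[OF R(5)[OF uv(1,6)] R(5)[OF uv(5,2)]] R(5)[OF uv(2,6)] uv(3,7) by simp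
  qed
  have mult: "z * w \<in> E0" if zw: "z \<in> E0" "w \<in> E0" for z w
  proof -
    obtain u v u' v' where uv: "u \<in> kX" "v \<in> kX" "v \<noteq> 0" "z = to_fract u / to_fract v" "u' \<in> kX" "v' \<in> kX" "v' \<noteq> 0" "w = to_fract u' / to_fract v'"
      using zw unfolding E0_def by blast
    have "z * w = to_fract (u * u') / to_fract (v * v')" unfolding uv(4,8) to_fract_mult by simp
    thus ?thesis using mem[of "u * u'" "v * v'"] R(5)[OF uv(1,5)] R(5)[OF uv(2,6)] uv(3,7) by simp
  qed
  have zo: "0 \<in> E0" "1 \<in> E0" using mem1[OF R(1)] mem1[OF R(2)] by simp_all
  have sub: "subring_set E0" unfolding subring_set_def by (intro conjI ballI zo neg add mult)
  have inv: "inverse z \<in> E0" if z: "z \<in> E0" for z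
  proof -
    obtain u v where uv: "u \<in> kX" "v \<in> kX" "v \<noteq> 0" "z = to_fract u / to_fract v" using z unfolding E0_def by blast
    show ?thesis
    proof (cases "u = 0")
      case True
      thus ?thesis using uv(4) zo(1) by simp
    next
      case False
      have "inverse z = to_fract v / to_fract u" unfolding uv(4) by simp
      thus ?thesis using mem[OF uv(2,1) False] by simp
    qed
  qed
  have gen: "insert (to_fract [:0, 1:]) ((\<lambda>c. to_fract [:c:]) ` GF J) \<subseteq> E0"
  proof
    fix g assume "g \<in> insert (to_fract [:0, 1:]) ((\<lambda>c. to_fract [:c:]) ` GF J)"
    then consider "g = to_fract [:0, 1:]" | c where "c \<in> GF J" "g = to_fract [:c:]" by blast
    thus "g \<in> E0"
    proof cases
      case 1
      show ?thesis unfolding 1 by (rule mem1[OF x_in_kX])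
    next
      case 2
      show ?thesis unfolding 2(2) by (rule mem1[OF const_in_coeffs_in[OF sub_k 2(1)]])
    qed
  qed
  have sf: "subfield E0 QF" using sub inv by (rule subfield_type_ring)
  have "S \<subseteq> E0" unfolding S_def rational_functions_def
    by (rule field.generate_field_min_subfield1[OF field_type_ring generators sf gen])
  thus "z \<in> S \<Longrightarrow> \<exists>u\<in>kX. \<exists>v\<in>kX. v \<noteq> 0 \<and> z = to_fract u / to_fract v" unfolding E0_def by blast
qed

lemma Ev_sum: "Ev q = (\<Sum>i<length q. \<theta> (rev q ! i) * y ^ i)"
  unfolding Ev_def eval_type_ring_sum length_map rev_map by (intro sum.cong refl) simp

lemma carrier_UP: "q \<in> carrier UP \<longleftrightarrow> q = [] \<or> set q \<subseteq> S \<and> hd q \<noteq> 0"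
  unfolding UP_def univ_poly_carrier[symmetric] polynomial_def by simp

lemma fp: "length fp = Suc p" "fp \<in> carrier UP" "fp \<noteq> []" "Ev fp = 0"
proof -
  have len: "length (Polynomial.coeffs \<Phi>) = Suc p"
    using degree_\<Phi> length_coeffs_degree[of \<Phi>] p by fastforce
  show l: "length fp = Suc p" unfolding fp_def curve_equation_def using len by simp
  thus ne: "fp \<noteq> []" by auto
  have P0: "\<Phi> \<noteq> 0" using degree_\<Phi> p by auto
  have nth: "rev fp ! i = to_fract (poly.coeff \<Phi> i)" if "i < Suc p" for i
    unfolding fp_def curve_equation_def rev_rev_ident using that len P0 by (simp add: coeffs_nth degree_\<Phi>)
  have set: "set fp \<subseteq> S"
  proof
    fix s assume "s \<in> set fp"
    then obtain c where c: "c \<in> set (Polynomial.coeffs \<Phi>)" "s = to_fract c" unfolding fp_def curve_equation_def by auto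
    obtain i where "c = poly.coeff \<Phi> i" using c(1) range_coeff[of \<Phi>] by (metis (no_types, lifting) imageE insertI2)
    hence "c \<in> kX" using coeffs_inD[OF \<Phi>_in] by simp
    thus "s \<in> S" unfolding c(2) by (rule S_gen)
  qed
  have "hd fp = to_fract (last (Polynomial.coeffs \<Phi>))"
    unfolding fp_def curve_equation_def using P0 by (simp add: hd_rev last_map)
  hence "hd fp \<noteq> 0" using P0 last_coeffs_eq_coeff_degree[OF P0] by simp
  thus "fp \<in> carrier UP" unfolding carrier_UP using set by blast
  have "Ev fp = (\<Sum>i<Suc p. \<xi> (poly.coeff \<Phi> i) * y ^ i)"
    unfolding Ev_sum l by (intro sum.cong refl) (simp add: nth xi_theta)
  also have "\<dots> = E \<Phi>" by (rule eval2_bound[OF xi, symmetric]) (simp add: degree_\<Phi>)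
  finally show "Ev fp = 0" using E_\<Phi> by simp
qed

lemma UP_domain: "domain UP"
  unfolding UP_def by (rule domain.univ_poly_is_domain[OF field.axioms(1)[OF field_type_ring] subfieldE(1)[OF S_subfield]])

lemma UP_ring: "ring UP"
  using UP_domain by (simp add: domain_def cring_def)

lemma Ev_ring_hom: "ring_hom_ring UP LF Ev"
proof (rule ring_hom_ringI2[OF UP_ring])
  interpret L: field LF by (rule field_type_ring)
  interpret Q: field QF by (rule field_type_ring)
  show "ring LF" by (rule L.ring_axioms)
  interpret th: ring_hom_ring QF LF \<theta>
    by (rule ring_hom_ringI2[OF Q.ring_axioms L.ring_axioms])
      (rule ring_hom_memI; simp add: rhomD(1)[OF theta] rhomD(2)[OF theta] rhomD(3)[OF theta])
  have en: "L.eval (L.normalize v) y = L.eval v y" for v by (rule L.eval_normalize) simp_all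
  show "Ev \<in> ring_hom UP LF"
  proof (rule ring_hom_memI)
    show "Ev (u \<otimes>\<^bsub>UP\<^esub> v) = Ev u \<otimes>\<^bsub>LF\<^esub> Ev v" for u v
    proof -
      have "Ev (u \<otimes>\<^bsub>UP\<^esub> v) = L.eval (L.normalize (map \<theta> (Q.poly_mult u v))) y"
        unfolding Ev_def en UP_def univ_poly_mult ..
      also have "\<dots> = L.eval (L.poly_mult (map \<theta> u) (map \<theta> v)) y"
        by (subst th.poly_mult_hom') simp_all
      also have "\<dots> = Ev u \<otimes>\<^bsub>LF\<^esub> Ev v" unfolding Ev_def by (rule L.eval_poly_mult) simp_all
      finally show ?thesis .
    qed
    show "Ev (u \<oplus>\<^bsub>UP\<^esub> v) = Ev u \<oplus>\<^bsub>LF\<^esub> Ev v" for u v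
    proof -
      have "Ev (u \<oplus>\<^bsub>UP\<^esub> v) = L.eval (L.normalize (map \<theta> (Q.poly_add u v))) y"
        unfolding Ev_def en UP_def univ_poly_add ..
      also have "\<dots> = L.eval (L.poly_add (map \<theta> u) (map \<theta> v)) y"
        by (subst th.poly_add_hom') simp_all
      also have "\<dots> = Ev u \<oplus>\<^bsub>LF\<^esub> Ev v" unfolding Ev_def by (rule L.eval_poly_add) simp_all
      finally show ?thesis .
    qed
    show "Ev \<one>\<^bsub>UP\<^esub> = \<one>\<^bsub>LF\<^esub>" unfolding Ev_sum UP_def univ_poly_one by (simp add: rhomD(1)[OF theta])
  qed simp
qed

lemma Ev_mult: "u \<in> carrier UP \<Longrightarrow> v \<in> carrier UP \<Longrightarrow> Ev (u \<otimes>\<^bsub>UP\<^esub> v) = Ev u * Ev v"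
  and Ev_add: "u \<in> carrier UP \<Longrightarrow> v \<in> carrier UP \<Longrightarrow> Ev (u \<oplus>\<^bsub>UP\<^esub> v) = Ev u + Ev v"
  using ring_hom_mult[OF ring_hom_ring.homh[OF Ev_ring_hom]] ring_hom_add[OF ring_hom_ring.homh[OF Ev_ring_hom]] by simp_all

lemma common_denominator:
  assumes "\<And>i. i < n \<Longrightarrow> c i \<in> S"
  shows "\<exists>v u. v \<noteq> 0 \<and> (\<forall>i<(n::nat). c i * to_fract v = to_fract (u i))"
  using assms
proof (induction n)
  case 0
  show ?case by (intro exI[of _ 1]) simp
next
  case (Suc n)
  obtain v u where vu: "v \<noteq> 0" "\<forall>i<n. c i * to_fract v = to_fract (u i)" using Suc by fastforce
  obtain a w where aw: "w \<noteq> 0" "c n = to_fract a / to_fract w" using S_fraction[OF Suc.prems[of n]] by blast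
  define u' where "u' i = (if i = n then a * v else u i * w)" for i
  have "c i * to_fract (v * w) = to_fract (u' i)" if "i < Suc n" for i
  proof (cases "i = n")
    case True
    thus ?thesis unfolding u'_def to_fract_mult using aw by simp
  next
    case False
    hence "c i * to_fract v = to_fract (u i)" using vu(2) that by simp
    thus ?thesis unfolding u'_def to_fract_mult using False by (simp flip: mult.assoc)
  qed
  thus ?case using vu(1) aw(1) by (intro exI[of _ "v * w"] exI[of _ u']) simp
qed

text \<open>Clearing denominators gives a polynomial of degree below p with value 0 under E, to
  which \<open>E_inj\<close> applies.\<close>

lemma Ev_short:
  assumes q: "q \<in> carrier UP" "length q \<le> p" "Ev q = 0"
  shows "q = []"
proof (rule ccontr)
  assume ne: "q \<noteq> []"
  have qS: "set q \<subseteq> S" "hd q \<noteq> 0" using q(1) ne unfolding carrier_UP by blast+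
  have "rev q ! i \<in> S" if "i < length q" for i
    using qS(1) nth_mem[of i "rev q"] that by auto
  from common_denominator[of "length q" "\<lambda>i. rev q ! i", OF this]
  obtain v u where vu: "v \<noteq> 0" "\<forall>i<length q. rev q ! i * to_fract v = to_fract (u i)" by blast
  define G where "G = (\<Sum>i<length q. Polynomial.monom (u i) i)"
  have co: "poly.coeff G j = (if j < length q then u j else 0)" for j
    unfolding G_def by (simp add: coeff_sum)
  have "degree G < p"
  proof (cases "G = 0")
    case True
    thus ?thesis using p by simp
  next
    case False
    hence "poly.coeff G (degree G) \<noteq> 0" by simp
    hence "degree G < length q" unfolding co by (simp split: if_splits)
    thus ?thesis using q(2) by simp
  qed
  moreover have "E G = 0"
  proof -
    have "E G = (\<Sum>i<p. \<xi> (poly.coeff G i) * y ^ i)" by (rule eval2_bound[OF xi]) fact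
    also have "\<dots> = (\<Sum>i<length q. \<xi> (poly.coeff G i) * y ^ i)"
    proof (rule sum.mono_neutral_right)
      show "{..<length q} \<subseteq> {..<p}" using q(2) by auto
      show "\<forall>i\<in>{..<p} - {..<length q}. \<xi> (poly.coeff G i) * y ^ i = 0" unfolding co using rhomD(4)[OF xi] by simp
    qed simp
    also have "\<dots> = (\<Sum>i<length q. \<theta> (rev q ! i) * y ^ i * \<xi> v)"
    proof (rule sum.cong[OF refl])
      fix i assume i: "i \<in> {..<length q}"
      have "\<xi> (u i) = \<theta> (rev q ! i) * \<xi> v" unfolding xi_theta rhomD(3)[OF theta, symmetric] using vu(2) i by simp
      thus "\<xi> (poly.coeff G i) * y ^ i = \<theta> (rev q ! i) * y ^ i * \<xi> v" unfolding co using i by simp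
    qed
    also have "\<dots> = Ev q * \<xi> v" unfolding Ev_sum sum_distrib_right ..
    finally show ?thesis using q(3) by simp
  qed
  ultimately have "G = 0" by (rule E_inj)
  hence "u (length q - 1) = 0" using co[of "length q - 1"] ne by simp
  hence "rev q ! (length q - 1) * to_fract v = 0" using vu(2) ne by simp
  hence "rev q ! (length q - 1) = 0" using vu(1) by simp
  moreover have "rev q ! (length q - 1) = hd q" using ne by (simp add: rev_nth hd_conv_nth)
  ultimately show False using qS(2) by simp
qed

text \<open>Division by \<open>fp\<close> leaves a remainder with at most p coefficients, which is 0
  by \<open>Ev_short\<close>. The rupture ring thus becomes isomorphic to the image
  \<open>KL\<close>, from which \<open>KF_field\<close> takes the field property.\<close>

lemma kernel_Ev: "a_kernel UP LF Ev = PIdl\<^bsub>UP\<^esub> fp"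
proof (rule equalityI; rule subsetI)
  interpret UP: domain UP by (rule UP_domain)
  fix q assume "q \<in> a_kernel UP LF Ev"
  hence q: "q \<in> carrier UP" "Ev q = 0" unfolding a_kernel_def' by simp_all
  have "domain QF" by (rule field.axioms(1)[OF field_type_ring])
  from domain.field_long_division_theorem_shell[OF this S_subfield q(1)[unfolded UP_def] fp(2)[unfolded UP_def], folded UP_def]
  obtain a s where as: "a \<in> carrier UP" "s \<in> carrier UP" "q = (fp \<otimes>\<^bsub>UP\<^esub> a) \<oplus>\<^bsub>UP\<^esub> s"
    "s = \<zero>\<^bsub>UP\<^esub> \<or> length s - 1 < length fp - 1"
    using fp(3) by (auto simp: UP_def univ_poly_zero)
  have "Ev q = Ev fp * Ev a + Ev s"
    unfolding as(3) using Ev_add[OF UP.m_closed[OF fp(2) as(1)] as(2)] Ev_mult[OF fp(2) as(1)] by simp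
  hence "Ev s = 0" using q(2) fp(4) by simp
  moreover have "length s \<le> p" using as(4) fp(1) p by (auto simp: UP_def univ_poly_zero)
  ultimately have "s = \<zero>\<^bsub>UP\<^esub>" using Ev_short[OF as(2)] by (simp add: UP_def univ_poly_zero)
  hence "q = a \<otimes>\<^bsub>UP\<^esub> fp" using as(1,3) fp(2) UP.m_comm by simp
  thus "q \<in> PIdl\<^bsub>UP\<^esub> fp" unfolding cgenideal_def using as(1) by blast
next
  interpret UP: domain UP by (rule UP_domain)
  fix q assume "q \<in> PIdl\<^bsub>UP\<^esub> fp"
  then obtain a where a: "a \<in> carrier UP" "q = a \<otimes>\<^bsub>UP\<^esub> fp" unfolding cgenideal_def by blast
  have "Ev q = 0" unfolding a(2) Ev_mult[OF a(1) fp(2)] fp(4) by simp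
  thus "q \<in> a_kernel UP LF Ev" unfolding a_kernel_def' using UP.m_closed[OF a(1) fp(2)] a(2) by simp
qed

lemma Ev_const: "s \<in> S \<Longrightarrow> \<exists>q\<in>carrier UP. Ev q = \<theta> s"
proof (cases "s = 0")
  case True
  show ?thesis unfolding True rhomD(4)[OF theta] by (intro bexI[of _ "[]"]) (simp_all add: Ev_sum carrier_UP)
next
  case False
  assume "s \<in> S"
  thus ?thesis using False by (intro bexI[of _ "[s]"]) (simp_all add: Ev_sum carrier_UP)
qed

lemma image_Ev: "Ev ` carrier UP = KL"
proof (rule equalityI; rule subsetI)
  fix z assume "z \<in> Ev ` carrier UP"
  then obtain q where q: "q \<in> carrier UP" "z = Ev q" by blast
  have th: "\<theta> s \<in> KL" if s: "s \<in> S" for s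
  proof -
    obtain u v where "u \<in> kX" "v \<in> kX" "s = to_fract u / to_fract v" using S_fraction[OF s] by blast
    thus ?thesis using KL_divide[OF xi_in_KL xi_in_KL, of u v] unfolding xi_theta theta_divide[symmetric] by simp
  qed
  have sub: "(\<Sum>i<j. a i) \<in> KL" if "\<And>i. i < j \<Longrightarrow> a i \<in> KL" for a and j :: nat
    using that by (induction j) (simp_all add: KL_01 KL_add)
  have nth: "rev q ! i \<in> S" if "i < length q" for i
    using q(1) nth_mem[of i "rev q"] that unfolding carrier_UP by auto
  show "z \<in> KL" unfolding q(2) Ev_sum
    by (rule sub) (intro KL_mult KL_power y_in_KL th nth)
next
  interpret UP: domain UP by (rule UP_domain)
  fix z assume z: "z \<in> KL"
  let ?I = "Ev ` carrier UP"
  have add: "u + v \<in> ?I" if uv: "u \<in> ?I" "v \<in> ?I" for u v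
  proof -
    obtain a c where ac: "a \<in> carrier UP" "u = Ev a" "c \<in> carrier UP" "v = Ev c" using uv by blast
    show ?thesis unfolding ac(2,4) Ev_add[OF ac(1,3), symmetric] by (rule imageI[OF UP.a_closed[OF ac(1,3)]])
  qed
  have mult: "u * v \<in> ?I" if uv: "u \<in> ?I" "v \<in> ?I" for u v
  proof -
    obtain a c where ac: "a \<in> carrier UP" "u = Ev a" "c \<in> carrier UP" "v = Ev c" using uv by blast
    show ?thesis unfolding ac(2,4) Ev_mult[OF ac(1,3), symmetric] by (rule imageI[OF UP.m_closed[OF ac(1,3)]])
  qed
  have c: "\<theta> s \<in> ?I" if s: "s \<in> S" for s
  proof -
    obtain q where q: "q \<in> carrier UP" "Ev q = \<theta> s" using Ev_const[OF s] by blast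
    show ?thesis unfolding q(2)[symmetric] by (rule imageI[OF q(1)])
  qed
  have one: "1 \<in> S" and zero: "0 \<in> S" using subring_setD(1,2)[OF S_subring_set] by blast+
  have u10: "[1, 0] \<in> carrier UP" unfolding carrier_UP using one zero by simp
  have e10: "Ev [1, 0] = y" unfolding Ev_sum by (simp add: numeral_2_eq_2 rhomD(1)[OF theta] rhomD(4)[OF theta])
  have y: "y \<in> ?I" using imageI[OF u10, of Ev] unfolding e10 .
  have 0: "0 \<in> ?I" using c[OF zero] rhomD(4)[OF theta] by simp
  have 1: "1 \<in> ?I" using c[OF one] rhomD(1)[OF theta] by simp
  have pow: "y ^ i \<in> ?I" for i by (induction i) (simp_all add: 1 mult y)
  have sm: "(\<Sum>i<j. a i) \<in> ?I" if "\<And>i. a i \<in> ?I" for a and j :: nat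
    by (induction j) (simp_all add: 0 add that)
  obtain G d where G: "G \<in> kXY" "d \<in> kX" "Rep z G d" using z by (rule KLE)
  have G': "degree G < p" "d \<noteq> 0" using G(3) unfolding Rep_def by blast+
  have EG: "E G = (\<Sum>i<p. \<xi> (poly.coeff G i) * y ^ i)" by (rule eval2_bound[OF xi G'(1)])
  have zsum: "z = (\<Sum>i<p. (\<xi> (poly.coeff G i) / \<xi> d) * y ^ i)"
    unfolding Rep_eq[OF G(3)] EG sum_divide_distrib by (intro sum.cong refl) simp
  have "\<xi> u / \<xi> d \<in> ?I" if u: "u \<in> kX" for u
  proof -
    have "to_fract u / to_fract d \<in> S"
      unfolding divide_inverse by (intro subring_setD(5)[OF S_subring_set S_gen[OF u] S_inverse[OF S_gen[OF G(2)]]])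
    from c[OF this] show ?thesis unfolding xi_theta theta_divide .
  qed
  hence "\<xi> (poly.coeff G i) / \<xi> d * y ^ i \<in> ?I" for i by (rule mult[OF _ pow]) (rule coeffs_inD[OF G(1)])
  thus "z \<in> ?I" unfolding zsum by (rule sm)
qed

definition KF :: "'a poly fract list set ring" where "KF = curve_function_field (GF J) \<Phi>"
definition kF :: "'a poly fract list set set" where "kF = curve_constants (GF J) \<Phi>"
definition \<phi> :: "'a poly fract list set \<Rightarrow> 'l" where "\<phi> = (\<lambda>Z. the_elem (Ev ` Z))"

lemma KF_Quot: "KF = UP Quot (a_kernel UP LF Ev)"
  unfolding kernel_Ev KF_def curve_function_field_def rupture_def
  unfolding UP_def fp_def S_def ..

lemma KF_ring: "ring KF"
  unfolding KF_Quot by (rule ideal.quotient_is_ring[OF ring_hom_ring.kernel_is_ideal[OF Ev_ring_hom]])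

lemma phi_iso: "\<phi> \<in> ring_iso KF (LF\<lparr>carrier := KL\<rparr>)"
  using ring_hom_ring.FactRing_iso_set_aux[OF Ev_ring_hom] unfolding KF_Quot \<phi>_def image_Ev .

lemma KL_subfield: "subfield KL LF"
proof (rule subfield_type_ring)
  show "subring_set KL" unfolding subring_set_def using KL_01 KL_uminus KL_add KL_mult by simp
qed (rule KL_inverse)

lemma KF_field: "field KF"
proof -
  interpret L: field LF by (rule field_type_ring)
  have F: "field (LF\<lparr>carrier := KL\<rparr>)" by (rule L.subfield_iff(2)[OF KL_subfield])
  have R: "ring (LF\<lparr>carrier := KL\<rparr>)" using F by (simp add: field_def domain_def cring_def)
  note sym = ring_iso_set_sym[OF KF_ring phi_iso]
  define \<psi> where "\<psi> = inv_into (carrier KF) \<phi>"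
  have "\<psi> \<in> ring_hom (LF\<lparr>carrier := KL\<rparr>) KF" using sym unfolding \<psi>_def ring_iso_def by blast
  hence z: "\<psi> \<zero>\<^bsub>LF\<lparr>carrier := KL\<rparr>\<^esub> = \<zero>\<^bsub>KF\<^esub>" by (rule ring_hom_zero[OF _ R KF_ring])
  have "field (KF \<lparr>zero := \<psi> \<zero>\<^bsub>LF\<lparr>carrier := KL\<rparr>\<^esub>\<rparr>)" using field.ring_iso_imp_img_field[OF F sym] unfolding \<psi>_def .
  thus ?thesis unfolding z by simp
qed

lemma transport: "curve_transport m J f \<xi> y l KF kF \<phi>"
proof (intro curve_transport.intro curve_transport_axioms.intro)
  interpret Evh: ring_hom_ring UP LF Ev by (rule Ev_ring_hom)
  show "as_curve_genus m J f \<xi> y l" by (rule as_curve_genus_axioms)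
  show "field KF" by (rule KF_field)
  show "\<phi> \<in> ring_hom KF LF" using phi_iso unfolding ring_iso_def ring_hom_def by auto
  show "bij_betw \<phi> (carrier KF) KL" using phi_iso unfolding ring_iso_def by simp
  interpret Q: field QF by (rule field_type_ring)
  define g where "g c = Q.poly_of_const (to_fract [:c:])" for c
  have kF: "kF = (\<lambda>c. a_kernel UP LF Ev +>\<^bsub>UP\<^esub> g c) ` GF J"
    unfolding kernel_Ev kF_def curve_constants_def
    unfolding UP_def fp_def S_def g_def ..
  have g: "g c = (if c = 0 then [] else [to_fract [:c:]])" for c
    unfolding g_def Q.poly_of_const_def by simp
  have gU: "g c \<in> carrier UP" if c: "c \<in> GF J" for c
    unfolding g carrier_UP using S_gen[OF const_in_coeffs_in[OF sub_k c]] by simp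
  have gE: "Ev (g c) = cst c" for c unfolding g Ev_sum xi_theta using rhomD(4)[OF theta] by simp
  show "kF \<subseteq> carrier KF" unfolding kF KF_Quot FactRing_def A_RCOSETS_def' using gU by auto
  have "\<phi> (a_kernel UP LF Ev +>\<^bsub>UP\<^esub> g c) = cst c" if c: "c \<in> GF J" for c
    unfolding \<phi>_def Evh.the_elem_simp[OF gU[OF c]] by (rule gE)
  thus "\<phi> ` kF = cst ` GF J" unfolding kF image_image by (intro image_cong refl)
qed

theorem smooth_maximal_iff:
  "smooth_compactification_maximal (GF J) \<Phi> \<longleftrightarrow>
    real (1 + card {(a, b). a \<in> GF J \<and> b \<in> GF J \<and> b ^ p + b = poly f a}) = real r + 1 + 2 * real genus_g * sqrt (real r)"
  unfolding smooth_compactification_maximal_def KF_def[symmetric] kF_def[symmetric]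
  by (rule curve_transport.maximal_curve_iff[OF transport])

end

subsection \<open>The curves of the theorem\<close>

context point_count
begin

definition fP :: "'a poly" where
  "fP = [:0, 1:] * (R_poly (2 ^ m) e b + Polynomial.smult (alpha_F (2 ^ m) e b t) [:0, 1:])"

lemma poly_fP: "poly fP a = f a"
  by (simp add: fP_def f_def mult_ac)

lemma coeff_fP: "poly.coeff fP j = (\<Sum>i=1..e. if j = Suc ((2 ^ m) ^ i) then R_coeff (2 ^ m) e b i else 0)
    + (if j = 2 then alpha_F (2 ^ m) e b t else 0)"
proof -
  have "fP = pCons 0 (R_poly (2 ^ m) e b + Polynomial.smult (alpha_F (2 ^ m) e b t) [:0, 1:])" by (simp add: fP_def)
  hence fP: "fP = pCons 0 (R_poly (2 ^ m) e b + [:0, alpha_F (2 ^ m) e b t:])" by simp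
  have lin: "poly.coeff [:0, c:] k = (if k = 1 then c else 0)" for c :: 'a and k
    by (auto simp: coeff_pCons split: nat.split)
  show ?thesis
  proof (cases j)
    case 0
    thus ?thesis unfolding fP by simp
  next
    case (Suc k)
    have "poly.coeff (R_poly (2 ^ m) e b) k = (\<Sum>i=1..e. if k = (2 ^ m) ^ i then R_coeff (2 ^ m) e b i else 0)"
      unfolding R_poly_def coeff_sum by (intro sum.cong refl) auto
    thus ?thesis unfolding fP Suc by (simp add: lin)
  qed
qed

lemma R_coeff_e: "R_coeff (2 ^ m) e b e \<noteq> 0"
proof -
  have "frob_root (2 ^ m) 0 z = z" for z :: 'a unfolding frob_root_def by simp
  thus ?thesis using b_nz by (simp add: R_coeff_def)
qed

text \<open>Only i = e reaches the exponent p^e + 1, with coefficient b_0 b_e; the summand in x^2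
  stays below it because p^e is at least 2.\<close>

lemma degree_fP: "degree fP = 2 ^ (m * e) + 1"
proof (rule antisym)
  have two_le: "(2::nat) \<le> 2 ^ (m * e)" using power_increasing[of 1 "m * e" "2::nat"] m e by simp
  have pow: "(2 ^ m) ^ i < (2::nat) ^ (m * e)" if "i < e" for i
    unfolding power_mult[symmetric] using that m by (intro power_strict_increasing) auto
  show "degree fP \<le> 2 ^ (m * e) + 1"
  proof (rule degree_le, intro allI impI)
    fix j :: nat assume j: "2 ^ (m * e) + 1 < j"
    have "j \<noteq> Suc ((2 ^ m) ^ i)" if "i \<in> {1..e}" for i
    proof (cases "i = e")
      case True
      thus ?thesis using j by (simp add: power_mult)
    next
      case False
      thus ?thesis using pow[of i] that j by auto
    qed
    hence "(\<Sum>i=1..e. if j = Suc ((2 ^ m) ^ i) then R_coeff (2 ^ m) e b i else 0) = 0" by (intro sum.neutral) simp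
    moreover have "j \<noteq> 2" using j two_le by simp
    ultimately show "poly.coeff fP j = 0" unfolding coeff_fP by simp
  qed
  have "(\<Sum>i=1..e. if 2 ^ (m * e) + 1 = Suc ((2 ^ m) ^ i) then R_coeff (2 ^ m) e b i else 0)
      = (\<Sum>i=1..e. if i = e then R_coeff (2 ^ m) e b i else 0)"
  proof (rule sum.cong[OF refl])
    fix i assume "i \<in> {1..e}"
    thus "(if 2 ^ (m * e) + 1 = Suc ((2 ^ m) ^ i) then R_coeff (2 ^ m) e b i else 0) = (if i = e then R_coeff (2 ^ m) e b i else 0)"
      using pow[of i] by (cases "i = e") (auto simp: power_mult)
  qed
  also have "\<dots> = R_coeff (2 ^ m) e b e" using e by (simp add: sum.delta)
  finally have sum_eq: "(\<Sum>i=1..e. if 2 ^ (m * e) + 1 = Suc ((2 ^ m) ^ i) then R_coeff (2 ^ m) e b i else 0) = R_coeff (2 ^ m) e b e" .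
  have ne2: "2 ^ (m * e) + 1 \<noteq> (2::nat)" using two_le by linarith
  from sum_eq have "poly.coeff fP (2 ^ (m * e) + 1) = R_coeff (2 ^ m) e b e"
    unfolding coeff_fP by (simp only: ne2 if_False add_0_right)
  thus "2 ^ (m * e) + 1 \<le> degree fP" using R_coeff_e by (intro le_degree) simp
qed

lemma GF_subset_N: "GF d \<subseteq> GF N" by (rule GF_mono) simp

lemma fP_in: "fP \<in> coeffs_in (GF N)"
  unfolding coeffs_in_def
proof (rule CollectI, rule allI)
  fix j
  have "(\<Sum>i=1..e. if j = Suc ((2 ^ m) ^ i) then R_coeff (2 ^ m) e b i else 0) \<in> GF N"
  proof (rule GF_sum)
    fix i assume "i \<in> {1..e}"
    hence "R_coeff (2 ^ m) e b i \<in> GF N" using R_coeff_GF[of i] GF_subset_N by auto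
    thus "(if j = Suc ((2 ^ m) ^ i) then R_coeff (2 ^ m) e b i else 0) \<in> GF N" using GF_0_1(1)[of N] by (simp only: split: if_split) blast
  qed
  moreover have "(if j = 2 then alpha_F (2 ^ m) e b t else 0) \<in> GF N"
    using subsetD[OF GF_subset_N alpha_GF] GF_0_1(1)[of N] by (simp only: split: if_split) blast
  ultimately show "poly.coeff fP j \<in> GF N" unfolding coeff_fP by (rule GF_add)
qed

lemma maximal:
  assumes alg: "\<And>u::'a. \<exists>k>0. u \<in> GF (N * k)"
  shows "smooth_compactification_maximal (GF N) (D_poly (2 ^ m) e b t)"
proof -
  \<comment> \<open>The ambient field is an algebraic closure of the rational functions, in which
    the equation of the curve has a root y.\<close>
  define \<theta> :: "'a poly fract \<Rightarrow> 'a poly fract alg_closure" where "\<theta> = to_ac"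
  define \<xi> where "\<xi> c = \<theta> (to_fract c)" for c
  have "1 < (2::nat) ^ m" by (rule one_less_power) (use m in simp_all)
  hence p0: "0 < (2::nat) ^ m" "1 < (2::nat) ^ m" by simp_all
  define Q where "Q = Polynomial.monom 1 (2 ^ m) + Polynomial.monom 1 1 + [:\<xi> fP:]"
  have "poly.coeff Q (2 ^ m) = 1"
    unfolding Q_def using p0 by (simp add: coeff_pCons split: nat.split)
  hence "2 ^ m \<le> degree Q" by (intro le_degree) simp
  hence "0 < degree Q" using p0 by linarith
  then obtain y where "poly Q y = 0" using alg_closed_imp_poly_has_root by blast
  hence y0: "y ^ (2 ^ m) + y + \<xi> fP = 0" unfolding Q_def by (simp add: poly_monom)
  have th: "rhom \<theta>" unfolding rhom_def \<theta>_def by simp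
  have xi: "rhom \<xi>" unfolding rhom_def \<xi>_def using rhomD(1)[OF th] rhomD(2)[OF th] rhomD(3)[OF th] by simp
  have "(2 :: 'a poly) = [:2:]" by (simp add: numeral_poly)
  hence two_p: "(2 :: 'a poly) = 0" using two by simp
  have "\<xi> 2 = \<xi> 1 + \<xi> 1" using rhomD(2)[OF xi, of 1 1] by simp
  hence two_l: "(2 :: 'a poly fract alg_closure) = 0" using two_p rhomD(4)[OF xi] rhomD(1)[OF xi] by simp
  have y: "y ^ (2 ^ m) + y = \<xi> fP"
    using y0 char2_minus[OF two_l, of "\<xi> fP"] by (simp add: add_eq_0_iff2)
  \<comment> \<open>The degree p^e + 1 of the right-hand side has to be written as p l + 1.\<close>
  define l :: nat where "l = 2 ^ (m * (e - 1))"
  have pl: "2 ^ (m * e) = 2 ^ m * (l :: nat)"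
    unfolding l_def power_add[symmetric] using e by (cases e) auto
  have odd: "odd (degree fP)" unfolding degree_fP pl using m by simp
  interpret RM: rupture_model "TYPE('a)" m N fP \<xi> y l \<theta>
  proof unfold_locales
    show "0 < m" "0 < N" "m dvd N" using m n by simp_all
    show "\<And>u::'a. \<exists>k>0. u \<in> GF (N * k)" by (rule alg)
    show "\<xi> c = 0 \<Longrightarrow> c = 0" for c unfolding \<xi>_def \<theta>_def by simp
    show "degree fP = 2 ^ m * l + 1" unfolding degree_fP pl ..
  qed (use fP_in odd xi y th in \<open>simp_all add: \<xi>_def\<close>)
  have D: "D_poly (2 ^ m) e b t = RM.\<Phi>"
    unfolding RM.\<Phi>_def D_poly_def fP_def[symmetric]
  proof -
    have two_pp: "(2 :: 'a poly poly) = 0" using two_p by (simp add: numeral_poly)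
    show "Polynomial.monom 1 (2 ^ m) - Polynomial.monom 1 1 - [:fP:] = Polynomial.monom 1 (2 ^ m) + Polynomial.monom 1 1 + [:fP:]"
      unfolding char2_diff[OF two_pp] ..
  qed
  have pts: "int (card {(a, b). a \<in> GF N \<and> b \<in> GF N \<and> b ^ (2 ^ m) + b = poly fP a}) = 2 ^ N + (2 ^ m - 1) * 2 ^ (m * e) * 2 ^ d"
    unfolding poly_fP by (rule card_points)
  \<comment> \<open>Twice the genus is p^e (p - 1). Multiplied by q, the square root of q^2, it is
    exactly the excess over q^2 in \<open>card_points\<close>; the remaining 1 is the place at
    infinity.\<close>
  have "2 * RM.genus_g = l * (2 * (2 ^ m * (2 ^ m - 1) div 2))" unfolding RM.genus_g_def by simp
  also have "2 * (2 ^ m * (2 ^ m - 1) div 2) = (2::nat) ^ m * (2 ^ m - 1)" using m by (intro dvd_mult_div_cancel) simp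
  finally have "2 * RM.genus_g = 2 ^ (m * e) * (2 ^ m - 1)" unfolding pl by simp
  hence "real (2 * RM.genus_g) = real (2 ^ (m * e) * (2 ^ m - 1))" by (simp only:)
  hence g: "2 * real RM.genus_g = 2 ^ (m * e) * (2 ^ m - 1)" using p0 by (simp add: of_nat_diff)
  have "real (2 ^ N) = (2 ^ d)\<^sup>2" by (simp add: power_mult[symmetric] mult.commute)
  hence sq: "sqrt (real (2 ^ N)) = 2 ^ d" by (metis real_sqrt_abs abs_of_nonneg zero_le_power zero_le_numeral)
  have "real_of_int (int (card {(a, b). a \<in> GF N \<and> b \<in> GF N \<and> b ^ (2 ^ m) + b = poly fP a})) = real_of_int (2 ^ N + (2 ^ m - 1) * 2 ^ (m * e) * 2 ^ d)"
    by (simp only: pts)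
  hence pts': "real (card {(a, b). a \<in> GF N \<and> b \<in> GF N \<and> b ^ (2 ^ m) + b = poly fP a}) = 2 ^ N + (2 ^ m - 1) * 2 ^ (m * e) * 2 ^ d"
    by (simp only: of_int_of_nat_eq of_int_add of_int_mult of_int_diff of_int_power of_int_numeral of_int_1)
  show ?thesis
    unfolding D RM.smooth_maximal_iff sq g of_nat_add pts' by (simp add: algebra_simps)
qed

end

section \<open>Finite subfields of an algebraic closure and the conclusion\<close>

lemma finite_subfield_power:
  fixes S :: "'b::field set"
  assumes S: "subfield S type_ring" "finite S" and u: "u \<in> S"
  shows "u ^ card S = u"
proof (cases "u = 0")
  case True
  have "S \<noteq> {}" using u by blast
  hence "0 < card S" using S(2) by (simp add: card_gt_0_iff)
  thus ?thesis using True by simp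
next
  case False
  interpret field "type_ring :: 'b ring" by (rule field_type_ring)
  note E = subringE[OF subfieldE(1)[OF S(1)], simplified]
  let ?T = "S - {0}"
  \<comment> \<open>Multiplication by u permutes the nonzero elements, so their product is unchanged
    although it acquires one factor u for each of them.\<close>
  have T: "(\<lambda>v. u * v) ` ?T = ?T"
  proof (rule card_subset_eq)
    show "finite ?T" using S(2) by simp
    show "(\<lambda>v. u * v) ` ?T \<subseteq> ?T" using E(6) u False by auto
    have "inj_on (\<lambda>v. u * v) ?T" using False by (auto simp: inj_on_def)
    thus "card ((\<lambda>v. u * v) ` ?T) = card ?T" by (rule card_image)
  qed
  have "(\<Prod>v\<in>?T. v) = (\<Prod>v\<in>(\<lambda>v. u * v) ` ?T. v)" by (simp only: T)
  also have "\<dots> = (\<Prod>v\<in>?T. u * v)" using False by (subst prod.reindex) (auto simp: inj_on_def)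
  also have "\<dots> = u ^ card ?T * (\<Prod>v\<in>?T. v)" by (simp add: prod.distrib)
  finally have "u ^ card ?T * (\<Prod>v\<in>?T. v) = 1 * (\<Prod>v\<in>?T. v)" by simp
  moreover have "(\<Prod>v\<in>?T. v) \<noteq> 0" using S(2) by simp
  ultimately have "u ^ card ?T = 1" by (metis mult_right_cancel)
  moreover have "card S = Suc (card ?T)" using card.remove[OF S(2) E(2)] by simp
  ultimately show ?thesis by simp
qed

text \<open>Translation by 1 permutes \<open>S\<close>, so adding 1 to every element does not change
  the sum of all elements.\<close>

lemma finite_subfield_card_zero:
  fixes S :: "'b::field set"
  assumes S: "subfield S type_ring" "finite S"
  shows "(of_nat (card S) :: 'b) = 0"
proof -
  interpret field "type_ring :: 'b ring" by (rule field_type_ring)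
  note E = subringE[OF subfieldE(1)[OF S(1)], simplified]
  have T: "(\<lambda>v. v + 1) ` S = S"
  proof (rule card_subset_eq[OF S(2)])
    show "(\<lambda>v. v + 1) ` S \<subseteq> S" using E(7)[OF _ E(3)] by auto
    show "card ((\<lambda>v. v + 1) ` S) = card S" by (intro card_image) (auto simp: inj_on_def)
  qed
  have "(\<Sum>v\<in>S. v) = (\<Sum>v\<in>(\<lambda>v. v + 1) ` S. v)" by (simp only: T)
  also have "\<dots> = (\<Sum>v\<in>S. v + 1)" by (subst sum.reindex) (auto simp: inj_on_def)
  also have "\<dots> = (\<Sum>v\<in>S. v) + of_nat (card S)" by (simp add: sum.distrib)
  finally show ?thesis by simp
qed

text \<open>Every element of \<open>S\<close> satisfies the equation defining \<open>GF k\<close>,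
  and both sets have 2^k elements.\<close>

lemma (in closed_char2) finite_subfield_GF:
  assumes S: "subfield S type_ring" and card: "card S = 2 ^ k" and k: "0 < k"
  shows "S = GF k"
proof (rule card_subset_eq[OF finite_GF[OF k]])
  have fin: "finite S" using card by (intro card_ge_0_finite) simp
  show "S \<subseteq> GF k" using finite_subfield_power[OF S fin] card by auto
  show "card S = card (GF k)" using card card_GF[OF k] by simp
qed

lemma algebraically_closed_root:
  fixes Q :: "'b::field poly"
  assumes "algebraically_closed (type_ring :: 'b ring)" "0 < Polynomial.degree Q"
  shows "\<exists>z. poly Q z = 0"
proof -
  interpret algebraically_closed "type_ring :: 'b ring" by (rule assms(1))
  define P where "P = rev (Polynomial.coeffs Q)"
  have Q0: "Q \<noteq> 0" using assms(2) by auto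
  have P: "P \<in> carrier (poly_ring (type_ring :: 'b ring))"
    using Q0 by (auto simp: P_def univ_poly_def polynomial_def hd_rev last_coeffs_eq_coeff_degree)
  have deg: "length P - 1 = Polynomial.degree Q" by (simp add: P_def degree_eq_length_coeffs)
  have "splitted P" by (rule roots_over_carrier[OF P])
  hence "roots P \<noteq> {#}" unfolding splitted_def using deg assms(2) by auto
  then obtain z where "z \<in># roots P" by blast
  hence "is_root P z" using roots_mem_iff_is_root[OF P] by auto
  hence "eval P z = 0" by (simp add: is_root_def)
  thus ?thesis unfolding eval_type_ring P_def by auto
qed

theorem theorem6p1:
  fixes Fq Fq2 :: "'a::field set" and p q m n e :: nat and b :: "nat \<Rightarrow> 'a" and t :: 'a
  assumes "0 < m" and "p = 2 ^ m"
    and "0 < n" and "even n" and "q = p ^ n"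
    and "algebraic_closure type_ring Fq" and "card Fq = q"
    and "subfield Fq2 type_ring" and "card Fq2 = q\<^sup>2"
    and "1 \<le> e" and "\<And>i. i \<le> e \<Longrightarrow> b i \<in> Fq"
    and "b 0 * b e \<noteq> 0"
    and "F_star p e b 1 = 0"
    and "{x. F_star p e b x = 0} \<subseteq> Fq"
    and "{x. F_star p e b (poly (F_poly p e b) x) = 0} \<subseteq> Fq"
    and "t \<in> Fq"
    and "trace_F2 (m * n) t = of_nat (m * n div 2 + 1)"
  shows "smooth_compactification_maximal Fq2 (D_poly p e b t)"
proof -
  interpret A: algebraic_closure "type_ring :: 'a ring" Fq by (rule assms(6))
  have sF: "subfield Fq type_ring" by (rule A.subfield_axioms)
  have d0: "0 < m * n" using assms(1,3) by simp
  have cq: "card Fq = 2 ^ (m * n)" using assms(2,5,7) by (simp add: power_mult)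
  have finq: "finite Fq" using cq by (intro card_ge_0_finite) simp
  \<comment> \<open>The cardinality 2^(m n) of the subfield vanishes in the field, which forces
    characteristic two.\<close>
  have "(2 :: 'a) ^ (m * n) = 0" using finite_subfield_card_zero[OF sF finq] unfolding cq by simp
  hence two: "(2 :: 'a) = 0" by simp
  interpret C: closed_char2 "TYPE('a)"
  proof
    show "(2 :: 'a) = 0" by (rule two)
    show "\<exists>x. poly Q x = 0" if "0 < Polynomial.degree Q" for Q :: "'a poly"
      by (rule algebraically_closed_root[OF A.algebraically_closed_axioms that])
  qed
  have Fq: "Fq = C.GF (m * n)" by (rule C.finite_subfield_GF[OF sF cq d0])
  interpret PC: point_count "TYPE('a)" m n e b t
    by (rule point_count.intro[OF C.closed_char2_axioms point_count_axioms.intro[OF assms(1,3,4,10)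
        assms(11)[unfolded Fq] assms(12) assms(13)[unfolded assms(2)] assms(15)[unfolded assms(2) Fq]
        assms(16)[unfolded Fq] assms(17)]])
  have Fq2: "Fq2 = C.GF (2 * (m * n))"
    by (rule C.finite_subfield_GF[OF assms(8)]) (use assms(2,5,9) d0 in \<open>simp_all add: power_mult[symmetric] mult_ac\<close>)
  \<comment> \<open>An element of the algebraic closure generates a finite extension of the field of
    order q, so it lies in a finite field; doubling the exponent passes to one that also contains
    the field of order q^2.\<close>
  have "\<exists>k>0. u \<in> C.GF (2 * (m * n) * k)" for u :: 'a
  proof -
    have alg: "(ring.algebraic type_ring over Fq) u" by (rule A.algebraic_extension) simp
    define T where "T = A.simple_extension Fq u"
    have sT: "subfield T type_ring" unfolding T_def using A.simple_extension_is_subfield[OF sF] alg by simp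
    have "A.finite_dimension Fq T" unfolding T_def using A.finite_dimension_simple_extension[OF sF] alg by simp
    then obtain i where "A.dimension i Fq T" unfolding A.finite_dimension_def by blast
    hence T: "finite T" "card T = 2 ^ (m * n * i)" using A.card_dimension[OF sF finq] unfolding cq power_mult by blast+
    have uT: "u \<in> T" unfolding T_def by (rule A.simple_extension_mem[OF subfieldE(1)[OF sF]]) simp
    have u: "u ^ (2 ^ (m * n * i)) = u" using finite_subfield_power[OF sT T(1) uT] T(2) by simp
    have "i \<noteq> 0"
    proof
      assume "i = 0"
      hence "card T = 1" using T(2) by simp
      moreover have "{0, 1} \<subseteq> T" using subringE(2,3)[OF subfieldE(1)[OF sT]] by simp
      hence "card {0, 1 :: 'a} \<le> card T" by (rule card_mono[OF T(1)])
      ultimately show False by simp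
    qed
    moreover have "u \<in> C.GF (2 * (m * n) * i)"
      using C.GF_mono[of "m * n * i" "2 * (m * n) * i"] u by (auto simp: mult_ac)
    ultimately show ?thesis by (intro exI[of _ i]) simp
  qed
  from PC.maximal[OF this] show ?thesis unfolding Fq2 assms(2) .
qed

end
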